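(* Let $A:\mathbb{R}^2\to\mathbb{C}$ be a continuous function with $\limsup_{|\mathbf{p}|\to\infty}|A(\mathbf{p})|/|\mathbf{p}|^2<1$. Put $\lambda_-(\mathbf{p})=|\mathbf{p}|^2-|A(\mathbf{p})|$, $\kappa=\inf_{\mathbf{p}\in\mathbb{R}^2}\lambda_-(\mathbf{p})$ and $S=\{\mathbf{p}\in\mathbb{R}^2:\lambda_-(\mathbf{p})=\kappa\}$, and assume that $|A|$ is of class $C^2$ in a neighborhood of $S$. Let $V:\mathbb{R}^2\to\mathbb{R}$ belong to $L^1(\mathbb{R}^2)\cap L^r(\mathbb{R}^2)$ for some $r>1$, and let $H=H_0+V$ be the associated self-adjoint operator in $L^2(\mathbb{R}^2)\otimes\mathbb{C}^2$ (defined in the context). Suppose that $V$ is non-positive (almost everywhere) and non-vanishing on a set of positive Lebesgue measure. Then $H$ has at least $\#S$ eigenvalues below $\kappa$, counting multiplicities, where $\#S$ is the number of points of $S$ if $S$ is finite and $\#S=\infty$ otherwise (in the latter case the conclusion means that $H$ has infinitely many eigenvalues below $\kappa$, counting multiplicities).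
   Context: The Hilbert space is $L^2(\mathbb{R}^2)\otimes\mathbb{C}^2$. The Fourier transform is $\widehat f(\mathbf{p})=\frac{1}{2\pi}\int_{\mathbb{R}^2}e^{-i\mathbf{p}\cdot\mathbf{x}}f(\mathbf{x})\,d\mathbf{x}$, extended to a unitary operator $\mathcal{F}$ on $L^2(\mathbb{R}^2)$; put $\mathcal{F}_2=\mathcal{F}\otimes 1_{\mathbb{C}^2}$. $H_0$ is the self-adjoint operator such that $\mathcal{F}_2H_0\mathcal{F}_2^{-1}$ is multiplication by the matrix $$\widehat H_0(\mathbf{p})=\begin{pmatrix}|\mathbf{p}|^2 & A(\mathbf{p})\\ \overline{A(\mathbf{p})} & |\mathbf{p}|^2\end{pmatrix}.$$ Under the growth assumption on $A$, $\kappa$ is finite, $S$ is non-empty and compact, and $\operatorname{spec}H_0=[\kappa,+\infty)$. The scalar potential $V$ acts as $V\otimes I_{\mathbb{C}^2}$. $H=H_0+V$ is the form sum: the self-adjoint operator associated with the closed, lower semibounded quadratic form on the Sobolev space $H^1(\mathbb{R}^2;\mathbb{C}^2)$ given by the quadratic form of $H_0$ plus $\int_{\mathbb{R}^2}V(\mathbf{x})|\Psi(\mathbf{x})|^2\,d\mathbf{x}$ (for $r\ge 2$ it is the operator sum on the domain of $H_0$). One has $\operatorname{spec}_{\mathrm{ess}}H=[\kappa,+\infty)$. *)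

theory Defs
  imports "HOL-Analysis.Analysis" "HOL-Library.Extended_Nat"
begin

type_synonym plane = "real^2"
type_synonym spinor = "complex^2"

text \<open>
  Elements of \<open>L\<^sup>2\<close> are represented by functions; everything below is invariant under
  changing them on Lebesgue null sets.
\<close>

definition L2 :: "(plane \<Rightarrow> 'b::euclidean_space) set" where
  "L2 = {f \<in> borel_measurable lebesgue. integrable lebesgue (\<lambda>x. (norm (f x))\<^sup>2)}"

definition spinor_inner :: "spinor \<Rightarrow> spinor \<Rightarrow> complex" where
  "spinor_inner u v = (\<Sum>i\<in>UNIV. cnj (u $ i) * v $ i)"

definition L2_inner :: "(plane \<Rightarrow> spinor) \<Rightarrow> (plane \<Rightarrow> spinor) \<Rightarrow> complex" where
  "L2_inner \<phi> \<psi> = (LINT x|lebesgue. spinor_inner (\<phi> x) (\<psi> x))"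

definition fourier_integral :: "(plane \<Rightarrow> complex) \<Rightarrow> plane \<Rightarrow> complex" where
  "fourier_integral f p =
     (LINT x|lebesgue. exp (- \<i> * complex_of_real (p \<bullet> x)) * f x) / complex_of_real (2 * pi)"

text \<open>
  The extension to \<open>L\<^sup>2\<close> by continuity: the \<open>L\<^sup>2\<close>-closure of the graph of the Fourier
  integral on \<open>L\<^sup>1 \<inter> L\<^sup>2\<close>. By Plancherel's theorem it is the graph of a function up to null
  sets, and \<open>fourier\<close> picks a representative.
\<close>

definition is_fourier :: "(plane \<Rightarrow> complex) \<Rightarrow> (plane \<Rightarrow> complex) \<Rightarrow> bool" where
  "is_fourier f g \<longleftrightarrow> f \<in> L2 \<and> g \<in> L2 \<and>
     (\<exists>u :: nat \<Rightarrow> plane \<Rightarrow> complex.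
        (\<forall>n. u n \<in> L2 \<and> integrable lebesgue (u n)) \<and>
        (\<lambda>n. \<integral>\<^sup>+x. ennreal ((cmod (u n x - f x))\<^sup>2) \<partial>lebesgue) \<longlonglongrightarrow> 0 \<and>
        (\<lambda>n. \<integral>\<^sup>+p. ennreal ((cmod (fourier_integral (u n) p - g p))\<^sup>2) \<partial>lebesgue) \<longlonglongrightarrow> 0)"

definition fourier :: "(plane \<Rightarrow> complex) \<Rightarrow> plane \<Rightarrow> complex" where
  "fourier f = (SOME g. is_fourier f g)"

definition fourier2 :: "(plane \<Rightarrow> spinor) \<Rightarrow> plane \<Rightarrow> spinor" where
  "fourier2 \<psi> p = (\<chi> i. fourier (\<lambda>x. \<psi> x $ i) p)"

definition sobolev_H1 :: "(plane \<Rightarrow> spinor) set" where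
  "sobolev_H1 =
     {\<psi> \<in> L2. integrable lebesgue (\<lambda>p. (1 + (norm p)\<^sup>2) * (norm (fourier2 \<psi> p))\<^sup>2)}"

definition H0_symbol :: "(plane \<Rightarrow> complex) \<Rightarrow> plane \<Rightarrow> complex^2^2" where
  "H0_symbol A p =
     vector [vector [complex_of_real ((norm p)\<^sup>2), A p],
             vector [cnj (A p), complex_of_real ((norm p)\<^sup>2)]]"

text \<open>Unbounded operators are given by their graphs.\<close>

definition H0 :: "(plane \<Rightarrow> complex) \<Rightarrow> ((plane \<Rightarrow> spinor) \<times> (plane \<Rightarrow> spinor)) set" where
  "H0 A = {(\<psi>, \<eta>). \<psi> \<in> L2 \<and> \<eta> \<in> L2 \<and>
             (AE p in lebesgue. fourier2 \<eta> p = H0_symbol A p *v fourier2 \<psi> p)}"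

text \<open>
  The sesquilinear form of \<open>H0\<close>, whose value at \<open>(\<psi>, \<psi>)\<close> is the quadratic form of \<open>H0\<close>.
  It is written in momentum space because \<open>\<psi>\<close> ranges over the form domain, which is
  larger than the operator domain.
\<close>

definition H0_form ::
    "(plane \<Rightarrow> complex) \<Rightarrow> (plane \<Rightarrow> spinor) \<Rightarrow> (plane \<Rightarrow> spinor) \<Rightarrow> complex" where
  "H0_form A \<phi> \<psi> =
     (LINT p|lebesgue. spinor_inner (fourier2 \<phi> p) (H0_symbol A p *v fourier2 \<psi> p))"

lemma H0_form_eq_L2_inner:
  assumes "(\<psi>, \<eta>) \<in> H0 A"
    and "fourier2 \<phi> \<in> borel_measurable lebesgue"
    and "fourier2 \<eta> \<in> borel_measurable lebesgue"
  shows "H0_form A \<phi> \<psi> = L2_inner (fourier2 \<phi>) (fourier2 \<eta>)"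
proof -
  let ?f = "\<lambda>p. spinor_inner (fourier2 \<phi> p) (H0_symbol A p *v fourier2 \<psi> p)"
  let ?g = "\<lambda>p. spinor_inner (fourier2 \<phi> p) (fourier2 \<eta> p)"
  have "continuous_on UNIV (\<lambda>z :: spinor \<times> spinor. spinor_inner (fst z) (snd z))"
    unfolding spinor_inner_def by (intro continuous_intros)
  from borel_measurable_continuous_onI[OF this]
  have "(\<lambda>p. spinor_inner (fst (fourier2 \<phi> p, fourier2 \<eta> p)) (snd (fourier2 \<phi> p, fourier2 \<eta> p)))
      \<in> borel_measurable lebesgue"
    by (rule measurable_compose[rotated]) (intro borel_measurable_Pair assms)
  then have g: "?g \<in> borel_measurable lebesgue" by simp
  have ae: "AE p in lebesgue. ?g p = ?f p"
    using assms(1) unfolding H0_def by auto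
  have f: "?f \<in> borel_measurable lebesgue"
    using g ae by (rule borel_measurable_AE)
  show ?thesis
    unfolding H0_form_def L2_inner_def using f g ae
    by (intro integral_cong_AE) auto
qed

definition H_form ::
    "(plane \<Rightarrow> complex) \<Rightarrow> (plane \<Rightarrow> real) \<Rightarrow> (plane \<Rightarrow> spinor) \<Rightarrow> (plane \<Rightarrow> spinor) \<Rightarrow> complex" where
  "H_form A V \<phi> \<psi> = H0_form A \<phi> \<psi> +
     (LINT x|lebesgue. complex_of_real (V x) * spinor_inner (\<phi> x) (\<psi> x))"

text \<open>The operator that the first representation theorem associates with the form.\<close>

definition form_operator ::
    "(plane \<Rightarrow> spinor) set \<Rightarrow> ((plane \<Rightarrow> spinor) \<Rightarrow> (plane \<Rightarrow> spinor) \<Rightarrow> complex) \<Rightarrow>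
     ((plane \<Rightarrow> spinor) \<times> (plane \<Rightarrow> spinor)) set" where
  "form_operator Q h =
     {(\<psi>, \<eta>). \<psi> \<in> Q \<and> \<eta> \<in> L2 \<and> (\<forall>\<phi>\<in>Q. h \<phi> \<psi> = L2_inner \<phi> \<eta>)}"

definition H_op ::
    "(plane \<Rightarrow> complex) \<Rightarrow> (plane \<Rightarrow> real) \<Rightarrow> ((plane \<Rightarrow> spinor) \<times> (plane \<Rightarrow> spinor)) set" where
  "H_op A V = form_operator sobolev_H1 (H_form A V)"

definition eigenspace ::
    "((plane \<Rightarrow> spinor) \<times> (plane \<Rightarrow> spinor)) set \<Rightarrow> real \<Rightarrow> (plane \<Rightarrow> spinor) set" where
  "eigenspace T \<mu> = {\<psi>. (\<psi>, \<lambda>x. \<mu> *\<^sub>R \<psi> x) \<in> T}"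

definition is_eigenvalue ::
    "((plane \<Rightarrow> spinor) \<times> (plane \<Rightarrow> spinor)) set \<Rightarrow> real \<Rightarrow> bool" where
  "is_eigenvalue T \<mu> \<longleftrightarrow> (\<exists>\<psi>\<in>eigenspace T \<mu>. \<not> (AE x in lebesgue. \<psi> x = 0))"

definition L2_independent :: "(plane \<Rightarrow> spinor) set \<Rightarrow> bool" where
  "L2_independent B \<longleftrightarrow>
     (\<forall>c :: (plane \<Rightarrow> spinor) \<Rightarrow> complex.
        (AE x in lebesgue. (\<Sum>\<psi>\<in>B. c \<psi> *s \<psi> x) = 0) \<longrightarrow> (\<forall>\<psi>\<in>B. c \<psi> = 0))"

text \<open>The complex dimension, possibly infinite, of the eigenspace modulo null functions.\<close>

definition multiplicity_of ::
    "((plane \<Rightarrow> spinor) \<times> (plane \<Rightarrow> spinor)) set \<Rightarrow> real \<Rightarrow> enat" where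
  "multiplicity_of T \<mu> =
     (SUP B\<in>{B. finite B \<and> B \<subseteq> eigenspace T \<mu> \<and> L2_independent B}. enat (card B))"

definition num_eigenvalues_below ::
    "((plane \<Rightarrow> spinor) \<times> (plane \<Rightarrow> spinor)) set \<Rightarrow> real \<Rightarrow> enat" where
  "num_eigenvalues_below T k =
     (\<Sum>\<^sub>\<infinity>\<mu>\<in>{\<mu>. is_eigenvalue T \<mu> \<and> \<mu> < k}. multiplicity_of T \<mu>)"

definition lambda_minus :: "(plane \<Rightarrow> complex) \<Rightarrow> plane \<Rightarrow> real" where
  "lambda_minus A p = (norm p)\<^sup>2 - cmod (A p)"

definition kappa :: "(plane \<Rightarrow> complex) \<Rightarrow> real" where
  "kappa A = (INF p. lambda_minus A p)"

definition min_set :: "(plane \<Rightarrow> complex) \<Rightarrow> plane set" where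
  "min_set A = {p. lambda_minus A p = kappa A}"

definition num_points :: "'a set \<Rightarrow> enat" where
  "num_points X = (if finite X then enat (card X) else \<infinity>)"

definition C2_on :: "'a::real_normed_vector set \<Rightarrow> ('a \<Rightarrow> 'b::real_normed_vector) \<Rightarrow> bool" where
  "C2_on U f \<longleftrightarrow>
     (\<exists>(f' :: 'a \<Rightarrow> 'a \<Rightarrow>\<^sub>L 'b) (f'' :: 'a \<Rightarrow> 'a \<Rightarrow>\<^sub>L 'a \<Rightarrow>\<^sub>L 'b).
        (\<forall>x\<in>U. (f has_derivative blinfun_apply (f' x)) (at x)) \<and>
        (\<forall>x\<in>U. (f' has_derivative blinfun_apply (f'' x)) (at x)) \<and>
        continuous_on U f'')"

end

theory Submission
  imports Defs "HOL-Probability.Characteristic_Functions" "HOL-Complex_Analysis.Great_Picard" "HOL-Library.Function_Algebras"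
begin

text \<open>
  For \<open>E < \<kappa>\<close> the form of \<open>H\<^sub>0 - E\<close> is equivalent to the squared \<open>H\<^sup>1\<close> norm, while \<open>\<bar>V\<bar>\<close> is a
  relatively compact form perturbation: cutting \<open>\<psi>\<close> into dyadic frequency shells and splitting
  \<open>V\<close> at a height depending on the shell gives a geometrically decaying bound for the high
  frequencies, and the low frequencies are equicontinuous. Hence the infimum of the form of \<open>H\<close> over
  the unit vectors orthogonal to given eigenvectors is attained whenever it is below \<open>\<kappa>\<close> (the
  parallelogram law turns a minimising sequence into a Cauchy sequence), and a minimiser is a new
  eigenvector. So it suffices to find an \<open>N\<close>-dimensional space on which the form is below \<open>\<kappa>\<close>.

  Near a point \<open>p\<^sub>j\<close> of \<open>S\<close> one has \<open>\<lambda>\<^sub>-(p) - \<kappa> \<le> C |p - p\<^sub>j|\<^sup>2\<close>. In two dimensions there are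
  approximate identities \<open>\<omega>\<^sub>n\<close> at \<open>p\<^sub>j\<close> with \<open>\<integral> |p - p\<^sub>j|\<^sup>2 \<omega>\<^sub>n\<^sup>2 \<rightarrow> 0\<close>: average the normalised indicators
  of many dyadic annuli. With the lower eigenvector \<open>u(p)\<close> of the symbol, the inverse Fourier
  transforms of \<open>\<omega>\<^sub>n u\<close> have vanishing excess energy over \<open>\<kappa>\<close> and converge to plane waves
  \<open>e\<^sup>i\<^sup>p\<^sup>x u(p\<^sub>j)\<close>. Plane waves with distinct frequencies are linearly independent on every set of
  positive measure, so \<open>\<integral> V |\<psi>|\<^sup>2\<close> stays strictly negative on their span and wins in the limit.
\<close>

section \<open>Relatively compact form perturbations\<close>

text \<open>In two dimensions H1 misses the bounded functions only logarithmically, and this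
  borderline shapes both halves. For the potential, Bernstein's inequality costs on the k-th shell
  the same factor \<open>2 ^ k\<close> that the H1 norm gains, so r = 1 would give no decay; every r
  > 1 leaves the ratio \<open>2 powr (1 / r - 1)\<close> below 1. For the trial functions, the
  profile \<open>1 / |q|^2\<close> makes the integrals of omega and of \<open>|q|^2\<close> omega^2
  diverge logarithmically together, so normalising the first sends the second to 0; dyadic annuli
  are its discrete version. What is normalised is the integral of omega_n, not of its square: the L2
  norms of the trial functions blow up, and Rayleigh quotients tend to \<open>kappa\<close> and
  decide nothing. Unnormalised energies are compared instead, with compactness taken among the
  finitely many coefficients. Vectors are functions rather than classes, and \<open>fourier\<close>
  is a chosen representative. Hence the forms are only semidefinite, linearity holds almost
  everywhere, and null vectors must be excluded before normalising. Eigenvectors come from the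
  direct method, so neither the spectral theorem nor min-max enters.\<close>

locale hermitian_form = vector_space sc
  for sc :: "complex \<Rightarrow> 'v::ab_group_add \<Rightarrow> 'v" +
  fixes Q :: "'v set" and s :: "'v \<Rightarrow> 'v \<Rightarrow> complex"
  assumes subspace_Q: "subspace Q"
    and add_right: "\<lbrakk>x \<in> Q; y \<in> Q; z \<in> Q\<rbrakk> \<Longrightarrow> s x (y + z) = s x y + s x z"
    and scale_right: "\<lbrakk>x \<in> Q; y \<in> Q\<rbrakk> \<Longrightarrow> s x (sc c y) = c * s x y"
    and hermitian: "\<lbrakk>x \<in> Q; y \<in> Q\<rbrakk> \<Longrightarrow> s y x = cnj (s x y)"
begin

abbreviation qf :: "'v \<Rightarrow> real" where "qf x \<equiv> Re (s x x)"

lemmas Q_closed [simp] = subspace_add[OF subspace_Q] subspace_scale[OF subspace_Q]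
  subspace_diff[OF subspace_Q] subspace_neg[OF subspace_Q] subspace_0[OF subspace_Q]
  subspace_sum[OF subspace_Q]

lemma add_left: "\<lbrakk>x \<in> Q; y \<in> Q; z \<in> Q\<rbrakk> \<Longrightarrow> s (x + y) z = s x z + s y z"
  using hermitian[of z "x + y"] hermitian[of z x] hermitian[of z y] add_right[of z x y] by simp

lemma scale_left: "\<lbrakk>x \<in> Q; y \<in> Q\<rbrakk> \<Longrightarrow> s (sc c x) y = cnj c * s x y"
  using hermitian[of y "sc c x"] hermitian[of y x] scale_right[of y x c] by simp

lemma diff_right: "\<lbrakk>x \<in> Q; y \<in> Q; z \<in> Q\<rbrakk> \<Longrightarrow> s x (y - z) = s x y - s x z"
  using add_right[of x "y - z" z] by simp

lemma diff_left: "\<lbrakk>x \<in> Q; y \<in> Q; z \<in> Q\<rbrakk> \<Longrightarrow> s (x - y) z = s x z - s y z"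
  using add_left[of "x - y" y z] by simp

lemma zero_right: "x \<in> Q \<Longrightarrow> s x 0 = 0"
  using scale_right[of x 0 0] by simp

lemma sum_right: "\<lbrakk>x \<in> Q; \<And>i. i \<in> I \<Longrightarrow> f i \<in> Q\<rbrakk> \<Longrightarrow> s x (\<Sum>i\<in>I. f i) = (\<Sum>i\<in>I. s x (f i))"
  by (induction I rule: infinite_finite_induct) (auto simp: zero_right add_right)

lemma sum_scale_right:
  assumes "x \<in> Q" "\<And>i. i \<in> I \<Longrightarrow> f i \<in> Q"
  shows "s x (\<Sum>i\<in>I. sc (c i) (f i)) = (\<Sum>i\<in>I. c i * s x (f i))"
  by (subst sum_right) (use assms in \<open>auto simp: scale_right intro!: sum.cong\<close>)

lemma self_real: "x \<in> Q \<Longrightarrow> s x x = of_real (qf x)"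
  using hermitian[of x x] by (simp add: complex_eq_iff)

lemma qf_add: "\<lbrakk>x \<in> Q; y \<in> Q\<rbrakk> \<Longrightarrow> qf (x + y) = qf x + qf y + 2 * Re (s x y)"
  using hermitian[of x y] by (simp add: add_left add_right)

lemma qf_diff: "\<lbrakk>x \<in> Q; y \<in> Q\<rbrakk> \<Longrightarrow> qf (x - y) = qf x + qf y - 2 * Re (s x y)"
  using hermitian[of x y] by (simp add: diff_left diff_right)

lemma qf_scale: "x \<in> Q \<Longrightarrow> qf (sc c x) = (cmod c)\<^sup>2 * qf x"
proof -
  assume x: "x \<in> Q"
  have "s (sc c x) (sc c x) = (cnj c * c) * s x x"
    using x by (simp add: scale_left scale_right)
  also have "cnj c * c = of_real ((cmod c)\<^sup>2)"
    by (metis complex_norm_square mult.commute)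
  finally show ?thesis by simp
qed

text \<open>The form shifted by the infimum is known to be nonnegative only on the orthogonal
  complement of the eigenvectors already found, so positivity is used on a subspace of
  \<open>Q\<close>.\<close>

lemma hermitian_form_subset: "X \<subseteq> Q \<Longrightarrow> subspace X \<Longrightarrow> hermitian_form sc X s"
  by unfold_locales (auto simp: subset_iff add_right scale_right intro: hermitian)

end

text \<open>The factor is real, since a complex one would destroy Hermitian symmetry. Instances are
  the perturbed form, its shift by an energy and the excess over \<open>kappa\<close>.\<close>

lemma hermitian_form_diff:
  assumes "hermitian_form sc Q s" "hermitian_form sc Q s'"
  shows "hermitian_form sc Q (\<lambda>x y. s x y - of_real a * s' x y)"
proof -
  interpret s: hermitian_form sc Q s by fact
  interpret s': hermitian_form sc Q s' by fact
  show ?thesis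
    by unfold_locales
      (auto simp: s.add_right s'.add_right s.scale_right s'.scale_right algebra_simps
         s.hermitian[symmetric] s'.hermitian[symmetric] s.subspace_Q)
qed

text \<open>Semidefinite rather than definite: a function that vanishes almost everywhere is a
  vector of norm 0 without being the zero vector.\<close>

locale positive_form = hermitian_form +
  assumes nonneg: "x \<in> Q \<Longrightarrow> 0 \<le> Re (s x x)"
begin

lemma cauchy_schwarz:
  assumes x: "x \<in> Q" and y: "y \<in> Q"
  shows "(cmod (s x y))\<^sup>2 \<le> qf x * qf y"
proof -
  define z where "z = s x y"
  \<comment> \<open>The phase \<open>cnj z\<close> makes the cross term real, a multiple of
    \<open>|z|^2\<close>, so one real parameter suffices.\<close>
  have *: "0 \<le> qf x + t\<^sup>2 * (cmod z)\<^sup>2 * qf y - 2 * t * (cmod z)\<^sup>2" for t :: real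
  proof -
    have "0 \<le> qf (x - sc (of_real t * cnj z) y)"
      using x y by (intro nonneg) auto
    also have "\<dots> = qf x + qf (sc (of_real t * cnj z) y) - 2 * Re (s x (sc (of_real t * cnj z) y))"
      using x y by (simp only: qf_diff Q_closed)
    also have "s x (sc (of_real t * cnj z) y) = of_real t * (cnj z * z)"
      using x y by (simp add: scale_right z_def mult.assoc)
    also have "qf (sc (of_real t * cnj z) y) = t\<^sup>2 * (cmod z)\<^sup>2 * qf y"
      using y by (simp only: qf_scale) (simp add: norm_mult power_mult_distrib)
    also have "cnj z * z = of_real ((cmod z)\<^sup>2)"
      by (metis complex_norm_square mult.commute)
    finally show ?thesis by simp
  qed
  show ?thesis
  proof (cases "qf y = 0")
    case True
    have "z = 0"
    proof (rule ccontr)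
      assume "z \<noteq> 0"
      \<comment> \<open>For \<open>qf y = 0\<close> the bound is affine in \<open>t\<close>, and
        this value of \<open>t\<close> makes it equal to -1.\<close>
      then show False
        using *[of "(qf x + 1) / (2 * (cmod z)\<^sup>2)"] True nonneg[OF x] by (simp add: field_simps)
    qed
    then show ?thesis using True by (simp add: z_def)
  next
    case False
    then have "qf y > 0" using nonneg[OF y] by simp
    then show ?thesis
      using *[of "1 / qf y"] by (simp add: field_simps power2_eq_square z_def)
  qed
qed

text \<open>Replaces an Euler-Lagrange computation: a minimiser is a null vector of the nonnegative
  shifted form, and Cauchy-Schwarz then makes it orthogonal to every vector.\<close>

lemma null_orthogonal:
  assumes "x \<in> Q" "y \<in> Q" "qf y = 0"
  shows "s x y = 0"
  using cauchy_schwarz[OF assms(1,2)] assms(3) by simp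

text \<open>The parallelogram law with the nonnegative term \<open>qf (x + y)\<close> discarded. If
  \<open>qf\<close> tends to 0 along a sequence, its differences become small in
  \<open>qf\<close>.\<close>

lemma qf_sum_diff: "\<lbrakk>x \<in> Q; y \<in> Q\<rbrakk> \<Longrightarrow> qf (x - y) \<le> 2 * qf x + 2 * qf y"
  using nonneg[of "x + y"] qf_add[of x y] qf_diff[of x y] by simp

lemma triangle:
  assumes "x \<in> Q" "y \<in> Q"
  shows "sqrt (qf (x + y)) \<le> sqrt (qf x) + sqrt (qf y)"
proof (rule real_le_lsqrt)
  have "Re (s x y) \<le> cmod (s x y)" by (rule complex_Re_le_cmod)
  also have "\<dots> \<le> sqrt (qf x * qf y)"
    using cauchy_schwarz[OF assms] by (intro real_le_rsqrt)
  finally show "qf (x + y) \<le> (sqrt (qf x) + sqrt (qf y))\<^sup>2"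
    using assms nonneg by (simp add: qf_add power2_sum real_sqrt_mult)
qed (use assms nonneg in auto)

lemma triangle_sum:
  assumes "\<And>i. i \<in> I \<Longrightarrow> f i \<in> Q"
  shows "sqrt (qf (\<Sum>i\<in>I. f i)) \<le> (\<Sum>i\<in>I. sqrt (qf (f i)))"
  using assms
proof (induction I rule: infinite_finite_induct)
  case (insert i I)
  then have "sqrt (qf (f i + (\<Sum>i\<in>I. f i))) \<le> sqrt (qf (f i)) + sqrt (qf (\<Sum>i\<in>I. f i))"
    by (intro triangle) auto
  with insert show ?case by fastforce
qed (auto simp: zero_right)

text \<open>The square root of \<open>qf\<close> is a seminorm, so the reverse triangle inequality
  applies.\<close>

lemma qf_tendsto:
  assumes x: "x \<in> Q" and y: "\<And>n. y n \<in> Q" and lim: "(\<lambda>n. qf (y n - x)) \<longlonglongrightarrow> 0"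
  shows "(\<lambda>n. qf (y n)) \<longlonglongrightarrow> qf x"
proof -
  have l0: "(\<lambda>n. sqrt (qf (y n - x))) \<longlonglongrightarrow> 0"
    using tendsto_real_sqrt[OF lim] by simp
  have neg: "qf (x - y n) = qf (y n - x)" for n
    using x y hermitian[of x "y n"] by (simp add: qf_diff)
  have "\<bar>sqrt (qf (y n)) - sqrt (qf x)\<bar> \<le> sqrt (qf (y n - x))" for n
    using triangle[of "y n - x" x] triangle[of "x - y n" "y n"] x y neg[of n] by auto
  then have "(\<lambda>n. sqrt (qf (y n)) - sqrt (qf x)) \<longlonglongrightarrow> 0"
    by (intro Lim_null_comparison[OF _ l0]) auto
  then have "(\<lambda>n. sqrt (qf (y n))) \<longlonglongrightarrow> sqrt (qf x)"
    by (rule LIM_zero_cancel)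
  then have "(\<lambda>n. (sqrt (qf (y n)))\<^sup>2) \<longlonglongrightarrow> (sqrt (qf x))\<^sup>2"
    by (rule tendsto_power)
  then show ?thesis
    unfolding real_sqrt_pow2[OF nonneg[OF x]] real_sqrt_pow2[OF nonneg[OF y]] .
qed

end

text \<open>Gaussian elimination. If the last equation has a nonzero coefficient, that one serves as
  pivot: its unknown is expressed through the others, and the remaining equations receive the
  reduced coefficients. Applied to trial functions, this gives a nontrivial combination orthogonal
  to the eigenvectors found so far, as long as these are fewer.\<close>

lemma homogeneous_system_nontrivial:
  fixes a :: "nat \<Rightarrow> 'j \<Rightarrow> complex"
  assumes "finite J" "n < card J"
  shows "\<exists>c. (\<exists>j\<in>J. c j \<noteq> 0) \<and> (\<forall>i<n. (\<Sum>j\<in>J. a i j * c j) = 0)"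
  using assms
proof (induction n arbitrary: J a)
  case 0
  then obtain j where "j \<in> J" by fastforce
  then show ?case by (intro exI[of _ "\<lambda>_. 1"]) auto
next
  case (Suc n)
  show ?case
  proof (cases "\<forall>j\<in>J. a n j = 0")
    case True
    from Suc.IH[of J a] Suc.prems obtain c
      where "\<exists>j\<in>J. c j \<noteq> 0" "\<forall>i<n. (\<Sum>j\<in>J. a i j * c j) = 0" by auto
    with True show ?thesis by (intro exI[of _ c]) (auto simp: less_Suc_eq)
  next
    case False
    then obtain k where k: "k \<in> J" "a n k \<noteq> 0" by blast
    define J' where "J' = J - {k}"
    have J': "finite J'" "n < card J'" "k \<notin> J'" "J = insert k J'"
      using Suc.prems k by (auto simp: J'_def)
    from Suc.IH[OF J'(1,2), of "\<lambda>i j. a i j - a i k * a n j / a n k"] obtain c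
      where c: "\<exists>j\<in>J'. c j \<noteq> 0" "\<And>i. i < n \<Longrightarrow> (\<Sum>j\<in>J'. (a i j - a i k * a n j / a n k) * c j) = 0"
      by auto
    define d where "d = c(k := - (\<Sum>j\<in>J'. a n j * c j) / a n k)"
    have eq: "(\<Sum>j\<in>J. a i j * d j) = (\<Sum>j\<in>J'. (a i j - a i k * a n j / a n k) * c j)" for i
    proof -
      have "(\<Sum>j\<in>J. a i j * d j) = a i k * d k + (\<Sum>j\<in>J'. a i j * c j)"
        unfolding J'(4) using J' by (simp add: d_def) (intro sum.cong, auto)
      also have "a i k * d k = - (\<Sum>j\<in>J'. a i k * a n j / a n k * c j)"
        by (simp add: d_def sum_distrib_left sum_divide_distrib sum_negf algebra_simps)
      finally show ?thesis by (simp add: algebra_simps sum_subtractf)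
    qed
    have "(\<Sum>j\<in>J. a i j * d j) = 0" if "i < Suc n" for i
    proof (cases "i = n")
      case True then show ?thesis using k by (simp add: eq)
    next
      case False then show ?thesis using that c(2)[of i] by (simp add: eq)
    qed
    moreover have "\<exists>j\<in>J. d j \<noteq> 0"
      using c(1) J' by (auto simp: d_def)
    ultimately show ?thesis by blast
  qed
qed

text \<open>
  The form \<open>t - w\<close> on \<open>Q\<close>, where \<open>n1\<close> is the square of the complete form norm, \<open>t\<close> is the
  unperturbed form with spectral bottom at least \<open>\<kappa>\<close> and the perturbation \<open>w\<close> is relatively compact.
\<close>
locale compact_perturbation = vector_space sc
  for sc :: "complex \<Rightarrow> 'v::ab_group_add \<Rightarrow> 'v" +
  fixes Q :: "'v set" and ip n1 t w :: "'v \<Rightarrow> 'v \<Rightarrow> complex" and \<kappa> :: real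
  assumes ip: "positive_form sc Q ip" and n1: "positive_form sc Q n1"
    and w: "positive_form sc Q w" and t: "hermitian_form sc Q t"
    and ip_le: "x \<in> Q \<Longrightarrow> Re (ip x x) \<le> Re (n1 x x)"
    and t_le: "\<exists>C. \<forall>x\<in>Q. Re (t x x) \<le> C * Re (n1 x x)"
    and t_ge: "E < \<kappa> \<Longrightarrow> \<exists>c>0. \<forall>x\<in>Q. c * Re (n1 x x) \<le> Re (t x x) - E * Re (ip x x)"
    and w_le: "\<epsilon> > 0 \<Longrightarrow> \<exists>C. \<forall>x\<in>Q. Re (w x x) \<le> \<epsilon> * Re (n1 x x) + C * Re (ip x x)"
    and w_compact: "\<lbrakk>\<And>n. f n \<in> Q; \<And>n. Re (n1 (f n) (f n)) \<le> B\<rbrakk> \<Longrightarrow>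
        \<exists>r. strict_mono (r :: nat \<Rightarrow> nat) \<and>
          (\<forall>e>0. \<exists>M. \<forall>m\<ge>M. \<forall>n\<ge>M. Re (w (f (r m) - f (r n)) (f (r m) - f (r n))) < e)"
    and complete: "\<lbrakk>\<And>n. f n \<in> Q;
          \<forall>e>0. \<exists>M. \<forall>m\<ge>M. \<forall>n\<ge>M. Re (n1 (f m - f n) (f m - f n)) < e\<rbrakk> \<Longrightarrow>
        \<exists>x\<in>Q. (\<lambda>n::nat. Re (n1 (f n - x) (f n - x))) \<longlonglongrightarrow> 0"
begin

interpretation ip: positive_form sc Q ip by (rule ip)
interpretation n1: positive_form sc Q n1 by (rule n1)
interpretation w: positive_form sc Q w by (rule w)
interpretation t: hermitian_form sc Q t by (rule t)

definition h :: "'v \<Rightarrow> 'v \<Rightarrow> complex" where "h x y = t x y - w x y"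

lemma h_hermitian: "hermitian_form sc Q h"
  using hermitian_form_diff[OF t, of w 1] w
  unfolding h_def[abs_def] positive_form_def by simp

interpretation h: hermitian_form sc Q h by (rule h_hermitian)

text \<open>The weak eigenvalue equation, tested on the whole form domain; this is what
  \<open>form_operator\<close> asks of an eigenpair.\<close>

definition eigenvector :: "real \<Rightarrow> 'v \<Rightarrow> bool" where
  "eigenvector \<mu> x \<longleftrightarrow> x \<in> Q \<and> (\<forall>y\<in>Q. h y x = of_real \<mu> * ip y x)"

text \<open>Half of the coercivity of \<open>t\<close> absorbs \<open>w\<close>. The energy
  \<open>\<kappa> - 1\<close> is an arbitrary one below \<open>\<kappa>\<close>.\<close>

lemma h_lower_bound:
  obtains c C where "c > 0" "\<And>x. x \<in> Q \<Longrightarrow> c * Re (n1 x x) - C * Re (ip x x) \<le> Re (h x x)"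
proof -
  from t_ge[of "\<kappa> - 1"] obtain c where c: "c > 0"
    "\<And>x. x \<in> Q \<Longrightarrow> c * Re (n1 x x) \<le> Re (t x x) - (\<kappa> - 1) * Re (ip x x)" by auto
  from w_le[of "c / 2"] c obtain C where C: 
    "\<And>x. x \<in> Q \<Longrightarrow> Re (w x x) \<le> c / 2 * Re (n1 x x) + C * Re (ip x x)" by auto
  show ?thesis
  proof (rule that)
    show "c / 2 > 0" using c by simp
    show "c / 2 * Re (n1 x x) - (C - (\<kappa> - 1)) * Re (ip x x) \<le> Re (h x x)" if "x \<in> Q" for x
      using c(2)[OF that] C[OF that] by (simp add: h_def algebra_simps)
  qed
qed

text \<open>The direct method on the orthogonal complement \<open>X\<close>. With \<open>E\<close>
  the infimum of \<open>h\<close> over unit vectors of \<open>X\<close>, the form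
  \<open>s = h - E ip\<close> is nonnegative there and tends to 0 along a minimising sequence. Since
  \<open>s + w = t - E ip\<close> is coercive for \<open>E < \<kappa>\<close>, small differences in
  \<open>s\<close> (parallelogram law) and in \<open>w\<close> (compactness) add up to small
  differences in the complete norm, so strong convergence is obtained without weak limits.\<close>

lemma minimizer_exists:
  assumes b: "\<And>i. i < n \<Longrightarrow> b i \<in> Q"
    and X_def: "X = {x \<in> Q. \<forall>i<n. ip (b i) x = 0}"
    and x0: "x0 \<in> X" "Re (h x0 x0) < \<kappa> * Re (ip x0 x0)"
  shows "\<exists>x\<in>X. \<exists>E<\<kappa>. ip x x = 1 \<and> (\<forall>y\<in>X. h y x = of_real E * ip y x)"
proof -
  have XQ: "X \<subseteq> Q" by (auto simp: X_def)
  have X: "subspace X"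
    unfolding X_def using b
    by (intro subspaceI) (auto simp: ip.zero_right ip.add_right ip.scale_right)
  obtain c C where c: "c > 0" and lower: "\<And>x. x \<in> Q \<Longrightarrow> c * Re (n1 x x) - C * Re (ip x x) \<le> Re (h x x)"
    using h_lower_bound by blast
  define R where "R = {Re (h x x) | x. x \<in> X \<and> Re (ip x x) = 1}"
  define E where "E = Inf R"
  \<comment> \<open>A vector of norm 0 cannot have negative energy, which is why \<open>x0\<close>
    can be normalised.\<close>
  have null: "0 \<le> Re (h x x)" if "x \<in> X" "Re (ip x x) = 0" for x
  proof -
    have "0 \<le> c * Re (n1 x x)" using that XQ c n1.nonneg by auto
    then show ?thesis using lower[of x] that XQ by auto
  qed
  have normalize: "Re (h x x) / Re (ip x x) \<in> R" if "x \<in> X" "Re (ip x x) \<noteq> 0" for x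
  proof -
    have pos: "Re (ip x x) > 0" using that ip.nonneg[of x] XQ by auto
    let ?a = "complex_of_real (1 / sqrt (Re (ip x x)))"
    have a2: "(cmod ?a)\<^sup>2 = 1 / Re (ip x x)" using pos by (simp add: power_divide norm_divide)
    have xQ: "x \<in> Q" using that XQ by auto
    have "Re (h (sc ?a x) (sc ?a x)) = Re (h x x) / Re (ip x x)"
      using h.qf_scale[OF xQ, of ?a] a2 by simp
    moreover have "Re (ip (sc ?a x) (sc ?a x)) = 1"
      using ip.qf_scale[OF xQ, of ?a] a2 pos by simp
    moreover have "sc ?a x \<in> X" using X that by (simp add: subspace_scale)
    ultimately show ?thesis unfolding R_def by (intro CollectI exI[of _ "sc ?a x"]) auto
  qed
  have bdd: "bdd_below R"
    unfolding bdd_below_def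
  proof (intro exI[of _ "- C"] ballI)
    fix y assume "y \<in> R"
    then obtain x where x: "x \<in> X" "Re (ip x x) = 1" "y = Re (h x x)" by (auto simp: R_def)
    moreover have "0 \<le> c * Re (n1 x x)" using x XQ c n1.nonneg by auto
    ultimately show "- C \<le> y" using lower[of x] XQ by auto
  qed
  have ip0: "Re (ip x0 x0) \<noteq> 0" using null[OF x0(1)] x0(2) by auto
  have R0: "Re (h x0 x0) / Re (ip x0 x0) \<in> R" using normalize[OF x0(1) ip0] .
  have "E \<le> Re (h x0 x0) / Re (ip x0 x0)"
    unfolding E_def by (rule cInf_lower[OF R0 bdd])
  also have "\<dots> < \<kappa>"
    using x0 ip0 ip.nonneg[of x0] XQ by (auto simp: field_simps)
  finally have E: "E < \<kappa>" .
  define s where "s = (\<lambda>x y. h x y - of_real E * ip x y)"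
  have "hermitian_form sc Q s"
    unfolding s_def by (rule hermitian_form_diff[OF h_hermitian ip.hermitian_form_axioms])
  then have sh: "hermitian_form sc X s"
    using XQ X by (rule hermitian_form.hermitian_form_subset)
  interpret s: positive_form sc X s
  proof (intro positive_form.intro sh positive_form_axioms.intro)
    fix x assume x: "x \<in> X"
    show "0 \<le> Re (s x x)"
    proof (cases "Re (ip x x) = 0")
      case True
      then show ?thesis using null[OF x] by (simp add: s_def)
    next
      case False
      have "E \<le> Re (h x x) / Re (ip x x)"
        unfolding E_def by (rule cInf_lower[OF normalize[OF x False] bdd])
      then show ?thesis
        using False ip.nonneg[of x] x XQ by (auto simp: s_def field_simps)
    qed
  qed
  have "\<exists>f. f \<in> X \<and> Re (ip f f) = 1 \<and> Re (h f f) < E + 1 / Suc k" for k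
  proof -
    have "\<exists>r\<in>R. r < E + 1 / Suc k"
      using cInf_lessD[of R "E + 1 / Suc k"] R0 by (auto simp: E_def)
    then show ?thesis by (auto simp: R_def)
  qed
  then obtain f where f: "\<And>k. f k \<in> X" "\<And>k. Re (ip (f k) (f k)) = 1"
    "\<And>k. Re (h (f k) (f k)) < E + 1 / Suc k" by metis
  have fQ: "f k \<in> Q" for k using f XQ by auto
  have sf: "Re (s (f k) (f k)) \<le> 1 / Suc k" for k
    using f(2)[of k] f(3)[of k] by (simp add: s_def)
  have "Re (n1 (f k) (f k)) \<le> (E + 1 + C) / c" for k
  proof -
    have "1 / real (Suc k) \<le> 1" by simp
    then have "c * Re (n1 (f k) (f k)) \<le> E + 1 + C"
      using lower[OF fQ, of k] f(3)[of k] unfolding f(2) by linarith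
    then show ?thesis using c by (simp add: field_simps)
  qed
  from w_compact[of f, OF fQ this] obtain r where r: "strict_mono (r :: nat \<Rightarrow> nat)"
    and wr: "\<And>e. e > 0 \<Longrightarrow> \<exists>M. \<forall>m\<ge>M. \<forall>n\<ge>M. Re (w (f (r m) - f (r n)) (f (r m) - f (r n))) < e"
    by blast
  define g where "g = f \<circ> r"
  have gX: "g k \<in> X" and gQ: "g k \<in> Q" for k using f fQ by (auto simp: g_def)
  have sg: "Re (s (g k) (g k)) \<le> 1 / Suc k" for k
  proof -
    have "Re (s (g k) (g k)) \<le> 1 / Suc (r k)" using sf by (simp add: g_def)
    also have "\<dots> \<le> 1 / Suc k" using seq_suble[OF r, of k] by (simp add: field_simps)
    finally show ?thesis .
  qed
  from t_ge[OF E] obtain c' where c': "c' > 0"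
    "\<And>x. x \<in> Q \<Longrightarrow> c' * Re (n1 x x) \<le> Re (t x x) - E * Re (ip x x)" by auto
  \<comment> \<open>Adding \<open>w\<close> back to \<open>s\<close> leaves the unperturbed form
    shifted by \<open>E\<close>, which is coercive.\<close>
  have split: "Re (t x x) - E * Re (ip x x) = Re (s x x) + Re (w x x)" for x
    by (simp add: s_def h_def)
  have "\<exists>M. \<forall>m\<ge>M. \<forall>n\<ge>M. Re (n1 (g m - g n) (g m - g n)) < e" if e: "e > 0" for e
  proof -
    from wr[of "c' * e / 2"] c' e obtain M where M:
      "\<And>m n. m \<ge> M \<Longrightarrow> n \<ge> M \<Longrightarrow> Re (w (g m - g n) (g m - g n)) < c' * e / 2"
      by (auto simp: g_def)
    \<comment> \<open>The parallelogram law doubles each of two terms, so eighths leave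
      \<open>c' * e / 2\<close> for \<open>w\<close>.\<close>
    obtain K :: nat where K: "1 / Suc K < c' * e / 8"
      using nat_approx_posE[of "c' * e / 8"] c' e by auto
    have "Re (n1 (g m - g n) (g m - g n)) < e" if mn: "m \<ge> max M K" "n \<ge> max M K" for m n
    proof -
      have k: "Re (s (g k) (g k)) < c' * e / 8" if "k \<ge> K" for k
      proof -
        have "1 / real (Suc k) \<le> 1 / Suc K" using that by (simp add: field_simps)
        then show ?thesis using sg[of k] K by linarith
      qed
      have "c' * Re (n1 (g m - g n) (g m - g n)) \<le> Re (s (g m - g n) (g m - g n)) + Re (w (g m - g n) (g m - g n))"
        using c'(2)[of "g m - g n"] gQ split by simp
      also have "\<dots> \<le> 2 * Re (s (g m) (g m)) + 2 * Re (s (g n) (g n)) + Re (w (g m - g n) (g m - g n))"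
        using s.qf_sum_diff[OF gX gX] by simp
      also have "\<dots> < c' * e"
        using k[of m] k[of n] M[of m n] mn by simp
      finally show ?thesis using c' by simp
    qed
    then show ?thesis by blast
  qed
  with complete[of g, OF gQ] obtain x where x: "x \<in> Q"
    and lim: "(\<lambda>n. Re (n1 (g n - x) (g n - x))) \<longlonglongrightarrow> 0" by auto
  have lim_ip: "(\<lambda>n. Re (ip (g n - x) (g n - x))) \<longlonglongrightarrow> 0"
    by (rule tendsto_sandwich[OF _ _ tendsto_const lim])
      (use ip.nonneg ip_le gQ x in auto)
  \<comment> \<open>Orthogonality passes to the limit by Cauchy-Schwarz, so the limit stays in
    \<open>X\<close>.\<close>
  have "ip (b i) x = 0" if i: "i < n" for i
  proof -
    have "(cmod (ip (b i) x))\<^sup>2 \<le> Re (ip (b i) (b i)) * Re (ip (g k - x) (g k - x))" for k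
    proof -
      have "ip (b i) (g k) = 0" using gX i by (auto simp: X_def)
      then have "cmod (ip (b i) x) = cmod (ip (b i) (g k - x))"
        using b[OF i] gQ x by (simp add: ip.diff_right)
      then show ?thesis using ip.cauchy_schwarz[of "b i" "g k - x"] b[OF i] gQ x by simp
    qed
    moreover have "(\<lambda>k. Re (ip (b i) (b i)) * Re (ip (g k - x) (g k - x))) \<longlonglongrightarrow> Re (ip (b i) (b i)) * 0"
      by (intro tendsto_intros lim_ip)
    ultimately have "(cmod (ip (b i) x))\<^sup>2 \<le> Re (ip (b i) (b i)) * 0"
      by (intro LIMSEQ_le_const) auto
    then show ?thesis by simp
  qed
  then have xX: "x \<in> X" using x by (auto simp: X_def)
  have "(\<lambda>n. Re (ip (g n) (g n))) \<longlonglongrightarrow> Re (ip x x)"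
    by (rule ip.qf_tendsto[OF x gQ lim_ip])
  then have "Re (ip x x) = 1"
    using f(2) by (simp add: g_def LIMSEQ_const_iff)
  then have ipx: "ip x x = 1" using ip.self_real[OF x] by simp
  from t_le obtain C2 where C2: "\<And>x. x \<in> Q \<Longrightarrow> Re (t x x) \<le> C2 * Re (n1 x x)" by auto
  \<comment> \<open>\<open>w\<close> enters \<open>s\<close> with a minus sign and is dropped; hence
    convergence in the form norm implies convergence in \<open>s\<close>.\<close>
  have s_le: "Re (s y y) \<le> (C2 + \<bar>E\<bar>) * Re (n1 y y)" if y: "y \<in> Q" for y
  proof -
    have "- E * Re (ip y y) \<le> \<bar>E\<bar> * Re (n1 y y)"
      using ip_le[OF y] ip.nonneg[OF y] by (meson abs_ge_minus_self abs_ge_zero mult_mono)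
    then show ?thesis using C2[OF y] split[of y] w.nonneg[OF y] by (simp add: algebra_simps)
  qed
  have up: "(\<lambda>n. (C2 + \<bar>E\<bar>) * Re (n1 (g n - x) (g n - x))) \<longlonglongrightarrow> 0"
    using tendsto_mult_left[OF lim, of "C2 + \<bar>E\<bar>"] by simp
  have "0 \<le> Re (s (g n - x) (g n - x))" for n
    by (rule s.nonneg[OF s.Q_closed(3)[OF gX xX]])
  moreover have "Re (s (g n - x) (g n - x)) \<le> (C2 + \<bar>E\<bar>) * Re (n1 (g n - x) (g n - x))" for n
    by (rule s_le[OF ip.Q_closed(3)[OF gQ x]])
  ultimately have "(\<lambda>n. Re (s (g n - x) (g n - x))) \<longlonglongrightarrow> 0"
    by (intro tendsto_sandwich[OF always_eventually always_eventually tendsto_const up]) auto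
  then have "(\<lambda>n. Re (s (g n) (g n))) \<longlonglongrightarrow> Re (s x x)"
    by (rule s.qf_tendsto[OF xX gX])
  moreover have "(\<lambda>n. Re (s (g n) (g n))) \<longlonglongrightarrow> 0"
    by (rule tendsto_sandwich[OF _ _ tendsto_const LIMSEQ_inverse_real_of_nat])
      (use sg s.nonneg gX in \<open>auto simp: inverse_eq_divide\<close>)
  ultimately have sx: "Re (s x x) = 0" using LIMSEQ_unique by blast
  have "h y x = of_real E * ip y x" if "y \<in> X" for y
    using s.null_orthogonal[OF that xX sx] by (simp add: s_def)
  with xX E ipx show ?thesis by blast
qed

text \<open>Each step adds one eigenvector: some nontrivial combination of the \<open>N\<close>
  trial functions is orthogonal to the \<open>n < N\<close> vectors found so far, so the infimum
  over their complement is below \<open>\<kappa>\<close>. Because these vectors are eigenvectors,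
  \<open>h\<close> does not couple them to the complement, and this extends the equation for the
  minimiser from the complement to all of \<open>Q\<close>.\<close>

theorem eigenvectors_exist:
  assumes \<psi>: "\<And>j. j < N \<Longrightarrow> \<psi> j \<in> Q"
    and trial: "\<And>c :: nat \<Rightarrow> complex. \<exists>j<N. c j \<noteq> 0 \<Longrightarrow>
      Re (h (\<Sum>j<N. sc (c j) (\<psi> j)) (\<Sum>j<N. sc (c j) (\<psi> j)))
        < \<kappa> * Re (ip (\<Sum>j<N. sc (c j) (\<psi> j)) (\<Sum>j<N. sc (c j) (\<psi> j)))"
  shows "\<exists>b \<mu>. (\<forall>i<N. eigenvector (\<mu> i) (b i) \<and> \<mu> i < \<kappa>) \<and>
      (\<forall>i<N. \<forall>j<N. ip (b i) (b j) = (if i = j then 1 else 0))"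
proof -
  have "n \<le> N \<Longrightarrow> \<exists>b \<mu>. (\<forall>i<n. eigenvector (\<mu> i) (b i) \<and> \<mu> i < \<kappa>) \<and>
      (\<forall>i<n. \<forall>j<n. ip (b i) (b j) = (if i = j then 1 else 0))" for n
  proof (induction n)
    case (Suc n)
    then obtain b \<mu> where b: "\<forall>i<n. eigenvector (\<mu> i) (b i) \<and> \<mu> i < \<kappa>"
      and orth: "\<forall>i<n. \<forall>j<n. ip (b i) (b j) = (if i = j then 1 else 0)"
      using Suc_leD by blast
    have bQ: "b i \<in> Q" if "i < n" for i using b that by (simp add: eigenvector_def)
    obtain c where c: "\<exists>j<N. c j \<noteq> 0" "\<And>i. i < n \<Longrightarrow> (\<Sum>j<N. ip (b i) (\<psi> j) * c j) = 0"
      using homogeneous_system_nontrivial[of "{..<N}" n "\<lambda>i j. ip (b i) (\<psi> j)"] Suc.prems by auto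
    define x0 where "x0 = (\<Sum>j<N. sc (c j) (\<psi> j))"
    define X where "X = {x \<in> Q. \<forall>i<n. ip (b i) x = 0}"
    have "ip (b i) x0 = 0" if "i < n" for i
      unfolding x0_def
      by (subst ip.sum_scale_right) (use c(2)[OF that] bQ[OF that] \<psi> in \<open>auto simp: mult.commute\<close>)
    moreover have "x0 \<in> Q" unfolding x0_def using \<psi> by (intro ip.Q_closed) auto
    ultimately have "x0 \<in> X" by (simp add: X_def)
    moreover have "Re (h x0 x0) < \<kappa> * Re (ip x0 x0)"
      using trial[OF c(1)] by (simp add: x0_def)
    ultimately obtain x E where x: "x \<in> X" "E < \<kappa>" "ip x x = 1" "\<And>y. y \<in> X \<Longrightarrow> h y x = of_real E * ip y x"
      using minimizer_exists[OF bQ X_def] by blast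
    have xQ: "x \<in> Q" and bx: "\<And>i. i < n \<Longrightarrow> ip (b i) x = 0" using x by (auto simp: X_def)
    have xb: "ip x (b i) = 0" if "i < n" for i
      using ip.hermitian[OF bQ[OF that] xQ] bx[OF that] by simp
    have hb: "h (b i) x = 0" if "i < n" for i
    proof -
      have "h x (b i) = 0" using b that xQ xb[OF that] by (simp add: eigenvector_def)
      then show ?thesis using h.hermitian[OF xQ bQ[OF that]] by simp
    qed
    have "eigenvector E x"
      unfolding eigenvector_def
    proof (intro conjI xQ ballI)
      fix y assume y: "y \<in> Q"
      \<comment> \<open>The orthogonal projection of the test vector onto the eigenvectors found so
        far; both sides of the equation vanish on it.\<close>
      define p where "p = (\<Sum>i<n. sc (ip (b i) y) (b i))"
      have pQ: "p \<in> Q" unfolding p_def using bQ by (intro ip.Q_closed) auto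
      have "ip (b i) (y - p) = 0" if i: "i < n" for i
      proof -
        have "ip (b i) p = (\<Sum>j<n. ip (b j) y * ip (b i) (b j))"
          unfolding p_def by (rule ip.sum_scale_right) (use bQ i in auto)
        also have "\<dots> = (\<Sum>j<n. if i = j then ip (b j) y else 0)"
          using orth i by (intro sum.cong) auto
        also have "\<dots> = ip (b i) y" using i by simp
        finally show ?thesis using bQ[OF i] y pQ by (simp add: ip.diff_right)
      qed
      then have "y - p \<in> X" using y pQ by (simp add: X_def)
      then have *: "h (y - p) x = of_real E * ip (y - p) x" by (rule x(4))
      have "h x p = 0"
        unfolding p_def
        by (subst h.sum_scale_right) (use bQ xQ hb h.hermitian[OF bQ xQ] in auto)
      then have "h p x = 0" using h.hermitian[OF xQ pQ] by simp
      moreover have "ip x p = 0"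
        unfolding p_def by (subst ip.sum_scale_right) (use bQ xQ xb in auto)
      then have "ip p x = 0" using ip.hermitian[OF xQ pQ] by simp
      ultimately show "h y x = of_real E * ip y x"
        using * y pQ xQ by (simp add: h.diff_left ip.diff_left)
    qed
    then show ?case
      using b orth x(2,3) bx xb
      by (intro exI[of _ "b(n := x)"] exI[of _ "\<mu>(n := E)"]) (simp add: less_Suc_eq all_conj_distrib)
  qed auto
  then show ?thesis by blast
qed

end

section \<open>The space \<open>L\<^sup>2\<close>\<close>

text \<open>Outside \<open>L2\<close> the integral may be the default value 0, so \<open>l2\<close>
  is informative only together with membership in \<open>L2\<close>.\<close>

definition l2 :: "(plane \<Rightarrow> 'b::euclidean_space) \<Rightarrow> real" where
  "l2 f = sqrt (LINT x|lebesgue. (norm (f x))\<^sup>2)"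

lemma L2_measurable [measurable_dest]: "f \<in> L2 \<Longrightarrow> f \<in> borel_measurable lebesgue"
  by (simp add: L2_def)

lemma L2_integrable: "f \<in> L2 \<Longrightarrow> integrable lebesgue (\<lambda>x. (norm (f x))\<^sup>2)"
  by (simp add: L2_def)

lemma L2_bound:
  assumes "f \<in> borel_measurable lebesgue" "integrable lebesgue g" "AE x in lebesgue. (norm (f x))\<^sup>2 \<le> g x"
  shows "f \<in> L2"
  using assms unfolding L2_def by (auto intro!: Bochner_Integration.integrable_bound[OF assms(2)])

lemma L2_nn_integral_iff:
  "f \<in> L2 \<longleftrightarrow> f \<in> borel_measurable lebesgue \<and> (\<integral>\<^sup>+x. ennreal ((norm (f x))\<^sup>2) \<partial>lebesgue) < \<infinity>"
  unfolding L2_def by (auto simp: integrable_iff_bounded)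

lemma l2_nonneg [simp]: "0 \<le> l2 f"
  by (simp add: l2_def)

lemma l2_square: "(l2 f)\<^sup>2 = (LINT x|lebesgue. (norm (f x))\<^sup>2)"
  by (simp add: l2_def)

lemma l2_nn_integral: "f \<in> L2 \<Longrightarrow> (\<integral>\<^sup>+x. ennreal ((norm (f x))\<^sup>2) \<partial>lebesgue) = ennreal ((l2 f)\<^sup>2)"
  unfolding l2_square by (intro nn_integral_eq_integral L2_integrable) auto

lemma l2_leI:
  assumes "f \<in> L2" "0 \<le> c" "(\<integral>\<^sup>+x. ennreal ((norm (f x))\<^sup>2) \<partial>lebesgue) \<le> ennreal (c\<^sup>2)"
  shows "l2 f \<le> c"
  using assms by (simp add: l2_nn_integral power2_le_iff_abs_le)

lemma L2_cong_AE:
  assumes "f \<in> L2" "AE x in lebesgue. f x = g x"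
  shows "g \<in> L2"
proof -
  have "g \<in> borel_measurable lebesgue"
    using L2_measurable[OF assms(1)] assms(2) by (rule borel_measurable_AE)
  then show ?thesis
    by (rule L2_bound[OF _ L2_integrable[OF assms(1)]]) (use assms(2) in auto)
qed

lemma l2_cong_AE:
  assumes "AE x in lebesgue. f x = g x" "f \<in> L2"
  shows "l2 f = l2 g"
  unfolding l2_def
  by (intro arg_cong[of _ _ sqrt] integral_cong_AE)
     (use assms L2_cong_AE[OF assms(2,1)] in \<open>auto intro!: borel_measurable_power borel_measurable_norm\<close>)

lemma L2_zero [simp]: "(\<lambda>x. 0) \<in> L2"
  by (simp add: L2_def)

lemma L2_scale:
  fixes f :: "plane \<Rightarrow> 'b::euclidean_space" and g :: "plane \<Rightarrow> 'c::euclidean_space"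
  assumes "f \<in> L2" "g \<in> borel_measurable lebesgue" "\<And>x. norm (g x) \<le> c * norm (f x)"
  shows "g \<in> L2"
proof (rule L2_bound[OF assms(2)])
  show "integrable lebesgue (\<lambda>x. c\<^sup>2 * (norm (f x))\<^sup>2)"
    by (intro integrable_mult_right L2_integrable assms)
  have "(norm (g x))\<^sup>2 \<le> c\<^sup>2 * (norm (f x))\<^sup>2" for x
    using power_mono[OF assms(3)[of x], of 2] by (simp add: power_mult_distrib)
  then show "AE x in lebesgue. (norm (g x))\<^sup>2 \<le> c\<^sup>2 * (norm (f x))\<^sup>2" by simp
qed

lemma L2_add:
  assumes f: "f \<in> L2" and g: "g \<in> L2"
  shows "(\<lambda>x. f x + g x) \<in> L2"
proof (rule L2_bound)
  show "(\<lambda>x. f x + g x) \<in> borel_measurable lebesgue"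
    using L2_measurable[OF f] L2_measurable[OF g] by (rule borel_measurable_add)
  show "integrable lebesgue (\<lambda>x. 2 * (norm (f x))\<^sup>2 + 2 * (norm (g x))\<^sup>2)"
    by (intro Bochner_Integration.integrable_add integrable_mult_right L2_integrable assms)
  have "(norm (f x + g x))\<^sup>2 \<le> 2 * (norm (f x))\<^sup>2 + 2 * (norm (g x))\<^sup>2" for x
  proof -
    have "(norm (f x + g x))\<^sup>2 \<le> (norm (f x) + norm (g x))\<^sup>2"
      by (intro power_mono norm_triangle_ineq) auto
    also have "\<dots> \<le> 2 * (norm (f x))\<^sup>2 + 2 * (norm (g x))\<^sup>2"
      using sum_squares_ge_zero[of "norm (f x) - norm (g x)" 0] 
      by (simp add: power2_eq_square algebra_simps)
    finally show ?thesis .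
  qed
  then show "AE x in lebesgue. (norm (f x + g x))\<^sup>2 \<le> 2 * (norm (f x))\<^sup>2 + 2 * (norm (g x))\<^sup>2" by simp
qed

lemma L2_scaleR: "f \<in> L2 \<Longrightarrow> (\<lambda>x. c *\<^sub>R f x) \<in> L2"
  by (rule L2_scale[of f _ "\<bar>c\<bar>"]) (auto intro!: borel_measurable_scaleR L2_measurable)

lemma L2_minus: "f \<in> L2 \<Longrightarrow> (\<lambda>x. - f x) \<in> L2"
  using L2_scaleR[of f "-1"] by simp

lemma L2_diff: "f \<in> L2 \<Longrightarrow> g \<in> L2 \<Longrightarrow> (\<lambda>x. f x - g x) \<in> L2"
  using L2_add[of f "\<lambda>x. - g x"] L2_minus[of g] by simp

lemma L2_norm_mult_integrable:
  assumes f: "f \<in> L2" and g: "g \<in> L2"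
  shows "integrable lebesgue (\<lambda>x. norm (f x) * norm (g x))"
proof (rule Bochner_Integration.integrable_bound)
  show "integrable lebesgue (\<lambda>x. (norm (f x))\<^sup>2 + (norm (g x))\<^sup>2)"
    by (intro Bochner_Integration.integrable_add L2_integrable assms)
  show "(\<lambda>x. norm (f x) * norm (g x)) \<in> borel_measurable lebesgue"
    using L2_measurable[OF f] L2_measurable[OF g] by simp
  have "norm (f x) * norm (g x) \<le> (norm (f x))\<^sup>2 + (norm (g x))\<^sup>2" for x
    using sum_squares_bound[of "norm (f x)" "norm (g x)"] mult_nonneg_nonneg[OF norm_ge_zero[of "f x"] norm_ge_zero[of "g x"]] 
    by linarith
  then show "AE x in lebesgue. norm (norm (f x) * norm (g x)) \<le> norm ((norm (f x))\<^sup>2 + (norm (g x))\<^sup>2)"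
    by simp
qed

lemma l2_cauchy_schwarz:
  assumes f: "f \<in> L2" and g: "g \<in> L2"
  shows "(LINT x|lebesgue. norm (f x) * norm (g x)) \<le> l2 f * l2 g"
proof -
  let ?I = "LINT x|lebesgue. norm (f x) * norm (g x)"
  have "(\<integral>\<^sup>+x. ennreal (norm (f x)) * ennreal (norm (g x)) \<partial>lebesgue)\<^sup>2
      \<le> (\<integral>\<^sup>+x. (ennreal (norm (f x)))\<^sup>2 \<partial>lebesgue) * (\<integral>\<^sup>+x. (ennreal (norm (g x)))\<^sup>2 \<partial>lebesgue)"
    using L2_measurable[OF f] L2_measurable[OF g] by (intro Cauchy_Schwarz_nn_integral) simp_all
  also have "(\<integral>\<^sup>+x. ennreal (norm (f x)) * ennreal (norm (g x)) \<partial>lebesgue) = ennreal ?I"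
    using L2_norm_mult_integrable[OF f g]
    by (subst nn_integral_eq_integral[symmetric]) (auto simp: ennreal_mult)
  finally have "(ennreal ?I)\<^sup>2 \<le> ennreal ((l2 f)\<^sup>2) * ennreal ((l2 g)\<^sup>2)"
    by (simp add: ennreal_power l2_nn_integral f g)
  then have "?I\<^sup>2 \<le> (l2 f * l2 g)\<^sup>2"
    by (simp add: ennreal_power power_mult_distrib flip: ennreal_mult)
  then show ?thesis by (rule power2_le_imp_le) simp
qed

lemma l2_triangle:
  assumes f: "f \<in> L2" and g: "g \<in> L2"
  shows "l2 (\<lambda>x. f x + g x) \<le> l2 f + l2 g"
proof (rule power2_le_imp_le)
  have "(l2 (\<lambda>x. f x + g x))\<^sup>2 \<le> (LINT x|lebesgue. (norm (f x))\<^sup>2 + (norm (g x))\<^sup>2 + 2 * (norm (f x) * norm (g x)))"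
    unfolding l2_square
  proof (intro integral_mono)
    show "(norm (f x + g x))\<^sup>2 \<le> (norm (f x))\<^sup>2 + (norm (g x))\<^sup>2 + 2 * (norm (f x) * norm (g x))" for x
      using power_mono[OF norm_triangle_ineq[of "f x" "g x"], of 2] by (simp add: power2_sum)
  qed (intro L2_integrable L2_add f g Bochner_Integration.integrable_add integrable_mult_right L2_norm_mult_integrable)+
  also have "\<dots> = (l2 f)\<^sup>2 + (l2 g)\<^sup>2 + 2 * (LINT x|lebesgue. norm (f x) * norm (g x))"
    using L2_integrable[OF f] L2_integrable[OF g] L2_norm_mult_integrable[OF f g]
    by (simp add: l2_square)
  also have "\<dots> \<le> (l2 f + l2 g)\<^sup>2"
    using l2_cauchy_schwarz[OF f g] by (simp add: power2_sum)
  finally show "(l2 (\<lambda>x. f x + g x))\<^sup>2 \<le> (l2 f + l2 g)\<^sup>2" .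
qed simp

lemma l2_diff_commute: "l2 (\<lambda>x. f x - g x) = l2 (\<lambda>x. g x - f x)"
  by (simp add: l2_def norm_minus_commute)

lemma l2_triangle_diff:
  assumes "f \<in> L2" "g \<in> L2" "k \<in> L2"
  shows "l2 (\<lambda>x. f x - g x) \<le> l2 (\<lambda>x. f x - k x) + l2 (\<lambda>x. k x - g x)"
  using l2_triangle[of "\<lambda>x. f x - k x" "\<lambda>x. k x - g x"] assms by (simp add: L2_diff)

lemma l2_diff_abs:
  assumes "f \<in> L2" "g \<in> L2"
  shows "\<bar>l2 f - l2 g\<bar> \<le> l2 (\<lambda>x. f x - g x)"
  using l2_triangle[of "\<lambda>x. f x - g x" g] l2_triangle[of "\<lambda>x. g x - f x" f] assms
    l2_diff_commute[of f g] by (simp add: L2_diff)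

lemma l2_tendsto:
  assumes "\<And>n. u n \<in> L2" "f \<in> L2" "(\<lambda>n. l2 (\<lambda>x. u n x - f x)) \<longlonglongrightarrow> 0"
  shows "(\<lambda>n. l2 (u n)) \<longlonglongrightarrow> l2 f"
  by (rule LIM_zero_cancel, rule Lim_null_comparison[OF _ assms(3)])
     (use l2_diff_abs[OF assms(1,2)] in auto)

lemma l2_eq_0_AE: "f \<in> L2 \<Longrightarrow> l2 f = 0 \<Longrightarrow> AE x in lebesgue. f x = 0"
  using integral_nonneg_eq_0_iff_AE[OF L2_integrable, of f] by (simp add: l2_def)

text \<open>The squared distances converge to 0 in L1, hence almost everywhere along a subsequence.
  This is the means of identifying an L2 limit with a pointwise one.\<close>

lemma L2_subseq_AE:
  assumes u: "\<And>n. u n \<in> L2" and f: "f \<in> L2" and lim: "(\<lambda>n. l2 (\<lambda>x. u n x - f x)) \<longlonglongrightarrow> 0"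
  shows "\<exists>r::nat \<Rightarrow> nat. strict_mono r \<and> (AE x in lebesgue. (\<lambda>n. u (r n) x) \<longlonglongrightarrow> f x)"
proof -
  have "(\<lambda>n. (l2 (\<lambda>x. u n x - f x))\<^sup>2) \<longlonglongrightarrow> 0"
    using tendsto_power[OF lim, of 2] by simp
  then have *: "(\<lambda>n. (LINT x|lebesgue. norm ((norm (u n x - f x))\<^sup>2))) \<longlonglongrightarrow> 0"
    by (simp add: l2_square)
  obtain r :: "nat \<Rightarrow> nat" where r: "strict_mono r"
    and ae: "AE x in lebesgue. (\<lambda>n. (norm (u (r n) x - f x))\<^sup>2) \<longlonglongrightarrow> 0"
    using tendsto_L1_AE_subseq[OF L2_integrable[OF L2_diff[OF u f]] *] by auto
  have "AE x in lebesgue. (\<lambda>n. u (r n) x) \<longlonglongrightarrow> f x"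
    using ae
  proof eventually_elim
    case (elim x)
    then have "(\<lambda>n. sqrt ((norm (u (r n) x - f x))\<^sup>2)) \<longlonglongrightarrow> sqrt 0"
      by (rule tendsto_real_sqrt)
    then show ?case by (simp add: LIM_zero_iff tendsto_norm_zero_iff)
  qed
  with r show ?thesis by blast
qed

text \<open>Riesz-Fischer. A subsequence with increments below \<open>(1/4) ^ k\<close> converges
  almost everywhere, and Fatou's lemma transfers the Cauchy estimate to the pointwise limit.\<close>

theorem L2_complete:
  fixes u :: "nat \<Rightarrow> plane \<Rightarrow> 'b::euclidean_space"
  assumes u: "\<And>n. u n \<in> L2"
    and cauchy: "\<And>e. e > 0 \<Longrightarrow> \<exists>M. \<forall>m\<ge>M. \<forall>n\<ge>M. l2 (\<lambda>x. u m x - u n x) < e"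
  shows "\<exists>f\<in>L2. (\<lambda>n. l2 (\<lambda>x. u n x - f x)) \<longlonglongrightarrow> 0"
proof -
  note [measurable] = L2_measurable[OF u]
  have "\<exists>M. \<forall>m\<ge>M. \<forall>n\<ge>M. l2 (\<lambda>x. u m x - u n x) < (1/4) ^ k" for k
    by (intro cauchy) simp
  then obtain M where M: "\<And>k m n. m \<ge> M k \<Longrightarrow> n \<ge> M k \<Longrightarrow> l2 (\<lambda>x. u m x - u n x) < (1/4) ^ k"
    by metis
  \<comment> \<open>Adding up all thresholds so far puts both \<open>r k\<close> and
    \<open>r (Suc k)\<close> beyond \<open>M k\<close>; the summand \<open>k\<close> lets the
    subsequence pass every index.\<close>
  define r where "r k = k + (\<Sum>i\<le>k. M i)" for k :: nat
  have rM: "r k \<ge> M k" and rk: "r k \<ge> k" and rS: "r (Suc k) \<ge> M k" for k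
    using member_le_sum[of k "{..k}" M] by (auto simp: r_def)
  define d where "d k x = norm (u (r (Suc k)) x - u (r k) x)" for k x
  have d_meas [measurable]: "d k \<in> borel_measurable lebesgue" for k unfolding d_def by measurable
  have dint: "(\<integral>\<^sup>+x. ennreal ((d k x)\<^sup>2) \<partial>lebesgue) \<le> ennreal ((1/16) ^ k)" for k
  proof -
    have "(\<integral>\<^sup>+x. ennreal ((d k x)\<^sup>2) \<partial>lebesgue) = ennreal ((l2 (\<lambda>x. u (r (Suc k)) x - u (r k) x))\<^sup>2)"
      unfolding d_def by (intro l2_nn_integral L2_diff u)
    also have "\<dots> \<le> ennreal (((1/4) ^ k)\<^sup>2)"
      using M[OF rS[of k] rM[of k]] by (intro ennreal_leI power_mono) auto
    also have "((1/4::real) ^ k)\<^sup>2 = (1/16) ^ k"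
      by (simp flip: power_mult) (simp add: power_mult power_divide power_even_eq power2_eq_square flip: power_mult_distrib)
    finally show ?thesis .
  qed
  \<comment> \<open>The weight \<open>4 ^ k\<close> against squared increments of order
    \<open>(1/16) ^ k\<close> leaves a convergent series, and its finiteness at a point forces
    increments of order \<open>(1/2) ^ k\<close> there.\<close>
  have "(\<integral>\<^sup>+x. (\<Sum>k. ennreal (4 ^ k * (d k x)\<^sup>2)) \<partial>lebesgue) = (\<Sum>k. \<integral>\<^sup>+x. ennreal (4 ^ k * (d k x)\<^sup>2) \<partial>lebesgue)"
    by (intro nn_integral_suminf) measurable
  also have "\<dots> \<le> (\<Sum>k. ennreal ((1/4) ^ k))"
  proof (intro suminf_le summableI)
    fix k
    have "(\<integral>\<^sup>+x. ennreal (4 ^ k * (d k x)\<^sup>2) \<partial>lebesgue) = ennreal (4 ^ k) * (\<integral>\<^sup>+x. ennreal ((d k x)\<^sup>2) \<partial>lebesgue)"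
      by (subst nn_integral_cmult[symmetric]) (auto simp: ennreal_mult)
    also have "\<dots> \<le> ennreal (4 ^ k) * ennreal ((1/16) ^ k)"
      by (intro mult_left_mono dint) simp
    also have "\<dots> = ennreal ((1/4) ^ k)"
      by (simp flip: ennreal_mult power_mult_distrib)
    finally show "(\<integral>\<^sup>+x. ennreal (4 ^ k * (d k x)\<^sup>2) \<partial>lebesgue) \<le> ennreal ((1/4) ^ k)" .
  qed
  also have "\<dots> < \<infinity>"
    by (subst suminf_ennreal2) (auto intro!: summable_geometric)
  finally have "AE x in lebesgue. (\<Sum>k. ennreal (4 ^ k * (d k x)\<^sup>2)) \<noteq> \<infinity>"
    by (intro nn_integral_noteq_infinite) auto
  then have conv: "AE x in lebesgue. convergent (\<lambda>k. u (r k) x)"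
  proof eventually_elim
    case (elim x)
    then have "summable (\<lambda>k. 4 ^ k * (d k x)\<^sup>2)"
      using summable_suminf_not_top[of "\<lambda>k. 4 ^ k * (d k x)\<^sup>2"] by simp
    then have "Bseq (\<lambda>k. 4 ^ k * (d k x)\<^sup>2)"
      by (intro convergent_imp_Bseq summable_imp_convergent)
    then obtain C where C: "C > 0" "\<And>k. 4 ^ k * (d k x)\<^sup>2 \<le> C"
      unfolding Bseq_def by (auto simp: abs_mult)
    have "d k x \<le> sqrt C * (1/2) ^ k" for k
    proof (rule power2_le_imp_le)
      have "(sqrt C * (1/2) ^ k)\<^sup>2 = C * (1/4) ^ k"
        using C by (simp add: power_mult_distrib flip: power_mult) (simp add: power_mult power_divide power_even_eq mult.commute[of k])
      also have "\<dots> \<ge> (d k x)\<^sup>2" using C(2)[of k] by (simp add: field_simps power_divide)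
      finally show "(d k x)\<^sup>2 \<le> (sqrt C * (1/2) ^ k)\<^sup>2" .
    qed (use C in auto)
    moreover have "summable (\<lambda>k. sqrt C * (1/2) ^ k)"
      by (intro summable_mult summable_geometric) simp
    ultimately have "summable (\<lambda>k. d k x)"
      by (intro summable_comparison_test'[of "\<lambda>k. sqrt C * (1/2) ^ k" 0 "\<lambda>k. d k x"]) (auto simp: d_def)
    then have "summable (\<lambda>k. u (r (Suc k)) x - u (r k) x)"
      unfolding d_def by (rule summable_norm_cancel)
    then have "convergent (\<lambda>n. \<Sum>k<n. u (r (Suc k)) x - u (r k) x)"
      by (rule summable_iff_convergent[THEN iffD1])
    then have "convergent (\<lambda>n. u (r n) x - u (r 0) x)"
      unfolding sum_lessThan_telescope[of "\<lambda>k. u (r k) x"] .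
    then have "convergent (\<lambda>n. (u (r n) x - u (r 0) x) + u (r 0) x)"
      by (rule convergent_add) (rule convergent_const)
    then show ?case by simp
  qed
  define f where "f x = lim (\<lambda>k. u (r k) x)" for x
  have f_meas [measurable]: "f \<in> borel_measurable lebesgue"
    unfolding f_def by (rule borel_measurable_lim_metric) measurable
  have bound: "(\<integral>\<^sup>+x. ennreal ((norm (u n x - f x))\<^sup>2) \<partial>lebesgue) \<le> ennreal (e\<^sup>2)"
    if N: "\<And>m n. m \<ge> N \<Longrightarrow> n \<ge> N \<Longrightarrow> l2 (\<lambda>x. u m x - u n x) < e" and n: "n \<ge> N" for n N e
  proof -
    have "(\<integral>\<^sup>+x. ennreal ((norm (u n x - f x))\<^sup>2) \<partial>lebesgue)
        = (\<integral>\<^sup>+x. liminf (\<lambda>k. ennreal ((norm (u n x - u (r k) x))\<^sup>2)) \<partial>lebesgue)"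
    proof (intro nn_integral_cong_AE)
      show "AE x in lebesgue. ennreal ((norm (u n x - f x))\<^sup>2) = liminf (\<lambda>k. ennreal ((norm (u n x - u (r k) x))\<^sup>2))"
        using conv
      proof eventually_elim
        case (elim x)
        then have "(\<lambda>k. u (r k) x) \<longlonglongrightarrow> f x"
          by (simp add: f_def convergent_LIMSEQ_iff)
        then have "(\<lambda>k. ennreal ((norm (u n x - u (r k) x))\<^sup>2)) \<longlonglongrightarrow> ennreal ((norm (u n x - f x))\<^sup>2)"
          by (intro tendsto_intros)
        then show ?case by (intro lim_imp_Liminf[symmetric]) simp_all
      qed
    qed
    also have "\<dots> \<le> liminf (\<lambda>k. \<integral>\<^sup>+x. ennreal ((norm (u n x - u (r k) x))\<^sup>2) \<partial>lebesgue)"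
      by (intro nn_integral_liminf) measurable
    also have "\<dots> \<le> liminf (\<lambda>k. ennreal (e\<^sup>2))"
    proof (intro Liminf_mono eventually_sequentiallyI[of N])
      fix k assume "N \<le> k"
      then have "r k \<ge> N" using rk[of k] by simp
      then have "l2 (\<lambda>x. u n x - u (r k) x) < e" using N n by blast
      then have "(l2 (\<lambda>x. u n x - u (r k) x))\<^sup>2 \<le> e\<^sup>2" by (intro power_mono) auto
      then show "(\<integral>\<^sup>+x. ennreal ((norm (u n x - u (r k) x))\<^sup>2) \<partial>lebesgue) \<le> ennreal (e\<^sup>2)"
        by (subst l2_nn_integral) (auto intro!: L2_diff u ennreal_leI)
    qed
    finally show ?thesis by (simp add: Liminf_const)
  qed
  obtain N1 where N1: "\<And>m n. m \<ge> N1 \<Longrightarrow> n \<ge> N1 \<Longrightarrow> l2 (\<lambda>x. u m x - u n x) < 1"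
    using cauchy[of 1] by auto
  \<comment> \<open>The limit is square integrable because it differs from one member of the
    sequence by a square integrable function.\<close>
  have "(\<lambda>x. u N1 x - f x) \<in> L2"
    unfolding L2_nn_integral_iff using bound[of N1 1 N1] N1
    by (auto intro: le_less_trans)
  from L2_diff[OF u[of N1] this] have f: "f \<in> L2" by simp
  have "(\<lambda>n. l2 (\<lambda>x. u n x - f x)) \<longlonglongrightarrow> 0"
  proof (rule LIMSEQ_I)
    fix e :: real assume e: "e > 0"
    then obtain N where N: "\<And>m n. m \<ge> N \<Longrightarrow> n \<ge> N \<Longrightarrow> l2 (\<lambda>x. u m x - u n x) < e/2"
      using cauchy[of "e/2"] by auto
    have le: "l2 (\<lambda>x. u n x - f x) \<le> e/2" if "n \<ge> N" for n
      by (rule l2_leI) (use bound[OF N that] e in \<open>auto intro: L2_diff u f\<close>)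
    then have "l2 (\<lambda>x. u n x - f x) < e" if "n \<ge> N" for n
      using le[OF that] e by linarith
    then show "\<exists>N. \<forall>n\<ge>N. norm (l2 (\<lambda>x. u n x - f x) - 0) < e"
      by (intro exI[of _ N]) simp
  qed
  with f show ?thesis by blast
qed

section \<open>Translations and dilations of Lebesgue measure\<close>

text \<open>Fubini's theorem is applied to the completed measure itself; the countable cover is
  inherited from \<open>lborel\<close>.\<close>

lemma sigma_finite_lebesgue: "sigma_finite_measure (lebesgue :: 'a::euclidean_space measure)"
proof (rule sigma_finite_measure.intro)
  obtain A :: "'a set set" where
    A: "countable A \<and> A \<subseteq> sets lborel \<and> \<Union>A = space lborel \<and> (\<forall>a\<in>A. emeasure lborel a \<noteq> \<infinity>)"
    using lborel.sigma_finite_countable by (rule exE)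
  have "a \<in> sets lebesgue \<and> emeasure lebesgue a \<noteq> \<infinity>" if "a \<in> A" for a
  proof -
    have a: "a \<in> sets lborel" using A that by (meson subsetD)
    then have "emeasure lebesgue a = emeasure lborel a" by simp
    moreover have "emeasure lborel a \<noteq> \<infinity>" using A that by meson
    ultimately show ?thesis using a by (simp only: sets_completionI_sets simp_thms)
  qed
  moreover have "\<Union>A = space lebesgue" using A by (simp only: space_completion)
  ultimately show "\<exists>A::'a set set. countable A \<and> A \<subseteq> sets lebesgue \<and> \<Union>A = space lebesgue \<and> (\<forall>a\<in>A. emeasure lebesgue a \<noteq> \<infinity>)"
    using A by (intro exI[of _ A] conjI subsetI ballI) meson+
qed

interpretation lebesgue: sigma_finite_measure "lebesgue :: plane measure"
  by (rule sigma_finite_lebesgue)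

interpretation lebesgue_pair: pair_sigma_finite "lebesgue :: plane measure" "lebesgue :: plane measure" ..

text \<open>Borel sets are Lebesgue measurable, so on the product of the completed measures the
  projections may be composed with Borel functions. This gives the measurability of integrands such
  as \<open>f (x - z)\<close>.\<close>

lemma fst_lebesgue_measurable [measurable]:
    "fst \<in> (lebesgue :: plane measure) \<Otimes>\<^sub>M (lebesgue :: plane measure) \<rightarrow>\<^sub>M borel"
  and snd_lebesgue_measurable [measurable]:
    "snd \<in> (lebesgue :: plane measure) \<Otimes>\<^sub>M (lebesgue :: plane measure) \<rightarrow>\<^sub>M borel"
proof -
  have id: "(\<lambda>x. x) \<in> (lebesgue :: plane measure) \<rightarrow>\<^sub>M borel"
    by (simp add: measurable_completion)
  show "fst \<in> (lebesgue :: plane measure) \<Otimes>\<^sub>M (lebesgue :: plane measure) \<rightarrow>\<^sub>M borel"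
    by (rule measurable_compose[OF measurable_fst id])
  show "snd \<in> (lebesgue :: plane measure) \<Otimes>\<^sub>M (lebesgue :: plane measure) \<rightarrow>\<^sub>M borel"
    by (rule measurable_compose[OF measurable_snd id])
qed

lemma borel_lebesgue_measurable: "f \<in> borel_measurable borel \<Longrightarrow> f \<in> borel_measurable lebesgue"
  by (simp add: measurable_completion)

lemma lebesgue_scaling:
  fixes t :: plane
  assumes c: "c \<noteq> 0"
  shows "lebesgue = density (distr lebesgue lebesgue (\<lambda>x::plane. t + c *\<^sub>R x)) (\<lambda>_. ennreal (c\<^sup>2))"
    and "(\<lambda>x::plane. t + c *\<^sub>R x) \<in> lebesgue \<rightarrow>\<^sub>M lebesgue"
proof -
  have T: "(\<lambda>x. t + (\<Sum>j\<in>Basis. (c * (x \<bullet> j)) *\<^sub>R j)) = (\<lambda>x::plane. t + c *\<^sub>R x)"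
  proof
    fix x :: plane
    have "(\<Sum>j\<in>Basis. (c * (x \<bullet> j)) *\<^sub>R j) = c *\<^sub>R (\<Sum>j\<in>Basis. (x \<bullet> j) *\<^sub>R j)"
      by (simp add: scaleR_sum_right)
    then show "t + (\<Sum>j\<in>Basis. (c * (x \<bullet> j)) *\<^sub>R j) = t + c *\<^sub>R x"
      by (simp only: euclidean_representation)
  qed
  have D: "(\<Prod>j\<in>(Basis::plane set). \<bar>c\<bar>) = c\<^sup>2"
    by simp
  show "lebesgue = density (distr lebesgue lebesgue (\<lambda>x::plane. t + c *\<^sub>R x)) (\<lambda>_. ennreal (c\<^sup>2))"
    using lebesgue_affine_euclidean[of "\<lambda>_. c" t, OF c] unfolding T D .
  show "(\<lambda>x::plane. t + c *\<^sub>R x) \<in> lebesgue \<rightarrow>\<^sub>M lebesgue"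
    using lebesgue_affine_measurable[of "\<lambda>_. c" t, OF c] unfolding T .
qed

lemma lebesgue_affine_integral:
  fixes f :: "plane \<Rightarrow> 'b::{banach, second_countable_topology}"
  assumes c: "c \<noteq> 0" and f: "f \<in> borel_measurable lebesgue"
  shows "(LINT x|lebesgue. f x) = c\<^sup>2 *\<^sub>R (LINT x|lebesgue. f (t + c *\<^sub>R x))"
    and "integrable lebesgue (\<lambda>x. f (t + c *\<^sub>R x)) \<longleftrightarrow> integrable lebesgue f"
    and "(\<lambda>x. f (t + c *\<^sub>R x)) \<in> borel_measurable lebesgue"
proof -
  note m [measurable] = lebesgue_scaling(2)[OF c, of t]
  note f [measurable]
  show "(\<lambda>x. f (t + c *\<^sub>R x)) \<in> borel_measurable lebesgue" by measurable
  have "(LINT x|lebesgue. f x) = (LINT x|density (distr lebesgue lebesgue (\<lambda>x. t + c *\<^sub>R x)) (\<lambda>_. ennreal (c\<^sup>2)). f x)"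
    by (rule arg_cong[OF lebesgue_scaling(1)[OF c, of t]])
  also have "\<dots> = c\<^sup>2 *\<^sub>R (LINT x|lebesgue. f (t + c *\<^sub>R x))"
    by (subst integral_density) (simp_all add: integral_distr)
  finally show "(LINT x|lebesgue. f x) = c\<^sup>2 *\<^sub>R (LINT x|lebesgue. f (t + c *\<^sub>R x))" .
  have "integrable lebesgue f \<longleftrightarrow> integrable (density (distr lebesgue lebesgue (\<lambda>x. t + c *\<^sub>R x)) (\<lambda>_. ennreal (c\<^sup>2))) f"
    by (rule arg_cong[where f = "\<lambda>M. integrable M f", OF lebesgue_scaling(1)[OF c, of t]])
  also have "\<dots> \<longleftrightarrow> integrable lebesgue (\<lambda>x. f (t + c *\<^sub>R x))"
  proof -
    have "integrable lebesgue (\<lambda>x. f (t + c *\<^sub>R x))" if "integrable lebesgue (\<lambda>x. c\<^sup>2 *\<^sub>R f (t + c *\<^sub>R x))"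
      using integrable_scaleR_right[OF that, of "1 / c\<^sup>2"] c by simp
    then show ?thesis
      by (subst integrable_density) (auto simp: integrable_distr_eq)
  qed
  finally show "integrable lebesgue (\<lambda>x. f (t + c *\<^sub>R x)) \<longleftrightarrow> integrable lebesgue f" by simp
qed

lemma lebesgue_shift:
  fixes f :: "plane \<Rightarrow> 'b::{banach, second_countable_topology}"
  assumes f: "f \<in> borel_measurable lebesgue"
  shows "(LINT x|lebesgue. f (x + t)) = (LINT x|lebesgue. f x)"
    and "integrable lebesgue (\<lambda>x. f (x + t)) \<longleftrightarrow> integrable lebesgue f"
    and "(\<lambda>x. f (x + t)) \<in> borel_measurable lebesgue"
proof -
  have e: "(\<lambda>x. f (x + t)) = (\<lambda>x. f (t + 1 *\<^sub>R x))"
    by (simp add: add.commute)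
  show "(LINT x|lebesgue. f (x + t)) = (LINT x|lebesgue. f x)"
    unfolding e using lebesgue_affine_integral(1)[OF one_neq_zero f, of t]
    unfolding power_one scaleR_one by (rule sym)
  show "integrable lebesgue (\<lambda>x. f (x + t)) \<longleftrightarrow> integrable lebesgue f"
    unfolding e by (rule lebesgue_affine_integral(2)[OF one_neq_zero f])
  show "(\<lambda>x. f (x + t)) \<in> borel_measurable lebesgue"
    unfolding e by (rule lebesgue_affine_integral(3)[OF one_neq_zero f])
qed

text \<open>A point of an open set stays in it under small shifts, so the part of \<open>U\<close>
  lost by shifting vanishes by dominated convergence. Invariance of the measure makes the part
  gained equally large, whence the factor 2 in the proof.\<close>

lemma L1_translation_open:
  fixes U :: "plane set"
  assumes U: "open U" "emeasure lebesgue U < \<infinity>" and H: "H \<longlonglongrightarrow> 0"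
  shows "(\<lambda>n. LINT x|lebesgue. \<bar>indicator U (x + H n) - indicat_real U x\<bar>) \<longlonglongrightarrow> 0"
proof -
  have Us [measurable]: "U \<in> sets lebesgue" using U by auto
  have intU: "integrable lebesgue (indicat_real U)"
    using U by (simp add: integrable_indicator_iff)
  have mU: "indicat_real U \<in> borel_measurable lebesgue" by simp
  note sh = lebesgue_shift[OF mU]
  let ?m = "\<lambda>n x. max 0 (indicat_real U x - indicator U (x + H n))"
  have mm: "?m n \<in> borel_measurable lebesgue" for n
    by (intro borel_measurable_max borel_measurable_diff sh(3) mU) simp
  have intm: "integrable lebesgue (?m n)" for n
    by (rule Bochner_Integration.integrable_bound[OF intU mm]) (auto simp: indicator_def)
  have lim: "(\<lambda>n. LINT x|lebesgue. ?m n x) \<longlonglongrightarrow> (LINT x|(lebesgue::plane measure). 0)"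
  proof (rule integral_dominated_convergence[OF _ mm intU])
    show "AE x in lebesgue. (\<lambda>n. ?m n x) \<longlonglongrightarrow> 0"
    proof (intro AE_I2)
      fix x :: plane
      show "(\<lambda>n. ?m n x) \<longlonglongrightarrow> 0"
      proof (cases "x \<in> U")
        case True
        have "(\<lambda>n. x + H n) \<longlonglongrightarrow> x + 0" by (intro tendsto_intros H)
        then have "eventually (\<lambda>n. x + H n \<in> U) sequentially"
          using U True by (auto dest: topological_tendstoD)
        then have "eventually (\<lambda>n. ?m n x = 0) sequentially"
          by eventually_elim (simp add: True)
        then show ?thesis by (rule tendsto_eventually)
      next
        case False
        then have "?m n x = 0" for n by (auto simp: indicator_def)
        then show ?thesis by simp
      qed
    qed
  qed (auto simp: indicator_def)
  have "(LINT x|lebesgue. \<bar>indicator U (x + H n) - indicat_real U x\<bar>) = 2 * (LINT x|lebesgue. ?m n x)" for n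
  proof -
    have "(LINT x|lebesgue. \<bar>indicator U (x + H n) - indicat_real U x\<bar>)
        = (LINT x|lebesgue. indicator U (x + H n) - indicat_real U x + 2 * ?m n x)"
      by (intro Bochner_Integration.integral_cong) (auto simp: indicator_def)
    also have "\<dots> = (LINT x|lebesgue. indicat_real U (x + H n)) - (LINT x|lebesgue. indicat_real U x) + 2 * (LINT x|lebesgue. ?m n x)"
      using intU sh(2)[of "H n"] intm[of n] by simp
    finally show ?thesis using sh(1)[of "H n"] by simp
  qed
  with lim show ?thesis by (auto intro: tendsto_eq_intros)
qed

text \<open>A measurable set is enclosed in an open one with small excess; the excess counts twice,
  shifted and unshifted. Sums and dominated limits then follow by induction on integrable
  functions.\<close>

lemma L1_translation:
  fixes f :: "plane \<Rightarrow> 'b::{banach, second_countable_topology}"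
  assumes "integrable lebesgue f" "H \<longlonglongrightarrow> 0"
  shows "(\<lambda>n. LINT x|lebesgue. norm (f (x + H n) - f x)) \<longlonglongrightarrow> 0"
  using assms(1)
proof (induction rule: integrable_induct)
  case (base A c)
  have A [measurable]: "A \<in> sets lebesgue" by fact
  have mA: "indicat_real A \<in> borel_measurable lebesgue" by simp
  have intA: "integrable lebesgue (indicat_real A)"
    using base by (simp add: integrable_indicator_iff)
  have "(\<lambda>n. LINT x|lebesgue. \<bar>indicator A (x + H n) - indicat_real A x\<bar>) \<longlonglongrightarrow> 0"
  proof (rule LIMSEQ_I)
    fix e :: real assume e: "e > 0"
    obtain U where U: "open U" "A \<subseteq> U" "U - A \<in> lmeasurable" "emeasure lebesgue (U - A) < ennreal (e / 3)"
      using sets_lebesgue_outer_open[OF A, of "e/3"] e by auto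
    have "A \<in> lmeasurable" using base by (simp add: fmeasurable_def)
    then have "A \<union> (U - A) \<in> lmeasurable" using U(3) by (rule fmeasurable.Un)
    then have Um: "U \<in> lmeasurable" using U(2) by (simp add: Un_absorb1)
    then have Ufin: "emeasure lebesgue U < \<infinity>" by (auto simp: fmeasurable_def)
    define D where "D = U - A"
    have mD: "indicat_real D \<in> borel_measurable lebesgue" using U(3) by (simp add: D_def fmeasurableD)
    have mU: "indicat_real U \<in> borel_measurable lebesgue" using Um by (simp add: fmeasurableD)
    have intD: "integrable lebesgue (indicat_real D)" and intU: "integrable lebesgue (indicat_real U)"
      using U(3) Um by (simp_all add: D_def lmeasurable_iff_integrable)
    have ID: "(LINT x|lebesgue. indicat_real D x) < e / 3"
    proof -
      have "measure lebesgue D < e / 3"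
        using U(3,4) e by (simp add: D_def emeasure_eq_measure2 fmeasurableD2 ennreal_less_iff)
      then show ?thesis using U(3) by (simp add: D_def fmeasurableD)
    qed
    from LIMSEQ_D[OF L1_translation_open[OF U(1) Ufin assms(2)], of "e/3"] e obtain N where
      N: "\<And>n. n \<ge> N \<Longrightarrow> \<bar>LINT x|lebesgue. \<bar>indicator U (x + H n) - indicat_real U x\<bar>\<bar> < e/3" by auto
    have "\<bar>LINT x|lebesgue. \<bar>indicator A (x + H n) - indicat_real A x\<bar>\<bar> < e" if "n \<ge> N" for n
    proof -
      have iA: "integrable lebesgue (\<lambda>x. \<bar>indicator A (x + H n) - indicat_real A x\<bar>)"
        and iU: "integrable lebesgue (\<lambda>x. \<bar>indicator U (x + H n) - indicat_real U x\<bar>)"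
        using lebesgue_shift(2)[OF mA] lebesgue_shift(2)[OF mU] intA intU
        by (auto intro!: integrable_abs Bochner_Integration.integrable_diff)
      have iD: "integrable lebesgue (\<lambda>x. indicat_real D (x + H n))"
        using lebesgue_shift(2)[OF mD] intD by blast
      have "(LINT x|lebesgue. \<bar>indicator A (x + H n) - indicat_real A x\<bar>)
         \<le> (LINT x|lebesgue. \<bar>indicator U (x + H n) - indicat_real U x\<bar> + (indicat_real D (x + H n) + indicat_real D x))"
      proof (rule integral_mono[OF iA Bochner_Integration.integrable_add[OF iU Bochner_Integration.integrable_add[OF iD intD]]])
        show "\<bar>indicator A (x + H n) - indicat_real A x\<bar>
            \<le> \<bar>indicator U (x + H n) - indicat_real U x\<bar> + (indicat_real D (x + H n) + indicat_real D x)" for x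
          using U(2) by (auto simp: indicator_def D_def)
      qed
      also have "\<dots> = (LINT x|lebesgue. \<bar>indicator U (x + H n) - indicat_real U x\<bar>)
           + ((LINT x|lebesgue. indicat_real D (x + H n)) + (LINT x|lebesgue. indicat_real D x))"
        by (subst Bochner_Integration.integral_add[OF iU Bochner_Integration.integrable_add[OF iD intD]],
            subst Bochner_Integration.integral_add[OF iD intD], rule refl)
      also have "\<dots> < e" using N[OF that] ID lebesgue_shift(1)[OF mD, of "H n"] by simp
      finally show ?thesis by simp
    qed
    then show "\<exists>N. \<forall>n\<ge>N. norm ((LINT x|lebesgue. \<bar>indicator A (x + H n) - indicat_real A x\<bar>) - 0) < e"
      by auto
  qed
  then have l: "(\<lambda>n. (LINT x|lebesgue. \<bar>indicator A (x + H n) - indicat_real A x\<bar>) * norm c) \<longlonglongrightarrow> 0"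
    by (rule tendsto_mult_left_zero)
  have nrm: "norm (indicat_real A (x + H n) *\<^sub>R c - indicat_real A x *\<^sub>R c)
      = \<bar>indicator A (x + H n) - indicat_real A x\<bar> * norm c" for x n
    unfolding scaleR_left_diff_distrib[symmetric] norm_scaleR ..
  have eq: "(LINT x|lebesgue. norm (indicat_real A (x + H n) *\<^sub>R c - indicat_real A x *\<^sub>R c))
      = (LINT x|lebesgue. \<bar>indicator A (x + H n) - indicat_real A x\<bar>) * norm c" for n
    unfolding nrm by (rule integral_mult_left_zero)
  show ?case unfolding eq by (rule l)
next
  case (add f g)
  note mf = borel_measurable_integrable[OF add.hyps(1)] and mg = borel_measurable_integrable[OF add.hyps(2)]
  have i: "integrable lebesgue (\<lambda>x. f (x + H n) - f x)" "integrable lebesgue (\<lambda>x. g (x + H n) - g x)" for n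
    using lebesgue_shift(2)[OF mf] lebesgue_shift(2)[OF mg] add.hyps by auto
  show ?case
  proof (rule Lim_null_comparison)
    show "(\<lambda>n. (LINT x|lebesgue. norm (f (x + H n) - f x)) + (LINT x|lebesgue. norm (g (x + H n) - g x))) \<longlonglongrightarrow> 0"
      using tendsto_add[OF add.IH] by simp
    have "(LINT x|lebesgue. norm (f (x + H n) + g (x + H n) - (f x + g x)))
       \<le> (LINT x|lebesgue. norm (f (x + H n) - f x) + norm (g (x + H n) - g x))" for n
    proof (intro integral_mono)
      show "integrable lebesgue (\<lambda>x. norm (f (x + H n) + g (x + H n) - (f x + g x)))"
        using Bochner_Integration.integrable_add[OF i[of n]] by (simp add: algebra_simps)
      show "norm (f (x + H n) + g (x + H n) - (f x + g x)) \<le> norm (f (x + H n) - f x) + norm (g (x + H n) - g x)" for x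
        using norm_triangle_ineq[of "f (x + H n) - f x" "g (x + H n) - g x"] by (simp add: algebra_simps)
    qed (use i in auto)
    then show "\<forall>\<^sub>F n in sequentially. norm (LINT x|lebesgue. norm (f (x + H n) + g (x + H n) - (f x + g x)))
        \<le> (LINT x|lebesgue. norm (f (x + H n) - f x)) + (LINT x|lebesgue. norm (g (x + H n) - g x))"
      using i by simp
  qed
next
  case (lim f s)
  note mf = borel_measurable_integrable[OF lim.hyps(4)] and ms = borel_measurable_integrable[OF lim.hyps(1)]
  have i: "integrable lebesgue (\<lambda>x. f (x + H n) - f x)" "integrable lebesgue (\<lambda>x. s k (x + H n) - s k x)"
    "integrable lebesgue (\<lambda>x. f (x + H n) - s k (x + H n))" "integrable lebesgue (\<lambda>x. f x - s k x)" for n k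
    using lebesgue_shift(2)[OF mf] lebesgue_shift(2)[OF ms] lim.hyps by auto
  have "(\<lambda>k. LINT x|lebesgue. norm (f x - s k x)) \<longlonglongrightarrow> (LINT x|(lebesgue::plane measure). 0)"
  proof (rule integral_dominated_convergence)
    show "integrable lebesgue (\<lambda>x. 3 * norm (f x))" using lim.hyps by simp
    show "AE x in lebesgue. (\<lambda>k. norm (f x - s k x)) \<longlonglongrightarrow> 0"
    proof (intro AE_I2)
      fix x :: plane
      have "(\<lambda>k. f x - s k x) \<longlonglongrightarrow> f x - f x" using lim.hyps(2)[of x] by (intro tendsto_intros) auto
      then show "(\<lambda>k. norm (f x - s k x)) \<longlonglongrightarrow> 0" by (simp add: tendsto_norm_zero)
    qed
    show "AE x in lebesgue. norm (norm (f x - s k x)) \<le> 3 * norm (f x)" for k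
    proof (intro AE_I2)
      fix x :: plane
      show "norm (norm (f x - s k x)) \<le> 3 * norm (f x)"
        using lim.hyps(3)[of x k] norm_triangle_ineq4[of "f x" "s k x"] by simp
    qed
  qed (use mf ms in auto)
  then have l: "(\<lambda>k. LINT x|lebesgue. norm (f x - s k x)) \<longlonglongrightarrow> 0" by simp
  show ?case
  proof (rule LIMSEQ_I)
    fix e :: real assume e: "e > 0"
    obtain k where k: "(LINT x|lebesgue. norm (f x - s k x)) < e / 3"
      using eventually_happens'[OF sequentially_bot order_tendstoD(2)[OF l, of "e/3"]] e by auto
    from LIMSEQ_D[OF lim.IH[of k], of "e/3"] e obtain N where
      N: "\<And>n. n \<ge> N \<Longrightarrow> (LINT x|lebesgue. norm (s k (x + H n) - s k x)) < e/3" by auto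
    have "(LINT x|lebesgue. norm (f (x + H n) - f x)) < e" if "n \<ge> N" for n
    proof -
      have "(LINT x|lebesgue. norm (f (x + H n) - f x)) \<le>
        (LINT x|lebesgue. norm (f (x + H n) - s k (x + H n)) + (norm (s k (x + H n) - s k x) + norm (f x - s k x)))"
      proof (intro integral_mono)
        fix x
        have "f (x + H n) - f x = (f (x + H n) - s k (x + H n)) + ((s k (x + H n) - s k x) - (f x - s k x))" by simp
        then have "norm (f (x + H n) - f x) \<le> norm (f (x + H n) - s k (x + H n)) + norm ((s k (x + H n) - s k x) - (f x - s k x))"
          by (simp only: norm_triangle_ineq)
        then show "norm (f (x + H n) - f x) \<le> norm (f (x + H n) - s k (x + H n)) + (norm (s k (x + H n) - s k x) + norm (f x - s k x))"
          using norm_triangle_ineq4[of "s k (x + H n) - s k x" "f x - s k x"] by linarith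
      qed (use i in auto)
      also have "\<dots> = (LINT x|lebesgue. norm (f (x + H n) - s k (x + H n))) + ((LINT x|lebesgue. norm (s k (x + H n) - s k x)) + (LINT x|lebesgue. norm (f x - s k x)))"
        using i by simp
      also have "(LINT x|lebesgue. norm (f (x + H n) - s k (x + H n))) = (LINT x|lebesgue. norm (f x - s k x))"
        using lebesgue_shift(1)[of "\<lambda>x. norm (f x - s k x)" "H n"] mf ms by simp
      finally show ?thesis using k N[OF that] by simp
    qed
    then show "\<exists>N. \<forall>n\<ge>N. norm ((LINT x|lebesgue. norm (f (x + H n) - f x)) - 0) < e"
      by auto
  qed
qed

section \<open>The Fourier transform on \<open>L\<^sup>2(\<real>\<^sup>2)\<close>\<close>

text \<open>Scaled so that it is its own transform under the convention with prefactor
  \<open>1 / (2 * pi)\<close>.\<close>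

definition gauss :: "plane \<Rightarrow> real" where "gauss x = exp (- (norm x)\<^sup>2 / 2)"

text \<open>The characteristic function of the standard normal law at \<open>- s\<close>, freed of
  the factor \<open>1 / sqrt (2 * pi)\<close> in the density.\<close>

lemma gauss_1d:
  fixes s :: real
  shows "integrable lborel (\<lambda>x. exp (- \<i> * of_real (s * x)) * of_real (exp (- x\<^sup>2 / 2)))"
    and "(LINT x|lborel. exp (- \<i> * of_real (s * x)) * of_real (exp (- x\<^sup>2 / 2))) = of_real (sqrt (2 * pi) * exp (- s\<^sup>2 / 2))"
proof -
  have sc: "std_normal_density x *\<^sub>R exp (\<i> * of_real ((- s) * x))
      = of_real (1 / sqrt (2 * pi)) * (exp (- \<i> * of_real (s * x)) * of_real (exp (- x\<^sup>2 / 2)))" for x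
    by (simp add: std_normal_density_def scaleR_conv_of_real)
  have dens: "integrable lborel std_normal_density"
    using integrable_std_normal_moment[of 0] by simp
  show int: "integrable lborel (\<lambda>x. exp (- \<i> * of_real (s * x)) * of_real (exp (- x\<^sup>2 / 2)))"
  proof (rule Bochner_Integration.integrable_bound)
    show "integrable lborel (\<lambda>x. sqrt (2 * pi) * std_normal_density x)"
      using dens by simp
    show "AE x in lborel. norm (exp (- \<i> * of_real (s * x)) * of_real (exp (- x\<^sup>2 / 2)))
        \<le> norm (sqrt (2 * pi) * std_normal_density x)"
      by (auto simp: std_normal_density_def norm_mult)
  qed measurable
  have "of_real (exp (- ((- s)\<^sup>2) / 2)) = char std_normal_distribution (- s)"
    by (simp add: char_std_normal_distribution)
  also have "\<dots> = (LINT x|lborel. std_normal_density x *\<^sub>R exp (\<i> * of_real ((- s) * x)))"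
    unfolding char_def by (subst integral_density) (auto simp: complex_exp_exists)
  also have "\<dots> = of_real (1 / sqrt (2 * pi)) * (LINT x|lborel. exp (- \<i> * of_real (s * x)) * of_real (exp (- x\<^sup>2 / 2)))"
    unfolding sc by (rule integral_mult_right_zero)
  finally show "(LINT x|lborel. exp (- \<i> * of_real (s * x)) * of_real (exp (- x\<^sup>2 / 2))) = of_real (sqrt (2 * pi) * exp (- s\<^sup>2 / 2))"
    by (simp add: field_simps)
qed

text \<open>The Gaussian and the exponential both factor over the coordinates, and
  \<open>lborel\<close> is the image of a product measure.\<close>

lemma gauss_fourier_lborel:
  fixes p :: plane
  shows "(LINT x|lborel. exp (- \<i> * of_real (p \<bullet> x)) * of_real (gauss x)) = of_real (2 * pi * gauss p)"
    and "integrable lborel (\<lambda>x. exp (- \<i> * of_real (p \<bullet> x)) * of_real (gauss x))"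
proof -
  interpret P: product_sigma_finite "\<lambda>b::plane. lborel :: real measure" ..
  let ?k = "\<lambda>b x. exp (- \<i> * of_real ((p \<bullet> b) * x)) * (of_real (exp (- x\<^sup>2 / 2)) :: complex)"
  let ?F = "\<lambda>x. exp (- \<i> * of_real (p \<bullet> x)) * (of_real (gauss x) :: complex)"
  have meas: "?F \<in> borel_measurable borel"
    unfolding gauss_def by measurable
  have comp: "(\<Sum>b\<in>Basis. f b *\<^sub>R b) \<bullet> c = f c" if "c \<in> Basis" for f :: "plane \<Rightarrow> real" and c
    using that by (simp add: inner_sum_left inner_Basis if_distrib cong: if_cong)
  have prod: "?F (\<Sum>b\<in>Basis. f b *\<^sub>R b) = (\<Prod>b\<in>Basis. ?k b (f b))" for f :: "plane \<Rightarrow> real"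
  proof -
    define x where "x = (\<Sum>b\<in>Basis. f b *\<^sub>R b)"
    have xb: "x \<bullet> b = f b" if "b \<in> Basis" for b using comp[OF that] by (simp add: x_def)
    have px: "p \<bullet> x = (\<Sum>b\<in>Basis. (p \<bullet> b) * f b)"
      by (subst euclidean_inner) (simp add: xb)
    have "(norm x)\<^sup>2 = (\<Sum>b\<in>Basis. (f b)\<^sup>2)"
      unfolding power2_norm_eq_inner by (subst euclidean_inner) (simp add: xb power2_eq_square)
    then have "gauss x = exp (\<Sum>b\<in>Basis. - (f b)\<^sup>2 / 2)"
      by (simp add: gauss_def sum_negf sum_divide_distrib)
    then have g: "gauss x = (\<Prod>b\<in>Basis. exp (- (f b)\<^sup>2 / 2))"
      by (simp add: exp_sum)
    have e: "exp (- \<i> * of_real (p \<bullet> x)) = (\<Prod>b\<in>Basis. exp (- \<i> * of_real ((p \<bullet> b) * f b)))"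
      by (simp add: px sum_distrib_left flip: exp_sum sum_negf)
    show ?thesis
      unfolding x_def[symmetric] e g by (simp add: prod.distrib)
  qed
  have m2: "(\<lambda>f. \<Sum>b\<in>(Basis :: plane set). f b *\<^sub>R b) \<in> Pi\<^sub>M Basis (\<lambda>b. lborel) \<rightarrow>\<^sub>M borel"
    by measurable
  have int: "integrable (Pi\<^sub>M Basis (\<lambda>b. lborel)) (\<lambda>f. \<Prod>b\<in>Basis. ?k b (f b))"
    by (rule P.product_integrable_prod[OF finite_Basis gauss_1d(1)])
  have lb: "(lborel :: plane measure) = distr (Pi\<^sub>M Basis (\<lambda>b. lborel)) borel (\<lambda>f. \<Sum>b\<in>Basis. f b *\<^sub>R b)"
    by (rule lborel_eq)
  have "(LINT x|lborel. ?F x) = (LINT f|Pi\<^sub>M Basis (\<lambda>b. lborel). ?F (\<Sum>b\<in>Basis. f b *\<^sub>R b))"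
    by (subst lb) (rule integral_distr[OF m2 meas])
  also have "\<dots> = (LINT f|Pi\<^sub>M Basis (\<lambda>b. lborel). (\<Prod>b\<in>Basis. ?k b (f b)))"
    by (simp only: prod)
  also have "\<dots> = (\<Prod>b\<in>Basis. (LINT x|lborel. ?k b x))"
    by (rule P.product_integral_prod[OF finite_Basis gauss_1d(1)])
  also have "\<dots> = (\<Prod>b\<in>(Basis :: plane set). of_real (sqrt (2 * pi) * exp (- (p \<bullet> b)\<^sup>2 / 2)))"
    by (simp only: gauss_1d(2))
  also have "\<dots> = of_real (\<Prod>b\<in>(Basis :: plane set). sqrt (2 * pi) * exp (- (p \<bullet> b)\<^sup>2 / 2))"
    by simp
  also have "(\<Prod>b\<in>(Basis :: plane set). sqrt (2 * pi) * exp (- (p \<bullet> b)\<^sup>2 / 2)) = 2 * pi * gauss p"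
  proof -
    have "(norm p)\<^sup>2 = (\<Sum>b\<in>Basis. (p \<bullet> b)\<^sup>2)"
      unfolding power2_norm_eq_inner by (subst euclidean_inner) (simp add: power2_eq_square)
    then have "gauss p = exp (\<Sum>b\<in>Basis. - (p \<bullet> b)\<^sup>2 / 2)"
      by (simp add: gauss_def sum_negf sum_divide_distrib)
    then have "gauss p = (\<Prod>b\<in>Basis. exp (- (p \<bullet> b)\<^sup>2 / 2))"
      by (simp add: exp_sum)
    then show ?thesis by (simp add: prod.distrib)
  qed
  finally show "(LINT x|lborel. ?F x) = of_real (2 * pi * gauss p)" .
  show "integrable lborel ?F"
    by (subst lb, subst integrable_distr_eq[OF m2 meas]) (simp only: prod int)
qed

lemma gauss_fourier: "fourier_integral (\<lambda>x. of_real (gauss x)) p = of_real (gauss p)"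
  and gauss_integrable: "integrable lebesgue gauss"
proof -
  have m: "(\<lambda>x. exp (- \<i> * complex_of_real (p \<bullet> x)) * of_real (gauss x)) \<in> borel_measurable lborel"
    unfolding gauss_def by measurable
  show "fourier_integral (\<lambda>x. of_real (gauss x)) p = of_real (gauss p)"
    unfolding fourier_integral_def integral_completion[OF m] gauss_fourier_lborel by simp
  have "integrable lborel (\<lambda>x. norm (exp (- \<i> * complex_of_real (0 \<bullet> x)) * of_real (gauss x)))"
    by (rule integrable_norm[OF gauss_fourier_lborel(2)])
  then have "integrable lborel gauss" by (simp add: gauss_def[abs_def])
  moreover have "gauss \<in> borel_measurable lborel" unfolding gauss_def by measurable
  ultimately show "integrable lebesgue gauss" by (simp add: integrable_completion)
qed

lemma gauss_bounds: "0 < gauss x" "gauss x \<le> 1"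
  by (auto simp: gauss_def)

lemma fourier_kernel_norm [simp]: "cmod (exp (- (\<i> * complex_of_real t))) = 1" "cmod (exp (- \<i> * complex_of_real t)) = 1"
  "cmod (exp (\<i> * complex_of_real t)) = 1"
  using norm_exp_i_times[of "-t"] norm_exp_i_times[of t] by simp_all

lemma fourier_integrand_integrable:
  fixes f :: "plane \<Rightarrow> complex"
  assumes f: "integrable lebesgue f"
  shows "integrable lebesgue (\<lambda>x. exp (- \<i> * of_real (p \<bullet> x)) * f x)"
proof (rule Bochner_Integration.integrable_bound[OF f])
  show "(\<lambda>x. exp (- \<i> * of_real (p \<bullet> x)) * f x) \<in> borel_measurable lebesgue"
  proof (rule borel_measurable_times[OF borel_lebesgue_measurable borel_measurable_integrable[OF f]])
    show "(\<lambda>x. exp (- \<i> * complex_of_real (p \<bullet> x))) \<in> borel_measurable borel" by measurable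
  qed
qed (simp add: norm_mult)

lemma fourier_integral_bound:
  assumes f: "integrable lebesgue f"
  shows "cmod (fourier_integral f p) \<le> (LINT x|lebesgue. cmod (f x))"
proof -
  have "cmod (fourier_integral f p) = cmod (LINT x|lebesgue. exp (- \<i> * of_real (p \<bullet> x)) * f x) / (2 * pi)"
    by (simp add: fourier_integral_def norm_divide)
  also have "\<dots> \<le> cmod (LINT x|lebesgue. exp (- \<i> * of_real (p \<bullet> x)) * f x)"
    using pi_gt3 by (intro divide_le_eq_1[THEN iffD2] divide_left_mono order_trans[OF divide_left_mono[of 1 "2 * pi"]]) auto
  also have "\<dots> \<le> (LINT x|lebesgue. cmod (exp (- \<i> * of_real (p \<bullet> x)) * f x))"
    by (rule integral_norm_bound)
  finally show ?thesis by (simp add: norm_mult)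
qed

lemma fourier_integral_measurable:
  assumes f: "integrable lebesgue f"
  shows "fourier_integral f \<in> borel_measurable lebesgue"
proof -
  note [measurable] = borel_measurable_integrable[OF f]
  have "(\<lambda>p. LINT x|lebesgue. exp (- \<i> * of_real (p \<bullet> x)) * f x) \<in> borel_measurable lebesgue"
    by (rule lebesgue.borel_measurable_lebesgue_integral) measurable
  then show ?thesis unfolding fourier_integral_def[abs_def] by (rule borel_measurable_divide) simp
qed

text \<open>Fubini's theorem and the symmetry of the kernel. It moves the transform from an unknown
  function to an explicit Gaussian.\<close>

lemma fourier_integral_mult:
  assumes f: "integrable lebesgue f" and g: "integrable lebesgue g"
  shows "(LINT p|lebesgue. fourier_integral f p * g p) = (LINT x|lebesgue. f x * fourier_integral g x)"
proof -
  note [measurable] = borel_measurable_integrable[OF f] borel_measurable_integrable[OF g]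
  let ?G = "\<lambda>p x. exp (- \<i> * of_real (p \<bullet> x)) * f x * g p"
  have "integrable (lebesgue \<Otimes>\<^sub>M lebesgue) (case_prod ?G)"
  proof (rule lebesgue_pair.Fubini_integrable)
    show "case_prod ?G \<in> borel_measurable (lebesgue \<Otimes>\<^sub>M lebesgue)" by measurable
    have "(LINT x|lebesgue. norm (case (p, x) of (p, x) \<Rightarrow> ?G p x)) = (LINT x|lebesgue. cmod (f x)) * cmod (g p)" for p
      by (simp add: norm_mult)
    then show "integrable lebesgue (\<lambda>p. LINT x|lebesgue. norm (case (p, x) of (p, x) \<Rightarrow> ?G p x))"
      using g by simp
    show "AE p in lebesgue. integrable lebesgue (\<lambda>x. case (p, x) of (p, x) \<Rightarrow> ?G p x)"
      using integrable_mult_left[OF fourier_integrand_integrable[OF f]] by simp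
  qed
  from lebesgue_pair.Fubini_integral[OF this]
  have eq: "(LINT x|lebesgue. LINT p|lebesgue. ?G p x) = (LINT p|lebesgue. LINT x|lebesgue. ?G p x)" .
  have "(LINT p|lebesgue. fourier_integral f p * g p) = (LINT p|lebesgue. (LINT x|lebesgue. ?G p x) / of_real (2 * pi))"
    by (intro Bochner_Integration.integral_cong) (simp_all add: fourier_integral_def)
  also have "\<dots> = (LINT p|lebesgue. LINT x|lebesgue. ?G p x) / of_real (2 * pi)"
    by (rule integral_divide_zero)
  also have "\<dots> = (LINT x|lebesgue. LINT p|lebesgue. ?G p x) / of_real (2 * pi)"
    by (simp only: eq)
  also have "\<dots> = (LINT x|lebesgue. (LINT p|lebesgue. ?G p x) / of_real (2 * pi))"
    by (rule integral_divide_zero[symmetric])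
  also have "\<dots> = (LINT x|lebesgue. f x * fourier_integral g x)"
  proof (intro Bochner_Integration.integral_cong refl)
    fix x
    have "(LINT p|lebesgue. ?G p x) = (LINT p|lebesgue. f x * (exp (- \<i> * of_real (x \<bullet> p)) * g p))"
      by (intro Bochner_Integration.integral_cong refl) (simp add: inner_commute mult_ac)
    also have "\<dots> = f x * (LINT p|lebesgue. exp (- \<i> * of_real (x \<bullet> p)) * g p)"
      by (rule integral_mult_right_zero)
    finally show "(LINT p|lebesgue. ?G p x) / of_real (2 * pi) = f x * fourier_integral g x"
      by (simp add: fourier_integral_def)
  qed
  finally show ?thesis .
qed

text \<open>The composition \<open>f (x - z)\<close> is handled on the product space for Borel
  functions, so a Lebesgue measurable \<open>f\<close> is first replaced by a Borel
  representative.\<close>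

lemma lebesgue_borel_representative:
  fixes f :: "plane \<Rightarrow> complex"
  assumes f: "f \<in> borel_measurable lebesgue"
  obtains g where "g \<in> borel_measurable borel" "AE x in lebesgue. f x = g x"
proof -
  have "(\<lambda>x. Re (f x)) \<in> borel_measurable lebesgue" "(\<lambda>x. Im (f x)) \<in> borel_measurable lebesgue"
    using f by measurable
  from this[THEN completion_ex_borel_measurable_real]
  obtain a b where ab: "a \<in> borel_measurable lborel" "AE x in lborel. Re (f x) = a x"
    "b \<in> borel_measurable lborel" "AE x in lborel. Im (f x) = b x" by (elim bexE)
  have [measurable]: "a \<in> borel_measurable borel" "b \<in> borel_measurable borel"
    using ab(1,3) by simp_all
  show thesis
  proof (rule that)
    show "(\<lambda>x. Complex (a x) (b x)) \<in> borel_measurable borel"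
      unfolding Complex_eq by measurable
    show "AE x in lebesgue. f x = Complex (a x) (b x)"
      using AE_completion[OF ab(2)] AE_completion[OF ab(4)] by eventually_elim (simp add: complex_eq_iff)
  qed
qed

section \<open>Plancherel's theorem on the intersection of L1 and L2\<close>

lemma borel_measurable_cnj [measurable (raw)]:
  assumes "f \<in> borel_measurable M"
  shows "(\<lambda>x. cnj (f x)) \<in> borel_measurable M"
proof -
  have "cnj \<in> borel_measurable borel"
    by (intro borel_measurable_continuous_onI continuous_intros)
  from measurable_compose[OF assms this] show ?thesis .
qed

definition autocorr :: "(plane \<Rightarrow> complex) \<Rightarrow> plane \<Rightarrow> complex" where
  "autocorr f h = (LINT x|lebesgue. f x * cnj (f (x - h)))"

lemma reflect_integral:
  fixes f :: "plane \<Rightarrow> 'b::{banach, second_countable_topology}"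
  assumes f: "f \<in> borel_measurable lebesgue"
  shows "(LINT z|lebesgue. f (x - z)) = (LINT z|lebesgue. f z)"
    and "integrable lebesgue (\<lambda>z. f (x - z)) \<longleftrightarrow> integrable lebesgue f"
proof -
  have c: "(- 1 :: real) \<noteq> 0" by simp
  have e: "(\<lambda>z. f (x - z)) = (\<lambda>z. f (x + (- 1) *\<^sub>R z))"
    by simp
  have s: "((- 1)\<^sup>2 :: real) = 1" by simp
  show "(LINT z|lebesgue. f (x - z)) = (LINT z|lebesgue. f z)"
    unfolding e using lebesgue_affine_integral(1)[OF c f, of x]
    unfolding s scaleR_one by (rule sym)
  show "integrable lebesgue (\<lambda>z. f (x - z)) \<longleftrightarrow> integrable lebesgue f"
    unfolding e by (rule lebesgue_affine_integral(2)[OF c f])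
qed

text \<open>The substitution \<open>u = x - z\<close> splits the exponential into two factors, so
  the transform is a squared modulus. The factor \<open>2 * pi\<close> arises because one prefactor
  faces two.\<close>

lemma autocorr_fourier:
  fixes f :: "plane \<Rightarrow> complex"
  assumes f: "f \<in> borel_measurable borel" and int: "integrable lebesgue f"
  shows "integrable lebesgue (autocorr f)"
    and "fourier_integral (autocorr f) p = of_real (2 * pi * (cmod (fourier_integral f p))\<^sup>2)"
proof -
  note f [measurable]
  have fl [measurable]: "f \<in> borel_measurable lebesgue" using f by (rule borel_lebesgue_measurable)
  let ?e = "\<lambda>p z. exp (- \<i> * complex_of_real (p \<bullet> z))"
  let ?G = "\<lambda>p x z. f x * cnj (f (x - z)) * ?e p z"
  have intG: "integrable (lebesgue \<Otimes>\<^sub>M lebesgue) (case_prod (?G p))" for p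
  proof (rule lebesgue_pair.Fubini_integrable)
    show "case_prod (?G p) \<in> borel_measurable (lebesgue \<Otimes>\<^sub>M lebesgue)"
    proof -
      have s: "(\<lambda>z. fst z - snd z) \<in> (lebesgue \<Otimes>\<^sub>M lebesgue :: (plane \<times> plane) measure) \<rightarrow>\<^sub>M borel"
        by (intro borel_measurable_diff fst_lebesgue_measurable snd_lebesgue_measurable)
      have e: "(\<lambda>z. ?e p z) \<in> borel_measurable borel" by measurable
      show ?thesis
        unfolding split_beta'
        by (intro borel_measurable_times borel_measurable_cnj measurable_compose[OF s f]
            measurable_compose[OF fst_lebesgue_measurable f] measurable_compose[OF snd_lebesgue_measurable e])
    qed
    have "(LINT z|lebesgue. norm (case (x, z) of (x, z) \<Rightarrow> ?G p x z)) = cmod (f x) * (LINT z|lebesgue. cmod (f z))" for x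
    proof -
      have "(LINT z|lebesgue. norm (case (x, z) of (x, z) \<Rightarrow> ?G p x z)) = (LINT z|lebesgue. cmod (f x) * cmod (f (x - z)))"
        by (simp add: norm_mult)
      also have "\<dots> = cmod (f x) * (LINT z|lebesgue. cmod (f (x - z)))"
        by (rule integral_mult_right_zero)
      also have "(LINT z|lebesgue. cmod (f (x - z))) = (LINT z|lebesgue. cmod (f z))"
        by (rule reflect_integral(1)) measurable
      finally show ?thesis .
    qed
    then show "integrable lebesgue (\<lambda>x. LINT z|lebesgue. norm (case (x, z) of (x, z) \<Rightarrow> ?G p x z))"
      using int by simp
    have "integrable lebesgue (\<lambda>z. f x * cnj (f (x - z)) * ?e p z)" for x
    proof -
      have "integrable lebesgue (\<lambda>z. f (x - z))"
        using reflect_integral(2)[OF fl] int by blast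
      then have "integrable lebesgue (\<lambda>z. f x * cnj (f (x - z)))"
        by (intro integrable_mult_right) simp
      from fourier_integrand_integrable[OF this, of p]
      show ?thesis by (simp add: mult_ac)
    qed
    then show "AE x in lebesgue. integrable lebesgue (\<lambda>z. case (x, z) of (x, z) \<Rightarrow> ?G p x z)" by simp
  qed
  have e0: "?e 0 z = 1" for z by simp
  show ac: "integrable lebesgue (autocorr f)"
    using lebesgue_pair.integrable_snd[OF intG[of 0]] unfolding e0 autocorr_def[abs_def] by simp
  have "(LINT z|lebesgue. ?e p z * autocorr f z) = (LINT z|lebesgue. LINT x|lebesgue. ?G p x z)"
  proof (intro Bochner_Integration.integral_cong refl)
    fix z
    have "(LINT x|lebesgue. ?G p x z) = autocorr f z * ?e p z"
      unfolding autocorr_def by (rule integral_mult_left_zero)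
    then show "?e p z * autocorr f z = (LINT x|lebesgue. ?G p x z)" by simp
  qed
  also have "\<dots> = (LINT x|lebesgue. LINT z|lebesgue. ?G p x z)"
    by (rule lebesgue_pair.Fubini_integral[OF intG])
  also have "\<dots> = (LINT x|lebesgue. (?e p x * f x) * cnj (LINT u|lebesgue. ?e p u * f u))"
  proof (intro Bochner_Integration.integral_cong refl)
    fix x
    have m: "(\<lambda>u. f x * cnj (f u) * ?e p (x - u)) \<in> borel_measurable lebesgue"
      by (rule borel_lebesgue_measurable) measurable
    have "(LINT z|lebesgue. ?G p x z) = (LINT u|lebesgue. f x * cnj (f u) * ?e p (x - u))"
      using reflect_integral(1)[OF m, of x] by simp
    also have "\<dots> = (LINT u|lebesgue. (?e p x * f x) * cnj (?e p u * f u))"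
    proof (intro Bochner_Integration.integral_cong refl)
      fix u
      have "?e p (x - u) = ?e p x * exp (\<i> * complex_of_real (p \<bullet> u))"
        by (simp add: inner_diff_right algebra_simps flip: exp_add)
      also have "exp (\<i> * complex_of_real (p \<bullet> u)) = cnj (?e p u)"
        by (simp add: exp_cnj)
      finally show "f x * cnj (f u) * ?e p (x - u) = (?e p x * f x) * cnj (?e p u * f u)" by simp
    qed
    also have "\<dots> = (?e p x * f x) * (LINT u|lebesgue. cnj (?e p u * f u))"
      by (rule integral_mult_right_zero)
    also have "(LINT u|lebesgue. cnj (?e p u * f u)) = cnj (LINT u|lebesgue. ?e p u * f u)"
      by (rule Bochner_Integration.integral_cnj)
    finally show "(LINT z|lebesgue. ?G p x z) = (?e p x * f x) * cnj (LINT u|lebesgue. ?e p u * f u)" .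
  qed
  also have "\<dots> = (LINT x|lebesgue. ?e p x * f x) * cnj (LINT u|lebesgue. ?e p u * f u)"
    by (rule integral_mult_left_zero)
  also have "\<dots> = of_real ((cmod (LINT x|lebesgue. ?e p x * f x))\<^sup>2)"
    by (rule complex_norm_square[symmetric])
  finally have "(LINT z|lebesgue. ?e p z * autocorr f z) = of_real ((cmod (LINT x|lebesgue. ?e p x * f x))\<^sup>2)" .
  then show "fourier_integral (autocorr f) p = of_real (2 * pi * (cmod (fourier_integral f p))\<^sup>2)"
    by (simp add: fourier_integral_def norm_divide power_divide power2_eq_square)
qed

text \<open>The second bound turns continuity of translations in L1 into continuity of the
  autocorrelation at 0. It uses a sup bound on \<open>f\<close>, which is why Plancherel's formula
  is first proved for bounded functions.\<close>

lemma autocorr_bounds: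
  fixes f :: "plane \<Rightarrow> complex"
  assumes int: "integrable lebesgue f" and B: "\<And>x. cmod (f x) \<le> B"
  shows "cmod (autocorr f h) \<le> B * (LINT x|lebesgue. cmod (f x))"
    and "cmod (autocorr f h - autocorr f 0) \<le> B * (LINT x|lebesgue. cmod (f (x - h) - f x))"
proof -
  note fm [measurable] = borel_measurable_integrable[OF int]
  have B0: "0 \<le> B" using B[of 0] norm_ge_zero[of "f 0"] by linarith
  have sh: "integrable lebesgue (\<lambda>x. f (x - h))"
    using lebesgue_shift(2)[OF fm, of "- h"] int by simp
  have ib: "integrable lebesgue (\<lambda>x. f x * cnj (f (x - h')))" if "integrable lebesgue (\<lambda>x. f (x - h'))" for h'
  proof (rule Bochner_Integration.integrable_bound)
    show "integrable lebesgue (\<lambda>x. B * cmod (f x))" using int by simp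
    show "(\<lambda>x. f x * cnj (f (x - h'))) \<in> borel_measurable lebesgue"
      using borel_measurable_integrable[OF that] by measurable
    show "AE x in lebesgue. norm (f x * cnj (f (x - h'))) \<le> norm (B * cmod (f x))"
      using B B0 by (auto simp: norm_mult mult.commute[of B] intro!: mult_left_mono)
  qed
  have "cmod (autocorr f h) \<le> (LINT x|lebesgue. cmod (f x * cnj (f (x - h))))"
    unfolding autocorr_def by (rule integral_norm_bound)
  also have "\<dots> \<le> (LINT x|lebesgue. B * cmod (f x))"
  proof (rule integral_mono)
    show "cmod (f x * cnj (f (x - h))) \<le> B * cmod (f x)" for x
      using B by (simp add: norm_mult mult.commute[of B] mult_left_mono)
  qed (use ib[OF sh] int in auto)
  also have "\<dots> = B * (LINT x|lebesgue. cmod (f x))"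
    by (rule integral_mult_right_zero)
  finally show "cmod (autocorr f h) \<le> B * (LINT x|lebesgue. cmod (f x))" .
  have ih: "integrable lebesgue (\<lambda>x. f x * cnj (f (x - h)))" and i0: "integrable lebesgue (\<lambda>x. f x * cnj (f x))"
    using ib[OF sh] ib[of 0] int by simp_all
  have id: "integrable lebesgue (\<lambda>x. f x * cnj (f (x - h) - f x))"
    using Bochner_Integration.integrable_diff[OF ih i0] by (simp add: right_diff_distrib)
  have "autocorr f h - autocorr f 0 = (LINT x|lebesgue. f x * cnj (f (x - h) - f x))"
    using Bochner_Integration.integral_diff[OF ih i0] by (simp add: autocorr_def right_diff_distrib)
  also have "cmod \<dots> \<le> (LINT x|lebesgue. cmod (f x * cnj (f (x - h) - f x)))"
    by (rule integral_norm_bound)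
  also have "\<dots> \<le> (LINT x|lebesgue. B * cmod (f (x - h) - f x))"
  proof (rule integral_mono)
    show "cmod (f x * cnj (f (x - h) - f x)) \<le> B * cmod (f (x - h) - f x)" for x
      using B by (simp add: norm_mult mult_right_mono flip: complex_cnj_diff)
    show "integrable lebesgue (\<lambda>x. B * cmod (f (x - h) - f x))"
      using sh int by simp
  qed (use id in simp)
  also have "\<dots> = B * (LINT x|lebesgue. cmod (f (x - h) - f x))"
    by (rule integral_mult_right_zero)
  finally show "cmod (autocorr f h - autocorr f 0) \<le> B * (LINT x|lebesgue. cmod (f (x - h) - f x))" .
qed

lemma gauss_measurable [measurable]: "gauss \<in> borel_measurable borel"
  unfolding gauss_def[abs_def] by measurable

lemma gauss_scaled_integrable:
  assumes "e > 0"
  shows "integrable lebesgue (\<lambda>p. gauss (e *\<^sub>R p))"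
  using lebesgue_affine_integral(2)[of e gauss 0] assms gauss_integrable
  by (simp add: borel_measurable_integrable)

lemma gauss_scaled_fourier:
  assumes e: "e > 0"
  shows "fourier_integral (\<lambda>p. of_real (gauss (e *\<^sub>R p))) z = of_real (gauss (z /\<^sub>R e) / e\<^sup>2)"
proof -
  let ?F = "\<lambda>p. exp (- \<i> * complex_of_real (z \<bullet> p)) * of_real (gauss (e *\<^sub>R p))"
  have m: "?F \<in> borel_measurable lebesgue"
    by (rule borel_lebesgue_measurable) measurable
  have "(LINT p|lebesgue. ?F p) = (1 / e)\<^sup>2 *\<^sub>R (LINT p|lebesgue. ?F (0 + (1 / e) *\<^sub>R p))"
    by (rule lebesgue_affine_integral(1)) (use e m in auto)
  also have "(LINT p|lebesgue. ?F (0 + (1 / e) *\<^sub>R p))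
      = (LINT p|lebesgue. exp (- \<i> * complex_of_real ((z /\<^sub>R e) \<bullet> p)) * of_real (gauss p))"
    using e by (intro Bochner_Integration.integral_cong refl) (simp add: inverse_eq_divide)
  also have "\<dots> = of_real (2 * pi) * fourier_integral (\<lambda>x. of_real (gauss x)) (z /\<^sub>R e)"
    by (simp add: fourier_integral_def)
  also have "\<dots> = of_real (2 * pi * gauss (z /\<^sub>R e))"
    by (simp add: gauss_fourier)
  finally show ?thesis
    by (simp add: fourier_integral_def scaleR_conv_of_real power_divide)
qed

text \<open>The Gaussian factor makes the integral of the squared transform converge before its
  finiteness is known; the multiplication formula then moves everything to the autocorrelation near
  0.\<close>

lemma plancherel_gauss:
  fixes f :: "plane \<Rightarrow> complex"
  assumes f: "f \<in> borel_measurable borel" and int: "integrable lebesgue f" and e: "e > 0"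
  shows "(LINT p|lebesgue. complex_of_real ((cmod (fourier_integral f p))\<^sup>2 * gauss (e *\<^sub>R p)))
    = (LINT w|lebesgue. autocorr f (e *\<^sub>R w) * of_real (gauss w)) / of_real (2 * pi)"
proof -
  note ac = autocorr_fourier[OF f int]
  have gi: "integrable lebesgue (\<lambda>p. complex_of_real (gauss (e *\<^sub>R p)))"
    using gauss_scaled_integrable[OF e] by (rule integrable_of_real)
  have "(LINT p|lebesgue. complex_of_real ((cmod (fourier_integral f p))\<^sup>2 * gauss (e *\<^sub>R p)))
      = (LINT p|lebesgue. fourier_integral (autocorr f) p * of_real (gauss (e *\<^sub>R p)) / of_real (2 * pi))"
    unfolding ac(2) by (intro Bochner_Integration.integral_cong refl) simp
  also have "\<dots> = (LINT p|lebesgue. fourier_integral (autocorr f) p * of_real (gauss (e *\<^sub>R p))) / of_real (2 * pi)"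
    by (rule integral_divide_zero)
  also have "(LINT p|lebesgue. fourier_integral (autocorr f) p * of_real (gauss (e *\<^sub>R p)))
      = (LINT z|lebesgue. autocorr f z * of_real (gauss (z /\<^sub>R e) / e\<^sup>2))"
    unfolding fourier_integral_mult[OF ac(1) gi] gauss_scaled_fourier[OF e] ..
  also have "\<dots> = e\<^sup>2 *\<^sub>R (LINT w|lebesgue. autocorr f (0 + e *\<^sub>R w) * of_real (gauss ((0 + e *\<^sub>R w) /\<^sub>R e) / e\<^sup>2))"
  proof (rule lebesgue_affine_integral(1))
    have "(\<lambda>z. complex_of_real (gauss (z /\<^sub>R e) / e\<^sup>2)) \<in> borel_measurable lebesgue"
      by (rule borel_lebesgue_measurable) measurable
    then show "(\<lambda>z. autocorr f z * of_real (gauss (z /\<^sub>R e) / e\<^sup>2)) \<in> borel_measurable lebesgue"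
      by (rule borel_measurable_times[OF borel_measurable_integrable[OF ac(1)]])
  qed (use e in simp)
  also have "\<dots> = (LINT w|lebesgue. e\<^sup>2 *\<^sub>R (autocorr f (0 + e *\<^sub>R w) * of_real (gauss ((0 + e *\<^sub>R w) /\<^sub>R e) / e\<^sup>2)))"
    by (rule integral_scaleR_right[symmetric])
  also have "\<dots> = (LINT w|lebesgue. autocorr f (e *\<^sub>R w) * of_real (gauss w))"
    using e by (intro Bochner_Integration.integral_cong refl) (simp add: scaleR_conv_of_real[where 'a = complex])
  finally show ?thesis .
qed

text \<open>The damping is removed. On the autocorrelation side, dominated convergence yields
  \<open>autocorr f 0\<close>, the squared norm; on the transform side, monotone convergence yields
  integrability and the value of the integral together.\<close>

lemma plancherel_bounded_borel:
  fixes f :: "plane \<Rightarrow> complex"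
  assumes f: "f \<in> borel_measurable borel" and int: "integrable lebesgue f" and B: "\<And>x. cmod (f x) \<le> B"
  shows "fourier_integral f \<in> L2 \<and> l2 (fourier_integral f) = l2 f"
proof -
  let ?F = "\<lambda>n p. (cmod (fourier_integral f p))\<^sup>2 * gauss ((1 / real (Suc n)) *\<^sub>R p)"
  have fm [measurable]: "fourier_integral f \<in> borel_measurable lebesgue"
    by (rule fourier_integral_measurable[OF int])
  have Fm: "?F n \<in> borel_measurable lebesgue" for n
  proof (rule borel_measurable_times)
    show "(\<lambda>p. gauss ((1 / real (Suc n)) *\<^sub>R p)) \<in> borel_measurable lebesgue"
      by (rule borel_lebesgue_measurable) measurable
  qed measurable
  have F_int: "integrable lebesgue (?F n)" for n
  proof (rule Bochner_Integration.integrable_bound)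
    show "integrable lebesgue (\<lambda>p. (LINT x|lebesgue. cmod (f x))\<^sup>2 * gauss ((1 / real (Suc n)) *\<^sub>R p))"
      using gauss_scaled_integrable[of "1 / real (Suc n)"] by (intro integrable_mult_right) simp
    show "AE p in lebesgue. norm (?F n p) \<le> norm ((LINT x|lebesgue. cmod (f x))\<^sup>2 * gauss ((1 / real (Suc n)) *\<^sub>R p))"
    proof (intro AE_I2)
      fix p
      have "?F n p \<le> (LINT x|lebesgue. cmod (f x))\<^sup>2 * gauss ((1 / real (Suc n)) *\<^sub>R p)"
        using fourier_integral_bound[OF int] gauss_bounds(1) by (intro mult_right_mono power_mono) (auto simp: less_imp_le)
      then show "norm (?F n p) \<le> norm ((LINT x|lebesgue. cmod (f x))\<^sup>2 * gauss ((1 / real (Suc n)) *\<^sub>R p))"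
        using gauss_bounds(1) by (simp add: abs_mult less_imp_le abs_of_pos)
    qed
  qed (rule Fm)
  have g2pi: "(LINT w|lebesgue. complex_of_real (gauss w)) = of_real (2 * pi)"
    using gauss_fourier[of 0] by (simp add: fourier_integral_def gauss_def field_simps)
  have lim: "(\<lambda>n. LINT w|lebesgue. autocorr f ((1 / real (Suc n)) *\<^sub>R w) * of_real (gauss w))
      \<longlonglongrightarrow> (LINT w|lebesgue. autocorr f 0 * of_real (gauss w))"
  proof (rule integral_dominated_convergence)
    show "integrable lebesgue (\<lambda>w. (B * (LINT x|lebesgue. cmod (f x))) * gauss w)"
      by (intro integrable_mult_right gauss_integrable)
    have gm: "(\<lambda>w. complex_of_real (gauss w)) \<in> borel_measurable lebesgue"
      by (rule borel_lebesgue_measurable) measurable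
    then show "(\<lambda>w. autocorr f 0 * of_real (gauss w)) \<in> borel_measurable lebesgue"
      by measurable
    show "(\<lambda>w. autocorr f ((1 / real (Suc n)) *\<^sub>R w) * of_real (gauss w)) \<in> borel_measurable lebesgue" for n
      using lebesgue_affine_integral(3)[OF _ borel_measurable_integrable[OF autocorr_fourier(1)[OF f int]], of "1 / real (Suc n)" 0]
      by (intro borel_measurable_times gm) simp
    show "AE w in lebesgue. (\<lambda>n. autocorr f ((1 / real (Suc n)) *\<^sub>R w) * of_real (gauss w)) \<longlonglongrightarrow> autocorr f 0 * of_real (gauss w)"
    proof (intro AE_I2 tendsto_mult tendsto_const)
      fix w :: plane
      have "(\<lambda>n. - ((1 / real (Suc n)) *\<^sub>R w)) \<longlonglongrightarrow> - (0 *\<^sub>R w)"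
        using LIMSEQ_inverse_real_of_nat by (intro tendsto_intros) (simp add: inverse_eq_divide)
      then have "(\<lambda>n. LINT x|lebesgue. norm (f (x + - ((1 / real (Suc n)) *\<^sub>R w)) - f x)) \<longlonglongrightarrow> 0"
        by (intro L1_translation[OF int]) simp
      then have "(\<lambda>n. B * (LINT x|lebesgue. cmod (f (x - (1 / real (Suc n)) *\<^sub>R w) - f x))) \<longlonglongrightarrow> 0"
        by (intro tendsto_mult_right_zero) simp
      then have "(\<lambda>n. autocorr f ((1 / real (Suc n)) *\<^sub>R w) - autocorr f 0) \<longlonglongrightarrow> 0"
        by (rule Lim_null_comparison[OF always_eventually, rotated]) (use autocorr_bounds(2)[OF int B] in blast)
      then show "(\<lambda>n. autocorr f ((1 / real (Suc n)) *\<^sub>R w)) \<longlonglongrightarrow> autocorr f 0"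
        by (rule LIM_zero_cancel)
    qed
    show "AE w in lebesgue. norm (autocorr f ((1 / real (Suc n)) *\<^sub>R w) * of_real (gauss w)) \<le> (B * (LINT x|lebesgue. cmod (f x))) * gauss w" for n
    proof (intro AE_I2)
      fix w
      show "norm (autocorr f ((1 / real (Suc n)) *\<^sub>R w) * of_real (gauss w)) \<le> (B * (LINT x|lebesgue. cmod (f x))) * gauss w"
        unfolding norm_mult norm_of_real abs_of_pos[OF gauss_bounds(1)]
        by (rule mult_right_mono[OF autocorr_bounds(1)[OF int B]]) (simp add: gauss_bounds less_imp_le)
    qed
  qed
  have ac0: "autocorr f 0 = of_real ((l2 f)\<^sup>2)"
  proof -
    have "autocorr f 0 = (LINT x|lebesgue. complex_of_real ((cmod (f x))\<^sup>2))"
      unfolding autocorr_def by (intro Bochner_Integration.integral_cong refl) (simp only: complex_norm_square diff_zero)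
    then show ?thesis by (simp only: l2_square integral_complex_of_real)
  qed
  have "(LINT w|lebesgue. autocorr f 0 * of_real (gauss w)) = of_real ((l2 f)\<^sup>2) * of_real (2 * pi)"
    unfolding integral_mult_right_zero g2pi ac0 ..
  with tendsto_divide[OF lim tendsto_const, of "of_real (2 * pi)"]
  have "(\<lambda>n. (LINT w|lebesgue. autocorr f ((1 / real (Suc n)) *\<^sub>R w) * of_real (gauss w)) / of_real (2 * pi))
      \<longlonglongrightarrow> of_real ((l2 f)\<^sup>2)" by simp
  moreover have "(LINT w|lebesgue. autocorr f ((1 / real (Suc n)) *\<^sub>R w) * of_real (gauss w)) / of_real (2 * pi)
      = complex_of_real (LINT p|lebesgue. ?F n p)" for n
    using plancherel_gauss[OF f int, of "1 / real (Suc n)"] by (simp only: integral_complex_of_real) simp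
  ultimately have "(\<lambda>n. complex_of_real (LINT p|lebesgue. ?F n p)) \<longlonglongrightarrow> of_real ((l2 f)\<^sup>2)" by simp
  then have l: "(\<lambda>n. LINT p|lebesgue. ?F n p) \<longlonglongrightarrow> (l2 f)\<^sup>2"
    by (simp only: tendsto_of_real_iff)
  have mono: "AE p in lebesgue. mono (\<lambda>n. ?F n p)"
  proof (intro AE_I2 monoI mult_left_mono)
    fix p :: plane and m n :: nat assume "m \<le> n"
    then have "norm p / real (Suc n) \<le> norm p / real (Suc m)" by (intro divide_left_mono) auto
    then have "(norm p / real (Suc n))\<^sup>2 \<le> (norm p / real (Suc m))\<^sup>2" by (intro power_mono) auto
    then show "gauss ((1 / real (Suc m)) *\<^sub>R p) \<le> gauss ((1 / real (Suc n)) *\<^sub>R p)"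
      by (simp add: gauss_def)
  qed simp
  have pw: "AE p in lebesgue. (\<lambda>n. ?F n p) \<longlonglongrightarrow> (cmod (fourier_integral f p))\<^sup>2"
  proof (intro AE_I2)
    fix p :: plane
    have "(\<lambda>n. - (inverse (real (Suc n)) * norm p)\<^sup>2 / 2) \<longlonglongrightarrow> - (0 * norm p)\<^sup>2 / 2"
      by (intro tendsto_intros LIMSEQ_inverse_real_of_nat) simp
    then have "(\<lambda>n. exp (- (inverse (real (Suc n)) * norm p)\<^sup>2 / 2)) \<longlonglongrightarrow> exp 0"
      by (intro tendsto_exp) simp
    then have "(\<lambda>n. gauss ((1 / real (Suc n)) *\<^sub>R p)) \<longlonglongrightarrow> 1"
      by (simp add: gauss_def inverse_eq_divide)
    from tendsto_mult[OF tendsto_const this]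
    show "(\<lambda>n. ?F n p) \<longlonglongrightarrow> (cmod (fourier_integral f p))\<^sup>2" by force
  qed
  have um: "(\<lambda>p. (cmod (fourier_integral f p))\<^sup>2) \<in> borel_measurable lebesgue" by measurable
  note mc = F_int mono pw l um
  have "integrable lebesgue (\<lambda>p. (cmod (fourier_integral f p))\<^sup>2)"
    by (rule integrable_monotone_convergence[OF mc])
  moreover have "(LINT p|lebesgue. (cmod (fourier_integral f p))\<^sup>2) = (l2 f)\<^sup>2"
    by (rule integral_monotone_convergence[OF mc])
  ultimately show ?thesis using fm by (simp add: L2_def l2_def[of "fourier_integral f"])
qed

lemma fourier_integral_cong_AE:
  assumes "AE x in lebesgue. f x = g x"
  shows "fourier_integral f p = fourier_integral g p"
proof (cases "f \<in> borel_measurable lebesgue")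
  case True
  then have g: "g \<in> borel_measurable lebesgue" using assms by (rule borel_measurable_AE)
  have e: "(\<lambda>x. exp (- \<i> * complex_of_real (p \<bullet> x))) \<in> borel_measurable lebesgue"
    by (rule borel_lebesgue_measurable) measurable
  have "(LINT x|lebesgue. exp (- \<i> * complex_of_real (p \<bullet> x)) * f x) = (LINT x|lebesgue. exp (- \<i> * complex_of_real (p \<bullet> x)) * g x)"
    by (intro integral_cong_AE borel_measurable_times e True g) (use assms in auto)
  then show ?thesis by (simp add: fourier_integral_def)
next
  case False
  have gn: "g \<notin> borel_measurable lebesgue"
  proof
    assume "g \<in> borel_measurable lebesgue"
    moreover have "AE x in lebesgue. g x = f x" using assms by eventually_elim simp
    ultimately have "f \<in> borel_measurable lebesgue" by (rule borel_measurable_AE)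
    with False show False by simp
  qed
  \<comment> \<open>Multiplying back by the inverse exponential would make \<open>h\<close>
    measurable. So without measurability both integrals take the same default value 0.\<close>
  have *: "\<not> integrable lebesgue (\<lambda>x. exp (- \<i> * complex_of_real (p \<bullet> x)) * h x)"
    if h: "h \<notin> borel_measurable lebesgue" for h :: "plane \<Rightarrow> complex"
  proof
    assume i: "integrable lebesgue (\<lambda>x. exp (- \<i> * complex_of_real (p \<bullet> x)) * h x)"
    have e: "(\<lambda>x. exp (\<i> * complex_of_real (p \<bullet> x))) \<in> borel_measurable lebesgue"
      by (rule borel_lebesgue_measurable) measurable
    have "(\<lambda>x. exp (\<i> * complex_of_real (p \<bullet> x)) * (exp (- \<i> * complex_of_real (p \<bullet> x)) * h x)) \<in> borel_measurable lebesgue"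
      by (rule borel_measurable_times[OF e borel_measurable_integrable[OF i]])
    moreover have "exp (\<i> * complex_of_real (p \<bullet> x)) * (exp (- \<i> * complex_of_real (p \<bullet> x)) * h x) = h x" for x
      unfolding mult.assoc[symmetric] exp_add[symmetric] by simp
    ultimately show False using h by (simp only: simp_thms)
  qed
  show ?thesis
    unfolding fourier_integral_def not_integrable_integral_eq[OF *[OF False]] not_integrable_integral_eq[OF *[OF gn]] ..
qed

lemma fourier_integral_add_scale:
  assumes f: "integrable lebesgue f" and g: "integrable lebesgue g"
  shows "fourier_integral (\<lambda>x. c * f x + g x) p = c * fourier_integral f p + fourier_integral g p"
proof -
  let ?e = "\<lambda>x. exp (- \<i> * complex_of_real (p \<bullet> x))"
  have i1: "integrable lebesgue (\<lambda>x. c * (?e x * f x))" and i2: "integrable lebesgue (\<lambda>x. ?e x * g x)"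
    by (intro integrable_mult_right fourier_integrand_integrable f g)+
  have "(LINT x|lebesgue. ?e x * (c * f x + g x)) = (LINT x|lebesgue. c * (?e x * f x) + ?e x * g x)"
    by (intro Bochner_Integration.integral_cong refl) (simp add: algebra_simps)
  also have "\<dots> = (LINT x|lebesgue. c * (?e x * f x)) + (LINT x|lebesgue. ?e x * g x)"
    by (rule Bochner_Integration.integral_add[OF i1 i2])
  also have "(LINT x|lebesgue. c * (?e x * f x)) = c * (LINT x|lebesgue. ?e x * f x)"
    by (rule integral_mult_right_zero)
  finally show ?thesis by (simp add: fourier_integral_def add_divide_distrib)
qed

lemma fourier_integral_diff:
  assumes f: "integrable lebesgue f" and g: "integrable lebesgue g"
  shows "fourier_integral (\<lambda>x. f x - g x) p = fourier_integral f p - fourier_integral g p"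
  using fourier_integral_add_scale[OF g f, of "-1" p] by simp

lemma plancherel_bounded:
  fixes f :: "plane \<Rightarrow> complex"
  assumes int: "integrable lebesgue f" and B: "\<And>x. cmod (f x) \<le> B"
  shows "fourier_integral f \<in> L2 \<and> l2 (fourier_integral f) = l2 f"
proof -
  have B0: "0 \<le> B" using B[of 0] norm_ge_zero[of "f 0"] by linarith
  obtain g where g [measurable]: "g \<in> borel_measurable borel" and fg: "AE x in lebesgue. f x = g x"
    using lebesgue_borel_representative[OF borel_measurable_integrable[OF int]] .
  \<comment> \<open>The Borel representative obeys the bound only almost everywhere; cutting it off
    at \<open>B\<close> restores the bound at every point.\<close>
  define h where "h x = (if cmod (g x) \<le> B then g x else 0)" for x
  have h: "h \<in> borel_measurable borel" unfolding h_def[abs_def] by measurable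
  have fh: "AE x in lebesgue. f x = h x"
    using fg
  proof eventually_elim
    case (elim x)
    with B[of x] show ?case by (simp add: h_def)
  qed
  have inth: "integrable lebesgue h"
    by (rule integrable_cong_AE_imp[OF int borel_lebesgue_measurable[OF h]]) (use fh in \<open>auto simp: eq_commute\<close>)
  have "cmod (h x) \<le> B" for x using B0 by (simp add: h_def)
  from plancherel_bounded_borel[OF h inth this]
  have "fourier_integral h \<in> L2" "l2 (fourier_integral h) = l2 h" by auto
  moreover have "fourier_integral f = fourier_integral h"
    by (rule ext) (rule fourier_integral_cong_AE[OF fh])
  moreover have "l2 f = l2 h"
    unfolding l2_def
    by (intro arg_cong[of _ _ sqrt] integral_cong_AE)
       (use fh borel_measurable_integrable[OF int] borel_lebesgue_measurable[OF h] in auto)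
  ultimately show ?thesis by simp
qed

lemma L2_dominated_convergence:
  fixes f :: "plane \<Rightarrow> 'b::euclidean_space" and b :: "plane \<Rightarrow> 'c::euclidean_space"
  assumes b: "b \<in> L2" and u: "\<And>n. u n \<in> borel_measurable lebesgue"
    and lim: "\<And>x. (\<lambda>n. u n x) \<longlonglongrightarrow> f x" and bound: "\<And>n x. norm (u n x) \<le> norm (b x)"
  shows "u n \<in> L2" "f \<in> L2" "(\<lambda>n. l2 (\<lambda>x. u n x - f x)) \<longlonglongrightarrow> 0"
proof -
  show un: "u n \<in> L2" for n
    by (rule L2_scale[OF b u, of _ 1]) (simp add: bound)
  have fb: "norm (f x) \<le> norm (b x)" for x
    by (rule LIMSEQ_le_const2[OF tendsto_norm[OF lim]]) (use bound in blast)
  have fm: "f \<in> borel_measurable lebesgue"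
    by (rule borel_measurable_LIMSEQ_metric[OF u lim])
  show f: "f \<in> L2"
    by (rule L2_scale[OF b fm, of 1]) (simp add: fb)
  have "(\<lambda>n. LINT x|lebesgue. (norm (u n x - f x))\<^sup>2) \<longlonglongrightarrow> (LINT x|(lebesgue::plane measure). 0)"
  proof (rule integral_dominated_convergence)
    show "integrable lebesgue (\<lambda>x. 4 * (norm (b x))\<^sup>2)"
      by (intro integrable_mult_right L2_integrable b)
    show "AE x in lebesgue. (\<lambda>n. (norm (u n x - f x))\<^sup>2) \<longlonglongrightarrow> 0"
    proof (intro AE_I2)
      fix x
      have "(\<lambda>n. (norm (u n x - f x))\<^sup>2) \<longlonglongrightarrow> (norm (f x - f x))\<^sup>2"
        by (intro tendsto_intros lim)
      then show "(\<lambda>n. (norm (u n x - f x))\<^sup>2) \<longlonglongrightarrow> 0" by simp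
    qed
    show "AE x in lebesgue. norm ((norm (u n x - f x))\<^sup>2) \<le> 4 * (norm (b x))\<^sup>2" for n
    proof (intro AE_I2)
      fix x
      have "norm (u n x - f x) \<le> 2 * norm (b x)"
        using norm_triangle_ineq4[of "u n x" "f x"] bound[of n x] fb[of x] by linarith
      from power_mono[OF this, of 2]
      show "norm ((norm (u n x - f x))\<^sup>2) \<le> 4 * (norm (b x))\<^sup>2"
        by (simp add: power_mult_distrib)
    qed
    show "(\<lambda>x. (norm (u n x - f x))\<^sup>2) \<in> borel_measurable lebesgue" for n
      by (intro borel_measurable_integrable L2_integrable L2_diff un f)
  qed simp
  then have "(\<lambda>n. sqrt (LINT x|lebesgue. (norm (u n x - f x))\<^sup>2)) \<longlonglongrightarrow> sqrt 0"
    by (intro tendsto_real_sqrt) simp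
  then show "(\<lambda>n. l2 (\<lambda>x. u n x - f x)) \<longlonglongrightarrow> 0" by (simp add: l2_def)
qed

lemma L2_convergent_Cauchy:
  assumes u: "\<And>n. u n \<in> L2" and f: "f \<in> L2" and lim: "(\<lambda>n. l2 (\<lambda>x. u n x - f x)) \<longlonglongrightarrow> 0"
    and e: "e > 0"
  shows "\<exists>M. \<forall>m\<ge>M. \<forall>n\<ge>M. l2 (\<lambda>x. u m x - u n x) < e"
proof -
  have "eventually (\<lambda>n. l2 (\<lambda>x. u n x - f x) < e / 2) sequentially"
    using e by (intro order_tendstoD(2)[OF lim]) simp
  then obtain M where M: "\<And>n. n \<ge> M \<Longrightarrow> l2 (\<lambda>x. u n x - f x) < e / 2"
    unfolding eventually_sequentially by blast
  have "l2 (\<lambda>x. u m x - u n x) < e" if "m \<ge> M" "n \<ge> M" for m n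
    using l2_triangle_diff[OF u u f, of m n] M[OF that(1)] M[OF that(2)] l2_diff_commute[of f "u n"] by linarith
  then show ?thesis by blast
qed

text \<open>Truncation in height reduces to bounded functions. The transforms have an L2 limit by
  isometry and a pointwise limit by L1 convergence; an almost everywhere convergent subsequence
  identifies the two.\<close>

theorem plancherel_L1_L2:
  fixes f :: "plane \<Rightarrow> complex"
  assumes f: "f \<in> L2" and int: "integrable lebesgue f"
  shows "fourier_integral f \<in> L2" "l2 (fourier_integral f) = l2 f"
proof -
  define u where "u n x = (if cmod (f x) \<le> real n then f x else 0)" for n x
  note [measurable] = borel_measurable_integrable[OF int]
  have um [measurable]: "u n \<in> borel_measurable lebesgue" for n unfolding u_def[abs_def] by measurable
  have ub: "cmod (u n x) \<le> cmod (f x)" for n x by (simp add: u_def)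
  have ui: "integrable lebesgue (u n)" for n
    by (rule Bochner_Integration.integrable_bound[OF int um]) (simp add: ub)
  have ulim: "(\<lambda>n. u n x) \<longlonglongrightarrow> f x" for x
  proof (rule tendsto_eventually)
    obtain N where "cmod (f x) \<le> real N" using real_arch_simple by blast
    then show "\<forall>\<^sub>F n in sequentially. u n x = f x"
      by (intro eventually_sequentiallyI[of N]) (simp add: u_def)
  qed
  note conv = L2_dominated_convergence[OF f um ulim ub]
  have pl: "fourier_integral (u n) \<in> L2" "l2 (fourier_integral (u n)) = l2 (u n)" for n
    using plancherel_bounded[OF ui, of n n] by (auto simp: u_def)
  have pld: "l2 (\<lambda>p. fourier_integral (u m) p - fourier_integral (u n) p) = l2 (\<lambda>x. u m x - u n x)" for m n
  proof -
    have "cmod (u m x - u n x) \<le> real m + real n" for x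
      using norm_triangle_ineq4[of "u m x" "u n x"] by (simp add: u_def split: if_splits)
    with plancherel_bounded[OF Bochner_Integration.integrable_diff[OF ui[of m] ui[of n]]]
    have "l2 (fourier_integral (\<lambda>x. u m x - u n x)) = l2 (\<lambda>x. u m x - u n x)" by blast
    moreover have "fourier_integral (\<lambda>x. u m x - u n x) = (\<lambda>p. fourier_integral (u m) p - fourier_integral (u n) p)"
      by (rule ext) (rule fourier_integral_diff[OF ui ui])
    ultimately show ?thesis by simp
  qed
  have "\<exists>g\<in>L2. (\<lambda>n. l2 (\<lambda>p. fourier_integral (u n) p - g p)) \<longlonglongrightarrow> 0"
  proof (rule L2_complete[OF pl(1)])
    fix e :: real assume "e > 0"
    from L2_convergent_Cauchy[OF conv(1) f conv(3) this]
    show "\<exists>M. \<forall>m\<ge>M. \<forall>n\<ge>M. l2 (\<lambda>p. fourier_integral (u m) p - fourier_integral (u n) p) < e"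
      unfolding pld .
  qed
  then obtain g where g: "g \<in> L2" "(\<lambda>n. l2 (\<lambda>p. fourier_integral (u n) p - g p)) \<longlonglongrightarrow> 0" by blast
  obtain r where r: "strict_mono (r :: nat \<Rightarrow> nat)" and ae: "AE p in lebesgue. (\<lambda>n. fourier_integral (u (r n)) p) \<longlonglongrightarrow> g p"
    using L2_subseq_AE[OF pl(1) g] by blast
  have "(\<lambda>n. LINT x|lebesgue. cmod (u n x - f x)) \<longlonglongrightarrow> (LINT x|(lebesgue::plane measure). 0)"
  proof (rule integral_dominated_convergence)
    show "integrable lebesgue (\<lambda>x. 2 * cmod (f x))" using int by simp
    show "AE x in lebesgue. (\<lambda>n. cmod (u n x - f x)) \<longlonglongrightarrow> 0"
      using ulim by (simp add: LIM_zero_iff tendsto_norm_zero_iff)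
    show "AE x in lebesgue. norm (cmod (u n x - f x)) \<le> 2 * cmod (f x)" for n
      by (auto simp: u_def)
  qed measurable
  then have L1: "(\<lambda>n. LINT x|lebesgue. cmod (u n x - f x)) \<longlonglongrightarrow> 0" by simp
  have pw: "(\<lambda>n. fourier_integral (u n) p) \<longlonglongrightarrow> fourier_integral f p" for p
  proof (rule LIM_zero_cancel, rule Lim_null_comparison[OF always_eventually L1], rule allI)
    fix n
    show "norm (fourier_integral (u n) p - fourier_integral f p) \<le> (LINT x|lebesgue. cmod (u n x - f x))"
      using fourier_integral_bound[OF Bochner_Integration.integrable_diff[OF ui[of n] int], of p]
      unfolding fourier_integral_diff[OF ui int] .
  qed
  have gf: "AE p in lebesgue. g p = fourier_integral f p"
    using ae
  proof eventually_elim
    case (elim p)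
    have "(\<lambda>n. fourier_integral (u (r n)) p) \<longlonglongrightarrow> fourier_integral f p"
      using LIMSEQ_subseq_LIMSEQ[OF pw r] by (simp add: o_def)
    with elim show ?case by (rule LIMSEQ_unique)
  qed
  show "fourier_integral f \<in> L2" by (rule L2_cong_AE[OF g(1) gf])
  have "(\<lambda>n. l2 (fourier_integral (u n))) \<longlonglongrightarrow> l2 g" by (rule l2_tendsto[OF pl(1) g])
  moreover have "(\<lambda>n. l2 (fourier_integral (u n))) \<longlonglongrightarrow> l2 f"
    unfolding pl(2) by (rule l2_tendsto[OF conv(1) f conv(3)])
  ultimately have "l2 g = l2 f" by (rule LIMSEQ_unique)
  then show "l2 (fourier_integral f) = l2 f" using l2_cong_AE[OF gf g(1)] by simp
qed

section \<open>The Fourier transform extended to L2, and its inverse\<close>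

lemma l2_limit_nn_integral:
  assumes "\<And>n. u n \<in> L2"
  shows "(\<lambda>n. \<integral>\<^sup>+x. ennreal ((norm (u n x))\<^sup>2) \<partial>lebesgue) \<longlonglongrightarrow> 0 \<longleftrightarrow> (\<lambda>n. l2 (u n)) \<longlonglongrightarrow> 0"
proof -
  have "(\<lambda>n. ennreal ((l2 (u n))\<^sup>2)) \<longlonglongrightarrow> 0 \<longleftrightarrow> (\<lambda>n. (l2 (u n))\<^sup>2) \<longlonglongrightarrow> 0"
    by (rule ennreal_tendsto_0_iff) simp
  also have "\<dots> \<longleftrightarrow> (\<lambda>n. l2 (u n)) \<longlonglongrightarrow> 0"
  proof
    assume "(\<lambda>n. (l2 (u n))\<^sup>2) \<longlonglongrightarrow> 0"
    from tendsto_real_sqrt[OF this] show "(\<lambda>n. l2 (u n)) \<longlonglongrightarrow> 0" by simp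
  next
    assume "(\<lambda>n. l2 (u n)) \<longlonglongrightarrow> 0"
    from tendsto_power[OF this, of 2] show "(\<lambda>n. (l2 (u n))\<^sup>2) \<longlonglongrightarrow> 0" by simp
  qed
  finally show ?thesis unfolding l2_nn_integral[OF assms] .
qed

lemma is_fourier_iff:
  "is_fourier f g \<longleftrightarrow> f \<in> L2 \<and> g \<in> L2 \<and> (\<exists>u. (\<forall>n. u n \<in> L2 \<and> integrable lebesgue (u n)) \<and>
     (\<lambda>n. l2 (\<lambda>x. u n x - f x)) \<longlonglongrightarrow> 0 \<and> (\<lambda>n. l2 (\<lambda>p. fourier_integral (u n) p - g p)) \<longlonglongrightarrow> 0)"
proof -
  have "(\<lambda>n. \<integral>\<^sup>+x. ennreal ((cmod (u n x - f x))\<^sup>2) \<partial>lebesgue) \<longlonglongrightarrow> 0 \<longleftrightarrow> (\<lambda>n. l2 (\<lambda>x. u n x - f x)) \<longlonglongrightarrow> 0"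
    "(\<lambda>n. \<integral>\<^sup>+p. ennreal ((cmod (fourier_integral (u n) p - g p))\<^sup>2) \<partial>lebesgue) \<longlonglongrightarrow> 0
       \<longleftrightarrow> (\<lambda>n. l2 (\<lambda>p. fourier_integral (u n) p - g p)) \<longlonglongrightarrow> 0"
    if "f \<in> L2" "g \<in> L2" "\<forall>n. u n \<in> L2 \<and> integrable lebesgue (u n)" for u :: "nat \<Rightarrow> plane \<Rightarrow> complex"
    using that by (auto intro!: l2_limit_nn_integral L2_diff plancherel_L1_L2)
  then show ?thesis unfolding is_fourier_def by (metis (no_types, lifting))
qed

lemma L2_set_integrable:
  fixes f :: "plane \<Rightarrow> 'b::euclidean_space"
  assumes f: "f \<in> L2" and S: "S \<in> lmeasurable"
  shows "integrable lebesgue (\<lambda>x. indicator S x *\<^sub>R f x)" "(\<lambda>x. indicator S x *\<^sub>R f x) \<in> L2"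
proof -
  have [measurable]: "S \<in> sets lebesgue" using S by (rule fmeasurableD)
  note [measurable] = L2_measurable[OF f]
  have m: "(\<lambda>x. indicator S x *\<^sub>R f x) \<in> borel_measurable lebesgue" by measurable
  show "(\<lambda>x. indicator S x *\<^sub>R f x) \<in> L2"
    by (rule L2_scale[OF f m, of 1]) (simp add: indicator_def)
  show "integrable lebesgue (\<lambda>x. indicator S x *\<^sub>R f x)"
  proof (rule Bochner_Integration.integrable_bound[OF _ m])
    show "integrable lebesgue (\<lambda>x. indicat_real S x + (norm (f x))\<^sup>2)"
      using S by (intro Bochner_Integration.integrable_add L2_integrable f) (simp add: lmeasurable_iff_integrable)
    have "norm y \<le> 1 + (norm y)\<^sup>2" for y :: 'b
      using zero_le_power2[of "norm y - 1"] norm_ge_zero[of y]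
      unfolding power2_diff power_one mult_1_right by linarith
    then show "AE x in lebesgue. norm (indicator S x *\<^sub>R f x) \<le> norm (indicat_real S x + (norm (f x))\<^sup>2)"
      by (auto simp: indicator_def)
  qed
qed

text \<open>Cutting \<open>f\<close> off outside balls gives functions in both L1 and L2, whose
  transforms are Cauchy by isometry.\<close>

lemma is_fourier_exists:
  assumes f: "f \<in> L2"
  shows "\<exists>g. is_fourier f g"
proof -
  define u where "u n x = indicat_real (cball 0 (real n)) x *\<^sub>R f x" for n x
  have u: "u n \<in> L2" "integrable lebesgue (u n)" for n
    using L2_set_integrable[OF f, of "cball 0 (real n)"] by (simp_all add: u_def[abs_def] lmeasurable_cball)
  have ulim: "(\<lambda>n. u n x) \<longlonglongrightarrow> f x" for x
  proof (rule tendsto_eventually)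
    obtain N where "norm x \<le> real N" using real_arch_simple by blast
    then show "\<forall>\<^sub>F n in sequentially. u n x = f x"
      by (intro eventually_sequentiallyI[of N]) (simp add: u_def)
  qed
  have ub: "cmod (u n x) \<le> cmod (f x)" for n x by (simp add: u_def indicator_def)
  note conv = L2_dominated_convergence(3)[OF f L2_measurable[OF u(1)] ulim ub]
  have d: "l2 (\<lambda>p. fourier_integral (u m) p - fourier_integral (u n) p) = l2 (\<lambda>x. u m x - u n x)" for m n
    unfolding fourier_integral_diff[OF u(2) u(2), symmetric]
    by (rule plancherel_L1_L2(2)[OF L2_diff[OF u(1) u(1)] Bochner_Integration.integrable_diff[OF u(2) u(2)]])
  have "\<exists>g\<in>L2. (\<lambda>n. l2 (\<lambda>p. fourier_integral (u n) p - g p)) \<longlonglongrightarrow> 0"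
  proof (rule L2_complete)
    show "fourier_integral (u n) \<in> L2" for n by (rule plancherel_L1_L2(1)[OF u])
    fix e :: real assume "e > 0"
    from L2_convergent_Cauchy[OF u(1) f conv this]
    show "\<exists>M. \<forall>m\<ge>M. \<forall>n\<ge>M. l2 (\<lambda>p. fourier_integral (u m) p - fourier_integral (u n) p) < e"
      unfolding d .
  qed
  then show ?thesis unfolding is_fourier_iff using f u conv by blast
qed

lemma is_fourier_l2:
  assumes "is_fourier f g"
  shows "l2 g = l2 f"
proof -
  from assms obtain u where fg: "f \<in> L2" "g \<in> L2" and u: "\<And>n. u n \<in> L2" "\<And>n. integrable lebesgue (u n)"
    and l: "(\<lambda>n. l2 (\<lambda>x. u n x - f x)) \<longlonglongrightarrow> 0" "(\<lambda>n. l2 (\<lambda>p. fourier_integral (u n) p - g p)) \<longlonglongrightarrow> 0"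
    unfolding is_fourier_iff by blast
  have "(\<lambda>n. l2 (u n)) \<longlonglongrightarrow> l2 f" by (rule l2_tendsto[OF u(1) fg(1) l(1)])
  moreover have "(\<lambda>n. l2 (fourier_integral (u n))) \<longlonglongrightarrow> l2 g"
    by (rule l2_tendsto[OF plancherel_L1_L2(1)[OF u] fg(2) l(2)])
  ultimately show ?thesis
    unfolding plancherel_L1_L2(2)[OF u] using LIMSEQ_unique by blast
qed

lemma L2_mult_left:
  fixes f :: "plane \<Rightarrow> complex"
  assumes "f \<in> L2"
  shows "(\<lambda>x. c * f x) \<in> L2"
  by (rule L2_scale[OF assms, of _ "cmod c"]) (use L2_measurable[OF assms] in \<open>auto simp: norm_mult\<close>)

lemma l2_mult_left: "l2 (\<lambda>x. c * f x) = cmod c * l2 f" for f :: "plane \<Rightarrow> complex"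
  by (simp add: l2_def norm_mult power_mult_distrib real_sqrt_mult)

lemma l2_add_scale_tendsto:
  fixes f g :: "plane \<Rightarrow> complex"
  assumes u: "\<And>n. u n \<in> L2" and f: "f \<in> L2" and v: "\<And>n. v n \<in> L2" and g: "g \<in> L2"
    and lu: "(\<lambda>n. l2 (\<lambda>x. u n x - f x)) \<longlonglongrightarrow> 0" and lv: "(\<lambda>n. l2 (\<lambda>x. v n x - g x)) \<longlonglongrightarrow> 0"
  shows "(\<lambda>n. l2 (\<lambda>x. (c * u n x + v n x) - (c * f x + g x))) \<longlonglongrightarrow> 0"
proof (rule Lim_null_comparison[OF always_eventually])
  show "(\<lambda>n. cmod c * l2 (\<lambda>x. u n x - f x) + l2 (\<lambda>x. v n x - g x)) \<longlonglongrightarrow> 0"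
    using tendsto_add[OF tendsto_mult_right_zero[OF lu, of "cmod c"] lv] by simp
  show "\<forall>n. norm (l2 (\<lambda>x. (c * u n x + v n x) - (c * f x + g x))) \<le> cmod c * l2 (\<lambda>x. u n x - f x) + l2 (\<lambda>x. v n x - g x)"
  proof
    fix n
    have e: "(\<lambda>x. (c * u n x + v n x) - (c * f x + g x)) = (\<lambda>x. c * (u n x - f x) + (v n x - g x))"
      by (simp add: algebra_simps)
    show "norm (l2 (\<lambda>x. (c * u n x + v n x) - (c * f x + g x))) \<le> cmod c * l2 (\<lambda>x. u n x - f x) + l2 (\<lambda>x. v n x - g x)"
      unfolding e
      using l2_triangle[OF L2_mult_left[OF L2_diff[OF u f]] L2_diff[OF v g], of c n n]
      by (simp add: l2_mult_left)
  qed
qed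

lemma is_fourier_add_scale:
  assumes "is_fourier f g" "is_fourier f' g'"
  shows "is_fourier (\<lambda>x. c * f x + f' x) (\<lambda>x. c * g x + g' x)"
proof -
  from assms(1) obtain u where fg: "f \<in> L2" "g \<in> L2" and u: "\<And>n. u n \<in> L2" "\<And>n. integrable lebesgue (u n)"
    and l: "(\<lambda>n. l2 (\<lambda>x. u n x - f x)) \<longlonglongrightarrow> 0" "(\<lambda>n. l2 (\<lambda>p. fourier_integral (u n) p - g p)) \<longlonglongrightarrow> 0"
    unfolding is_fourier_iff by blast
  from assms(2) obtain u' where fg': "f' \<in> L2" "g' \<in> L2" and u': "\<And>n. u' n \<in> L2" "\<And>n. integrable lebesgue (u' n)"
    and l': "(\<lambda>n. l2 (\<lambda>x. u' n x - f' x)) \<longlonglongrightarrow> 0" "(\<lambda>n. l2 (\<lambda>p. fourier_integral (u' n) p - g' p)) \<longlonglongrightarrow> 0"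
    unfolding is_fourier_iff by blast
  show ?thesis
    unfolding is_fourier_iff
  proof (intro conjI exI[of _ "\<lambda>n x. c * u n x + u' n x"] allI)
    show "(\<lambda>n. l2 (\<lambda>p. fourier_integral (\<lambda>x. c * u n x + u' n x) p - (c * g p + g' p))) \<longlonglongrightarrow> 0"
      unfolding fourier_integral_add_scale[OF u(2) u'(2)]
      by (rule l2_add_scale_tendsto[OF plancherel_L1_L2(1)[OF u] fg(2) plancherel_L1_L2(1)[OF u'] fg'(2) l(2) l'(2)])
    show "(\<lambda>n. l2 (\<lambda>x. c * u n x + u' n x - (c * f x + f' x))) \<longlonglongrightarrow> 0"
      by (rule l2_add_scale_tendsto[OF u(1) fg(1) u'(1) fg'(1) l(1) l'(1)])
  qed (use u u' fg fg' in \<open>auto intro!: L2_add L2_mult_left\<close>)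
qed

text \<open>By linearity and isometry the difference is a transform of the zero function and has
  norm 0.\<close>

lemma is_fourier_unique:
  assumes "is_fourier f g" "is_fourier f g'"
  shows "AE p in lebesgue. g p = g' p"
proof -
  have L: "g \<in> L2" "g' \<in> L2" using assms by (auto simp: is_fourier_iff)
  from is_fourier_l2[OF is_fourier_add_scale[OF assms, of "- 1"]]
  have "l2 (\<lambda>x. - 1 * g x + g' x) = l2 (\<lambda>x. 0 :: complex)" by simp
  then have z: "l2 (\<lambda>x. g' x - g x) = 0" by (simp add: l2_def[of "\<lambda>x. 0 :: complex"])
  from l2_eq_0_AE[OF L2_diff[OF L(2,1)] z] show ?thesis by eventually_elim simp
qed

lemma fourier_is_fourier: "f \<in> L2 \<Longrightarrow> is_fourier f (fourier f)"
  unfolding fourier_def using is_fourier_exists by (rule someI_ex)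

lemma fourier_eqI: "is_fourier f g \<Longrightarrow> AE p in lebesgue. fourier f p = g p"
  by (rule is_fourier_unique[OF fourier_is_fourier]) (simp_all add: is_fourier_iff)

lemma fourier_L2 [simp]: "f \<in> L2 \<Longrightarrow> fourier f \<in> L2"
  using fourier_is_fourier[of f] by (simp add: is_fourier_iff)

lemma fourier_l2 [simp]: "f \<in> L2 \<Longrightarrow> l2 (fourier f) = l2 f"
  by (rule is_fourier_l2[OF fourier_is_fourier])

lemma fourier_add_scale:
  assumes "f \<in> L2" "g \<in> L2"
  shows "AE p in lebesgue. fourier (\<lambda>x. c * f x + g x) p = c * fourier f p + fourier g p"
  by (intro fourier_eqI is_fourier_add_scale fourier_is_fourier assms)

lemma fourier_eq_integral:
  assumes "f \<in> L2" "integrable lebesgue f"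
  shows "AE p in lebesgue. fourier f p = fourier_integral f p"
proof (rule fourier_eqI)
  have z: "l2 (\<lambda>x. 0 :: complex) = 0" by (simp add: l2_def)
  show "is_fourier f (fourier_integral f)"
    unfolding is_fourier_iff
    using assms plancherel_L1_L2(1)[OF assms] by (intro conjI exI[of _ "\<lambda>n. f"]) (simp_all add: z)
qed

lemma L2_mult_integrable:
  fixes f g :: "plane \<Rightarrow> complex"
  assumes "f \<in> L2" "g \<in> L2"
  shows "integrable lebesgue (\<lambda>x. f x * g x)"
  by (rule Bochner_Integration.integrable_bound[OF L2_norm_mult_integrable[OF assms]])
     (use L2_measurable[OF assms(1)] L2_measurable[OF assms(2)] in \<open>auto simp: norm_mult\<close>)

lemma L2_mult_integral_tendsto:
  fixes f g :: "plane \<Rightarrow> complex"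
  assumes u: "\<And>n. u n \<in> L2" and f: "f \<in> L2" and v: "\<And>n. v n \<in> L2" and g: "g \<in> L2"
    and lu: "(\<lambda>n. l2 (\<lambda>x. u n x - f x)) \<longlonglongrightarrow> 0" and lv: "(\<lambda>n. l2 (\<lambda>x. v n x - g x)) \<longlonglongrightarrow> 0"
  shows "(\<lambda>n. LINT x|lebesgue. u n x * v n x) \<longlonglongrightarrow> (LINT x|lebesgue. f x * g x)"
proof (rule LIM_zero_cancel, rule Lim_null_comparison[OF always_eventually])
  have "(\<lambda>n. l2 (\<lambda>x. u n x - f x) * l2 (v n) + l2 f * l2 (\<lambda>x. v n x - g x)) \<longlonglongrightarrow> 0 * l2 g + l2 f * 0"
    by (intro tendsto_intros lu lv l2_tendsto[OF v g lv])
  then show "(\<lambda>n. l2 (\<lambda>x. u n x - f x) * l2 (v n) + l2 f * l2 (\<lambda>x. v n x - g x)) \<longlonglongrightarrow> 0" by simp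
  have CS: "cmod (LINT x|lebesgue. a x * b x) \<le> l2 a * l2 b" if "a \<in> L2" "b \<in> L2" for a b :: "plane \<Rightarrow> complex"
  proof -
    have "cmod (LINT x|lebesgue. a x * b x) \<le> (LINT x|lebesgue. cmod (a x) * cmod (b x))"
      using integral_norm_bound[of lebesgue "\<lambda>x. a x * b x"] by (simp add: norm_mult)
    also have "\<dots> \<le> l2 a * l2 b" by (rule l2_cauchy_schwarz[OF that])
    finally show ?thesis .
  qed
  show "\<forall>n. norm ((LINT x|lebesgue. u n x * v n x) - (LINT x|lebesgue. f x * g x))
      \<le> l2 (\<lambda>x. u n x - f x) * l2 (v n) + l2 f * l2 (\<lambda>x. v n x - g x)"
  proof
    fix n
    note i = L2_mult_integrable[OF u[of n] v[of n]] L2_mult_integrable[OF f v[of n]] L2_mult_integrable[OF f g]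
    have "(LINT x|lebesgue. u n x * v n x) - (LINT x|lebesgue. f x * g x)
        = (LINT x|lebesgue. (u n x - f x) * v n x) + (LINT x|lebesgue. f x * (v n x - g x))"
      using i by (simp add: left_diff_distrib right_diff_distrib)
    also have "norm \<dots> \<le> l2 (\<lambda>x. u n x - f x) * l2 (v n) + l2 f * l2 (\<lambda>x. v n x - g x)"
      by (rule norm_triangle_le[OF add_mono[OF CS[OF L2_diff[OF u f] v] CS[OF f L2_diff[OF v g]]]])
    finally show "norm ((LINT x|lebesgue. u n x * v n x) - (LINT x|lebesgue. f x * g x))
      \<le> l2 (\<lambda>x. u n x - f x) * l2 (v n) + l2 f * l2 (\<lambda>x. v n x - g x)" .
  qed
qed

text \<open>Both sides are continuous in the L2 norm, so the formula passes from integrable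
  approximants to the limit.\<close>

lemma fourier_mult:
  fixes f g :: "plane \<Rightarrow> complex"
  assumes "f \<in> L2" "g \<in> L2"
  shows "(LINT p|lebesgue. fourier f p * g p) = (LINT x|lebesgue. f x * fourier g x)"
proof -
  from fourier_is_fourier[OF assms(1)] obtain u where u: "\<And>n. u n \<in> L2" "\<And>n. integrable lebesgue (u n)"
    and lu: "(\<lambda>n. l2 (\<lambda>x. u n x - f x)) \<longlonglongrightarrow> 0" "(\<lambda>n. l2 (\<lambda>p. fourier_integral (u n) p - fourier f p)) \<longlonglongrightarrow> 0"
    unfolding is_fourier_iff by blast
  from fourier_is_fourier[OF assms(2)] obtain v where v: "\<And>n. v n \<in> L2" "\<And>n. integrable lebesgue (v n)"
    and lv: "(\<lambda>n. l2 (\<lambda>x. v n x - g x)) \<longlonglongrightarrow> 0" "(\<lambda>n. l2 (\<lambda>p. fourier_integral (v n) p - fourier g p)) \<longlonglongrightarrow> 0"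
    unfolding is_fourier_iff by blast
  have "(\<lambda>n. LINT p|lebesgue. fourier_integral (u n) p * v n p) \<longlonglongrightarrow> (LINT p|lebesgue. fourier f p * g p)"
    by (rule L2_mult_integral_tendsto[OF plancherel_L1_L2(1)[OF u] fourier_L2[OF assms(1)] v(1) assms(2) lu(2) lv(1)])
  moreover have "(\<lambda>n. LINT p|lebesgue. u n p * fourier_integral (v n) p) \<longlonglongrightarrow> (LINT p|lebesgue. f p * fourier g p)"
    by (rule L2_mult_integral_tendsto[OF u(1) assms(1) plancherel_L1_L2(1)[OF v] fourier_L2[OF assms(2)] lu(1) lv(2)])
  ultimately show ?thesis
    unfolding fourier_integral_mult[OF u(2) v(2)] by (rule LIMSEQ_unique)
qed

text \<open>Conjugation before and after reverses the sign in the exponent, so the properties of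
  \<open>fourier\<close> carry over without a second construction.\<close>

definition inv_fourier :: "(plane \<Rightarrow> complex) \<Rightarrow> plane \<Rightarrow> complex" where
  "inv_fourier g x = cnj (fourier (\<lambda>p. cnj (g p)) x)"

lemma L2_cnj: "f \<in> L2 \<Longrightarrow> (\<lambda>x. cnj (f x)) \<in> L2"
  by (rule L2_scale[of f _ 1]) (auto intro!: borel_measurable_cnj L2_measurable)

lemma l2_cnj [simp]: "l2 (\<lambda>x. cnj (f x)) = l2 f"
  by (simp add: l2_def)

lemma inv_fourier_L2 [simp]: "g \<in> L2 \<Longrightarrow> inv_fourier g \<in> L2"
  unfolding inv_fourier_def[abs_def] by (intro L2_cnj fourier_L2)

lemma inv_fourier_l2 [simp]: "g \<in> L2 \<Longrightarrow> l2 (inv_fourier g) = l2 g"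
  unfolding inv_fourier_def[abs_def] by (simp add: L2_cnj)

lemma l2_diff_square:
  fixes f g :: "plane \<Rightarrow> complex"
  assumes "f \<in> L2" "g \<in> L2"
  shows "(l2 (\<lambda>x. f x - g x))\<^sup>2 = (l2 f)\<^sup>2 + (l2 g)\<^sup>2 - 2 * Re (LINT x|lebesgue. f x * cnj (g x))"
proof -
  note i = L2_integrable[OF assms(1)] L2_integrable[OF assms(2)] L2_mult_integrable[OF assms(1) L2_cnj[OF assms(2)]]
  have eq: "(cmod (f x - g x))\<^sup>2 = (cmod (f x))\<^sup>2 + (cmod (g x))\<^sup>2 - 2 * Re (f x * cnj (g x))" for x
    unfolding cmod_power2 by (simp add: power2_eq_square algebra_simps)
  have r: "integrable lebesgue (\<lambda>x. 2 * Re (f x * cnj (g x)))"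
    by (intro integrable_mult_right integrable_Re i)
  have "(LINT x|lebesgue. 2 * Re (f x * cnj (g x))) = 2 * (LINT x|lebesgue. Re (f x * cnj (g x)))"
    by (rule integral_mult_right_zero)
  also have "(LINT x|lebesgue. Re (f x * cnj (g x))) = Re (LINT x|lebesgue. f x * cnj (g x))"
    by (rule integral_Re[OF i(3)])
  finally show ?thesis
    unfolding l2_square eq Bochner_Integration.integral_diff[OF Bochner_Integration.integrable_add[OF i(1,2)] r]
      Bochner_Integration.integral_add[OF i(1,2)] by (simp only:)
qed

text \<open>\<open>inv_fourier\<close> is the adjoint of \<open>fourier\<close>; since both are isometric, it is the inverse.\<close>
theorem fourier_inv_fourier:
  assumes g: "g \<in> L2"
  shows "AE p in lebesgue. fourier (inv_fourier g) p = g p"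
proof -
  let ?f = "inv_fourier g"
  have f: "?f \<in> L2" using g by simp
  have "(LINT p|lebesgue. fourier ?f p * cnj (g p)) = (LINT x|lebesgue. ?f x * fourier (\<lambda>p. cnj (g p)) x)"
    by (rule fourier_mult[OF f L2_cnj[OF g]])
  also have "\<dots> = (LINT x|lebesgue. complex_of_real ((cmod (?f x))\<^sup>2))"
    by (intro Bochner_Integration.integral_cong refl) (simp only: complex_norm_square inv_fourier_def complex_cnj_cnj)
  also have "\<dots> = of_real ((l2 g)\<^sup>2)"
    using inv_fourier_l2[OF g] by (simp only: integral_complex_of_real flip: l2_square)
  \<comment> \<open>Both functions have norm \<open>l2 g\<close>, and their inner product is the
    square of it, so their distance is 0.\<close>
  finally have "(l2 (\<lambda>p. fourier ?f p - g p))\<^sup>2 = 0"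
    unfolding l2_diff_square[OF fourier_L2[OF f] g] using g f by simp
  then have "l2 (\<lambda>p. fourier ?f p - g p) = 0" by simp
  from l2_eq_0_AE[OF L2_diff[OF fourier_L2[OF f] g] this] show ?thesis by eventually_elim simp
qed

lemma inv_fourier_eq_integral:
  assumes "g \<in> L2" "integrable lebesgue g"
  shows "AE x in lebesgue. inv_fourier g x = fourier_integral g (- x)"
proof -
  have "integrable lebesgue (\<lambda>x. cnj (g x))" using assms by simp
  from fourier_eq_integral[OF L2_cnj[OF assms(1)] this]
  show ?thesis
  proof eventually_elim
    case (elim x)
    have "cnj (fourier_integral (\<lambda>p. cnj (g p)) x)
        = (LINT p|lebesgue. cnj (exp (- \<i> * of_real (x \<bullet> p)) * cnj (g p))) / of_real (2 * pi)"
      by (simp only: fourier_integral_def complex_cnj_divide complex_cnj_complex_of_real Bochner_Integration.integral_cnj)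
    also have "\<dots> = fourier_integral g (- x)"
      by (simp add: fourier_integral_def exp_cnj)
    finally show ?case using elim by (simp add: inv_fourier_def)
  qed
qed

section \<open>Dyadic frequency decomposition and relative compactness of the potential\<close>

text \<open>A Fourier integral rather than \<open>inv_fourier\<close>, because sup bounds, Lipschitz
  bounds and limits are taken at every single point.\<close>

definition band :: "plane set \<Rightarrow> (plane \<Rightarrow> complex) \<Rightarrow> plane \<Rightarrow> complex" where
  "band S g x = fourier_integral (\<lambda>p. indicator S p *\<^sub>R g p) (- x)"

context
  fixes S :: "plane set" and g :: "plane \<Rightarrow> complex"
  assumes S: "S \<in> lmeasurable" and g: "g \<in> L2"
begin

lemma set_L2 [simp]: "(\<lambda>p. indicator S p *\<^sub>R g p) \<in> L2"
  and set_integrable [simp]: "integrable lebesgue (\<lambda>p. indicator S p *\<^sub>R g p)"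
  using L2_set_integrable[OF g S] by auto

text \<open>Cauchy-Schwarz against the indicator of \<open>S\<close>. Together with
  \<open>band_bound\<close> it is Bernstein's inequality: a sup bound by the L2 norm, at the cost of
  the square root of the area of the frequency set.\<close>

lemma set_L1_le: "(LINT p|lebesgue. cmod (indicator S p *\<^sub>R g p)) \<le> sqrt (measure lebesgue S) * l2 (\<lambda>p. indicator S p *\<^sub>R g p)"
proof -
  have [measurable]: "S \<in> sets lebesgue" using S by (rule fmeasurableD)
  have iS: "integrable lebesgue (indicat_real S)" using S by (simp add: lmeasurable_iff_integrable)
  have sq: "(norm (indicat_real S p))\<^sup>2 = indicat_real S p" for p by (simp add: indicator_def)
  have L: "indicat_real S \<in> L2"
    unfolding L2_def mem_Collect_eq sq using iS by simp
  have l: "l2 (indicat_real S) = sqrt (measure lebesgue S)"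
    unfolding l2_def sq by simp
  have "(LINT p|lebesgue. cmod (indicator S p *\<^sub>R g p)) = (LINT p|lebesgue. norm (indicat_real S p) * norm (indicator S p *\<^sub>R g p))"
    by (intro Bochner_Integration.integral_cong refl) (simp add: indicator_def)
  also have "\<dots> \<le> l2 (indicat_real S) * l2 (\<lambda>p. indicator S p *\<^sub>R g p)"
    by (rule l2_cauchy_schwarz[OF L set_L2])
  finally show ?thesis by (simp add: l)
qed

lemma band_bound: "cmod (band S g x) \<le> sqrt (measure lebesgue S) * l2 (\<lambda>p. indicator S p *\<^sub>R g p)"
  unfolding band_def using fourier_integral_bound[OF set_integrable] set_L1_le by (rule order_trans)

lemma band_AE: "AE x in lebesgue. inv_fourier (\<lambda>p. indicator S p *\<^sub>R g p) x = band S g x"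
  unfolding band_def by (rule inv_fourier_eq_integral[OF set_L2 set_integrable])

lemma band_L2: "band S g \<in> L2"
  by (rule L2_cong_AE[OF inv_fourier_L2[OF set_L2] band_AE])

lemma band_l2: "l2 (band S g) = l2 (\<lambda>p. indicator S p *\<^sub>R g p)"
  using l2_cong_AE[OF band_AE inv_fourier_L2[OF set_L2]] inv_fourier_l2[OF set_L2] by simp

lemma band_measurable: "band S g \<in> borel_measurable lebesgue"
  by (rule L2_measurable[OF band_L2])

end

lemma L2_set:
  fixes g :: "plane \<Rightarrow> 'b::euclidean_space"
  assumes "S \<in> sets lebesgue" "g \<in> L2"
  shows "(\<lambda>p. indicator S p *\<^sub>R g p) \<in> L2" "l2 (\<lambda>p. indicator S p *\<^sub>R g p) \<le> l2 g"
proof -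
  note [measurable] = assms(1) L2_measurable[OF assms(2)]
  have m: "(\<lambda>p. indicator S p *\<^sub>R g p) \<in> borel_measurable lebesgue" by measurable
  show L: "(\<lambda>p. indicator S p *\<^sub>R g p) \<in> L2"
    by (rule L2_scale[OF assms(2) m, of 1]) (simp add: indicator_def)
  show "l2 (\<lambda>p. indicator S p *\<^sub>R g p) \<le> l2 g"
    unfolding l2_def
    by (intro real_sqrt_le_mono integral_mono L2_integrable L assms(2)) (simp add: indicator_def)
qed

text \<open>Isometry moves the cutoff error to the frequency side, where dominated convergence
  applies.\<close>

lemma band_approx:
  assumes f: "f \<in> L2" and S: "S \<in> lmeasurable"
  shows "l2 (\<lambda>x. band S (fourier f) x - f x) = l2 (\<lambda>p. indicator S p *\<^sub>R fourier f p - fourier f p)"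
proof -
  let ?g = "\<lambda>p. indicator S p *\<^sub>R fourier f p"
  have g: "?g \<in> L2" by (rule set_L2[OF S fourier_L2[OF f]])
  let ?b = "inv_fourier ?g"
  have b: "?b \<in> L2" by (rule inv_fourier_L2[OF g])
  have "AE p in lebesgue. fourier (\<lambda>x. - 1 * f x + ?b x) p = ?g p - fourier f p"
    using fourier_add_scale[OF f b, of "- 1"] fourier_inv_fourier[OF g] by eventually_elim simp
  then have "l2 (fourier (\<lambda>x. - 1 * f x + ?b x)) = l2 (\<lambda>p. ?g p - fourier f p)"
    by (rule l2_cong_AE) (intro fourier_L2 L2_add L2_mult_left f b)
  moreover have "l2 (fourier (\<lambda>x. - 1 * f x + ?b x)) = l2 (\<lambda>x. - 1 * f x + ?b x)"
    by (intro fourier_l2 L2_add L2_mult_left f b)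
  moreover have "l2 (\<lambda>x. - 1 * f x + ?b x) = l2 (\<lambda>x. band S (fourier f) x - f x)"
  proof (rule l2_cong_AE)
    show "AE x in lebesgue. - 1 * f x + ?b x = band S (fourier f) x - f x"
      using band_AE[OF S fourier_L2[OF f]] by eventually_elim simp
  qed (intro L2_add L2_mult_left f b)
  ultimately show ?thesis by simp
qed

abbreviation low :: "nat \<Rightarrow> (plane \<Rightarrow> complex) \<Rightarrow> plane \<Rightarrow> complex" where
  "low k \<equiv> band (ball 0 (2 ^ k))"

definition shell :: "nat \<Rightarrow> plane set" where
  "shell k = ball 0 (2 ^ Suc k) - ball 0 (2 ^ k)"

lemma shell_lmeasurable: "shell k \<in> lmeasurable"
  unfolding shell_def by (intro fmeasurable.Diff lmeasurable_ball)

lemma low_Suc: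
  assumes "g \<in> L2"
  shows "low (Suc k) g x - low k g x = band (shell k) g x"
proof -
  have sub: "ball 0 (2 ^ k) \<subseteq> (ball 0 (2 ^ Suc k) :: plane set)" by (rule subset_ball) simp
  have "(\<lambda>p. indicator (shell k) p *\<^sub>R g p) = (\<lambda>p. indicator (ball 0 (2 ^ Suc k)) p *\<^sub>R g p - indicator (ball 0 (2 ^ k)) p *\<^sub>R g p)"
  proof
    fix p
    show "indicator (shell k) p *\<^sub>R g p = indicator (ball 0 (2 ^ Suc k)) p *\<^sub>R g p - indicator (ball 0 (2 ^ k)) p *\<^sub>R g p"
      using sub unfolding shell_def by (auto simp: indicator_def)
  qed
  then show ?thesis
    unfolding band_def
    using fourier_integral_diff[OF set_integrable[OF lmeasurable_ball assms] set_integrable[OF lmeasurable_ball assms]]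
    by simp
qed

text \<open>The disc is enclosed in a square of side \<open>2 ^ Suc k\<close>, which keeps the later
  constants powers of 2.\<close>

lemma measure_ball_le: "measure lebesgue (ball (0::plane) (2 ^ k)) \<le> (2 ^ Suc k)\<^sup>2"
proof -
  let ?c = "cbox (\<chi> i. - (2 ^ k)) (\<chi> i. 2 ^ k) :: plane set"
  have "ball (0::plane) (2 ^ k) \<subseteq> ?c"
  proof
    fix x :: plane assume "x \<in> ball 0 (2 ^ k)"
    then have "norm x < 2 ^ k" by (simp add: dist_norm)
    then have "\<bar>x $ i\<bar> \<le> 2 ^ k" for i using component_le_norm_cart[of x i] by linarith
    then show "x \<in> ?c" by (auto simp: mem_box_cart abs_le_iff minus_le_iff)
  qed
  then have "measure lebesgue (ball (0::plane) (2 ^ k)) \<le> measure lebesgue ?c"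
    by (rule measure_mono_fmeasurable) (auto simp: lmeasurable_cbox)
  also have "\<dots> = measure lborel ?c" by simp
  also have "\<dots> = (2 ^ Suc k)\<^sup>2"
  proof -
    have "?c \<noteq> {}" by (simp add: interval_eq_empty_cart not_less)
    then show ?thesis by (simp add: content_cbox_cart)
  qed
  finally show ?thesis .
qed

lemma measure_shell_le: "measure lebesgue (shell k) \<le> (2 ^ Suc (Suc k))\<^sup>2"
proof -
  have "measure lebesgue (shell k) \<le> measure lebesgue (ball (0::plane) (2 ^ Suc k))"
    unfolding shell_def by (rule measure_mono_fmeasurable) auto
  then show ?thesis using measure_ball_le[of "Suc k"] by linarith
qed

lemma low_bound:
  assumes "g \<in> L2"
  shows "cmod (low k g x) \<le> 2 ^ Suc k * l2 g"
proof -
  have "cmod (low k g x) \<le> sqrt (measure lebesgue (ball (0::plane) (2 ^ k))) * l2 (\<lambda>p. indicator (ball 0 (2 ^ k)) p *\<^sub>R g p)"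
    by (rule band_bound[OF lmeasurable_ball assms])
  also have "\<dots> \<le> 2 ^ Suc k * l2 g"
    by (intro mult_mono real_le_lsqrt measure_ball_le L2_set assms) auto
  finally show ?thesis .
qed

text \<open>Frequencies stay below \<open>2 ^ k\<close>, so the exponentials have that Lipschitz
  constant. The bound depends on \<open>g\<close> through its norm alone, so the low-frequency parts
  of a bounded family are equicontinuous.\<close>

lemma low_lipschitz:
  assumes g: "g \<in> L2"
  shows "cmod (low k g x - low k g y) \<le> 2 ^ k * norm (x - y) * (2 ^ Suc k * l2 g)"
proof -
  let ?S = "ball (0::plane) (2 ^ k)"
  let ?h = "\<lambda>p. indicator ?S p *\<^sub>R g p"
  let ?e = "\<lambda>x p. exp (- \<i> * complex_of_real (- x \<bullet> p))"
  have h: "integrable lebesgue ?h" by (rule set_integrable[OF lmeasurable_ball g])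
  note i = fourier_integrand_integrable[OF h]
  have exp_lip: "cmod (?e x p - ?e y p) \<le> \<bar>(x - y) \<bullet> p\<bar>" for p
  proof -
    have "cmod (exp (\<i> * complex_of_real ((x - y) \<bullet> p)) - 1) \<le> \<bar>(x - y) \<bullet> p\<bar>"
      using iexp_approx1[of "(x - y) \<bullet> p" 0] by simp
    moreover have "?e x p - ?e y p = ?e y p * (exp (\<i> * complex_of_real ((x - y) \<bullet> p)) - 1)"
      by (simp add: right_diff_distrib inner_diff_left algebra_simps flip: exp_add)
    ultimately show ?thesis by (simp add: norm_mult)
  qed
  have "low k g x - low k g y = ((LINT p|lebesgue. ?e x p * ?h p) - (LINT p|lebesgue. ?e y p * ?h p)) / of_real (2 * pi)"
    unfolding band_def fourier_integral_def by (simp add: diff_divide_distrib)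
  also have "(LINT p|lebesgue. ?e x p * ?h p) - (LINT p|lebesgue. ?e y p * ?h p) = (LINT p|lebesgue. ?e x p * ?h p - ?e y p * ?h p)"
    by (rule Bochner_Integration.integral_diff[OF i i, symmetric])
  finally have "cmod (low k g x - low k g y) = cmod (LINT p|lebesgue. ?e x p * ?h p - ?e y p * ?h p) / (2 * pi)"
    by (simp add: norm_divide)
  also have "\<dots> \<le> cmod (LINT p|lebesgue. ?e x p * ?h p - ?e y p * ?h p) / 1"
    using pi_gt3 by (intro divide_left_mono) auto
  also have "\<dots> \<le> (LINT p|lebesgue. cmod (?e x p * ?h p - ?e y p * ?h p))"
    using integral_norm_bound[of lebesgue "\<lambda>p. ?e x p * ?h p - ?e y p * ?h p"] by simp
  also have "\<dots> \<le> (LINT p|lebesgue. 2 ^ k * norm (x - y) * cmod (?h p))"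
  proof (rule integral_mono)
    show "integrable lebesgue (\<lambda>p. cmod (?e x p * ?h p - ?e y p * ?h p))"
      by (intro integrable_norm Bochner_Integration.integrable_diff i)
    show "integrable lebesgue (\<lambda>p. 2 ^ k * norm (x - y) * cmod (?h p))"
      by (intro integrable_mult_right integrable_norm h)
    fix p
    show "cmod (?e x p * ?h p - ?e y p * ?h p) \<le> 2 ^ k * norm (x - y) * cmod (?h p)"
    proof (cases "p \<in> ?S")
      case True
      have "cmod (?e x p - ?e y p) \<le> norm (x - y) * norm p"
        using exp_lip[of p] Cauchy_Schwarz_ineq2[of "x - y" p] by linarith
      also have "\<dots> \<le> norm (x - y) * 2 ^ k"
        using True by (intro mult_left_mono) (auto simp: dist_norm)
      finally have "cmod ((?e x p - ?e y p) * ?h p) \<le> 2 ^ k * norm (x - y) * cmod (?h p)"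
        unfolding norm_mult by (intro mult_right_mono) (simp_all add: mult.commute)
      then show ?thesis by (simp only: left_diff_distrib)
    qed simp
  qed
  also have "\<dots> = 2 ^ k * norm (x - y) * (LINT p|lebesgue. cmod (?h p))"
    by (rule integral_mult_right_zero)
  also have "\<dots> \<le> 2 ^ k * norm (x - y) * (2 ^ Suc k * l2 g)"
  proof (rule mult_left_mono)
    have "(LINT p|lebesgue. cmod (?h p)) \<le> sqrt (measure lebesgue ?S) * l2 ?h"
      by (rule set_L1_le[OF lmeasurable_ball g])
    also have "\<dots> \<le> 2 ^ Suc k * l2 g"
      by (intro mult_mono real_le_lsqrt measure_ball_le L2_set g) auto
    finally show "(LINT p|lebesgue. cmod (?h p)) \<le> 2 ^ Suc k * l2 g" .
  qed simp
  finally show ?thesis .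
qed

lemma low_tendsto:
  assumes f: "f \<in> L2"
  shows "(\<lambda>k. l2 (\<lambda>x. low k (fourier f) x - f x)) \<longlonglongrightarrow> 0"
  unfolding band_approx[OF f lmeasurable_ball]
proof (rule L2_dominated_convergence(3)[OF fourier_L2[OF f]])
  show "(\<lambda>p. indicator (ball 0 (2 ^ k)) p *\<^sub>R fourier f p) \<in> borel_measurable lebesgue" for k
    by (rule L2_measurable[OF set_L2[OF lmeasurable_ball fourier_L2[OF f]]])
  show "(\<lambda>k. indicator (ball 0 (2 ^ k)) p *\<^sub>R fourier f p) \<longlonglongrightarrow> fourier f p" for p
  proof (rule tendsto_eventually)
    obtain N where N: "norm p < 2 ^ N" using real_arch_pow[of 2 "norm p"] by auto
    have "indicator (ball 0 (2 ^ k)) p *\<^sub>R fourier f p = fourier f p" if "k \<ge> N" for k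
    proof -
      have "(2::real) ^ N \<le> 2 ^ k" using that by (intro power_increasing) auto
      then have "norm p < 2 ^ k" using N by linarith
      then show ?thesis by (simp add: dist_norm indicator_def)
    qed
    then show "\<forall>\<^sub>F k in sequentially. indicator (ball 0 (2 ^ k)) p *\<^sub>R fourier f p = fourier f p"
      by (rule eventually_sequentiallyI)
  qed
  show "norm (indicator (ball 0 (2 ^ k)) p *\<^sub>R fourier f p) \<le> norm (fourier f p)" for k p
    by (simp add: indicator_def)
qed

section \<open>Form bounds and compactness for a nonnegative potential\<close>

locale potential =
  fixes W :: "plane \<Rightarrow> real" and r :: real
  assumes W_nonneg: "0 \<le> W x" and r: "r > 1"
    and W_int: "integrable lebesgue W" and W_powr: "integrable lebesgue (\<lambda>x. W x powr r)"
begin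

text \<open>The square root turns the form of \<open>W\<close> into a squared L2 norm, so that
  completeness and the triangle inequality apply to it.\<close>

abbreviation wt :: "(plane \<Rightarrow> complex) \<Rightarrow> plane \<Rightarrow> complex" where
  "wt f x \<equiv> sqrt (W x) *\<^sub>R f x"

text \<open>The ratio of successive shell bounds: the square root of the splitting height
  \<open>4 powr (k / r)\<close> grows by \<open>2 powr (1 / r)\<close> per shell, against the factor
  2 that the H1 norm gains.\<close>

definition rate :: real where "rate = 2 powr (1 / r - 1)"

lemma rate_bounds: "0 < rate" "rate < 1"
proof -
  have "2 powr (1 / r - 1) < 2 powr (0::real)" using r by (intro powr_less_mono) (auto simp: field_simps)
  then show "rate < 1" by (simp add: rate_def)
qed (simp add: rate_def)

text \<open>Where \<open>W\<close> exceeds \<open>M\<close>, the factor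
  \<open>W powr (1 - r)\<close> has a negative exponent and is at most
  \<open>M powr (1 - r)\<close>.\<close>

lemma W_split:
  assumes M: "M > 0"
  shows "W x \<le> M + W x powr r * M powr (1 - r)"
proof (cases "W x \<le> M")
  case False
  then have pos: "W x > 0" using M by linarith
  have "W x = W x powr r * W x powr (1 - r)"
    using pos by (simp flip: powr_add)
  also have "\<dots> \<le> W x powr r * M powr (1 - r)"
    using False M r by (intro mult_left_mono powr_mono2') auto
  finally show ?thesis using M by linarith
qed (use M in \<open>simp add: add_increasing2\<close>)

lemma W_measurable [measurable]: "W \<in> borel_measurable lebesgue"
  by (rule borel_measurable_integrable[OF W_int])

lemma wt_bounded:
  assumes f: "f \<in> borel_measurable lebesgue" and B: "\<And>x. cmod (f x) \<le> B"
  shows "wt f \<in> L2" "l2 (wt f) \<le> sqrt (LINT x|lebesgue. W x) * B"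
proof -
  note [measurable] = f
  have B0: "0 \<le> B" using B[of 0] norm_ge_zero[of "f 0"] by linarith
  have le: "(norm (wt f x))\<^sup>2 \<le> W x * B\<^sup>2" for x
    using W_nonneg[of x] power_mono[OF B[of x] norm_ge_zero, of 2]
    by (simp add: power_mult_distrib mult_left_mono)
  show L: "wt f \<in> L2"
  proof (rule L2_bound)
    show "integrable lebesgue (\<lambda>x. W x * B\<^sup>2)" using W_int by simp
    show "AE x in lebesgue. (norm (wt f x))\<^sup>2 \<le> W x * B\<^sup>2" using le by simp
  qed measurable
  have "(l2 (wt f))\<^sup>2 \<le> (LINT x|lebesgue. W x * B\<^sup>2)"
    unfolding l2_square
    by (rule integral_mono[OF L2_integrable[OF L] _ le]) (use W_int in simp)
  also have "\<dots> = (sqrt (LINT x|lebesgue. W x) * B)\<^sup>2"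
    using W_nonneg by (simp add: power_mult_distrib)
  finally show "l2 (wt f) \<le> sqrt (LINT x|lebesgue. W x) * B"
    by (rule power2_le_imp_le) (use B0 W_nonneg in simp)
qed

text \<open>Under the root, 1 comes from the part of \<open>W\<close> below the splitting height,
  and 16 from the square of the sup bound \<open>2 ^ Suc (Suc k)\<close> once its factor
  \<open>4 ^ k\<close> is absorbed by the height.\<close>

definition shell_const :: real where "shell_const = sqrt (1 + 16 * (LINT x|lebesgue. W x powr r))"

lemma shell_const_nonneg: "0 \<le> shell_const"
  unfolding shell_const_def by (intro real_sqrt_ge_zero add_nonneg_nonneg mult_nonneg_nonneg Bochner_Integration.integral_nonneg) auto

text \<open>Splitting \<open>W\<close> at the height \<open>M = 4\<^sup>k\<^sup>/\<^sup>r\<close> balances the two contributions.\<close>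
lemma wt_shell:
  assumes g: "g \<in> L2"
  shows "wt (band (shell k) g) \<in> L2"
    "l2 (wt (band (shell k) g)) \<le> shell_const * rate ^ k * (2 ^ k * l2 (\<lambda>p. indicator (shell k) p *\<^sub>R g p))"
proof -
  define a where "a = l2 (\<lambda>p. indicator (shell k) p *\<^sub>R g p)"
  define \<phi> where "\<phi> = band (shell k) g"
  define M where "M = (2 powr (1 / r)) ^ (2 * k)"
  define I where "I = (LINT x|lebesgue. W x powr r)"
  have a0: "0 \<le> a" by (simp add: a_def)
  have M0: "M > 0" by (simp add: M_def)
  have I0: "0 \<le> I" unfolding I_def by (intro Bochner_Integration.integral_nonneg) auto
  have \<phi>L: "\<phi> \<in> L2" and \<phi>l: "l2 \<phi> = a"
    unfolding \<phi>_def a_def by (rule band_L2[OF shell_lmeasurable g] band_l2[OF shell_lmeasurable g])+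
  have bound: "cmod (\<phi> x) \<le> 2 ^ Suc (Suc k) * a" for x
  proof -
    have "cmod (\<phi> x) \<le> sqrt (measure lebesgue (shell k)) * a"
      unfolding \<phi>_def a_def by (rule band_bound[OF shell_lmeasurable g])
    also have "\<dots> \<le> 2 ^ Suc (Suc k) * a"
      using a0 measure_shell_le[of k] by (intro mult_right_mono real_le_lsqrt) auto
    finally show ?thesis .
  qed
  show L: "wt (band (shell k) g) \<in> L2"
    using wt_bounded(1)[OF L2_measurable[OF \<phi>L] bound] unfolding \<phi>_def .
  \<comment> \<open>By the choice of the height \<open>M powr r = 4 ^ k\<close>, so the part of
    \<open>W\<close> above the height also contributes a multiple of \<open>M\<close>.\<close>
  have Mpow: "M powr (1 - r) * (2 ^ Suc (Suc k))\<^sup>2 = 16 * M"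
  proof -
    have M2: "M = 2 powr (2 * k / r)"
      by (simp add: M_def powr_power)
    have four: "(2::real) ^ (2 * k) = 2 powr (2 * k)"
      by (subst powr_realpow[symmetric]) simp_all
    have "M powr (1 - r) = 2 powr (2 * k / r - 2 * k)"
      unfolding M2 powr_powr using r by (simp add: field_simps)
    also have "\<dots> = M / 2 ^ (2 * k)"
      unfolding M2 four by (rule powr_diff)
    finally have "M powr (1 - r) = M / 2 ^ (2 * k)" .
    moreover have "((2::real) ^ Suc (Suc k))\<^sup>2 = 16 * 2 ^ (2 * k)"
      by (simp add: power_mult_distrib power_even_eq)
    ultimately show ?thesis by simp
  qed
  have "(l2 (wt \<phi>))\<^sup>2 \<le> (LINT x|lebesgue. M * (cmod (\<phi> x))\<^sup>2 + (M powr (1 - r) * (2 ^ Suc (Suc k) * a)\<^sup>2) * W x powr r)"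
    unfolding l2_square
  proof (rule integral_mono)
    show "integrable lebesgue (\<lambda>x. (norm (wt \<phi> x))\<^sup>2)" using L2_integrable[OF L] unfolding \<phi>_def .
    show "integrable lebesgue (\<lambda>x. M * (cmod (\<phi> x))\<^sup>2 + (M powr (1 - r) * (2 ^ Suc (Suc k) * a)\<^sup>2) * W x powr r)"
      by (intro Bochner_Integration.integrable_add integrable_mult_right L2_integrable \<phi>L W_powr)
    fix x
    have "(norm (wt \<phi> x))\<^sup>2 = W x * (cmod (\<phi> x))\<^sup>2"
      using W_nonneg[of x] by (simp add: power_mult_distrib)
    also have "\<dots> \<le> (M + W x powr r * M powr (1 - r)) * (cmod (\<phi> x))\<^sup>2"
      by (intro mult_right_mono W_split M0) simp
    also have "\<dots> = M * (cmod (\<phi> x))\<^sup>2 + (M powr (1 - r) * W x powr r) * (cmod (\<phi> x))\<^sup>2"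
      by (simp add: algebra_simps)
    also have "\<dots> \<le> M * (cmod (\<phi> x))\<^sup>2 + (M powr (1 - r) * W x powr r) * (2 ^ Suc (Suc k) * a)\<^sup>2"
      by (intro add_left_mono mult_left_mono power_mono bound) auto
    finally show "(norm (wt \<phi> x))\<^sup>2 \<le> M * (cmod (\<phi> x))\<^sup>2 + (M powr (1 - r) * (2 ^ Suc (Suc k) * a)\<^sup>2) * W x powr r"
      by (simp add: mult_ac)
  qed
  also have "\<dots> = M * (LINT x|lebesgue. (cmod (\<phi> x))\<^sup>2) + (M powr (1 - r) * (2 ^ Suc (Suc k) * a)\<^sup>2) * I"
    unfolding I_def using L2_integrable[OF \<phi>L] W_powr by simp
  also have "(LINT x|lebesgue. (cmod (\<phi> x))\<^sup>2) = a\<^sup>2"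
    using l2_square[of \<phi>] \<phi>l by simp
  also have "M powr (1 - r) * (2 ^ Suc (Suc k) * a)\<^sup>2 = 16 * M * a\<^sup>2"
    unfolding power_mult_distrib mult.assoc[symmetric] Mpow ..
  also have "M * a\<^sup>2 + 16 * M * a\<^sup>2 * I = (shell_const * ((2 powr (1 / r)) ^ k * a))\<^sup>2"
  proof -
    have "shell_const\<^sup>2 = 1 + 16 * I" using I0 by (simp add: shell_const_def I_def)
    moreover have "((2 powr (1 / r)) ^ k)\<^sup>2 = M" by (simp add: M_def power_mult[symmetric] mult.commute)
    ultimately show ?thesis by (simp add: power_mult_distrib algebra_simps)
  qed
  finally have "l2 (wt \<phi>) \<le> shell_const * ((2 powr (1 / r)) ^ k * a)"
    by (rule power2_le_imp_le) (use a0 shell_const_nonneg in simp)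
  moreover have "2 powr (1 / r) = rate * 2"
    by (simp add: rate_def powr_diff)
  ultimately show "l2 (wt (band (shell k) g)) \<le> shell_const * rate ^ k * (2 ^ k * l2 (\<lambda>p. indicator (shell k) p *\<^sub>R g p))"
    by (simp add: \<phi>_def a_def power_mult_distrib mult_ac)
qed

text \<open>The sum of the geometric series of shell bounds.\<close>

definition tail_const :: real where "tail_const = shell_const / (1 - rate)"

definition h1 :: "(plane \<Rightarrow> complex) \<Rightarrow> real" where
  "h1 f = sqrt (LINT p|lebesgue. (1 + (norm p)\<^sup>2) * (cmod (fourier f p))\<^sup>2)"

definition H1 :: "(plane \<Rightarrow> complex) set" where
  "H1 = {f \<in> L2. integrable lebesgue (\<lambda>p. (1 + (norm p)\<^sup>2) * (cmod (fourier f p))\<^sup>2)}"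

lemma tail_const_nonneg: "0 \<le> tail_const"
  using shell_const_nonneg rate_bounds by (simp add: tail_const_def)

lemma h1_nonneg [simp]: "0 \<le> h1 f"
  unfolding h1_def by (intro real_sqrt_ge_zero Bochner_Integration.integral_nonneg) simp

lemma l2_le_h1:
  assumes "f \<in> H1"
  shows "l2 f \<le> h1 f"
proof -
  have f: "f \<in> L2" and i: "integrable lebesgue (\<lambda>p. (1 + (norm p)\<^sup>2) * (cmod (fourier f p))\<^sup>2)"
    using assms by (auto simp: H1_def)
  have "l2 (fourier f) \<le> h1 f"
    unfolding l2_def h1_def
    by (intro real_sqrt_le_mono integral_mono L2_integrable fourier_L2 f i) (simp add: algebra_simps)
  then show ?thesis using f by simp
qed

text \<open>On the shell \<open>|p|\<close> is at least \<open>2 ^ k\<close>; this gain in the H1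
  norm offsets the loss in Bernstein's inequality.\<close>

lemma shell_h1:
  assumes "f \<in> H1"
  shows "2 ^ k * l2 (\<lambda>p. indicator (shell k) p *\<^sub>R fourier f p) \<le> h1 f"
proof (rule power2_le_imp_le)
  let ?g = "\<lambda>p. indicator (shell k) p *\<^sub>R fourier f p"
  have f: "fourier f \<in> L2" and i: "integrable lebesgue (\<lambda>p. (1 + (norm p)\<^sup>2) * (cmod (fourier f p))\<^sup>2)"
    using assms by (auto simp: H1_def)
  have g: "?g \<in> L2" by (rule set_L2[OF shell_lmeasurable f])
  have "(2 ^ k * l2 ?g)\<^sup>2 = (LINT p|lebesgue. (2 ^ k)\<^sup>2 * (cmod (?g p))\<^sup>2)"
    unfolding power_mult_distrib l2_square by (rule integral_mult_right_zero[symmetric])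
  also have "\<dots> \<le> (LINT p|lebesgue. (1 + (norm p)\<^sup>2) * (cmod (fourier f p))\<^sup>2)"
  proof (rule integral_mono[OF integrable_mult_right[OF L2_integrable[OF g]] i])
    fix p
    show "(2 ^ k)\<^sup>2 * (cmod (?g p))\<^sup>2 \<le> (1 + (norm p)\<^sup>2) * (cmod (fourier f p))\<^sup>2"
    proof (cases "p \<in> shell k")
      case True
      then have "2 ^ k \<le> norm p" by (simp add: shell_def dist_norm)
      then have "(2 ^ k)\<^sup>2 \<le> (norm p)\<^sup>2" by (intro power_mono) auto
      then have "(2 ^ k)\<^sup>2 \<le> 1 + (norm p)\<^sup>2" by linarith
      from mult_right_mono[OF this, of "(cmod (fourier f p))\<^sup>2"] show ?thesis using True by simp
    qed simp
  qed
  also have "\<dots> = (h1 f)\<^sup>2"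
    unfolding h1_def by (rule real_sqrt_pow2[symmetric]) (simp add: Bochner_Integration.integral_nonneg)
  finally show "(2 ^ k * l2 ?g)\<^sup>2 \<le> (h1 f)\<^sup>2" .
qed simp

lemma wt_low:
  assumes "g \<in> L2"
  shows "wt (low k g) \<in> L2" "l2 (wt (low k g)) \<le> sqrt (LINT x|lebesgue. W x) * (2 ^ Suc k * l2 g)"
  by (rule wt_bounded[OF band_measurable[OF lmeasurable_ball assms] low_bound[OF assms]])+

text \<open>Stated with the exact partial sum \<open>rate ^ k - rate ^ m\<close>, so that the
  induction over shells telescopes.\<close>

lemma wt_low_diff:
  assumes f: "f \<in> H1" and "k \<le> m"
  shows "l2 (\<lambda>x. wt (low m (fourier f)) x - wt (low k (fourier f)) x) \<le> tail_const * (rate ^ k - rate ^ m) * h1 f"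
  using \<open>k \<le> m\<close>
proof (induction m rule: dec_induct)
  case base
  then show ?case by (simp add: l2_def)
next
  case (step m)
  have g: "fourier f \<in> L2" using f by (simp add: H1_def)
  let ?w = "\<lambda>m. wt (low m (fourier f))"
  have "l2 (\<lambda>x. ?w (Suc m) x - ?w m x) = l2 (wt (band (shell m) (fourier f)))"
    by (simp only: low_Suc[OF g, symmetric] scaleR_right_diff_distrib)
  also have "\<dots> \<le> shell_const * rate ^ m * (2 ^ m * l2 (\<lambda>p. indicator (shell m) p *\<^sub>R fourier f p))"
    by (rule wt_shell(2)[OF g])
  also have "\<dots> \<le> shell_const * rate ^ m * h1 f"
    using shell_const_nonneg rate_bounds by (intro mult_left_mono shell_h1 f) auto
  also have "\<dots> = tail_const * (rate ^ m - rate ^ Suc m) * h1 f"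
    using rate_bounds by (simp add: tail_const_def field_simps)
  finally have "l2 (\<lambda>x. ?w (Suc m) x - ?w m x) \<le> tail_const * (rate ^ m - rate ^ Suc m) * h1 f" .
  with l2_triangle_diff[OF wt_low(1)[OF g] wt_low(1)[OF g] wt_low(1)[OF g], of "Suc m" k m] step.IH
  have "l2 (\<lambda>x. ?w (Suc m) x - ?w k x) \<le> tail_const * (rate ^ m - rate ^ Suc m) * h1 f + tail_const * (rate ^ k - rate ^ m) * h1 f"
    by linarith
  also have "\<dots> = tail_const * (rate ^ k - rate ^ Suc m) * h1 f"
    by (simp add: left_diff_distrib right_diff_distrib del: power_Suc)
  finally show ?case .
qed

text \<open>Square integrability of \<open>wt f\<close> is part of the claim. The weighted
  low-frequency parts are Cauchy by the geometric bound, and an almost everywhere convergent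
  subsequence shows that their limit is \<open>wt f\<close>.\<close>

lemma wt_tail:
  assumes f: "f \<in> H1"
  shows "wt f \<in> L2" "l2 (\<lambda>x. wt f x - wt (low k (fourier f)) x) \<le> tail_const * rate ^ k * h1 f"
proof -
  have fL: "f \<in> L2" and g: "fourier f \<in> L2" using f by (auto simp: H1_def)
  let ?w = "\<lambda>m. wt (low m (fourier f))"
  note w = wt_low(1)[OF g]
  have diff: "l2 (\<lambda>x. ?w m x - ?w k x) \<le> tail_const * rate ^ k * h1 f" if "k \<le> m" for k m
  proof -
    have "tail_const * (rate ^ k - rate ^ m) * h1 f \<le> tail_const * rate ^ k * h1 f"
      using tail_const_nonneg rate_bounds by (intro mult_right_mono mult_left_mono) auto
    then show ?thesis using wt_low_diff[OF f that] by linarith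
  qed
  have rlim: "(\<lambda>k. tail_const * rate ^ k * h1 f) \<longlonglongrightarrow> 0"
    using rate_bounds by (intro tendsto_mult_left_zero tendsto_mult_right_zero LIMSEQ_realpow_zero) auto
  have "\<exists>G\<in>L2. (\<lambda>n. l2 (\<lambda>x. ?w n x - G x)) \<longlonglongrightarrow> 0"
  proof (rule L2_complete[OF w])
    fix e :: real assume "e > 0"
    from eventually_happens'[OF sequentially_bot order_tendstoD(2)[OF rlim this]]
    obtain K where K: "tail_const * rate ^ K * h1 f < e" by blast
    have "l2 (\<lambda>x. ?w m x - ?w n x) < e" if mn: "m \<ge> K" "n \<ge> K" "n \<le> m" for m n
    proof -
      have "tail_const * rate ^ n * h1 f \<le> tail_const * rate ^ K * h1 f"
        using tail_const_nonneg rate_bounds mn by (intro mult_right_mono mult_left_mono power_decreasing) auto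
      then show ?thesis using diff[OF mn(3)] K by linarith
    qed
    note ordered = this
    have "l2 (\<lambda>x. ?w m x - ?w n x) < e" if mn: "m \<ge> K" "n \<ge> K" for m n
    proof (cases "n \<le> m")
      case True
      then show ?thesis by (rule ordered[OF mn])
    next
      case False
      then have "l2 (\<lambda>x. ?w n x - ?w m x) < e" by (intro ordered[OF mn(2,1)]) simp
      then show ?thesis unfolding l2_diff_commute[of "?w m" "?w n"] .
    qed
    then show "\<exists>M. \<forall>m\<ge>M. \<forall>n\<ge>M. l2 (\<lambda>x. ?w m x - ?w n x) < e" by blast
  qed
  then obtain G where G: "G \<in> L2" "(\<lambda>n. l2 (\<lambda>x. ?w n x - G x)) \<longlonglongrightarrow> 0" by blast
  have lowL: "low n (fourier f) \<in> L2" for n by (rule band_L2[OF lmeasurable_ball g])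
  \<comment> \<open>Two nested subsequences: \<open>a\<close> for convergence to \<open>f\<close>
    before weighting, then \<open>b\<close> for convergence to \<open>G\<close> after
    weighting.\<close>
  obtain a where a: "strict_mono (a :: nat \<Rightarrow> nat)" "AE x in lebesgue. (\<lambda>n. low (a n) (fourier f) x) \<longlonglongrightarrow> f x"
    using L2_subseq_AE[OF lowL fL low_tendsto[OF fL]] by blast
  have "(\<lambda>n. l2 (\<lambda>x. ?w (a n) x - G x)) \<longlonglongrightarrow> 0"
    using LIMSEQ_subseq_LIMSEQ[OF G(2) a(1)] by (simp add: o_def)
  from L2_subseq_AE[OF w G(1) this] obtain b where b: "strict_mono (b :: nat \<Rightarrow> nat)"
    "AE x in lebesgue. (\<lambda>n. ?w (a (b n)) x) \<longlonglongrightarrow> G x" by blast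
  have Gf: "AE x in lebesgue. G x = wt f x"
    using a(2) b(2)
  proof eventually_elim
    case (elim x)
    have "(\<lambda>n. low (a (b n)) (fourier f) x) \<longlonglongrightarrow> f x"
      using LIMSEQ_subseq_LIMSEQ[OF elim(1) b(1)] by (simp add: o_def)
    then have "(\<lambda>n. ?w (a (b n)) x) \<longlonglongrightarrow> wt f x" by (intro tendsto_intros)
    with elim(2) show ?case by (rule LIMSEQ_unique)
  qed
  show wf: "wt f \<in> L2" by (rule L2_cong_AE[OF G(1) Gf])
  have Geq: "l2 (\<lambda>x. G x - ?w k x) = l2 (\<lambda>x. wt f x - ?w k x)"
    by (rule l2_cong_AE[OF _ L2_diff[OF G(1) w]]) (use Gf in eventually_elim, simp)
  have "(\<lambda>n. l2 (\<lambda>x. ?w n x - ?w k x)) \<longlonglongrightarrow> l2 (\<lambda>x. G x - ?w k x)"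
    by (rule l2_tendsto[OF L2_diff[OF w w] L2_diff[OF G(1) w]]) (simp add: G(2))
  then have "l2 (\<lambda>x. G x - ?w k x) \<le> tail_const * rate ^ k * h1 f"
    by (rule LIMSEQ_le_const2) (use diff in blast)
  then show "l2 (\<lambda>x. wt f x - wt (low k (fourier f)) x) \<le> tail_const * rate ^ k * h1 f"
    by (simp only: Geq)
qed

text \<open>Raising \<open>k\<close> makes the H1 coefficient as small as desired at the expense of
  the L2 coefficient: the relative form bound is zero.\<close>

lemma wt_bound:
  assumes f: "f \<in> H1"
  shows "l2 (wt f) \<le> tail_const * rate ^ k * h1 f + sqrt (LINT x|lebesgue. W x) * (2 ^ Suc k * l2 f)"
proof -
  have fL: "f \<in> L2" and g: "fourier f \<in> L2" using f by (auto simp: H1_def)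
  have "l2 (wt f) \<le> l2 (\<lambda>x. wt f x - wt (low k (fourier f)) x) + l2 (wt (low k (fourier f)))"
    using l2_triangle[OF L2_diff[OF wt_tail(1)[OF f] wt_low(1)[OF g, of k]] wt_low(1)[OF g, of k]] by simp
  then show ?thesis using wt_tail(2)[OF f, of k] wt_low(2)[OF g, of k] fL by simp
qed

text \<open>Arzela-Ascoli at every frequency level: convergence on a countable dense set, for all
  \<open>k\<close> along one subsequence, spreads to all points by equicontinuity. A multiple of
  \<open>sqrt (W x)\<close> dominates, so integrability of \<open>W\<close> does the work of a
  compact support. The tails are small uniformly in the family.\<close>

lemma wt_compact:
  assumes f: "\<And>n. f n \<in> H1" and B: "\<And>n. h1 (f n) \<le> B"
  shows "\<exists>a. strict_mono (a :: nat \<Rightarrow> nat) \<and>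
    (\<forall>e>0. \<exists>M. \<forall>m\<ge>M. \<forall>n\<ge>M. l2 (\<lambda>x. wt (f (a m)) x - wt (f (a n)) x) < e)"
proof -
  have fL: "f n \<in> L2" and g: "fourier (f n) \<in> L2" for n using f[of n] by (auto simp: H1_def)
  have B0: "0 \<le> B" using B[of 0] h1_nonneg[of "f 0"] by linarith
  have gB: "l2 (fourier (f n)) \<le> B" for n
    using l2_le_h1[OF f[of n]] B[of n] fL[of n] by simp
  obtain D :: "plane set" where D: "countable D" "\<And>X. open X \<Longrightarrow> X \<noteq> {} \<Longrightarrow> \<exists>d\<in>D. d \<in> X"
    using countable_dense_exists by blast
  \<comment> \<open>Division by \<open>2 ^ Suc k\<close> gives all levels the common bound
    \<open>B\<close> under which one subsequence serves them all.\<close>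
  define F where "F n = (\<lambda>(k, x). low k (fourier (f n)) x / of_real (2 ^ Suc k))" for n
  have "countable ((UNIV :: nat set) \<times> D)" using D(1) by simp
  moreover have "norm (F n kx) \<le> B" if "kx \<in> UNIV \<times> D" for n kx
  proof -
    obtain k x where kx: "kx = (k, x)" by (cases kx)
    have "cmod (low k (fourier (f n)) x) \<le> 2 ^ Suc k * B"
      by (rule order_trans[OF low_bound[OF g] mult_left_mono[OF gB]]) simp
    then show ?thesis by (simp add: F_def kx norm_divide field_simps norm_mult norm_power)
  qed
  ultimately obtain a where a: "strict_mono (a :: nat \<Rightarrow> nat)"
    and conv: "\<And>kx. kx \<in> UNIV \<times> D \<Longrightarrow> \<exists>l. (\<lambda>n. F (a n) kx) \<longlonglongrightarrow> l"
    by (rule function_convergent_subsequence[where f = F]) (assumption, rule that, assumption, blast)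
  have conv_D: "convergent (\<lambda>n. low k (fourier (f (a n))) d)" if d: "d \<in> D" for k d
  proof -
    obtain l where "(\<lambda>n. F (a n) (k, d)) \<longlonglongrightarrow> l" using conv[of "(k, d)"] d by auto
    then have "(\<lambda>n. of_real (2 ^ Suc k) * F (a n) (k, d)) \<longlonglongrightarrow> of_real (2 ^ Suc k) * l"
      by (rule tendsto_mult_left)
    then have "(\<lambda>n. low k (fourier (f (a n))) d) \<longlonglongrightarrow> of_real (2 ^ Suc k) * l"
      by (simp add: F_def)
    then show ?thesis by (rule convergentI)
  qed
  have conv_x: "convergent (\<lambda>n. low k (fourier (f (a n))) x)" for k x
  proof (rule Cauchy_convergent, rule metric_CauchyI)
    fix e :: real assume e: "e > 0"
    \<comment> \<open>The added 1 keeps \<open>L\<close> positive when \<open>B = 0\<close>.\<close>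
    define L where "L = 2 ^ k * (2 ^ Suc k * B) + 1"
    have L: "L > 0" using B0 by (simp add: L_def add_nonneg_pos)
    have "x \<in> ball x (e / (3 * L))" using e L by simp
    then obtain d where d: "d \<in> D" "d \<in> ball x (e / (3 * L))"
      using D(2)[OF open_ball, of x "e / (3 * L)"] by blast
    from convergent_Cauchy[OF conv_D[OF d(1), of k]] obtain M where
      M: "\<And>m n. m \<ge> M \<Longrightarrow> n \<ge> M \<Longrightarrow> dist (low k (fourier (f (a m))) d) (low k (fourier (f (a n))) d) < e / 3"
      using e unfolding Cauchy_def by (metis divide_pos_pos zero_less_numeral)
    have lip: "dist (low k (fourier (f n)) x) (low k (fourier (f n)) d) < e / 3" for n
    proof -
      have xd: "norm (x - d) < e / (3 * L)" using d(2) by (simp add: dist_norm)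
      have "cmod (low k (fourier (f n)) x - low k (fourier (f n)) d) \<le> 2 ^ k * norm (x - d) * (2 ^ Suc k * l2 (fourier (f n)))"
        by (rule low_lipschitz[OF g])
      also have "\<dots> \<le> 2 ^ k * norm (x - d) * (2 ^ Suc k * B)"
        by (intro mult_left_mono gB) auto
      also have "\<dots> \<le> norm (x - d) * L"
        by (simp add: L_def algebra_simps)
      also have "\<dots> < e / (3 * L) * L" using xd L by (intro mult_strict_right_mono)
      also have "\<dots> = e / 3" using L by simp
      finally show ?thesis by (simp add: dist_norm)
    qed
    have "dist (low k (fourier (f (a m))) x) (low k (fourier (f (a n))) x) < e" if "m \<ge> M" "n \<ge> M" for m n
      using lip[of "a m"] lip[of "a n"] M[OF that]
        dist_triangle[of "low k (fourier (f (a m))) x" "low k (fourier (f (a n))) x" "low k (fourier (f (a m))) d"]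
        dist_triangle2[of "low k (fourier (f (a m))) d" "low k (fourier (f (a n))) x" "low k (fourier (f (a n))) d"]
      by linarith
    then show "\<exists>M. \<forall>m\<ge>M. \<forall>n\<ge>M. dist (low k (fourier (f (a m))) x) (low k (fourier (f (a n))) x) < e" by blast
  qed
  have low_cauchy: "\<exists>M. \<forall>m\<ge>M. \<forall>n\<ge>M. l2 (\<lambda>x. wt (low k (fourier (f (a m)))) x - wt (low k (fourier (f (a n)))) x) < e"
    if "e > 0" for k e
  proof -
    define limfun where "limfun x = lim (\<lambda>n. low k (fourier (f (a n))) x)" for x
    define C where "C = (2 ^ Suc k * B)"
    have l: "(\<lambda>n. wt (low k (fourier (f (a n)))) x) \<longlonglongrightarrow> wt limfun x" for x
    proof (rule tendsto_scaleR[OF tendsto_const])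
      show "(\<lambda>n. low k (fourier (f (a n))) x) \<longlonglongrightarrow> limfun x"
        unfolding limfun_def by (rule convergent_LIMSEQ_iff[THEN iffD1, OF conv_x])
    qed
    have bL: "(\<lambda>x. sqrt (W x) * C) \<in> L2"
    proof (rule L2_scale)
      have "0 \<le> C" using B0 by (simp add: C_def)
      then show "wt (\<lambda>_. of_real C) \<in> L2" by (intro wt_bounded(1)[of _ C]) simp_all
      show "(\<lambda>x. sqrt (W x) * C) \<in> borel_measurable lebesgue" by measurable
      show "norm (sqrt (W x) * C) \<le> 1 * norm (wt (\<lambda>_. of_real C) x)" for x by (simp add: abs_mult)
    qed
    have b: "norm (wt (low k (fourier (f (a n)))) x) \<le> norm (sqrt (W x) * C)" for n x
    proof -
      have "cmod (low k (fourier (f (a n))) x) \<le> C"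
        unfolding C_def by (rule order_trans[OF low_bound[OF g] mult_left_mono[OF gB]]) simp
      then show ?thesis using W_nonneg[of x] by (simp add: abs_mult mult_left_mono)
    qed
    note dc = L2_dominated_convergence[OF bL L2_measurable[OF wt_low(1)[OF g]] l b]
    show ?thesis by (rule L2_convergent_Cauchy[OF dc that])
  qed
  have "\<exists>M. \<forall>m\<ge>M. \<forall>n\<ge>M. l2 (\<lambda>x. wt (f (a m)) x - wt (f (a n)) x) < e" if e: "e > 0" for e
  proof -
    have "(\<lambda>k. tail_const * rate ^ k * B) \<longlonglongrightarrow> 0"
      using rate_bounds by (intro tendsto_mult_left_zero tendsto_mult_right_zero LIMSEQ_realpow_zero) auto
    from eventually_happens'[OF sequentially_bot order_tendstoD(2)[OF this, of "e / 3"]] e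
    obtain k where k: "tail_const * rate ^ k * B < e / 3" by auto
    have tail: "l2 (\<lambda>x. wt (f n) x - wt (low k (fourier (f n))) x) < e / 3" for n
    proof -
      have "tail_const * rate ^ k * h1 (f n) \<le> tail_const * rate ^ k * B"
        using tail_const_nonneg rate_bounds by (intro mult_left_mono B) auto
      then show ?thesis using wt_tail(2)[OF f[of n], of k] k by linarith
    qed
    from low_cauchy[of "e / 3" k] e obtain M where
      M: "\<And>m n. m \<ge> M \<Longrightarrow> n \<ge> M \<Longrightarrow> l2 (\<lambda>x. wt (low k (fourier (f (a m)))) x - wt (low k (fourier (f (a n)))) x) < e / 3"
      by auto
    have "l2 (\<lambda>x. wt (f (a m)) x - wt (f (a n)) x) < e" if "m \<ge> M" "n \<ge> M" for m n
    proof -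
      let ?F = "\<lambda>m. wt (f (a m))" and ?L = "\<lambda>m. wt (low k (fourier (f (a m))))"
      have FL: "?F m \<in> L2" and LL: "?L m \<in> L2" for m
        by (rule wt_tail(1)[OF f] wt_low(1)[OF g])+
      have "l2 (\<lambda>x. ?F m x - ?F n x) \<le> l2 (\<lambda>x. ?F m x - ?L m x) + l2 (\<lambda>x. ?L m x - ?F n x)"
        by (rule l2_triangle_diff[OF FL FL LL])
      moreover have "l2 (\<lambda>x. ?L m x - ?F n x) \<le> l2 (\<lambda>x. ?L m x - ?L n x) + l2 (\<lambda>x. ?L n x - ?F n x)"
        by (rule l2_triangle_diff[OF LL FL LL])
      ultimately show ?thesis
        using M[OF that] tail[of "a m"] tail[of "a n"] l2_diff_commute[of "?L n" "?F n"] by linarith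
    qed
    then show ?thesis by blast
  qed
  with a show ?thesis by blast
qed

end

section \<open>Forms on spinors\<close>

lemma norm_spinor_square: "(norm (v :: spinor))\<^sup>2 = (\<Sum>i\<in>UNIV. (cmod (v $ i))\<^sup>2)"
  by (simp add: norm_vec_def L2_set_def sum_nonneg)

lemma spinor_inner_self: "spinor_inner v v = of_real ((norm v)\<^sup>2)"
proof -
  have "cnj z * z = of_real ((cmod z)\<^sup>2)" for z
    by (metis complex_norm_square mult.commute)
  then show ?thesis by (simp add: spinor_inner_def norm_spinor_square)
qed

lemma spinor_inner_cnj: "spinor_inner v u = cnj (spinor_inner u v)"
  by (simp add: spinor_inner_def mult.commute)

lemma spinor_inner_add_right: "spinor_inner u (v + w) = spinor_inner u v + spinor_inner u w"
  by (simp add: spinor_inner_def algebra_simps sum.distrib)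

lemma spinor_inner_smult_right: "spinor_inner u (c *s v) = c * spinor_inner u v"
  by (simp add: spinor_inner_def sum_distrib_left algebra_simps)

lemma spinor_inner_scaleR_right: "spinor_inner u (a *\<^sub>R v) = of_real a * spinor_inner u v"
  by (simp add: spinor_inner_def sum_distrib_left scaleR_conv_of_real[where 'a = complex] algebra_simps)

lemma spinor_inner_scaleR_left: "spinor_inner (a *\<^sub>R u) v = of_real a * spinor_inner u v"
  by (simp add: spinor_inner_def sum_distrib_left scaleR_conv_of_real[where 'a = complex] algebra_simps)

lemma norm_smult_spinor: "norm (c *s (v :: spinor)) = cmod c * norm v"
proof -
  have "(norm (c *s v))\<^sup>2 = (cmod c * norm v)\<^sup>2"
    by (simp add: norm_spinor_square norm_mult power_mult_distrib sum_distrib_left)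
  then show ?thesis by (rule power2_eq_imp_eq) simp_all
qed

lemma spinor_component_le: "cmod (v $ i) \<le> norm (v :: spinor)"
  by (rule Finite_Cartesian_Product.norm_nth_le)

lemma spinor_inner_bound: "cmod (spinor_inner u v) \<le> 2 * (norm u * norm v)"
proof -
  have "cmod (spinor_inner u v) \<le> (\<Sum>i\<in>(UNIV :: 2 set). cmod (cnj (u $ i) * v $ i))"
    unfolding spinor_inner_def by (rule norm_sum)
  also have "\<dots> \<le> (\<Sum>i\<in>(UNIV :: 2 set). norm u * norm v)"
    by (intro sum_mono) (simp add: norm_mult mult_mono spinor_component_le)
  finally show ?thesis by simp
qed

lemma borel_measurable_spinor_nth:
  assumes "f \<in> borel_measurable M"
  shows "(\<lambda>x. (f x :: spinor) $ i) \<in> borel_measurable M"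
proof -
  have "(\<lambda>v :: spinor. v $ i) \<in> borel_measurable borel"
    by (intro borel_measurable_continuous_onI continuous_intros)
  from measurable_compose[OF assms this] show ?thesis .
qed

lemma borel_measurable_spinor:
  assumes "\<And>i. (\<lambda>x. (f x :: spinor) $ i) \<in> borel_measurable M"
  shows "f \<in> borel_measurable M"
proof -
  have f: "f = (\<lambda>x. \<Sum>i\<in>UNIV. axis i (f x $ i))"
    by (intro ext) (simp add: vec_eq_iff axis_def if_distrib cong: if_cong)
  have "continuous_on UNIV (\<lambda>z. if j = i then z else (0 :: complex))" for i j :: 2
    by (cases "j = i") (auto intro: continuous_intros)
  then have "(\<lambda>z. axis i z :: spinor) \<in> borel_measurable borel" for i
    unfolding axis_def by (intro borel_measurable_continuous_onI continuous_on_vec_lambda)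
  from measurable_compose[OF assms this] show ?thesis
    by (subst f) (intro borel_measurable_sum)
qed

lemma borel_measurable_spinor_inner:
  assumes "f \<in> borel_measurable M" "g \<in> borel_measurable M"
  shows "(\<lambda>x. spinor_inner (f x) (g x)) \<in> borel_measurable M"
  unfolding spinor_inner_def
  by (intro borel_measurable_sum borel_measurable_times borel_measurable_cnj borel_measurable_spinor_nth assms)

lemma L2_spinor_iff: "f \<in> L2 \<longleftrightarrow> (\<forall>i. (\<lambda>x. (f x :: spinor) $ i) \<in> L2)"
proof
  assume f: "f \<in> L2"
  show "\<forall>i. (\<lambda>x. f x $ i) \<in> L2"
  proof
    fix i
    have "(\<lambda>x. f x $ i) \<in> borel_measurable lebesgue"
      by (rule borel_measurable_spinor_nth[OF L2_measurable[OF f]])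
    then show "(\<lambda>x. f x $ i) \<in> L2"
      by (rule L2_scale[OF f, of _ 1]) (simp add: spinor_component_le)
  qed
next
  assume f: "\<forall>i. (\<lambda>x. f x $ i) \<in> L2"
  show "f \<in> L2"
  proof (rule L2_bound)
    show "f \<in> borel_measurable lebesgue" by (intro borel_measurable_spinor L2_measurable f[THEN spec])
    show "integrable lebesgue (\<lambda>x. \<Sum>i\<in>UNIV. (cmod (f x $ i))\<^sup>2)"
      by (intro Bochner_Integration.integrable_sum L2_integrable f[THEN spec])
    show "AE x in lebesgue. (norm (f x))\<^sup>2 \<le> (\<Sum>i\<in>UNIV. (cmod (f x $ i))\<^sup>2)"
      by (simp add: norm_spinor_square)
  qed
qed

lemma l2_spinor_square:
  assumes "f \<in> L2"
  shows "(l2 f)\<^sup>2 = (\<Sum>i\<in>UNIV. (l2 (\<lambda>x. (f x :: spinor) $ i))\<^sup>2)"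
  unfolding l2_square norm_spinor_square
  by (rule Bochner_Integration.integral_sum, rule L2_integrable)
     (rule L2_spinor_iff[THEN iffD1, OF assms, THEN spec])

lemma L2_spinor_inner_integrable:
  fixes f g :: "plane \<Rightarrow> spinor"
  assumes f: "f \<in> L2" and g: "g \<in> L2"
  shows "integrable lebesgue (\<lambda>x. spinor_inner (f x) (g x))"
proof (rule Bochner_Integration.integrable_bound)
  show "integrable lebesgue (\<lambda>x. 2 * (norm (f x) * norm (g x)))"
    by (intro integrable_mult_right L2_norm_mult_integrable f g)
  show "(\<lambda>x. spinor_inner (f x) (g x)) \<in> borel_measurable lebesgue"
    by (intro borel_measurable_spinor_inner L2_measurable f g)
  show "AE x in lebesgue. norm (spinor_inner (f x) (g x)) \<le> norm (2 * (norm (f x) * norm (g x)))"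
  proof (intro AE_I2)
    fix x
    show "norm (spinor_inner (f x) (g x)) \<le> norm (2 * (norm (f x) * norm (g x)))"
      using spinor_inner_bound[of "f x" "g x"] by simp
  qed
qed

section \<open>Hermitian forms given by bounded multipliers\<close>

definition smult :: "complex \<Rightarrow> (plane \<Rightarrow> spinor) \<Rightarrow> plane \<Rightarrow> spinor" where
  "smult c \<psi> = (\<lambda>x. c *s \<psi> x)"

lemma vector_space_smult: "vector_space smult"
  by unfold_locales
    (simp_all add: smult_def fun_eq_iff vector_add_ldistrib vector_sadd_rdistrib vector_smult_assoc)

lemma L2_smult: "\<psi> \<in> L2 \<Longrightarrow> (\<lambda>x. c *s \<psi> x) \<in> L2" for \<psi> :: "plane \<Rightarrow> spinor"
proof (rule L2_scale[of \<psi> _ "cmod c"])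
  assume "\<psi> \<in> L2"
  then show "(\<lambda>x. c *s \<psi> x) \<in> borel_measurable lebesgue"
    unfolding vector_smult_component
    by (intro borel_measurable_spinor, unfold vector_smult_component)
       (intro borel_measurable_times borel_measurable_const borel_measurable_spinor_nth L2_measurable)
qed (simp_all add: norm_smult_spinor)

text \<open>
  All forms below are of the type \<open>\<integral> \<langle>T \<phi>, k (T \<psi>)\<rangle>\<close> with \<open>T\<close> linear into \<open>L\<^sup>2\<close> and \<open>k\<close> a bounded
  Hermitian multiplier.
\<close>
locale multiplier_form =
  fixes Q :: "(plane \<Rightarrow> spinor) set" and T :: "(plane \<Rightarrow> spinor) \<Rightarrow> plane \<Rightarrow> spinor"
    and k :: "plane \<Rightarrow> spinor \<Rightarrow> spinor" and C :: real
  assumes Q: "module.subspace smult Q"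
    and T_L2: "\<psi> \<in> Q \<Longrightarrow> T \<psi> \<in> L2"
    and T_add: "\<lbrakk>\<phi> \<in> Q; \<psi> \<in> Q\<rbrakk> \<Longrightarrow> AE x in lebesgue. T (\<phi> + \<psi>) x = T \<phi> x + T \<psi> x"
    and T_smult: "\<psi> \<in> Q \<Longrightarrow> AE x in lebesgue. T (smult c \<psi>) x = c *s T \<psi> x"
    and k_meas: "f \<in> borel_measurable lebesgue \<Longrightarrow> (\<lambda>x. k x (f x)) \<in> borel_measurable lebesgue"
    and k_bound: "norm (k x v) \<le> C * norm v"
    and k_add: "k x (u + v) = k x u + k x v" and k_smult: "k x (c *s v) = c *s k x v"
    and k_herm: "spinor_inner u (k x v) = cnj (spinor_inner v (k x u))"
begin

definition form :: "(plane \<Rightarrow> spinor) \<Rightarrow> (plane \<Rightarrow> spinor) \<Rightarrow> complex" where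
  "form \<phi> \<psi> = (LINT x|lebesgue. spinor_inner (T \<phi> x) (k x (T \<psi> x)))"

lemma kT_L2: "\<psi> \<in> Q \<Longrightarrow> (\<lambda>x. k x (T \<psi> x)) \<in> L2"
  by (rule L2_scale[OF T_L2 k_meas[OF L2_measurable[OF T_L2]] k_bound])

lemma form_integrable: "\<lbrakk>\<phi> \<in> Q; \<psi> \<in> Q\<rbrakk> \<Longrightarrow> integrable lebesgue (\<lambda>x. spinor_inner (T \<phi> x) (k x (T \<psi> x)))"
  by (intro L2_spinor_inner_integrable T_L2 kT_L2)

lemma hermitian: "hermitian_form smult Q form"
proof -
  interpret vector_space smult by (rule vector_space_smult)
  note cl = subspace_add[OF Q] subspace_scale[OF Q]
  have meas: "(\<lambda>x. spinor_inner (T \<phi> x) (k x (T \<psi> x))) \<in> borel_measurable lebesgue" if "\<phi> \<in> Q" "\<psi> \<in> Q" for \<phi> \<psi>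
    by (rule borel_measurable_integrable[OF form_integrable[OF that]])
  show ?thesis
  proof (unfold_locales, rule Q)
    fix \<phi> \<psi> \<theta> c assume q: "\<phi> \<in> Q" "\<psi> \<in> Q" "\<theta> \<in> Q"
    have "form \<phi> (\<psi> + \<theta>) = (LINT x|lebesgue. spinor_inner (T \<phi> x) (k x (T \<psi> x)) + spinor_inner (T \<phi> x) (k x (T \<theta> x)))"
      unfolding form_def
    proof (rule integral_cong_AE)
      show "AE x in lebesgue. spinor_inner (T \<phi> x) (k x (T (\<psi> + \<theta>) x))
          = spinor_inner (T \<phi> x) (k x (T \<psi> x)) + spinor_inner (T \<phi> x) (k x (T \<theta> x))"
        using T_add[OF q(2,3)] by eventually_elim (simp add: k_add spinor_inner_add_right)
    qed (intro meas borel_measurable_add q cl)+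
    also have "\<dots> = form \<phi> \<psi> + form \<phi> \<theta>"
      unfolding form_def by (rule Bochner_Integration.integral_add[OF form_integrable form_integrable]) (rule q)+
    finally show "form \<phi> (\<psi> + \<theta>) = form \<phi> \<psi> + form \<phi> \<theta>" .
  next
    fix \<phi> \<psi> c assume q: "\<phi> \<in> Q" "\<psi> \<in> Q"
    have "form \<phi> (smult c \<psi>) = (LINT x|lebesgue. c * spinor_inner (T \<phi> x) (k x (T \<psi> x)))"
      unfolding form_def
    proof (rule integral_cong_AE)
      show "AE x in lebesgue. spinor_inner (T \<phi> x) (k x (T (smult c \<psi>) x)) = c * spinor_inner (T \<phi> x) (k x (T \<psi> x))"
        using T_smult[OF q(2), of c] by eventually_elim (simp add: k_smult spinor_inner_smult_right)
    qed (intro meas borel_measurable_times borel_measurable_const q cl)+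
    also have "\<dots> = c * form \<phi> \<psi>"
      unfolding form_def by (rule integral_mult_right_zero)
    finally show "form \<phi> (smult c \<psi>) = c * form \<phi> \<psi>" .
    have "form \<psi> \<phi> = (LINT x|lebesgue. cnj (spinor_inner (T \<phi> x) (k x (T \<psi> x))))"
      unfolding form_def by (intro Bochner_Integration.integral_cong refl k_herm)
    also have "\<dots> = cnj (form \<phi> \<psi>)"
      unfolding form_def by (rule Bochner_Integration.integral_cnj)
    finally show "form \<psi> \<phi> = cnj (form \<phi> \<psi>)" .
  qed
qed

lemma Re_form:
  assumes "\<psi> \<in> Q"
  shows "integrable lebesgue (\<lambda>x. Re (spinor_inner (T \<psi> x) (k x (T \<psi> x))))"
    "Re (form \<psi> \<psi>) = (LINT x|lebesgue. Re (spinor_inner (T \<psi> x) (k x (T \<psi> x))))"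
  unfolding form_def
  using form_integrable[OF assms assms] by (rule integrable_Re integral_Re[symmetric])+

end

text \<open>The identity multiplier. The instances are the L2 product, the H1 product and the form
  of the potential, with \<open>T\<close> the identity, \<open>hat\<close> and
  \<open>wt2\<close>.\<close>

locale l2_form =
  fixes Q :: "(plane \<Rightarrow> spinor) set" and T :: "(plane \<Rightarrow> spinor) \<Rightarrow> plane \<Rightarrow> spinor"
  assumes Q_subspace: "module.subspace smult Q"
    and T_in_L2: "\<psi> \<in> Q \<Longrightarrow> T \<psi> \<in> L2"
    and T_plus: "\<lbrakk>\<phi> \<in> Q; \<psi> \<in> Q\<rbrakk> \<Longrightarrow> AE x in lebesgue. T (\<phi> + \<psi>) x = T \<phi> x + T \<psi> x"
    and T_scale: "\<psi> \<in> Q \<Longrightarrow> AE x in lebesgue. T (smult c \<psi>) x = c *s T \<psi> x"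
begin

sublocale multiplier_form Q T "\<lambda>x v. v" 1
  by unfold_locales
    (rule Q_subspace refl | erule T_in_L2 | erule (1) T_plus | erule T_scale | assumption | rule spinor_inner_cnj | simp)+

lemma form_self: "\<psi> \<in> Q \<Longrightarrow> form \<psi> \<psi> = of_real ((l2 (T \<psi>))\<^sup>2)"
  unfolding form_def spinor_inner_self integral_complex_of_real l2_square ..

lemma positive: "positive_form smult Q form"
  by (intro positive_form.intro hermitian positive_form_axioms.intro) (simp add: form_self)

lemma T_diff:
  assumes "\<phi> \<in> Q" "\<psi> \<in> Q"
  shows "AE x in lebesgue. T (\<phi> - \<psi>) x = T \<phi> x - T \<psi> x"
proof -
  interpret vector_space smult by (rule vector_space_smult)
  have e: "\<phi> - \<psi> = \<phi> + smult (- 1) \<psi>" by simp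
  have "smult (- 1) \<psi> \<in> Q" by (rule subspace_scale[OF Q assms(2)])
  from T_add[OF assms(1) this] T_smult[OF assms(2), of "- 1"]
  show ?thesis unfolding e by eventually_elim simp
qed

end

text \<open>\<open>fourier\<close> is a choice among representatives, so even this equality is
  obtained from isometry and only almost everywhere.\<close>

lemma fourier_zero: "AE p in lebesgue. fourier (\<lambda>x. 0) p = 0"
proof (rule l2_eq_0_AE)
  have "l2 (fourier (\<lambda>x. 0)) = l2 (\<lambda>x::plane. 0 :: complex)" by (rule fourier_l2[OF L2_zero])
  then show "l2 (fourier (\<lambda>x. 0)) = 0" by (simp add: l2_def)
qed (rule fourier_L2[OF L2_zero])

lemma fourier_smult:
  assumes "f \<in> L2"
  shows "AE p in lebesgue. fourier (\<lambda>x. c * f x) p = c * fourier f p"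
  using fourier_add_scale[OF assms L2_zero, of c] fourier_zero by eventually_elim simp

lemma fourier_add:
  assumes "f \<in> L2" "g \<in> L2"
  shows "AE p in lebesgue. fourier (\<lambda>x. f x + g x) p = fourier f p + fourier g p"
  using fourier_add_scale[OF assms, of 1] by simp

lemma L2_spinor_nth: "\<psi> \<in> L2 \<Longrightarrow> (\<lambda>x. (\<psi> x :: spinor) $ i) \<in> L2"
  by (rule L2_spinor_iff[THEN iffD1, THEN spec])

lemma fourier2_nth: "fourier2 \<psi> p $ i = fourier (\<lambda>x. \<psi> x $ i) p"
  by (simp add: fourier2_def)

lemma fourier2_L2: "\<psi> \<in> L2 \<Longrightarrow> fourier2 \<psi> \<in> L2"
  by (rule L2_spinor_iff[THEN iffD2], rule allI, unfold fourier2_nth) (intro fourier_L2 L2_spinor_nth)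

lemma AE_spinor_eqI:
  assumes "\<And>i. AE p in lebesgue. (f p :: spinor) $ i = g p $ i"
  shows "AE p in lebesgue. f p = g p"
proof -
  have "AE p in lebesgue. \<forall>i\<in>UNIV. f p $ i = g p $ i"
    by (rule AE_finite_allI[OF finite]) (rule assms)
  then show ?thesis by eventually_elim (simp add: vec_eq_iff)
qed

lemma fourier2_add:
  assumes "\<phi> \<in> L2" "\<psi> \<in> L2"
  shows "AE p in lebesgue. fourier2 (\<phi> + \<psi>) p = fourier2 \<phi> p + fourier2 \<psi> p"
proof (rule AE_spinor_eqI)
  fix i
  show "AE p in lebesgue. fourier2 (\<phi> + \<psi>) p $ i = (fourier2 \<phi> p + fourier2 \<psi> p) $ i"
    unfolding fourier2_nth vector_add_component plus_fun_apply
    by (rule fourier_add[OF L2_spinor_nth L2_spinor_nth]) (rule assms)+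
qed

lemma fourier2_smult:
  assumes "\<psi> \<in> L2"
  shows "AE p in lebesgue. fourier2 (smult c \<psi>) p = c *s fourier2 \<psi> p"
proof (rule AE_spinor_eqI)
  fix i
  show "AE p in lebesgue. fourier2 (smult c \<psi>) p $ i = (c *s fourier2 \<psi> p) $ i"
    unfolding fourier2_nth vector_smult_component smult_def
    by (rule fourier_smult[OF L2_spinor_nth]) (rule assms)
qed

section \<open>The Sobolev space as form domain\<close>

definition bracket :: "plane \<Rightarrow> real" where "bracket p = sqrt (1 + (norm p)\<^sup>2)"

text \<open>Makes the H1 norm the L2 norm of an image that is linear almost everywhere, so
  completeness of H1 reduces to that of L2.\<close>

definition hat :: "(plane \<Rightarrow> spinor) \<Rightarrow> plane \<Rightarrow> spinor" where
  "hat \<psi> p = bracket p *\<^sub>R fourier2 \<psi> p"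

lemma bracket_ge_1: "1 \<le> bracket p"
  by (simp add: bracket_def)

lemma bracket_pos [simp]: "0 < bracket p" "bracket p \<noteq> 0" "0 \<le> bracket p"
  using bracket_ge_1[of p] by linarith+

lemma bracket_square: "(bracket p)\<^sup>2 = 1 + (norm p)\<^sup>2"
  by (simp add: bracket_def add_nonneg_nonneg)

lemma bracket_measurable: "bracket \<in> borel_measurable lebesgue"
proof (rule borel_lebesgue_measurable)
  show "bracket \<in> borel_measurable borel" unfolding bracket_def[abs_def] by measurable
qed

lemma norm_hat_square: "(norm (hat \<psi> p))\<^sup>2 = (1 + (norm p)\<^sup>2) * (norm (fourier2 \<psi> p))\<^sup>2"
  by (simp add: hat_def power_mult_distrib bracket_square)

lemma sobolev_iff: "\<psi> \<in> sobolev_H1 \<longleftrightarrow> \<psi> \<in> L2 \<and> hat \<psi> \<in> L2"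
proof -
  have "hat \<psi> \<in> borel_measurable lebesgue" if "\<psi> \<in> L2"
    unfolding hat_def[abs_def]
    by (intro borel_measurable_scaleR bracket_measurable L2_measurable fourier2_L2 that)
  then have "hat \<psi> \<in> L2 \<longleftrightarrow> integrable lebesgue (\<lambda>p. (1 + (norm p)\<^sup>2) * (norm (fourier2 \<psi> p))\<^sup>2)" if "\<psi> \<in> L2"
    unfolding L2_def[where 'b = spinor] mem_Collect_eq norm_hat_square using that by (simp add: L2_def)
  then show ?thesis unfolding sobolev_H1_def mem_Collect_eq by (simp cong: conj_cong)
qed

lemma sobolev_L2: "\<psi> \<in> sobolev_H1 \<Longrightarrow> \<psi> \<in> L2" and hat_L2: "\<psi> \<in> sobolev_H1 \<Longrightarrow> hat \<psi> \<in> L2"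
  by (simp_all only: sobolev_iff)

lemma L2_plus: "\<phi> \<in> L2 \<Longrightarrow> \<psi> \<in> L2 \<Longrightarrow> \<phi> + \<psi> \<in> L2"
  unfolding plus_fun_def by (rule L2_add)

lemma smult_L2: "\<psi> \<in> L2 \<Longrightarrow> smult c \<psi> \<in> L2"
  unfolding smult_def by (rule L2_smult)

lemma hat_add:
  assumes "\<phi> \<in> L2" "\<psi> \<in> L2"
  shows "AE p in lebesgue. hat (\<phi> + \<psi>) p = hat \<phi> p + hat \<psi> p"
  using fourier2_add[OF assms] by eventually_elim (simp add: hat_def scaleR_right_distrib)

lemma hat_smult:
  assumes "\<psi> \<in> L2"
  shows "AE p in lebesgue. hat (smult c \<psi>) p = c *s hat \<psi> p"
  using fourier2_smult[OF assms, of c]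
  by eventually_elim (simp add: hat_def vec_eq_iff scaleR_conv_of_real[where 'a = complex])

lemma subspace_sobolev: "module.subspace smult sobolev_H1"
proof -
  interpret vector_space smult by (rule vector_space_smult)
  show ?thesis
  proof (rule subspaceI)
    have z: "(0 :: plane \<Rightarrow> spinor) \<in> L2" unfolding zero_fun_def by (rule L2_zero)
    have s: "smult 0 (0 :: plane \<Rightarrow> spinor) = 0" by (simp add: smult_def zero_fun_def)
    have "AE p in lebesgue. hat 0 p = 0"
      using hat_smult[OF z, of 0] unfolding s by eventually_elim simp
    then have "AE p in lebesgue. 0 = hat 0 p" by eventually_elim simp
    then have "hat 0 \<in> L2" by (rule L2_cong_AE[OF L2_zero])
    then show "0 \<in> sobolev_H1" using z by (simp only: sobolev_iff)
  next
    fix \<phi> \<psi> assume "\<phi> \<in> sobolev_H1" "\<psi> \<in> sobolev_H1"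
    then have L: "\<phi> \<in> L2" "\<psi> \<in> L2" "hat \<phi> \<in> L2" "hat \<psi> \<in> L2" by (simp_all only: sobolev_iff)
    have "AE p in lebesgue. hat \<phi> p + hat \<psi> p = hat (\<phi> + \<psi>) p"
      using hat_add[OF L(1,2)] by eventually_elim simp
    then have "hat (\<phi> + \<psi>) \<in> L2" by (rule L2_cong_AE[OF L2_add[OF L(3,4)]])
    then show "\<phi> + \<psi> \<in> sobolev_H1" using L2_plus[OF L(1,2)] by (simp only: sobolev_iff)
  next
    fix c \<psi> assume "\<psi> \<in> sobolev_H1"
    then have L: "\<psi> \<in> L2" "hat \<psi> \<in> L2" by (simp_all only: sobolev_iff)
    have "AE p in lebesgue. c *s hat \<psi> p = hat (smult c \<psi>) p"
      using hat_smult[OF L(1), of c] by eventually_elim simp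
    then have "hat (smult c \<psi>) \<in> L2" by (rule L2_cong_AE[OF L2_smult[OF L(2)]])
    then show "smult c \<psi> \<in> sobolev_H1" using smult_L2[OF L(1)] by (simp only: sobolev_iff)
  qed
qed

interpretation ip: l2_form sobolev_H1 "\<lambda>\<psi>. \<psi>"
proof (unfold_locales, rule subspace_sobolev, erule sobolev_L2)
  fix \<phi> \<psi> :: "plane \<Rightarrow> spinor" and c
  show "AE x in lebesgue. (\<phi> + \<psi>) x = \<phi> x + \<psi> x" by simp
  show "AE x in lebesgue. smult c \<psi> x = c *s \<psi> x" by (simp add: smult_def)
qed

interpretation n1: l2_form sobolev_H1 hat
  by (unfold_locales, rule subspace_sobolev, erule hat_L2,
      rule hat_add[OF sobolev_L2 sobolev_L2], assumption+, rule hat_smult[OF sobolev_L2], assumption)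

lemma ip_form: "ip.form = L2_inner"
  by (intro ext) (simp add: ip.form_def L2_inner_def)

text \<open>The L2 limit of \<open>hat (f n)\<close> is divided by \<open>bracket\<close> and
  transformed back; surjectivity of the Fourier transform makes it the image of a function.\<close>

lemma sobolev_complete:
  assumes f: "\<And>n. f n \<in> sobolev_H1"
    and cauchy: "\<And>e. e > 0 \<Longrightarrow> \<exists>M. \<forall>m\<ge>M. \<forall>n\<ge>M. l2 (hat (f m - f n)) < e"
  shows "\<exists>\<psi>\<in>sobolev_H1. (\<lambda>n. l2 (hat (f n - \<psi>))) \<longlonglongrightarrow> 0"
proof -
  interpret vector_space smult by (rule vector_space_smult)
  note hf = hat_L2[OF f]
  have d: "l2 (hat (\<phi> - \<psi>)) = l2 (\<lambda>p. hat \<phi> p - hat \<psi> p)" if "\<phi> \<in> sobolev_H1" "\<psi> \<in> sobolev_H1" for \<phi> \<psi>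
    by (rule l2_cong_AE[OF n1.T_diff[OF that] hat_L2[OF subspace_diff[OF subspace_sobolev that]]])
  have "\<exists>G\<in>L2. (\<lambda>n. l2 (\<lambda>p. hat (f n) p - G p)) \<longlonglongrightarrow> 0"
    by (rule L2_complete[OF hf]) (use cauchy in \<open>simp only: d[OF f f]\<close>)
  then obtain G where G: "G \<in> L2" "(\<lambda>n. l2 (\<lambda>p. hat (f n) p - G p)) \<longlonglongrightarrow> 0" by (elim bexE)
  define g where "g p = (1 / bracket p) *\<^sub>R G p" for p
  have g: "g \<in> L2"
  proof (rule L2_scale[OF G(1), of _ 1])
    show "g \<in> borel_measurable lebesgue"
      unfolding g_def[abs_def]
      by (intro borel_measurable_scaleR borel_measurable_divide borel_measurable_const bracket_measurable L2_measurable G)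
    fix p
    have "norm (g p) = norm (G p) / bracket p" by (simp add: g_def)
    also have "\<dots> \<le> norm (G p) / 1" using bracket_ge_1[of p] by (intro divide_left_mono) simp_all
    finally show "norm (g p) \<le> 1 * norm (G p)" by simp
  qed
  define \<psi> where "\<psi> x = (\<chi> i. inv_fourier (\<lambda>p. g p $ i) x)" for x
  have \<psi>: "\<psi> \<in> L2"
    by (rule L2_spinor_iff[THEN iffD2], rule allI) (simp add: \<psi>_def inv_fourier_L2 L2_spinor_nth g)
  have "AE p in lebesgue. fourier2 \<psi> p = g p"
  proof (rule AE_spinor_eqI)
    fix i
    have "(\<lambda>x. \<psi> x $ i) = inv_fourier (\<lambda>p. g p $ i)" by (simp add: \<psi>_def fun_eq_iff)
    then show "AE p in lebesgue. fourier2 \<psi> p $ i = g p $ i"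
      unfolding fourier2_nth using fourier_inv_fourier[OF L2_spinor_nth[OF g]] by simp
  qed
  then have hG: "AE p in lebesgue. G p = hat \<psi> p"
    by eventually_elim (simp add: hat_def g_def)
  then have \<psi>Q: "\<psi> \<in> sobolev_H1" using \<psi> L2_cong_AE[OF G(1) hG] by (simp only: sobolev_iff)
  have "l2 (hat (f n - \<psi>)) = l2 (\<lambda>p. hat (f n) p - G p)" for n
    unfolding d[OF f \<psi>Q]
    by (rule l2_cong_AE[OF _ L2_diff[OF hf hat_L2[OF \<psi>Q]]]) (use hG in eventually_elim, simp)
  then show ?thesis using \<psi>Q G(2) by (intro bexI[of _ \<psi>]) (simp_all only:)
qed

section \<open>The symbol of the free operator\<close>

lemma H0_symbol_apply:
  "(H0_symbol A p *v v) $ 1 = of_real ((norm p)\<^sup>2) * v $ 1 + A p * v $ 2"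
  "(H0_symbol A p *v v) $ 2 = cnj (A p) * v $ 1 + of_real ((norm p)\<^sup>2) * v $ 2"
  by (simp_all add: H0_symbol_def matrix_vector_mult_def sum_2)

lemma Re_symbol:
  "Re (spinor_inner v (H0_symbol A p *v v)) = (norm p)\<^sup>2 * (norm v)\<^sup>2 + 2 * Re (cnj (v $ 1) * A p * v $ 2)"
proof -
  define z where "z = cnj (v $ 1) * A p * v $ 2"
  have "spinor_inner v (H0_symbol A p *v v)
      = of_real ((norm p)\<^sup>2) * (cnj (v $ 1) * v $ 1 + cnj (v $ 2) * v $ 2) + (z + cnj z)"
    by (simp add: z_def spinor_inner_def sum_2 H0_symbol_apply algebra_simps)
  also have "cnj (v $ 1) * v $ 1 + cnj (v $ 2) * v $ 2 = of_real ((norm v)\<^sup>2)"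
    using spinor_inner_self[of v] by (simp add: spinor_inner_def sum_2)
  finally show ?thesis unfolding z_def[symmetric] by simp
qed

text \<open>The eigenvalues of the matrix are \<open>|p|^2 - |A p|\<close> and
  \<open>|p|^2 + |A p|\<close>; the off-diagonal term is estimated by
  \<open>2 a b <= a^2 + b^2\<close>.\<close>

lemma Re_symbol_bounds:
  "lambda_minus A p * (norm v)\<^sup>2 \<le> Re (spinor_inner v (H0_symbol A p *v v))"
  "Re (spinor_inner v (H0_symbol A p *v v)) \<le> ((norm p)\<^sup>2 + cmod (A p)) * (norm v)\<^sup>2"
proof -
  have "\<bar>Re (cnj (v $ 1) * A p * v $ 2)\<bar> \<le> cmod (A p) * (cmod (v $ 1) * cmod (v $ 2))"
    using abs_Re_le_cmod[of "cnj (v $ 1) * A p * v $ 2"] by (simp add: norm_mult mult_ac)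
  then have "\<bar>2 * Re (cnj (v $ 1) * A p * v $ 2)\<bar> \<le> cmod (A p) * (2 * cmod (v $ 1) * cmod (v $ 2))"
    by simp
  also have "\<dots> \<le> cmod (A p) * (norm v)\<^sup>2"
    using sum_squares_bound[of "cmod (v $ 1)" "cmod (v $ 2)"]
    by (intro mult_left_mono) (simp_all add: norm_spinor_square sum_2)
  finally have b: "\<bar>2 * Re (cnj (v $ 1) * A p * v $ 2)\<bar> \<le> cmod (A p) * (norm v)\<^sup>2" .
  show "lambda_minus A p * (norm v)\<^sup>2 \<le> Re (spinor_inner v (H0_symbol A p *v v))"
    "Re (spinor_inner v (H0_symbol A p *v v)) \<le> ((norm p)\<^sup>2 + cmod (A p)) * (norm v)\<^sup>2"
    unfolding Re_symbol lambda_minus_def left_diff_distrib distrib_right using b by linarith+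
qed

text \<open>Division by the square of \<open>bracket p\<close> turns the quadratically growing
  symbol into a bounded multiplier acting on \<open>hat\<close>.\<close>

definition scaled_symbol :: "(plane \<Rightarrow> complex) \<Rightarrow> plane \<Rightarrow> spinor \<Rightarrow> spinor" where
  "scaled_symbol A p v = (1 / (1 + (norm p)\<^sup>2)) *\<^sub>R (H0_symbol A p *v v)"

lemma norm_symbol_le: "norm (H0_symbol A p *v v) \<le> 2 * ((norm p)\<^sup>2 + cmod (A p)) * norm v"
proof -
  have c: "cmod ((H0_symbol A p *v v) $ i) \<le> ((norm p)\<^sup>2 + cmod (A p)) * norm v" for i
  proof -
    have "cmod (of_real ((norm p)\<^sup>2) * v $ j + B * v $ k) \<le> ((norm p)\<^sup>2 + cmod (A p)) * norm v"
      if "cmod B = cmod (A p)" for j k B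
    proof -
      have "cmod (of_real ((norm p)\<^sup>2) * v $ j + B * v $ k) \<le> (norm p)\<^sup>2 * cmod (v $ j) + cmod (A p) * cmod (v $ k)"
        by (rule order_trans[OF norm_triangle_ineq]) (simp add: norm_mult that norm_power)
      also have "\<dots> \<le> (norm p)\<^sup>2 * norm v + cmod (A p) * norm v"
        by (intro add_mono mult_left_mono spinor_component_le) simp_all
      finally show ?thesis by (simp add: distrib_right)
    qed
    from this[of "A p" 1 2] this[of "cnj (A p)" 2 1] show ?thesis
      using exhaust_2[of i] by (auto simp: H0_symbol_apply add.commute)
  qed
  have "norm (H0_symbol A p *v v) \<le> (\<Sum>i\<in>UNIV. cmod ((H0_symbol A p *v v) $ i))"
    unfolding norm_vec_def by (rule L2_set_le_sum) simp
  also have "\<dots> \<le> (\<Sum>i\<in>(UNIV::2 set). ((norm p)\<^sup>2 + cmod (A p)) * norm v)"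
    by (intro sum_mono c)
  also have "\<dots> = 2 * (((norm p)\<^sup>2 + cmod (A p)) * norm v)" by simp
  finally show ?thesis by (simp only: mult.assoc)
qed

locale spin_potential = potential W r for W :: "plane \<Rightarrow> real" and r :: real +
  fixes A :: "plane \<Rightarrow> complex"
  assumes A_cont: "continuous_on UNIV A"
    and A_growth: "Limsup at_infinity (\<lambda>p. ereal (cmod (A p) / (norm p)\<^sup>2)) < 1"
begin

text \<open>The growth assumption controls \<open>A\<close> near infinity with a factor below 1, and
  continuity bounds it on the remaining disc.\<close>

lemma A_bound: "\<exists>\<theta> K. 0 \<le> \<theta> \<and> \<theta> < 1 \<and> 0 \<le> K \<and> (\<forall>p. cmod (A p) \<le> \<theta> * (norm p)\<^sup>2 + K)"
proof -
  obtain \<theta>0 where t0: "Limsup at_infinity (\<lambda>p. ereal (cmod (A p) / (norm p)\<^sup>2)) < ereal \<theta>0" "ereal \<theta>0 < 1"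
    using ereal_dense2[OF A_growth] by blast
  define \<theta> where "\<theta> = max \<theta>0 0"
  have t: "0 \<le> \<theta>" "\<theta> < 1" using t0(2) by (simp_all add: \<theta>_def)
  have "\<forall>\<^sub>F p in at_infinity. ereal (cmod (A p) / (norm p)\<^sup>2) < ereal \<theta>0"
    by (rule Limsup_lessD[OF t0(1)])
  then obtain b where b: "\<And>p. b \<le> norm p \<Longrightarrow> cmod (A p) / (norm p)\<^sup>2 < \<theta>0"
    unfolding eventually_at_infinity by auto
  \<comment> \<open>A radius of at least 1 keeps the origin inside the disc, so outside it the
    quotient by \<open>|p|^2\<close> can be cleared.\<close>
  have "compact (A ` cball 0 (max b 1))"
    by (rule compact_continuous_image[OF continuous_on_subset[OF A_cont] compact_cball]) simp
  then have "bounded (A ` cball 0 (max b 1))" by (rule compact_imp_bounded)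
  then obtain K where K: "\<And>p. p \<in> cball 0 (max b 1) \<Longrightarrow> cmod (A p) \<le> K"
    unfolding bounded_iff by blast
  have "cmod (A p) \<le> \<theta> * (norm p)\<^sup>2 + \<bar>K\<bar>" for p
  proof (cases "p \<in> cball 0 (max b 1)")
    case True
    have "0 \<le> \<theta> * (norm p)\<^sup>2" using t by simp
    then show ?thesis using K[OF True] by linarith
  next
    case False
    then have n: "norm p > b" "norm p > 1" by (simp_all add: dist_norm)
    then have "p \<noteq> 0" by fastforce
    then have "cmod (A p) < \<theta>0 * (norm p)\<^sup>2"
      using b[of p] n by (simp add: divide_less_eq)
    also have "\<dots> \<le> \<theta> * (norm p)\<^sup>2" by (intro mult_right_mono) (simp_all add: \<theta>_def)
    finally show ?thesis by linarith
  qed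
  with t show ?thesis by (intro exI[of _ \<theta>] exI[of _ "\<bar>K\<bar>"]) simp
qed

lemma kappa_le: "kappa A \<le> lambda_minus A p"
proof -
  obtain \<theta> K where t: "\<theta> < 1" "\<And>p. cmod (A p) \<le> \<theta> * (norm p)\<^sup>2 + K" using A_bound by blast
  have "- K \<le> lambda_minus A p" for p
  proof -
    have "\<theta> * (norm p)\<^sup>2 \<le> 1 * (norm p)\<^sup>2" using t(1) by (intro mult_right_mono) simp_all
    then show ?thesis using t(2)[of p] unfolding lambda_minus_def by linarith
  qed
  then have "bdd_below (range (lambda_minus A))" by (intro bdd_belowI2)
  then show ?thesis unfolding kappa_def by (rule cINF_lower) simp
qed

text \<open>A convex combination of two lower bounds: the gap \<open>d = kappa A - E\<close>,
  uniform in \<open>p\<close>, and the growth \<open>(1 - \<theta>) * |p|^2 - D\<close>. The weight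
  \<open>m\<close> is chosen so that the constant terms leave \<open>d / 2\<close>.\<close>

lemma symbol_lower:
  assumes E: "E < kappa A"
  shows "\<exists>c>0. \<forall>p. c * (1 + (norm p)\<^sup>2) \<le> lambda_minus A p - E"
proof -
  obtain \<theta> K where t: "\<theta> < 1" "0 \<le> K" "\<And>p. cmod (A p) \<le> \<theta> * (norm p)\<^sup>2 + K" using A_bound by blast
  define d where "d = kappa A - E"
  define D where "D = K + \<bar>E\<bar> + 1"
  define m where "m = d / (2 * (d + D))"
  have d: "0 < d" using E by (simp add: d_def)
  have D: "0 < D" using t(2) by (simp add: D_def)
  have m: "0 < m" "m < 1" "m * (d + D) = d / 2" using d D by (simp_all add: m_def field_simps)
  define c where "c = min (d / 2) (m * (1 - \<theta>))"
  have c: "0 < c" using d m t by (simp add: c_def)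
  have "c * (1 + (norm p)\<^sup>2) \<le> lambda_minus A p - E" for p
  proof -
    have 1: "d \<le> lambda_minus A p - E" using kappa_le[of p] by (simp add: d_def)
    have 2: "(1 - \<theta>) * (norm p)\<^sup>2 - D \<le> lambda_minus A p - E"
    proof -
      have "(1 - \<theta>) * (norm p)\<^sup>2 = (norm p)\<^sup>2 - \<theta> * (norm p)\<^sup>2" by (simp add: left_diff_distrib)
      then show ?thesis using t(3)[of p] unfolding lambda_minus_def D_def by linarith
    qed
    have "c * (1 + (norm p)\<^sup>2) = c + c * (norm p)\<^sup>2" by (simp add: distrib_left)
    also have "\<dots> \<le> d / 2 + m * (1 - \<theta>) * (norm p)\<^sup>2"
      by (intro add_mono mult_right_mono) (simp_all add: c_def)
    also have "d / 2 = (1 - m) * d - m * D" using m(3) by (simp add: algebra_simps)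
    also have "(1 - m) * d - m * D + m * (1 - \<theta>) * (norm p)\<^sup>2 = (1 - m) * d + m * ((1 - \<theta>) * (norm p)\<^sup>2 - D)"
      by (simp add: algebra_simps)
    also have "\<dots> \<le> (1 - m) * (lambda_minus A p - E) + m * (lambda_minus A p - E)"
      by (intro add_mono mult_left_mono 1 2) (use m in simp_all)
    also have "\<dots> = lambda_minus A p - E" by (simp add: left_diff_distrib)
    finally show ?thesis .
  qed
  with c show ?thesis by blast
qed

lemma A_measurable: "A \<in> borel_measurable lebesgue"
  by (rule borel_lebesgue_measurable[OF borel_measurable_continuous_onI[OF A_cont]])

lemma scaled_symbol_measurable:
  assumes "f \<in> borel_measurable lebesgue"
  shows "(\<lambda>x. scaled_symbol A x (f x)) \<in> borel_measurable lebesgue"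
proof -
  have n: "(\<lambda>p::plane. complex_of_real ((norm p)\<^sup>2)) \<in> borel_measurable lebesgue"
    by (rule borel_lebesgue_measurable) measurable
  have n': "(\<lambda>p::plane. 1 / (1 + (norm p)\<^sup>2)) \<in> borel_measurable lebesgue"
    by (rule borel_lebesgue_measurable) measurable
  have "(\<lambda>x. H0_symbol A x *v f x) \<in> borel_measurable lebesgue"
  proof (rule borel_measurable_spinor)
    fix i :: 2
    consider "i = 1" | "i = 2" using exhaust_2[of i] by blast
    then show "(\<lambda>x. (H0_symbol A x *v f x) $ i) \<in> borel_measurable lebesgue"
      by cases (simp_all only: H0_symbol_apply, (intro borel_measurable_add borel_measurable_times n A_measurable
        borel_measurable_cnj borel_measurable_spinor_nth assms)+)
  qed
  then show ?thesis unfolding scaled_symbol_def by (intro borel_measurable_scaleR n')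
qed

lemma scaled_symbol_form: "\<exists>C. multiplier_form sobolev_H1 hat (scaled_symbol A) C"
proof -
  obtain \<theta> K where t: "0 \<le> \<theta>" "0 \<le> K" "\<And>p. cmod (A p) \<le> \<theta> * (norm p)\<^sup>2 + K" using A_bound by blast
  define C where "C = 2 * (1 + \<theta> + K)"
  have "multiplier_form sobolev_H1 hat (scaled_symbol A) C"
  proof
    fix x :: plane and u v :: spinor and c
    show "norm (scaled_symbol A x v) \<le> C * norm v"
    proof -
      let ?n = "1 + (norm x)\<^sup>2"
      have n: "0 < ?n" by (simp add: add_pos_nonneg)
      have "(norm x)\<^sup>2 + cmod (A x) \<le> (norm x)\<^sup>2 + \<theta> * (norm x)\<^sup>2 + K" using t(3)[of x] by linarith
      also have "\<dots> \<le> (1 + \<theta> + K) * ?n"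
        using t(1,2) by (simp add: algebra_simps)
      finally have le: "(norm x)\<^sup>2 + cmod (A x) \<le> (1 + \<theta> + K) * ?n" .
      have "norm (H0_symbol A x *v v) \<le> 2 * ((norm x)\<^sup>2 + cmod (A x)) * norm v" by (rule norm_symbol_le)
      also have "\<dots> \<le> 2 * ((1 + \<theta> + K) * ?n) * norm v"
        by (intro mult_right_mono mult_left_mono le) simp_all
      also have "\<dots> = ?n * (C * norm v)" by (simp add: C_def)
      finally have "norm (H0_symbol A x *v v) / ?n \<le> C * norm v"
        using n by (simp add: pos_divide_le_eq mult.commute)
      then show ?thesis using n by (simp add: scaled_symbol_def)
    qed
    show "scaled_symbol A x (u + v) = scaled_symbol A x u + scaled_symbol A x v"
      by (simp add: scaled_symbol_def matrix_vector_right_distrib scaleR_right_distrib)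
    have cs: "H0_symbol A x *v (c *s v) = c *s (H0_symbol A x *v v)"
      by (simp add: vec_eq_iff forall_2 H0_symbol_apply algebra_simps)
    show "scaled_symbol A x (c *s v) = c *s scaled_symbol A x v"
      unfolding scaled_symbol_def cs by (simp add: vec_eq_iff scaleR_conv_of_real[where 'a = complex])
    have "spinor_inner u (H0_symbol A x *v v) = cnj (spinor_inner v (H0_symbol A x *v u))"
      by (simp add: spinor_inner_def sum_2 H0_symbol_apply algebra_simps)
    then show "spinor_inner u (scaled_symbol A x v) = cnj (spinor_inner v (scaled_symbol A x u))"
      by (simp add: scaled_symbol_def spinor_inner_scaleR_right)
  qed (rule subspace_sobolev, erule hat_L2, rule hat_add[OF sobolev_L2 sobolev_L2], assumption+,
      rule hat_smult[OF sobolev_L2], assumption, erule scaled_symbol_measurable)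
  then show ?thesis ..
qed

lemma spinor_scaled_symbol:
  "spinor_inner (hat \<phi> p) (scaled_symbol A p (hat \<psi> p)) = spinor_inner (fourier2 \<phi> p) (H0_symbol A p *v fourier2 \<psi> p)"
proof -
  have cs: "H0_symbol A p *v (a *\<^sub>R v) = a *\<^sub>R (H0_symbol A p *v v)" for a v
    by (simp add: vec_eq_iff forall_2 H0_symbol_apply scaleR_conv_of_real[where 'a = complex] algebra_simps)
  have "bracket p * (1 / (1 + (norm p)\<^sup>2)) * bracket p = 1"
    using bracket_square[of p] by (simp add: power2_eq_square[of "bracket p"] flip: bracket_square)
  then have "complex_of_real (bracket p * (1 / (1 + (norm p)\<^sup>2)) * bracket p) = 1" by simp
  then show ?thesis
    unfolding hat_def scaled_symbol_def cs spinor_inner_scaleR_left spinor_inner_scaleR_right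
    by (simp flip: mult.assoc of_real_mult)
qed

text \<open>Identifies the bounded multiplier form on \<open>hat\<close> with the unweighted
  momentum-space expression in the definition of \<open>H0_form\<close>; the weights cancel.\<close>

lemma H0_form_eq: "multiplier_form.form hat (scaled_symbol A) = H0_form A"
proof -
  obtain C where "multiplier_form sobolev_H1 hat (scaled_symbol A) C" using scaled_symbol_form by blast
  then interpret t: multiplier_form sobolev_H1 hat "scaled_symbol A" C .
  show ?thesis by (intro ext) (simp only: t.form_def H0_form_def spinor_scaled_symbol)
qed

lemma H0_form_hermitian: "hermitian_form smult sobolev_H1 (H0_form A)"
  using scaled_symbol_form multiplier_form.hermitian H0_form_eq by metis

lemma Re_H0_form:
  assumes "\<psi> \<in> sobolev_H1"
  shows "integrable lebesgue (\<lambda>p. Re (spinor_inner (fourier2 \<psi> p) (H0_symbol A p *v fourier2 \<psi> p)))"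
    "Re (H0_form A \<psi> \<psi>) = (LINT p|lebesgue. Re (spinor_inner (fourier2 \<psi> p) (H0_symbol A p *v fourier2 \<psi> p)))"
proof -
  obtain C where "multiplier_form sobolev_H1 hat (scaled_symbol A) C" using scaled_symbol_form by blast
  then interpret t: multiplier_form sobolev_H1 hat "scaled_symbol A" C .
  show "integrable lebesgue (\<lambda>p. Re (spinor_inner (fourier2 \<psi> p) (H0_symbol A p *v fourier2 \<psi> p)))"
    using t.Re_form(1)[OF assms] by (simp only: spinor_scaled_symbol)
  show "Re (H0_form A \<psi> \<psi>) = (LINT p|lebesgue. Re (spinor_inner (fourier2 \<psi> p) (H0_symbol A p *v fourier2 \<psi> p)))"
    using t.Re_form(2)[OF assms] by (simp only: spinor_scaled_symbol H0_form_eq)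
qed

lemma l2_fourier2:
  assumes "\<psi> \<in> L2"
  shows "l2 (fourier2 \<psi>) = l2 \<psi>"
proof -
  have "(l2 (fourier2 \<psi>))\<^sup>2 = (l2 \<psi>)\<^sup>2"
    unfolding l2_spinor_square[OF assms] l2_spinor_square[OF fourier2_L2[OF assms]] fourier2_nth
    by (intro sum.cong refl) (simp add: fourier_l2[OF L2_spinor_nth[OF assms]])
  then show ?thesis by (rule power2_eq_imp_eq) simp_all
qed

end

context potential
begin

definition wt2 :: "(plane \<Rightarrow> spinor) \<Rightarrow> plane \<Rightarrow> spinor" where
  "wt2 \<psi> x = sqrt (W x) *\<^sub>R \<psi> x"

lemma wt2_nth: "(\<lambda>x. wt2 \<psi> x $ i) = wt (\<lambda>x. \<psi> x $ i)"
  by (simp add: wt2_def fun_eq_iff)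

lemma sobolev_nth:
  assumes "\<psi> \<in> sobolev_H1"
  shows "(\<lambda>x. \<psi> x $ i) \<in> H1" "h1 (\<lambda>x. \<psi> x $ i) = l2 (\<lambda>p. hat \<psi> p $ i)"
proof -
  have eq: "(norm (hat \<psi> p $ i))\<^sup>2 = (1 + (norm p)\<^sup>2) * (cmod (fourier (\<lambda>x. \<psi> x $ i) p))\<^sup>2" for p
    by (simp add: hat_def fourier2_nth power_mult_distrib bracket_square)
  show "h1 (\<lambda>x. \<psi> x $ i) = l2 (\<lambda>p. hat \<psi> p $ i)"
    unfolding h1_def l2_def eq ..
  show "(\<lambda>x. \<psi> x $ i) \<in> H1"
    unfolding H1_def mem_Collect_eq
    using L2_spinor_nth[OF sobolev_L2[OF assms]] L2_integrable[OF L2_spinor_nth[OF hat_L2[OF assms]], of i]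
    unfolding eq by (rule conjI)
qed

lemma wt2_L2: "\<psi> \<in> sobolev_H1 \<Longrightarrow> wt2 \<psi> \<in> L2"
  by (rule L2_spinor_iff[THEN iffD2], rule allI, unfold wt2_nth) (rule wt_tail(1)[OF sobolev_nth(1)])

lemma wt2_form: "l2_form sobolev_H1 wt2"
proof
  fix \<phi> \<psi> :: "plane \<Rightarrow> spinor" and c
  show "AE x in lebesgue. wt2 (\<phi> + \<psi>) x = wt2 \<phi> x + wt2 \<psi> x"
    by (simp add: wt2_def scaleR_right_distrib)
  show "AE x in lebesgue. wt2 (smult c \<psi>) x = c *s wt2 \<psi> x"
    by (simp add: wt2_def smult_def vec_eq_iff scaleR_conv_of_real[where 'a = complex])
qed (rule subspace_sobolev, erule wt2_L2)

sublocale w: l2_form sobolev_H1 wt2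
  by (rule wt2_form)

lemma w_form_eq: "w.form \<phi> \<psi> = (LINT x|lebesgue. of_real (W x) * spinor_inner (\<phi> x) (\<psi> x))"
  unfolding w.form_def
proof (intro Bochner_Integration.integral_cong refl)
  fix x
  have "complex_of_real (sqrt (W x)) * complex_of_real (sqrt (W x)) = of_real (W x)"
    using W_nonneg[of x] by (simp flip: of_real_mult)
  then show "spinor_inner (wt2 \<phi> x) (wt2 \<psi> x) = of_real (W x) * spinor_inner (\<phi> x) (\<psi> x)"
    by (simp add: wt2_def spinor_inner_scaleR_left spinor_inner_scaleR_right flip: mult.assoc)
qed

lemma wt2_square: "\<psi> \<in> sobolev_H1 \<Longrightarrow> (l2 (wt2 \<psi>))\<^sup>2 = (\<Sum>i\<in>UNIV. (l2 (wt (\<lambda>x. \<psi> x $ i)))\<^sup>2)"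
  using l2_spinor_square[OF wt2_L2, of \<psi>] by (simp only: wt2_nth)

lemma wt2_relative_bound:
  assumes e: "e > 0"
  shows "\<exists>C. \<forall>\<psi>\<in>sobolev_H1. (l2 (wt2 \<psi>))\<^sup>2 \<le> e * (l2 (hat \<psi>))\<^sup>2 + C * (l2 \<psi>)\<^sup>2"
proof -
  \<comment> \<open>The factor 2 anticipates the square of a sum of two terms.\<close>
  have "(\<lambda>k. 2 * (tail_const * rate ^ k)\<^sup>2) \<longlonglongrightarrow> 2 * (tail_const * 0)\<^sup>2"
    using rate_bounds by (intro tendsto_intros LIMSEQ_realpow_zero) auto
  then have "(\<lambda>k. 2 * (tail_const * rate ^ k)\<^sup>2) \<longlonglongrightarrow> 0" by simp
  from eventually_happens'[OF sequentially_bot order_tendstoD(2)[OF this e]]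
  obtain k where k: "2 * (tail_const * rate ^ k)\<^sup>2 < e" by blast
  define C where "C = 2 * (sqrt (LINT x|lebesgue. W x) * 2 ^ Suc k)\<^sup>2"
  have "(l2 (wt2 \<psi>))\<^sup>2 \<le> e * (l2 (hat \<psi>))\<^sup>2 + C * (l2 \<psi>)\<^sup>2" if \<psi>: "\<psi> \<in> sobolev_H1" for \<psi>
  proof -
    have comp: "(l2 (wt (\<lambda>x. \<psi> x $ i)))\<^sup>2 \<le> e * (l2 (\<lambda>p. hat \<psi> p $ i))\<^sup>2 + C * (l2 (\<lambda>x. \<psi> x $ i))\<^sup>2" for i
    proof -
      let ?a = "tail_const * rate ^ k * l2 (\<lambda>p. hat \<psi> p $ i)"
      let ?b = "sqrt (LINT x|lebesgue. W x) * 2 ^ Suc k * l2 (\<lambda>x. \<psi> x $ i)"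
      have "l2 (wt (\<lambda>x. \<psi> x $ i)) \<le> ?a + ?b"
        using wt_bound[OF sobolev_nth(1)[OF \<psi>, of i], of k] unfolding sobolev_nth(2)[OF \<psi>] by (simp only: mult.assoc)
      then have "(l2 (wt (\<lambda>x. \<psi> x $ i)))\<^sup>2 \<le> (?a + ?b)\<^sup>2" by (rule power_mono) simp
      also have "\<dots> \<le> 2 * ?a\<^sup>2 + 2 * ?b\<^sup>2"
        using sum_squares_bound[of ?a ?b] by (simp only: power2_sum)
      also have "2 * ?a\<^sup>2 = 2 * (tail_const * rate ^ k)\<^sup>2 * (l2 (\<lambda>p. hat \<psi> p $ i))\<^sup>2"
        by (simp only: power_mult_distrib mult.assoc)
      also have "\<dots> \<le> e * (l2 (\<lambda>p. hat \<psi> p $ i))\<^sup>2"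
        using k by (intro mult_right_mono) simp_all
      also have "2 * ?b\<^sup>2 = C * (l2 (\<lambda>x. \<psi> x $ i))\<^sup>2"
        by (simp only: C_def power_mult_distrib mult.assoc)
      finally show ?thesis by linarith
    qed
    have "(l2 (wt2 \<psi>))\<^sup>2 \<le> (\<Sum>i\<in>UNIV. e * (l2 (\<lambda>p. hat \<psi> p $ i))\<^sup>2 + C * (l2 (\<lambda>x. \<psi> x $ i))\<^sup>2)"
      unfolding wt2_square[OF \<psi>] by (intro sum_mono comp)
    also have "\<dots> = e * (l2 (hat \<psi>))\<^sup>2 + C * (l2 \<psi>)\<^sup>2"
      unfolding l2_spinor_square[OF hat_L2[OF \<psi>]] l2_spinor_square[OF sobolev_L2[OF \<psi>]]
      by (simp only: sum.distrib sum_distrib_left)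
    finally show ?thesis .
  qed
  then show ?thesis by blast
qed

lemma wt2_compact:
  assumes f: "\<And>n. f n \<in> sobolev_H1" and B: "\<And>n. (l2 (hat (f n)))\<^sup>2 \<le> B"
  shows "\<exists>a. strict_mono (a :: nat \<Rightarrow> nat) \<and> (\<forall>e>0. \<exists>M. \<forall>m\<ge>M. \<forall>n\<ge>M. (l2 (wt2 (f (a m) - f (a n))))\<^sup>2 < e)"
proof -
  interpret vector_space smult by (rule vector_space_smult)
  have hB: "h1 (\<lambda>x. f n x $ i) \<le> sqrt B" for n i
  proof -
    have "(l2 (\<lambda>p. hat (f n) p $ i))\<^sup>2 \<le> (l2 (hat (f n)))\<^sup>2"
      unfolding l2_spinor_square[OF hat_L2[OF f]] by (rule member_le_sum) simp_all
    then have "(l2 (\<lambda>p. hat (f n) p $ i))\<^sup>2 \<le> B" using B[of n] by linarith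
    then show ?thesis unfolding sobolev_nth(2)[OF f] by (rule real_le_rsqrt)
  qed
  obtain a where a: "strict_mono (a :: nat \<Rightarrow> nat)"
    and ca: "\<forall>e>0. \<exists>M. \<forall>m\<ge>M. \<forall>n\<ge>M. l2 (\<lambda>x. wt (\<lambda>x. f (a m) x $ 1) x - wt (\<lambda>x. f (a n) x $ 1) x) < e"
    using wt_compact[of "\<lambda>n x. f n x $ 1", OF sobolev_nth(1)[OF f] hB] by (elim exE conjE) (rule that)
  \<comment> \<open>The second component is treated along the subsequence already chosen for the
    first.\<close>
  obtain b where b: "strict_mono (b :: nat \<Rightarrow> nat)"
    and cb: "\<forall>e>0. \<exists>M. \<forall>m\<ge>M. \<forall>n\<ge>M. l2 (\<lambda>x. wt (\<lambda>x. f (a (b m)) x $ 2) x - wt (\<lambda>x. f (a (b n)) x $ 2) x) < e"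
    using wt_compact[of "\<lambda>n x. f (a n) x $ 2", OF sobolev_nth(1)[OF f] hB] by (elim exE conjE) (rule that)
  have "\<exists>M. \<forall>m\<ge>M. \<forall>n\<ge>M. (l2 (wt2 (f ((a \<circ> b) m) - f ((a \<circ> b) n))))\<^sup>2 < e" if e: "e > 0" for e
  proof -
    have e2: "sqrt (e / 2) > 0" using e by simp
    obtain M1 where M1: "\<And>m n. m \<ge> M1 \<Longrightarrow> n \<ge> M1 \<Longrightarrow> l2 (\<lambda>x. wt (\<lambda>x. f (a m) x $ 1) x - wt (\<lambda>x. f (a n) x $ 1) x) < sqrt (e / 2)"
      using ca[rule_format, OF e2] by blast
    obtain M2 where M2: "\<And>m n. m \<ge> M2 \<Longrightarrow> n \<ge> M2 \<Longrightarrow> l2 (\<lambda>x. wt (\<lambda>x. f (a (b m)) x $ 2) x - wt (\<lambda>x. f (a (b n)) x $ 2) x) < sqrt (e / 2)"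
      using cb[rule_format, OF e2] by blast
    have "(l2 (wt2 (f ((a \<circ> b) m) - f ((a \<circ> b) n))))\<^sup>2 < e" if mn: "m \<ge> max M1 M2" "n \<ge> max M1 M2" for m n
    proof -
      let ?m = "(a \<circ> b) m" and ?n = "(a \<circ> b) n"
      have Q: "f ?m - f ?n \<in> sobolev_H1" by (rule subspace_diff[OF subspace_sobolev f f])
      have dist: "wt (\<lambda>x. (f ?m - f ?n) x $ i) = (\<lambda>x. wt (\<lambda>x. f ?m x $ i) x - wt (\<lambda>x. f ?n x $ i) x)" for i
        by (simp add: fun_eq_iff scaleR_right_diff_distrib)
      have "b m \<ge> M1" "b n \<ge> M1" using mn seq_suble[OF b, of m] seq_suble[OF b, of n] by linarith+
      then have 1: "l2 (wt (\<lambda>x. (f ?m - f ?n) x $ 1)) < sqrt (e / 2)"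
        unfolding dist unfolding o_def by (rule M1)
      have 2: "l2 (wt (\<lambda>x. (f ?m - f ?n) x $ 2)) < sqrt (e / 2)"
        unfolding dist unfolding o_def by (rule M2) (use mn in linarith)+
      have "(l2 (wt (\<lambda>x. (f ?m - f ?n) x $ 1)))\<^sup>2 < (sqrt (e / 2))\<^sup>2" "(l2 (wt (\<lambda>x. (f ?m - f ?n) x $ 2)))\<^sup>2 < (sqrt (e / 2))\<^sup>2"
        by (rule power_strict_mono[OF 1]; simp) (rule power_strict_mono[OF 2]; simp)
      then show ?thesis unfolding wt2_square[OF Q] sum_2 using e by simp
    qed
    then show ?thesis by blast
  qed
  then have "\<forall>e>0. \<exists>M. \<forall>m\<ge>M. \<forall>n\<ge>M. (l2 (wt2 (f ((a \<circ> b) m) - f ((a \<circ> b) n))))\<^sup>2 < e"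
    by (intro allI impI)
  moreover have "strict_mono (a \<circ> b)" using a b by (rule strict_mono_o)
  ultimately show ?thesis by (intro exI[of _ "a \<circ> b"] conjI)
qed

end

section \<open>Verification of the abstract hypotheses\<close>

context spin_potential
begin

lemma H0_form_le: "\<exists>C. \<forall>\<psi>\<in>sobolev_H1. Re (H0_form A \<psi> \<psi>) \<le> C * (l2 (hat \<psi>))\<^sup>2"
proof -
  obtain \<theta> K where t: "0 \<le> \<theta>" "0 \<le> K" "\<And>p. cmod (A p) \<le> \<theta> * (norm p)\<^sup>2 + K" using A_bound by blast
  have "Re (H0_form A \<psi> \<psi>) \<le> (1 + \<theta> + K) * (l2 (hat \<psi>))\<^sup>2" if \<psi>: "\<psi> \<in> sobolev_H1" for \<psi>
  proof -
    have "Re (H0_form A \<psi> \<psi>) \<le> (LINT p|lebesgue. (1 + \<theta> + K) * (norm (hat \<psi> p))\<^sup>2)"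
      unfolding Re_H0_form(2)[OF \<psi>]
    proof (rule integral_mono[OF Re_H0_form(1)[OF \<psi>] integrable_mult_right[OF L2_integrable[OF hat_L2[OF \<psi>]]]])
      fix p
      have "Re (spinor_inner (fourier2 \<psi> p) (H0_symbol A p *v fourier2 \<psi> p)) \<le> ((norm p)\<^sup>2 + cmod (A p)) * (norm (fourier2 \<psi> p))\<^sup>2"
        by (rule Re_symbol_bounds(2))
      also have "\<dots> \<le> ((1 + \<theta> + K) * (1 + (norm p)\<^sup>2)) * (norm (fourier2 \<psi> p))\<^sup>2"
      proof (rule mult_right_mono)
        have "0 \<le> K * (norm p)\<^sup>2" using t by simp
        then show "(norm p)\<^sup>2 + cmod (A p) \<le> (1 + \<theta> + K) * (1 + (norm p)\<^sup>2)"
          using t(3)[of p] t(1) by (simp add: algebra_simps)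
      qed simp
      finally show "Re (spinor_inner (fourier2 \<psi> p) (H0_symbol A p *v fourier2 \<psi> p)) \<le> (1 + \<theta> + K) * (norm (hat \<psi> p))\<^sup>2"
        by (simp only: norm_hat_square mult.assoc)
    qed
    also have "\<dots> = (1 + \<theta> + K) * (l2 (hat \<psi>))\<^sup>2"
      unfolding l2_square by (rule integral_mult_right_zero)
    finally show ?thesis .
  qed
  then show ?thesis by blast
qed

lemma H0_form_ge:
  assumes "E < kappa A"
  shows "\<exists>c>0. \<forall>\<psi>\<in>sobolev_H1. c * (l2 (hat \<psi>))\<^sup>2 \<le> Re (H0_form A \<psi> \<psi>) - E * (l2 \<psi>)\<^sup>2"
proof -
  obtain c where c: "c > 0" "\<And>p. c * (1 + (norm p)\<^sup>2) \<le> lambda_minus A p - E"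
    using symbol_lower[OF assms] by blast
  have "c * (l2 (hat \<psi>))\<^sup>2 + E * (l2 \<psi>)\<^sup>2 \<le> Re (H0_form A \<psi> \<psi>)" if \<psi>: "\<psi> \<in> sobolev_H1" for \<psi>
  proof -
    note i = integrable_mult_right[OF L2_integrable[OF hat_L2[OF \<psi>]], of c]
      integrable_mult_right[OF L2_integrable[OF fourier2_L2[OF sobolev_L2[OF \<psi>]]], of E]
    have "c * (l2 (hat \<psi>))\<^sup>2 + E * (l2 \<psi>)\<^sup>2 = (LINT p|lebesgue. c * (norm (hat \<psi> p))\<^sup>2) + (LINT p|lebesgue. E * (norm (fourier2 \<psi> p))\<^sup>2)"
      unfolding l2_fourier2[OF sobolev_L2[OF \<psi>], symmetric] l2_square integral_mult_right_zero ..
    also have "\<dots> = (LINT p|lebesgue. c * (norm (hat \<psi> p))\<^sup>2 + E * (norm (fourier2 \<psi> p))\<^sup>2)"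
      by (rule Bochner_Integration.integral_add[OF i, symmetric])
    also have "\<dots> \<le> Re (H0_form A \<psi> \<psi>)"
      unfolding Re_H0_form(2)[OF \<psi>]
    proof (rule integral_mono[OF Bochner_Integration.integrable_add[OF i] Re_H0_form(1)[OF \<psi>]])
      fix p
      have "c * (norm (hat \<psi> p))\<^sup>2 + E * (norm (fourier2 \<psi> p))\<^sup>2 = (c * (1 + (norm p)\<^sup>2) + E) * (norm (fourier2 \<psi> p))\<^sup>2"
        by (simp add: norm_hat_square algebra_simps)
      also have "\<dots> \<le> lambda_minus A p * (norm (fourier2 \<psi> p))\<^sup>2"
        using c(2)[of p] by (intro mult_right_mono) simp_all
      also have "\<dots> \<le> Re (spinor_inner (fourier2 \<psi> p) (H0_symbol A p *v fourier2 \<psi> p))"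
        by (rule Re_symbol_bounds(1))
      finally show "c * (norm (hat \<psi> p))\<^sup>2 + E * (norm (fourier2 \<psi> p))\<^sup>2 \<le> Re (spinor_inner (fourier2 \<psi> p) (H0_symbol A p *v fourier2 \<psi> p))" .
    qed
    finally show ?thesis .
  qed
  then have "\<forall>\<psi>\<in>sobolev_H1. c * (l2 (hat \<psi>))\<^sup>2 \<le> Re (H0_form A \<psi> \<psi>) - E * (l2 \<psi>)\<^sup>2" by (simp add: algebra_simps)
  with c(1) show ?thesis by blast
qed

lemma Re_ip: "\<psi> \<in> sobolev_H1 \<Longrightarrow> Re (L2_inner \<psi> \<psi>) = (l2 \<psi>)\<^sup>2"
  using ip.form_self[of \<psi>] by (simp add: ip_form)

lemma Re_n1: "\<psi> \<in> sobolev_H1 \<Longrightarrow> Re (n1.form \<psi> \<psi>) = (l2 (hat \<psi>))\<^sup>2"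
  using n1.form_self[of \<psi>] by simp

lemma Re_w: "\<psi> \<in> sobolev_H1 \<Longrightarrow> Re (w.form \<psi> \<psi>) = (l2 (wt2 \<psi>))\<^sup>2"
  using w.form_self[of \<psi>] by simp

lemma sobolev_diff: "\<phi> \<in> sobolev_H1 \<Longrightarrow> \<psi> \<in> sobolev_H1 \<Longrightarrow> \<phi> - \<psi> \<in> sobolev_H1"
proof -
  interpret vector_space smult by (rule vector_space_smult)
  show "\<phi> \<in> sobolev_H1 \<Longrightarrow> \<psi> \<in> sobolev_H1 \<Longrightarrow> \<phi> - \<psi> \<in> sobolev_H1"
    by (rule subspace_diff[OF subspace_sobolev])
qed

sublocale P: compact_perturbation smult sobolev_H1 L2_inner n1.form "H0_form A" w.form "kappa A"
proof (intro compact_perturbation.intro compact_perturbation_axioms.intro vector_space_smult)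
  show "positive_form smult sobolev_H1 L2_inner" using ip.positive by (simp only: ip_form)
  show "positive_form smult sobolev_H1 n1.form" by (rule n1.positive)
  show "positive_form smult sobolev_H1 w.form" by (rule w.positive)
  show "hermitian_form smult sobolev_H1 (H0_form A)" by (rule H0_form_hermitian)
  show "\<exists>C. \<forall>x\<in>sobolev_H1. Re (H0_form A x x) \<le> C * Re (n1.form x x)"
    using H0_form_le by (simp add: Re_n1)
  show "\<exists>c>0. \<forall>x\<in>sobolev_H1. c * Re (n1.form x x) \<le> Re (H0_form A x x) - E * Re (L2_inner x x)" if "E < kappa A" for E
    using H0_form_ge[OF that] by (simp add: Re_n1 Re_ip)
  show "\<exists>C. \<forall>x\<in>sobolev_H1. Re (w.form x x) \<le> e * Re (n1.form x x) + C * Re (L2_inner x x)" if "0 < e" for e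
    using wt2_relative_bound[OF that] by (simp add: Re_n1 Re_ip Re_w)
  show "Re (L2_inner \<psi> \<psi>) \<le> Re (n1.form \<psi> \<psi>)" if \<psi>: "\<psi> \<in> sobolev_H1" for \<psi>
    unfolding Re_n1[OF \<psi>] Re_ip[OF \<psi>] l2_fourier2[OF sobolev_L2[OF \<psi>], symmetric] l2_square
  proof (rule integral_mono[OF L2_integrable[OF fourier2_L2[OF sobolev_L2[OF \<psi>]]] L2_integrable[OF hat_L2[OF \<psi>]]])
    show "(norm (fourier2 \<psi> p))\<^sup>2 \<le> (norm (hat \<psi> p))\<^sup>2" for p
      unfolding norm_hat_square by (simp add: distrib_right)
  qed
  show "\<exists>a. strict_mono (a :: nat \<Rightarrow> nat) \<and> (\<forall>e>0. \<exists>M. \<forall>m\<ge>M. \<forall>n\<ge>M. Re (w.form (f (a m) - f (a n)) (f (a m) - f (a n))) < e)"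
    if f: "\<And>n. f n \<in> sobolev_H1" and B: "\<And>n. Re (n1.form (f n) (f n)) \<le> B" for f :: "nat \<Rightarrow> plane \<Rightarrow> spinor" and B
  proof -
    have "(l2 (hat (f n)))\<^sup>2 \<le> B" for n using B[of n] Re_n1[OF f] by simp
    from wt2_compact[of f B, OF f this] show ?thesis
      by (simp add: Re_w[OF sobolev_diff[OF f f]])
  qed
  show "\<exists>x\<in>sobolev_H1. (\<lambda>n. Re (n1.form (f n - x) (f n - x))) \<longlonglongrightarrow> 0"
    if f: "\<And>n. f n \<in> sobolev_H1"
      and c: "\<forall>e>0. \<exists>M. \<forall>m\<ge>M. \<forall>n\<ge>M. Re (n1.form (f m - f n) (f m - f n)) < e" for f :: "nat \<Rightarrow> plane \<Rightarrow> spinor"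
  proof -
    have "\<exists>M. \<forall>m\<ge>M. \<forall>n\<ge>M. l2 (hat (f m - f n)) < e" if e: "e > 0" for e
    proof -
      from c e have "\<exists>M. \<forall>m\<ge>M. \<forall>n\<ge>M. (l2 (hat (f m - f n)))\<^sup>2 < e\<^sup>2"
        by (simp add: Re_n1[OF sobolev_diff[OF f f]])
      then obtain M where "\<And>m n. m \<ge> M \<Longrightarrow> n \<ge> M \<Longrightarrow> (l2 (hat (f m - f n)))\<^sup>2 < e\<^sup>2" by blast
      then have "l2 (hat (f m - f n)) < e" if "m \<ge> M" "n \<ge> M" for m n
        using that e by (intro power2_less_imp_less[of _ e]) simp_all
      then show ?thesis by blast
    qed
    from sobolev_complete[OF f this] obtain \<psi> where \<psi>: "\<psi> \<in> sobolev_H1" "(\<lambda>n. l2 (hat (f n - \<psi>))) \<longlonglongrightarrow> 0" by blast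
    from tendsto_power[OF \<psi>(2), of 2] \<psi>(1) show ?thesis
      by (intro bexI[of _ \<psi>]) (simp_all add: Re_n1[OF sobolev_diff[OF f \<psi>(1)]])
  qed
qed

end

section \<open>Trial functions\<close>

text \<open>At a minimum the gradient vanishes, so Lipschitz continuity of the gradient gives a quadratic bound.\<close>
lemma quadratic_bound_at_minimum:
  fixes g :: "plane \<Rightarrow> real"
  assumes U: "open U" "p0 \<in> U" and C2: "C2_on U g" and min: "\<And>p. (norm p0)\<^sup>2 - g p0 \<le> (norm p)\<^sup>2 - g p"
  shows "\<exists>C \<rho>. 0 \<le> C \<and> 0 < \<rho> \<and> (\<forall>p. norm (p - p0) < \<rho> \<longrightarrow> ((norm p)\<^sup>2 - g p) - ((norm p0)\<^sup>2 - g p0) \<le> C * (norm (p - p0))\<^sup>2)"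
proof -
  obtain g' :: "plane \<Rightarrow> plane \<Rightarrow>\<^sub>L real" and g'' :: "plane \<Rightarrow> plane \<Rightarrow>\<^sub>L plane \<Rightarrow>\<^sub>L real" where
    g': "\<And>x. x \<in> U \<Longrightarrow> (g has_derivative blinfun_apply (g' x)) (at x)" and
    g'': "\<And>x. x \<in> U \<Longrightarrow> (g' has_derivative blinfun_apply (g'' x)) (at x)"
    using C2 unfolding C2_on_def by blast
  define f where "f p = (norm p)\<^sup>2 - g p" for p
  have f': "(f has_derivative (\<lambda>v. 2 * (x \<bullet> v) - blinfun_apply (g' x) v)) (at x)" if "x \<in> U" for x
    unfolding f_def[abs_def] power2_norm_eq_inner
    by (rule has_derivative_eq_rhs, rule has_derivative_diff[OF has_derivative_inner[OF has_derivative_ident has_derivative_ident] g'[OF that]])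
       (simp add: fun_eq_iff inner_commute)
  have D0: "(\<lambda>v. 2 * (p0 \<bullet> v) - blinfun_apply (g' p0) v) = (\<lambda>v. 0)"
    by (rule differential_zero_maxmin[OF U(2,1) f'[OF U(2)]]) (use min in \<open>simp add: f_def\<close>)
  then have D0': "2 * (p0 \<bullet> v) = blinfun_apply (g' p0) v" for v
    by (simp add: fun_eq_iff)
  obtain d where d: "0 < d" "\<And>y. norm (y - p0) < d \<Longrightarrow> norm (g' y - g' p0 - blinfun_apply (g'' p0) (y - p0)) \<le> 1 * norm (y - p0)"
    using g''[OF U(2)] unfolding has_derivative_at_alt using zero_less_one by blast
  obtain r where r: "0 < r" "ball p0 r \<subseteq> U" using U by (rule openE)
  \<comment> \<open>In \<open>L\<close>, 2 is the Lipschitz constant of the gradient of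
    \<open>|p|^2\<close>, \<open>norm (g'' p0)\<close> that of the linearised \<open>g'\<close>, and
    1 the tolerance used in the differentiability of \<open>g'\<close> at \<open>p0\<close>.\<close>
  define L where "L = 3 + norm (g'' p0)"
  define \<rho> where "\<rho> = min d r"
  have L: "0 \<le> L" by (simp add: L_def)
  have "f p - f p0 \<le> L * (norm (p - p0))\<^sup>2" if p: "norm (p - p0) < \<rho>" for p
  proof -
    define s where "s = norm (p - p0)"
    have ball: "x \<in> U" "norm (x - p0) < d" "norm (x - p0) \<le> s" if "x \<in> cball p0 s" for x
    proof -
      show n: "norm (x - p0) \<le> s" using that by (simp add: dist_norm norm_minus_commute)
      show "norm (x - p0) < d" using n p by (simp add: s_def \<rho>_def)
      have "x \<in> ball p0 r" using n p by (simp add: s_def \<rho>_def dist_norm norm_minus_commute)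
      then show "x \<in> U" using r(2) by (rule subsetD[rotated])
    qed
    \<comment> \<open>The mean value inequality on a ball of radius \<open>s\<close>: the derivative
      is at most \<open>L * s\<close> there, and the distance supplies the second factor
      \<open>s\<close>.\<close>
    have "norm (f p - f p0) \<le> (L * s) * norm (p - p0)"
    proof (rule differentiable_bound[of "cball p0 s" f "\<lambda>x v. 2 * (x \<bullet> v) - blinfun_apply (g' x) v"])
      show "convex (cball p0 s)" by (rule convex_cball)
      show "p \<in> cball p0 s" "p0 \<in> cball p0 s" by (simp_all add: s_def dist_norm norm_minus_commute)
      fix x assume x: "x \<in> cball p0 s"
      show "(f has_derivative (\<lambda>v. 2 * (x \<bullet> v) - blinfun_apply (g' x) v)) (at x within cball p0 s)"
        by (rule has_derivative_at_withinI[OF f'[OF ball(1)[OF x]]])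
      have gl: "norm (g' x - g' p0) \<le> (1 + norm (g'' p0)) * norm (x - p0)"
      proof -
        have "norm (g' x - g' p0) \<le> norm (g' x - g' p0 - blinfun_apply (g'' p0) (x - p0)) + norm (blinfun_apply (g'' p0) (x - p0))"
          using norm_triangle_ineq[of "g' x - g' p0 - blinfun_apply (g'' p0) (x - p0)" "blinfun_apply (g'' p0) (x - p0)"] by simp
        also have "\<dots> \<le> 1 * norm (x - p0) + norm (g'' p0) * norm (x - p0)"
          by (intro add_mono d(2) ball(2) x norm_blinfun)
        finally show ?thesis by (simp add: distrib_right)
      qed
      show "onorm (\<lambda>v. 2 * (x \<bullet> v) - blinfun_apply (g' x) v) \<le> L * s"
      proof (rule onorm_le)
        fix v
        have "2 * (x \<bullet> v) - blinfun_apply (g' x) v = 2 * ((x - p0) \<bullet> v) - blinfun_apply (g' x - g' p0) v"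
          by (simp add: inner_diff_left blinfun.diff_left D0'[symmetric])
        also have "norm \<dots> \<le> norm (2 * ((x - p0) \<bullet> v)) + norm (blinfun_apply (g' x - g' p0) v)"
          by (rule norm_triangle_ineq4)
        also have "\<dots> \<le> 2 * (norm (x - p0) * norm v) + norm (g' x - g' p0) * norm v"
          using Cauchy_Schwarz_ineq2[of "x - p0" v] by (intro add_mono norm_blinfun) (simp add: abs_mult)
        also have "\<dots> \<le> 2 * (norm (x - p0) * norm v) + (1 + norm (g'' p0)) * norm (x - p0) * norm v"
          by (intro add_left_mono mult_right_mono gl) simp
        also have "\<dots> = L * norm (x - p0) * norm v" by (simp add: L_def algebra_simps)
        also have "\<dots> \<le> L * s * norm v" by (intro mult_right_mono mult_left_mono ball(3) x L) simp
        finally show "norm (2 * (x \<bullet> v) - blinfun_apply (g' x) v) \<le> L * s * norm v" .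
      qed
    qed
    then show ?thesis by (simp add: s_def power2_eq_square)
  qed
  then show ?thesis
    using L d(1) r(1) by (intro exI[of _ L] exI[of _ \<rho>]) (simp add: f_def \<rho>_def)
qed

section \<open>Approximate identities of vanishing energy\<close>

definition annulus :: "plane \<Rightarrow> real \<Rightarrow> nat \<Rightarrow> plane set" where
  "annulus p0 \<rho> k = ball p0 (\<rho> / 2 ^ k) - ball p0 (\<rho> / 2 ^ Suc k)"

text \<open>A step version of the profile \<open>1 / |p - p0|^2\<close>, to which every dyadic
  annulus contributes the same mass. Beginning at index \<open>N\<close> shrinks the support, while
  the number \<open>N\<close> of annuli averaged over lowers the energy.\<close>

definition bump :: "plane \<Rightarrow> real \<Rightarrow> nat \<Rightarrow> plane \<Rightarrow> real" where
  "bump p0 \<rho> N p = (\<Sum>k\<in>{N..<2 * N}. indicator (annulus p0 \<rho> k) p / measure lebesgue (annulus p0 \<rho> k)) / N"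

lemma annulus_lmeasurable [simp]: "annulus p0 \<rho> k \<in> lmeasurable"
  unfolding annulus_def by (intro fmeasurable.Diff lmeasurable_ball)

lemma measure_annulus:
  assumes "\<rho> > 0"
  shows "measure lebesgue (annulus p0 \<rho> k) = 3 / 4 * unit_ball_vol 2 * (\<rho> / 2 ^ k)\<^sup>2"
proof -
  have sub: "ball p0 (\<rho> / 2 ^ Suc k) \<subseteq> ball p0 (\<rho> / 2 ^ k)"
    using assms by (intro subset_ball) (simp add: field_simps)
  have b: "measure lebesgue (ball p0 s) = unit_ball_vol 2 * s\<^sup>2" if "0 \<le> s" for s
    using content_ball[OF that, of p0] by simp
  have "measure lebesgue (annulus p0 \<rho> k) = measure lebesgue (ball p0 (\<rho> / 2 ^ k)) - measure lebesgue (ball p0 (\<rho> / 2 ^ Suc k))"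
    unfolding annulus_def by (rule measurable_measure_Diff[OF lmeasurable_ball _ sub]) simp
  also have "\<dots> = unit_ball_vol 2 * (\<rho> / 2 ^ k)\<^sup>2 - unit_ball_vol 2 * (\<rho> / 2 ^ Suc k)\<^sup>2"
    using assms by (simp only: b divide_nonneg_nonneg less_imp_le zero_le_power zero_le_numeral)
  also have "\<dots> = 3 / 4 * unit_ball_vol 2 * (\<rho> / 2 ^ k)\<^sup>2"
    by (simp add: power_divide field_simps power2_eq_square)
  finally show ?thesis .
qed

lemma unit_ball_vol_2_pos: "0 < unit_ball_vol 2"
  by (simp add: unit_ball_vol_2)

lemma measure_annulus_pos: "\<rho> > 0 \<Longrightarrow> 0 < measure lebesgue (annulus p0 \<rho> k)"
  using unit_ball_vol_2_pos by (simp add: measure_annulus)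

lemma annulus_disjoint:
  assumes "\<rho> > 0" "p \<in> annulus p0 \<rho> k" "p \<in> annulus p0 \<rho> l"
  shows "k = l"
proof -
  have "\<not> i < j" if "p \<in> annulus p0 \<rho> i" "p \<in> annulus p0 \<rho> j" for i j
  proof
    assume "i < j"
    then have "(2::real) ^ Suc i \<le> 2 ^ j" by (intro power_increasing) auto
    then have "\<rho> / 2 ^ j \<le> \<rho> / 2 ^ Suc i" using assms(1) by (intro divide_left_mono) auto
    then have "ball p0 (\<rho> / 2 ^ j) \<subseteq> ball p0 (\<rho> / 2 ^ Suc i)" by (rule subset_ball)
    then show False using that unfolding annulus_def by blast
  qed
  from this[OF assms(2,3)] this[OF assms(3,2)] show ?thesis by simp
qed

context
  fixes p0 :: plane and \<rho> :: real
  assumes \<rho>: "\<rho> > 0"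
begin

lemma bump_nonneg: "0 \<le> bump p0 \<rho> N p"
  unfolding bump_def by (intro divide_nonneg_nonneg sum_nonneg) simp_all

lemma bump_support:
  assumes "bump p0 \<rho> N p \<noteq> 0"
  shows "norm (p - p0) < \<rho> / 2 ^ N"
proof (rule ccontr)
  assume n: "\<not> norm (p - p0) < \<rho> / 2 ^ N"
  have "indicator (annulus p0 \<rho> k) p = (0::real)" if "k \<in> {N..<2 * N}" for k
  proof -
    have "(2::real) ^ N \<le> 2 ^ k" using that by (intro power_increasing) auto
    then have "\<rho> / 2 ^ k \<le> \<rho> / 2 ^ N" using \<rho> by (intro divide_left_mono) auto
    then have "p \<notin> ball p0 (\<rho> / 2 ^ k)" using n by (simp add: dist_norm norm_minus_commute)
    then show ?thesis by (simp add: annulus_def)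
  qed
  then have "bump p0 \<rho> N p = 0" by (simp add: bump_def)
  with assms show False by simp
qed

lemma bump_integrable: "integrable lebesgue (bump p0 \<rho> N)"
  unfolding bump_def[abs_def]
  by (intro integrable_divide Bochner_Integration.integrable_sum) (rule annulus_lmeasurable[unfolded lmeasurable_iff_integrable])

lemma bump_integral:
  assumes "N > 0"
  shows "(LINT p|lebesgue. bump p0 \<rho> N p) = 1"
proof -
  have i: "integrable lebesgue (\<lambda>p. indicat_real (annulus p0 \<rho> k) p / measure lebesgue (annulus p0 \<rho> k))" for k
    by (intro integrable_divide annulus_lmeasurable[unfolded lmeasurable_iff_integrable])
  have "(LINT p|lebesgue. bump p0 \<rho> N p)
      = (LINT p|lebesgue. (\<Sum>k\<in>{N..<2 * N}. indicator (annulus p0 \<rho> k) p / measure lebesgue (annulus p0 \<rho> k))) / N"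
    unfolding bump_def by (rule integral_divide_zero)
  also have "(LINT p|lebesgue. (\<Sum>k\<in>{N..<2 * N}. indicator (annulus p0 \<rho> k) p / measure lebesgue (annulus p0 \<rho> k)))
      = (\<Sum>k\<in>{N..<2 * N}. (LINT p|lebesgue. indicat_real (annulus p0 \<rho> k) p / measure lebesgue (annulus p0 \<rho> k)))"
    by (rule Bochner_Integration.integral_sum) (rule i)
  also have "\<dots> = (\<Sum>k\<in>{N..<2 * N}. 1)"
  proof (intro sum.cong refl)
    fix k
    have "(LINT p|lebesgue. indicat_real (annulus p0 \<rho> k) p / measure lebesgue (annulus p0 \<rho> k))
        = (LINT p|lebesgue. indicat_real (annulus p0 \<rho> k) p) / measure lebesgue (annulus p0 \<rho> k)"
      by (rule integral_divide_zero)
    then show "(LINT p|lebesgue. indicat_real (annulus p0 \<rho> k) p / measure lebesgue (annulus p0 \<rho> k)) = 1"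
      using measure_annulus_pos[OF \<rho>, of p0 k] by simp
  qed
  finally show ?thesis using assms by simp
qed

lemma bump_measurable: "bump p0 \<rho> N \<in> borel_measurable lebesgue"
  by (rule borel_measurable_integrable[OF bump_integrable])

lemma bump_bounded: "\<exists>B. \<forall>p. bump p0 \<rho> N p \<le> B"
proof -
  have "bump p0 \<rho> N p \<le> (\<Sum>k\<in>{N..<2 * N}. 1 / measure lebesgue (annulus p0 \<rho> k)) / N" for p
    unfolding bump_def by (intro divide_right_mono sum_mono) (simp_all add: indicator_def)
  then show ?thesis by blast
qed

text \<open>On each annulus \<open>|p - p0|\<^sup>2\<close> is comparable to its area, which makes this of order \<open>1 / N\<close>.\<close>
lemma bump_energy:
  assumes N: "N > 0"
  shows "integrable lebesgue (\<lambda>p. (bump p0 \<rho> N p)\<^sup>2 * (norm (p - p0))\<^sup>2)"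
    "(LINT p|lebesgue. (bump p0 \<rho> N p)\<^sup>2 * (norm (p - p0))\<^sup>2) \<le> 4 / (3 * unit_ball_vol 2) / N"
proof -
  define m where "m k = measure lebesgue (annulus p0 \<rho> k)" for k
  \<comment> \<open>The reciprocal of 3/4 of the area of the unit disc, so that the squared outer
    radius of an annulus is exactly \<open>c * m k\<close>.\<close>
  define c where "c = 4 / (3 * unit_ball_vol 2)"
  have m: "0 < m k" for k unfolding m_def by (rule measure_annulus_pos[OF \<rho>])
  have c: "0 < c" using unit_ball_vol_2_pos by (simp add: c_def)
  let ?G = "\<lambda>p. (\<Sum>k\<in>{N..<2 * N}. (c / (real N)\<^sup>2) * (indicat_real (annulus p0 \<rho> k) p / m k))"
  have iG: "integrable lebesgue ?G"
    by (intro Bochner_Integration.integrable_sum integrable_mult_right integrable_divide annulus_lmeasurable[unfolded lmeasurable_iff_integrable])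
  have le: "(bump p0 \<rho> N p)\<^sup>2 * (norm (p - p0))\<^sup>2 \<le> ?G p" for p
  proof (cases "\<exists>k\<in>{N..<2 * N}. p \<in> annulus p0 \<rho> k")
    case True
    then obtain k where k: "k \<in> {N..<2 * N}" "p \<in> annulus p0 \<rho> k" by blast
    have ind: "indicat_real (annulus p0 \<rho> l) p = (if l = k then 1 else 0)" for l
    proof (cases "p \<in> annulus p0 \<rho> l")
      case True
      then show ?thesis using annulus_disjoint[OF \<rho> k(2) True] by simp
    next
      case False
      then show ?thesis using k(2) by (cases "l = k") simp_all
    qed
    have G: "?G p = c / (real N)\<^sup>2 / m k"
      unfolding ind using k(1) by (subst sum.remove[of _ k]) simp_all
    have b: "bump p0 \<rho> N p = 1 / m k / N"
      unfolding bump_def ind m_def[symmetric] using k(1) by (subst sum.remove[of _ k]) simp_all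
    have "norm (p - p0) < \<rho> / 2 ^ k" using k(2) by (simp add: annulus_def dist_norm norm_minus_commute)
    then have "(norm (p - p0))\<^sup>2 \<le> (\<rho> / 2 ^ k)\<^sup>2" by (intro power_mono) auto
    also have "(\<rho> / 2 ^ k)\<^sup>2 = c * m k"
      unfolding c_def m_def measure_annulus[OF \<rho>] unit_ball_vol_2 by simp
    finally have "(bump p0 \<rho> N p)\<^sup>2 * (norm (p - p0))\<^sup>2 \<le> (1 / m k / N)\<^sup>2 * (c * m k)"
      unfolding b by (rule mult_left_mono) simp
    also have "\<dots> = c / (real N)\<^sup>2 / m k"
    proof -
      have "(1 / a / b)\<^sup>2 * (c * a) = c / b\<^sup>2 / a" if "a \<noteq> 0" "b \<noteq> 0" for a b :: real
        using that by (simp add: power2_eq_square)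
      then show ?thesis using m[of k] N by (metis of_nat_0_less_iff less_irrefl)
    qed
    finally show ?thesis unfolding G .
  next
    case False
    then have z: "indicat_real (annulus p0 \<rho> k) p = 0" if "k \<in> {N..<2 * N}" for k using that by auto
    then have "bump p0 \<rho> N p = 0" "?G p = 0" by (simp_all add: bump_def)
    then show ?thesis by simp
  qed
  have meas: "(\<lambda>p. (bump p0 \<rho> N p)\<^sup>2 * (norm (p - p0))\<^sup>2) \<in> borel_measurable lebesgue"
  proof (intro borel_measurable_times borel_measurable_power bump_measurable)
    show "(\<lambda>p. norm (p - p0)) \<in> borel_measurable lebesgue" by (rule borel_lebesgue_measurable) measurable
  qed
  show i: "integrable lebesgue (\<lambda>p. (bump p0 \<rho> N p)\<^sup>2 * (norm (p - p0))\<^sup>2)"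
  proof (rule Bochner_Integration.integrable_bound[OF iG meas], intro AE_I2)
    fix p
    have "norm ((bump p0 \<rho> N p)\<^sup>2 * (norm (p - p0))\<^sup>2) = (bump p0 \<rho> N p)\<^sup>2 * (norm (p - p0))\<^sup>2" by simp
    also have "\<dots> \<le> norm (?G p)" using le[of p] by (rule order_trans) (simp only: real_norm_def abs_ge_self)
    finally show "norm ((bump p0 \<rho> N p)\<^sup>2 * (norm (p - p0))\<^sup>2) \<le> norm (?G p)" .
  qed
  have "(LINT p|lebesgue. (bump p0 \<rho> N p)\<^sup>2 * (norm (p - p0))\<^sup>2) \<le> (LINT p|lebesgue. ?G p)"
    by (rule integral_mono[OF i iG le])
  also have "\<dots> = (\<Sum>k\<in>{N..<2 * N}. (LINT p|lebesgue. (c / (real N)\<^sup>2) * (indicat_real (annulus p0 \<rho> k) p / m k)))"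
    by (intro Bochner_Integration.integral_sum integrable_mult_right integrable_divide annulus_lmeasurable[unfolded lmeasurable_iff_integrable])
  also have "\<dots> = (\<Sum>k\<in>{N..<2 * N}. c / (real N)\<^sup>2)"
  proof (intro sum.cong refl)
    fix k
    show "(LINT p|lebesgue. (c / (real N)\<^sup>2) * (indicat_real (annulus p0 \<rho> k) p / m k)) = c / (real N)\<^sup>2"
      unfolding integral_mult_right_zero integral_divide_zero using m[of k] by (simp add: m_def)
  qed
  also have "\<dots> = 4 / (3 * unit_ball_vol 2) / N"
    using N by (simp add: c_def power2_eq_square)
  finally show "(LINT p|lebesgue. (bump p0 \<rho> N p)\<^sup>2 * (norm (p - p0))\<^sup>2) \<le> 4 / (3 * unit_ball_vol 2) / N" .
qed

lemma bump_mult_integrable: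
  fixes F :: "plane \<Rightarrow> complex"
  assumes F: "F \<in> borel_measurable lebesgue" "\<And>p. cmod (F p) \<le> 1"
  shows "integrable lebesgue (\<lambda>p. bump p0 \<rho> N p *\<^sub>R F p)"
proof (rule Bochner_Integration.integrable_bound[OF bump_integrable])
  show "(\<lambda>p. bump p0 \<rho> N p *\<^sub>R F p) \<in> borel_measurable lebesgue"
    by (intro borel_measurable_scaleR bump_measurable F)
  show "AE p in lebesgue. norm (bump p0 \<rho> N p *\<^sub>R F p) \<le> norm (bump p0 \<rho> N p)"
    using F(2) by (intro AE_I2) (simp add: mult_left_le)
qed

text \<open>Unit mass on shrinking discs. The index \<open>Suc N\<close> excludes the empty average,
  which is 0 instead of having mass 1.\<close>

lemma bump_tendsto:
  fixes F :: "plane \<Rightarrow> complex"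
  assumes F: "F \<in> borel_measurable lebesgue" "\<And>p. cmod (F p) \<le> 1" and cont: "isCont F p0"
  shows "(\<lambda>N. LINT p|lebesgue. bump p0 \<rho> (Suc N) p *\<^sub>R F p) \<longlonglongrightarrow> F p0"
proof (rule LIMSEQ_I)
  fix e :: real assume e: "e > 0"
  obtain d where d: "d > 0" "\<And>p. norm (p - p0) < d \<Longrightarrow> norm (F p - F p0) < e / 2"
    using cont e unfolding continuous_at_eps_delta dist_norm by (meson half_gt_zero)
  have "(\<lambda>N. \<rho> * (1 / 2) ^ N) \<longlonglongrightarrow> \<rho> * 0"
    by (intro tendsto_intros LIMSEQ_realpow_zero) simp_all
  then have "\<forall>\<^sub>F N in sequentially. \<rho> * (1 / 2) ^ N < d"
    using d(1) by (intro order_tendstoD(2)) simp_all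
  then obtain M where M: "\<And>N. N \<ge> M \<Longrightarrow> \<rho> / 2 ^ N < d"
    unfolding eventually_sequentially by (auto simp: power_one_over)
  have "norm ((LINT p|lebesgue. bump p0 \<rho> (Suc N) p *\<^sub>R F p) - F p0) < e" if N: "N \<ge> M" for N
  proof -
    let ?b = "bump p0 \<rho> (Suc N)"
    note iF = bump_mult_integrable[OF F, of "Suc N"]
    have ic: "integrable lebesgue (\<lambda>p. ?b p *\<^sub>R F p0)" by (rule integrable_scaleR_left[OF bump_integrable])
    have "F p0 = (LINT p|lebesgue. ?b p *\<^sub>R F p0)"
    proof -
      have "(LINT p|lebesgue. ?b p *\<^sub>R F p0) = (LINT p|lebesgue. ?b p) *\<^sub>R F p0"
        by (rule Bochner_Integration.integral_scaleR_left) (rule bump_integrable)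
      then show ?thesis using bump_integral[of "Suc N"] by simp
    qed
    then have "(LINT p|lebesgue. ?b p *\<^sub>R F p) - F p0 = (LINT p|lebesgue. ?b p *\<^sub>R F p - ?b p *\<^sub>R F p0)"
      using Bochner_Integration.integral_diff[OF iF ic] by simp
    also have "norm \<dots> \<le> (LINT p|lebesgue. norm (?b p *\<^sub>R F p - ?b p *\<^sub>R F p0))"
      by (rule integral_norm_bound)
    also have "\<dots> \<le> (LINT p|lebesgue. e / 2 * ?b p)"
    proof (rule integral_mono[OF integrable_norm[OF Bochner_Integration.integrable_diff[OF iF ic]] integrable_mult_right[OF bump_integrable]])
      fix p
      have n: "norm (?b p *\<^sub>R F p - ?b p *\<^sub>R F p0) = ?b p * norm (F p - F p0)"
        using bump_nonneg[of "Suc N" p] by (simp flip: scaleR_right_diff_distrib)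
      show "norm (?b p *\<^sub>R F p - ?b p *\<^sub>R F p0) \<le> e / 2 * ?b p"
      proof (cases "?b p = 0")
        case False
        have "norm (p - p0) < d" using bump_support[OF False] M[of "Suc N"] N by simp
        from d(2)[OF this] have "?b p * norm (F p - F p0) \<le> ?b p * (e / 2)"
          by (intro mult_left_mono bump_nonneg) simp
        then show ?thesis unfolding n by (simp add: mult.commute)
      qed simp
    qed
    also have "\<dots> = e / 2" using bump_integral[of "Suc N"] by simp
    finally show ?thesis using e by simp
  qed
  then show "\<exists>M. \<forall>N\<ge>M. norm ((LINT p|lebesgue. bump p0 \<rho> (Suc N) p *\<^sub>R F p) - F p0) < e" by blast
qed

end

text \<open>The part of \<open>Z\<close> lost in the overlap is at most the L1 distance between its
  indicator and a translate, which eventually falls below the measure of \<open>Z\<close>.\<close>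

lemma positive_measure_overlap:
  fixes Z :: "plane set"
  assumes Z: "Z \<in> lmeasurable" "0 < measure lebesgue Z" and H: "H \<longlonglongrightarrow> 0"
  shows "\<forall>\<^sub>F n in sequentially. {x \<in> Z. x + H n \<in> Z} \<in> lmeasurable \<and> 0 < measure lebesgue {x \<in> Z. x + H n \<in> Z}"
proof -
  have i: "integrable lebesgue (indicat_real Z)" using Z(1) by (simp only: lmeasurable_iff_integrable)
  note m = borel_measurable_integrable[OF i]
  have meas: "{x \<in> Z. x + h \<in> Z} \<in> lmeasurable" for h
  proof (rule fmeasurableI2[OF Z(1)])
    have "(\<lambda>x. x + h) \<in> lebesgue \<rightarrow>\<^sub>M lebesgue"
      using lebesgue_scaling(2)[of 1 h] by (simp add: add.commute)
    then have "(\<lambda>x. x + h) -` Z \<inter> space lebesgue \<in> sets lebesgue"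
      by (rule measurable_sets[OF _ fmeasurableD[OF Z(1)]])
    then have "Z \<inter> ((\<lambda>x. x + h) -` Z \<inter> space lebesgue) \<in> sets lebesgue"
      by (rule sets.Int[OF fmeasurableD[OF Z(1)]])
    moreover have "Z \<inter> ((\<lambda>x. x + h) -` Z \<inter> space lebesgue) = {x \<in> Z. x + h \<in> Z}" by auto
    ultimately show "{x \<in> Z. x + h \<in> Z} \<in> sets lebesgue" by (simp only:)
  qed auto
  have "\<forall>\<^sub>F n in sequentially. (LINT x|lebesgue. norm (indicat_real Z (x + H n) - indicat_real Z x)) < measure lebesgue Z"
    by (rule order_tendstoD(2)[OF L1_translation[OF i H] Z(2)])
  then show ?thesis
  proof eventually_elim
    case (elim n)
    let ?Z = "{x \<in> Z. x + H n \<in> Z}"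
    have iz: "integrable lebesgue (indicat_real ?Z)" using meas[of "H n"] by (simp only: lmeasurable_iff_integrable)
    have i2: "integrable lebesgue (\<lambda>x. indicat_real Z (x + H n))" using lebesgue_shift(2)[OF m, of "H n"] i by (simp only:)
    have "(LINT x|lebesgue. indicat_real Z x - indicat_real ?Z x) \<le> (LINT x|lebesgue. norm (indicat_real Z (x + H n) - indicat_real Z x))"
    proof (rule integral_mono)
      show "integrable lebesgue (\<lambda>x. indicat_real Z x - indicat_real ?Z x)"
        by (rule Bochner_Integration.integrable_diff[OF i iz])
      show "integrable lebesgue (\<lambda>x. norm (indicat_real Z (x + H n) - indicat_real Z x))"
        by (rule integrable_norm[OF Bochner_Integration.integrable_diff[OF i2 i]])
      show "indicat_real Z x - indicat_real ?Z x \<le> norm (indicat_real Z (x + H n) - indicat_real Z x)" for x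
        by (auto simp: indicator_def)
    qed
    moreover have "(LINT x|lebesgue. indicat_real Z x - indicat_real ?Z x) = measure lebesgue Z - measure lebesgue ?Z"
      unfolding Bochner_Integration.integral_diff[OF i iz] by simp
    ultimately show ?case using elim meas[of "H n"] by simp
  qed
qed

text \<open>
  If a trigonometric sum vanishes on \<open>Z\<close>, so does its difference quotient on the overlap of \<open>Z\<close> with a
  small translate, and the latter has fewer frequencies after removing a common factor.
\<close>
lemma trigonometric_independent:
  fixes p :: "'j \<Rightarrow> plane" and c :: "'j \<Rightarrow> complex"
  assumes "finite J" "inj_on p J" "Z \<in> lmeasurable" "0 < measure lebesgue Z"
    and "\<And>x. x \<in> Z \<Longrightarrow> (\<Sum>j\<in>J. c j * exp (\<i> * of_real (p j \<bullet> x))) = 0"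
  shows "\<forall>j\<in>J. c j = 0"
  using assms
proof (induction J arbitrary: c Z rule: finite_induct)
  case (insert k J)
  define e where "e j x = exp (\<i> * complex_of_real (p j \<bullet> x))" for j x
  have e_add: "e j (x + h) = e j x * e j h" for j x h
    by (simp add: e_def inner_add_right algebra_simps flip: exp_add)
  have e_nz: "e j x \<noteq> 0" for j x by (simp add: e_def)
  have van: "c k * e k x + (\<Sum>j\<in>J. c j * e j x) = 0" if "x \<in> Z" for x
    using insert.prems(4)[OF that] insert.hyps by (simp add: e_def)
  have zero: "c j = 0" if j: "j \<in> J" for j
  proof -
    \<comment> \<open>Shifting along the frequency difference changes the relative phase by
      \<open>inverse (real (Suc n)) * (q \<bullet> q)\<close>, which lies strictly between 0 and
      \<open>2 * pi\<close> for suitable \<open>n\<close>; hence \<open>e j h\<close> and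
      \<open>e k h\<close> differ. The shift is chosen separately for each \<open>j\<close>.\<close>
    define q where "q = p j - p k"
    have "q \<noteq> 0" using insert.prems(1) insert.hyps(2) j by (auto simp: q_def inj_on_def)
    then have q: "0 < q \<bullet> q" by simp
    have "(\<lambda>n. inverse (real (Suc n)) *\<^sub>R q) \<longlonglongrightarrow> 0 *\<^sub>R q"
      by (intro tendsto_scaleR LIMSEQ_inverse_real_of_nat tendsto_const)
    then have H: "(\<lambda>n. inverse (real (Suc n)) *\<^sub>R q) \<longlonglongrightarrow> 0" by simp
    have "(\<lambda>n. inverse (real (Suc n)) * (q \<bullet> q)) \<longlonglongrightarrow> 0 * (q \<bullet> q)"
      by (intro tendsto_mult LIMSEQ_inverse_real_of_nat tendsto_const)
    then have "\<forall>\<^sub>F n in sequentially. inverse (real (Suc n)) * (q \<bullet> q) < 2 * pi"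
      by (rule order_tendstoD(2)) simp
    with positive_measure_overlap[OF insert.prems(2,3) H]
    have "\<forall>\<^sub>F n in sequentially. inverse (real (Suc n)) * (q \<bullet> q) < 2 * pi \<and>
        {x \<in> Z. x + inverse (real (Suc n)) *\<^sub>R q \<in> Z} \<in> lmeasurable \<and>
        0 < measure lebesgue {x \<in> Z. x + inverse (real (Suc n)) *\<^sub>R q \<in> Z}"
      by eventually_elim simp
    from eventually_happens'[OF sequentially_bot this] obtain n where
      n: "inverse (real (Suc n)) * (q \<bullet> q) < 2 * pi" and
      Zn: "{x \<in> Z. x + inverse (real (Suc n)) *\<^sub>R q \<in> Z} \<in> lmeasurable"
        "0 < measure lebesgue {x \<in> Z. x + inverse (real (Suc n)) *\<^sub>R q \<in> Z}" by (elim exE conjE)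
    define h where "h = inverse (real (Suc n)) *\<^sub>R q"
    have inj: "inj_on p J" using insert.prems(1) by (rule inj_on_subset) auto
    have "\<forall>j\<in>J. c j * (e j h - e k h) = 0"
    proof (rule insert.IH[OF inj Zn])
      fix x assume "x \<in> {x \<in> Z. x + inverse (real (Suc n)) *\<^sub>R q \<in> Z}"
      then have x: "x \<in> Z" "x + h \<in> Z" by (auto simp: h_def)
      have "(\<Sum>j\<in>J. c j * (e j h - e k h) * e j x) = (\<Sum>j\<in>J. c j * e j (x + h)) - e k h * (\<Sum>j\<in>J. c j * e j x)"
        unfolding sum_distrib_left sum_subtractf[symmetric] by (intro sum.cong refl) (simp add: e_add algebra_simps)
      also have "(\<Sum>j\<in>J. c j * e j (x + h)) = - (c k * e k (x + h))"
        using van[OF x(2)] by (simp add: add_eq_0_iff)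
      also have "(\<Sum>j\<in>J. c j * e j x) = - (c k * e k x)"
        using van[OF x(1)] by (simp add: add_eq_0_iff)
      finally show "(\<Sum>j\<in>J. c j * (e j h - e k h) * exp (\<i> * of_real (p j \<bullet> x))) = 0"
        by (simp add: e_add e_def[symmetric])
    qed
    then have "c j * (e j h - e k h) = 0" using j by blast
    moreover have "e j h \<noteq> e k h"
    proof
      define t where "t = inverse (real (Suc n)) * (q \<bullet> q)"
      assume "e j h = e k h"
      then have "exp (\<i> * complex_of_real (p j \<bullet> h) - \<i> * complex_of_real (p k \<bullet> h)) = 1"
        unfolding exp_diff e_def by simp
      also have "\<i> * complex_of_real (p j \<bullet> h) - \<i> * complex_of_real (p k \<bullet> h) = \<i> * of_real t"
        by (simp add: t_def h_def q_def inner_diff_left inner_diff_right algebra_simps)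
      finally have "exp (\<i> * of_real t) = 1" .
      then obtain m :: int where m: "t = of_int (2 * m) * pi"
        by (auto simp: exp_eq_1)
      have t: "0 < t" "t < 2 * pi" using q n by (simp_all add: t_def)
      have "0 < m" using t(1) pi_gt_zero unfolding m by (simp add: zero_less_mult_iff)
      then have "2 * pi \<le> t" unfolding m by simp
      with t(2) show False by simp
    qed
    ultimately show ?thesis by simp
  qed
  have "Z \<noteq> {}" using insert.prems(3) by auto
  then obtain x where x: "x \<in> Z" by blast
  have "c k * e k x = 0" using van[OF x] zero by simp
  then show ?case using zero e_nz by simp
qed simp

text \<open>Isometry applied to the difference. An argument is required because
  \<open>fourier\<close> chooses a representative for each function separately.\<close>

lemma fourier_cong_AE:
  assumes f: "f \<in> L2" and fg: "AE x in lebesgue. f x = g x"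
  shows "AE p in lebesgue. fourier f p = fourier g p"
proof -
  have g: "g \<in> L2" by (rule L2_cong_AE[OF f fg])
  let ?d = "\<lambda>x. - 1 * f x + g x"
  have d: "?d \<in> L2" by (intro L2_add L2_mult_left f g)
  have "l2 ?d = l2 (\<lambda>x::plane. 0 :: complex)"
    by (rule l2_cong_AE[OF _ d]) (use fg in eventually_elim, simp)
  then have "l2 ?d = 0" by (simp only: l2_def norm_zero power_zero_numeral integral_zero real_sqrt_zero)
  then have "l2 (fourier ?d) = 0" by (simp only: fourier_l2[OF d])
  from l2_eq_0_AE[OF fourier_L2[OF d] this] fourier_add_scale[OF f g, of "- 1"]
  show ?thesis by eventually_elim simp
qed

text \<open>The inverse transform as an integral with a value at every point, since the bounds and
  limits of the trial functions are pointwise.\<close>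

definition position :: "(plane \<Rightarrow> spinor) \<Rightarrow> plane \<Rightarrow> spinor" where
  "position G x = (\<chi> i. fourier_integral (\<lambda>p. G p $ i) (- x))"

text \<open>A bounded symbol of bounded support is integrable and square integrable, also with the
  weight \<open>bracket\<close>, so the integral in \<open>position\<close> agrees almost everywhere
  with the inverse transform on L2.\<close>

lemma position_sobolev:
  assumes G: "G \<in> borel_measurable lebesgue" and B: "\<And>p. norm (G p) \<le> B" and R: "\<And>p. G p \<noteq> 0 \<Longrightarrow> norm p \<le> R"
  shows "AE p in lebesgue. fourier2 (position G) p = G p" "position G \<in> sobolev_H1"
    "integrable lebesgue (\<lambda>p. G p $ i)"
proof -
  have ind: "G p = indicator (cball 0 R) p *\<^sub>R G p" for p
    using R[of p] by (cases "G p = 0") (simp_all add: dist_norm indicator_def)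
  have L: "G \<in> L2"
  proof (rule L2_bound[OF G])
    show "integrable lebesgue (\<lambda>p. B\<^sup>2 * indicat_real (cball 0 R) p)"
      by (intro integrable_mult_right lmeasurable_cball[unfolded lmeasurable_iff_integrable])
    have "(norm (G p))\<^sup>2 \<le> B\<^sup>2 * indicat_real (cball 0 R) p" for p
      using power_mono[OF B[of p] norm_ge_zero, of 2] R[of p] by (cases "G p = 0") (simp_all add: dist_norm indicator_def)
    then show "AE p in lebesgue. (norm (G p))\<^sup>2 \<le> B\<^sup>2 * indicat_real (cball 0 R) p" by (rule AE_I2)
  qed
  have Li: "(\<lambda>p. G p $ i) \<in> L2" for i by (rule L2_spinor_nth[OF L])
  have Ii: "integrable lebesgue (\<lambda>p. G p $ i)" for i
  proof -
    have "(\<lambda>p. G p $ i) = (\<lambda>p. indicator (cball 0 R) p *\<^sub>R (G p $ i))"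
    proof (rule ext)
      fix p
      show "G p $ i = indicator (cball 0 R) p *\<^sub>R (G p $ i)"
        using arg_cong[OF ind[of p], of "\<lambda>v. v $ i"] by (simp only: vector_scaleR_component)
    qed
    then show ?thesis using L2_set_integrable(1)[OF Li[of i] lmeasurable_cball, of 0 R] by (simp only:)
  qed
  show "integrable lebesgue (\<lambda>p. G p $ i)" by (rule Ii)
  have pos: "(\<lambda>x. position G x $ i) = (\<lambda>x. fourier_integral (\<lambda>p. G p $ i) (- x))" for i
    by (simp add: position_def)
  have ae: "AE x in lebesgue. inv_fourier (\<lambda>p. G p $ i) x = position G x $ i" for i
    using inv_fourier_eq_integral[OF Li Ii, of i] by (simp add: position_def)
  have pL: "position G \<in> L2"
    by (rule L2_spinor_iff[THEN iffD2], rule allI) (rule L2_cong_AE[OF inv_fourier_L2[OF Li] ae])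
  show eq: "AE p in lebesgue. fourier2 (position G) p = G p"
  proof (rule AE_spinor_eqI)
    fix i
    show "AE p in lebesgue. fourier2 (position G) p $ i = G p $ i"
      unfolding fourier2_nth
      using fourier_cong_AE[OF inv_fourier_L2[OF Li] ae, of i] fourier_inv_fourier[OF Li, of i]
      by eventually_elim simp
  qed
  have "(\<lambda>p. bracket p *\<^sub>R G p) \<in> L2"
  proof (rule L2_scale[OF L])
    show "(\<lambda>p. bracket p *\<^sub>R G p) \<in> borel_measurable lebesgue"
      by (intro borel_measurable_scaleR bracket_measurable G)
    show "norm (bracket p *\<^sub>R G p) \<le> sqrt (1 + R\<^sup>2) * norm (G p)" for p
    proof (cases "G p = 0")
      case False
      have "bracket p \<le> sqrt (1 + R\<^sup>2)"
        unfolding bracket_def using power_mono[OF R[OF False] norm_ge_zero, of 2] by (intro real_sqrt_le_mono) simp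
      then show ?thesis by (simp add: mult_right_mono)
    qed simp
  qed
  moreover have "AE p in lebesgue. bracket p *\<^sub>R G p = hat (position G) p"
    using eq by eventually_elim (simp add: hat_def)
  ultimately have "hat (position G) \<in> L2" by (rule L2_cong_AE)
  then show "position G \<in> sobolev_H1" using pL by (simp only: sobolev_iff)
qed

lemma Re_symbol_scaleR:
  "Re (spinor_inner (a *\<^sub>R v) (H0_symbol A p *v (a *\<^sub>R v))) = a\<^sup>2 * Re (spinor_inner v (H0_symbol A p *v v))"
proof -
  have cs: "H0_symbol A p *v (a *\<^sub>R v) = a *\<^sub>R (H0_symbol A p *v v)"
    by (simp add: vec_eq_iff forall_2 H0_symbol_apply scaleR_conv_of_real[where 'a = complex] algebra_simps)
  show ?thesis
    unfolding cs spinor_inner_scaleR_left spinor_inner_scaleR_right by (simp add: power2_eq_square)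
qed

context spin_potential
begin

text \<open>The borderline energy \<open>kappa A\<close>, where coercivity gives way to a mere sign;
  this makes \<open>excess\<close> semidefinite.\<close>

lemma H0_form_ge_kappa:
  assumes "\<psi> \<in> sobolev_H1"
  shows "kappa A * (l2 \<psi>)\<^sup>2 \<le> Re (H0_form A \<psi> \<psi>)"
proof -
  note i = integrable_mult_right[OF L2_integrable[OF fourier2_L2[OF sobolev_L2[OF assms]]], of "kappa A"]
  have "kappa A * (l2 \<psi>)\<^sup>2 = (LINT p|lebesgue. kappa A * (norm (fourier2 \<psi> p))\<^sup>2)"
    unfolding l2_fourier2[OF sobolev_L2[OF assms], symmetric] l2_square integral_mult_right_zero ..
  also have "\<dots> \<le> Re (H0_form A \<psi> \<psi>)"
    unfolding Re_H0_form(2)[OF assms]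
  proof (rule integral_mono[OF i Re_H0_form(1)[OF assms]])
    fix p
    have "kappa A * (norm (fourier2 \<psi> p))\<^sup>2 \<le> lambda_minus A p * (norm (fourier2 \<psi> p))\<^sup>2"
      by (rule mult_right_mono[OF kappa_le]) simp
    also have "\<dots> \<le> Re (spinor_inner (fourier2 \<psi> p) (H0_symbol A p *v fourier2 \<psi> p))"
      by (rule Re_symbol_bounds(1))
    finally show "kappa A * (norm (fourier2 \<psi> p))\<^sup>2 \<le> Re (spinor_inner (fourier2 \<psi> p) (H0_symbol A p *v fourier2 \<psi> p))" .
  qed
  finally show ?thesis .
qed

text \<open>The form of the free operator shifted by \<open>kappa A\<close>. An energy of
  \<open>P.h\<close> below \<open>kappa A\<close> means exactly that the potential energy
  \<open>w\<close> exceeds the excess.\<close>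

definition excess :: "(plane \<Rightarrow> spinor) \<Rightarrow> (plane \<Rightarrow> spinor) \<Rightarrow> complex" where
  "excess \<phi> \<psi> = H0_form A \<phi> \<psi> - of_real (kappa A) * L2_inner \<phi> \<psi>"

lemma Re_excess: "\<psi> \<in> sobolev_H1 \<Longrightarrow> Re (excess \<psi> \<psi>) = Re (H0_form A \<psi> \<psi>) - kappa A * (l2 \<psi>)\<^sup>2"
  by (simp add: excess_def Re_ip)

lemma excess_positive: "positive_form smult sobolev_H1 excess"
proof (intro positive_form.intro positive_form_axioms.intro)
  have "hermitian_form smult sobolev_H1 L2_inner" using ip.hermitian by (simp only: ip_form)
  then show "hermitian_form smult sobolev_H1 excess"
    unfolding excess_def[abs_def] by (rule hermitian_form_diff[OF H0_form_hermitian])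
  show "0 \<le> Re (excess \<psi> \<psi>)" if "\<psi> \<in> sobolev_H1" for \<psi>
    using H0_form_ge_kappa[OF that] by (simp add: Re_excess[OF that])
qed

text \<open>
  The (unnormalised) eigenvector \<open>(A / |A|, -1)\<close> for \<open>\<lambda>\<^sub>-\<close>. If \<open>A p0 = 0\<close> it has no limit at \<open>p0\<close>;
  then \<open>(0, -1)\<close> serves instead, because this case only occurs for \<open>p0 = 0\<close>, \<open>\<kappa> = 0\<close>.
\<close>
definition phase :: "plane \<Rightarrow> plane \<Rightarrow> complex" where
  "phase p0 p = (if A p0 = 0 then 0 else A p / of_real (cmod (A p)))"

definition spin :: "plane \<Rightarrow> plane \<Rightarrow> spinor" where
  "spin p0 p = vector [phase p0 p, - 1]"

lemma spin_nth: "spin p0 p $ 1 = phase p0 p" "spin p0 p $ 2 = - 1"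
  by (simp_all add: spin_def)

lemma phase_bound: "cmod (phase p0 p) \<le> 1"
  by (simp add: phase_def norm_divide)

lemma spin_bound: "cmod (spin p0 p $ i) \<le> 1"
  using exhaust_2[of i] phase_bound[of p0 p] by (auto simp: spin_nth)

lemma phase_measurable: "phase p0 \<in> borel_measurable lebesgue"
proof (cases "A p0 = 0")
  case False
  have "(\<lambda>p. complex_of_real (cmod (A p))) \<in> borel_measurable lebesgue"
    using A_measurable by measurable
  then have "(\<lambda>p. A p / of_real (cmod (A p))) \<in> borel_measurable lebesgue"
    by (rule borel_measurable_divide[OF A_measurable])
  then show ?thesis using False by (simp add: phase_def[abs_def])
qed (simp add: phase_def[abs_def])

lemma spin_nth_measurable: "(\<lambda>p. spin p0 p $ i) \<in> borel_measurable lebesgue"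
proof -
  consider "i = 1" | "i = 2" using exhaust_2[of i] by blast
  then show ?thesis by cases (simp_all add: spin_nth phase_measurable)
qed

lemma isCont_A: "isCont A p"
  using A_cont by (simp add: continuous_on_eq_continuous_at)

lemma isCont_spin_nth: "isCont (\<lambda>p. spin p0 p $ i) p0"
proof -
  have "isCont (phase p0) p0"
  proof (cases "A p0 = 0")
    case False
    have "isCont (\<lambda>p. A p / of_real (cmod (A p))) p0"
      by (intro isCont_divide isCont_A isCont_of_real isCont_norm) (use False in simp)
    then show ?thesis using False by (simp add: phase_def[abs_def])
  qed (simp add: phase_def[abs_def])
  then show ?thesis
    using exhaust_2[of i] by (elim disjE) (simp_all add: spin_nth)
qed

text \<open>Along the eigenvector with unimodular phase the excess equals
  \<open>2 * (lambda_minus A p - kappa A)\<close>, to which the quadratic bound at a minimum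
  applies. If \<open>A p0 = 0\<close>, the constant vector has excess exactly
  \<open>|p|^2\<close>.\<close>

lemma spin_energy:
  assumes p0: "p0 \<in> min_set A" and U: "open U" "p0 \<in> U" "C2_on U (\<lambda>p. cmod (A p))"
  shows "\<exists>C \<rho>. 0 \<le> C \<and> 0 < \<rho> \<and> (\<forall>p. norm (p - p0) < \<rho> \<longrightarrow>
    Re (spinor_inner (spin p0 p) (H0_symbol A p *v spin p0 p)) - kappa A * (norm (spin p0 p))\<^sup>2 \<le> C * (norm (p - p0))\<^sup>2)"
proof -
  have k: "lambda_minus A p0 = kappa A" using p0 by (simp add: min_set_def)
  have en: "Re (spinor_inner (spin p0 p) (H0_symbol A p *v spin p0 p)) - kappa A * (norm (spin p0 p))\<^sup>2
      = ((norm p)\<^sup>2 - kappa A) * ((cmod (phase p0 p))\<^sup>2 + 1) - 2 * Re (cnj (phase p0 p) * A p)" for p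
    unfolding Re_symbol norm_spinor_square sum_2 spin_nth by (simp add: algebra_simps)
  show ?thesis
  proof (cases "A p0 = 0")
    case True
    \<comment> \<open>Comparison with the value at 0 gives \<open>|p0|^2 <= - |A 0|\<close>, which
      forces \<open>p0 = 0\<close> and \<open>kappa A = 0\<close>.\<close>
    have "(norm p0)\<^sup>2 = kappa A" using k True by (simp add: lambda_minus_def)
    moreover have "kappa A \<le> - cmod (A 0)" using kappa_le[of 0] by (simp add: lambda_minus_def)
    moreover have "0 \<le> (norm p0)\<^sup>2" "0 \<le> cmod (A 0)" by simp_all
    ultimately have "(norm p0)\<^sup>2 = 0" "kappa A = 0" by linarith+
    then have z: "p0 = 0" "kappa A = 0" by simp_all
    have ph: "phase p0 p = 0" for p using True by (simp add: phase_def)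
    show ?thesis
      unfolding en ph unfolding z by (intro exI[of _ 1]) simp
  next
    case False
    obtain C \<rho> where C: "0 \<le> C" "0 < \<rho>" "\<And>p. norm (p - p0) < \<rho> \<Longrightarrow>
        ((norm p)\<^sup>2 - cmod (A p)) - ((norm p0)\<^sup>2 - cmod (A p0)) \<le> C * (norm (p - p0))\<^sup>2"
    proof -
      have min: "(norm p0)\<^sup>2 - cmod (A p0) \<le> (norm p)\<^sup>2 - cmod (A p)" for p
        using kappa_le[of p] k unfolding lambda_minus_def by linarith
      show thesis using quadratic_bound_at_minimum[OF U min] that by blast
    qed
    \<comment> \<open>Within distance \<open>d\<close> of \<open>p0\<close> the value of
      \<open>A\<close> is nonzero, so the phase has modulus 1 there.\<close>
    obtain d where d: "0 < d" "\<And>p. norm (p - p0) < d \<Longrightarrow> norm (A p - A p0) < cmod (A p0)"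
    proof -
      have "0 < cmod (A p0)" using False by simp
      then show thesis
        using isCont_A[of p0, unfolded continuous_at_eps_delta, rule_format] that unfolding dist_norm by blast
    qed
    have "Re (spinor_inner (spin p0 p) (H0_symbol A p *v spin p0 p)) - kappa A * (norm (spin p0 p))\<^sup>2 \<le> 2 * C * (norm (p - p0))\<^sup>2"
      if p: "norm (p - p0) < min d \<rho>" for p
    proof -
      have Ap: "A p \<noteq> 0"
      proof
        assume "A p = 0"
        then show False using d(2)[of p] p by simp
      qed
      then have "cmod (phase p0 p) = 1" using False by (simp add: phase_def norm_divide)
      moreover have "cnj (phase p0 p) * A p = of_real (cmod (A p))"
      proof -
        have "cnj (A p) * A p = of_real (cmod (A p)) * of_real (cmod (A p))"
          using complex_norm_square[of "A p"] by (simp add: power2_eq_square mult.commute)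
        then show ?thesis using Ap False by (simp add: phase_def field_simps)
      qed
      moreover have "kappa A = (norm p0)\<^sup>2 - cmod (A p0)" using k by (simp add: lambda_minus_def)
      ultimately have "Re (spinor_inner (spin p0 p) (H0_symbol A p *v spin p0 p)) - kappa A * (norm (spin p0 p))\<^sup>2
          = 2 * (((norm p)\<^sup>2 - cmod (A p)) - ((norm p0)\<^sup>2 - cmod (A p0)))"
        unfolding en by simp
      also have "\<dots> \<le> 2 * (C * (norm (p - p0))\<^sup>2)"
        using C(3)[of p] p by (intro mult_left_mono) simp_all
      finally show ?thesis by (simp only: mult.assoc)
    qed
    then show ?thesis
      using C(1,2) d(1) by (intro exI[of _ "2 * C"] exI[of _ "min d \<rho>"]) simp
  qed
qed

text \<open>The symbols are \<open>bump\<close> times \<open>spin\<close>. Their mass 1 bounds each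
  of the two components by 1 at every point, whence the bound 2, and continuity of
  \<open>spin\<close> at \<open>p0\<close> gives the plane wave as pointwise limit. The pointwise
  bound is what serves later for domination.\<close>

lemma trial_sequence:
  assumes p0: "p0 \<in> min_set A" and U: "open U" "p0 \<in> U" "C2_on U (\<lambda>p. cmod (A p))"
  shows "\<exists>\<psi> :: nat \<Rightarrow> plane \<Rightarrow> spinor. (\<forall>n. \<psi> n \<in> sobolev_H1) \<and> (\<lambda>n. Re (excess (\<psi> n) (\<psi> n))) \<longlonglongrightarrow> 0 \<and>
    (\<forall>n x. norm (\<psi> n x) \<le> 2) \<and>
    (\<forall>x. (\<lambda>n. \<psi> n x) \<longlonglongrightarrow> (exp (\<i> * of_real (p0 \<bullet> x)) / of_real (2 * pi)) *s spin p0 p0)"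
proof -
  obtain C \<rho> where C: "0 \<le> C" and \<rho>: "0 < \<rho>" and en: "\<And>p. norm (p - p0) < \<rho> \<Longrightarrow>
    Re (spinor_inner (spin p0 p) (H0_symbol A p *v spin p0 p)) - kappa A * (norm (spin p0 p))\<^sup>2 \<le> C * (norm (p - p0))\<^sup>2"
    using spin_energy[OF assms] by (elim exE conjE) (rule that, assumption, assumption, simp)
  define b where "b n = bump p0 \<rho> (Suc n)" for n
  define G where "G n p = b n p *\<^sub>R spin p0 p" for n p
  have b0: "0 \<le> b n p" for n p unfolding b_def by (rule bump_nonneg[OF \<rho>])
  have G_nth: "G n p $ i = b n p *\<^sub>R (spin p0 p $ i)" for n p i by (simp add: G_def)
  have Gm: "G n \<in> borel_measurable lebesgue" for n
    by (rule borel_measurable_spinor, unfold G_nth b_def)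
       (intro borel_measurable_scaleR bump_measurable[OF \<rho>] spin_nth_measurable)
  have spin2: "norm (spin p0 p) \<le> 2" for p
  proof -
    have "norm (spin p0 p) \<le> (\<Sum>i\<in>UNIV. cmod (spin p0 p $ i))"
      unfolding norm_vec_def by (rule L2_set_le_sum) simp
    also have "\<dots> \<le> (\<Sum>i\<in>(UNIV :: 2 set). 1)" by (intro sum_mono spin_bound)
    finally show ?thesis by simp
  qed
  have supp: "norm (p - p0) < \<rho>" if "b n p \<noteq> 0" for n p
  proof -
    have "norm (p - p0) < \<rho> / 2 ^ Suc n" by (rule bump_support[OF \<rho> that[unfolded b_def]])
    also have "\<dots> \<le> \<rho> / 1" using \<rho> by (intro divide_left_mono one_le_power) simp_all
    finally show ?thesis by simp
  qed
  have pos: "AE p in lebesgue. fourier2 (position (G n)) p = G n p" "position (G n) \<in> sobolev_H1"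
    "\<And>i. integrable lebesgue (\<lambda>p. G n p $ i)" for n
  proof -
    obtain B where B: "\<And>p. b n p \<le> B" using bump_bounded[OF \<rho>, of p0 "Suc n"] unfolding b_def by blast
    have B': "norm (G n p) \<le> B * 2" for p
      unfolding G_def norm_scaleR abs_of_nonneg[OF b0] using order_trans[OF b0 B] by (intro mult_mono B spin2) simp_all
    have R: "norm p \<le> \<rho> + norm p0" if "G n p \<noteq> 0" for p
    proof -
      have "norm (p - p0) < \<rho>" using that by (intro supp[of n]) (auto simp: G_def)
      then show ?thesis using norm_triangle_sub[of p p0] by linarith
    qed
    show "AE p in lebesgue. fourier2 (position (G n)) p = G n p"
      by (rule position_sobolev(1)[OF Gm B' R])
    show "position (G n) \<in> sobolev_H1"
      by (rule position_sobolev(2)[OF Gm B' R])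
    show "integrable lebesgue (\<lambda>p. G n p $ i)" for i
      by (rule position_sobolev(3)[OF Gm B' R])
  qed
  define \<psi> where "\<psi> n = position (G n)" for n
  have \<psi>Q: "\<psi> n \<in> sobolev_H1" for n unfolding \<psi>_def by (rule pos)
  define c where "c = 4 / (3 * unit_ball_vol 2)"
  have up: "Re (excess (\<psi> n) (\<psi> n)) \<le> C * c * inverse (real (Suc n))" for n
  proof -
    note L = fourier2_L2[OF sobolev_L2[OF \<psi>Q[of n]]]
    note i2 = integrable_mult_right[OF L2_integrable[OF L], of "kappa A"]
    have "Re (excess (\<psi> n) (\<psi> n))
        = (LINT p|lebesgue. Re (spinor_inner (fourier2 (\<psi> n) p) (H0_symbol A p *v fourier2 (\<psi> n) p)))
        - (LINT p|lebesgue. kappa A * (norm (fourier2 (\<psi> n) p))\<^sup>2)"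
      unfolding Re_excess[OF \<psi>Q] Re_H0_form(2)[OF \<psi>Q] l2_fourier2[OF sobolev_L2[OF \<psi>Q], symmetric]
        l2_square integral_mult_right_zero ..
    also have "\<dots> = (LINT p|lebesgue. Re (spinor_inner (fourier2 (\<psi> n) p) (H0_symbol A p *v fourier2 (\<psi> n) p))
        - kappa A * (norm (fourier2 (\<psi> n) p))\<^sup>2)"
      by (rule Bochner_Integration.integral_diff[OF Re_H0_form(1)[OF \<psi>Q] i2, symmetric])
    also have "\<dots> \<le> (LINT p|lebesgue. C * ((b n p)\<^sup>2 * (norm (p - p0))\<^sup>2))"
    proof (rule integral_mono_AE[OF Bochner_Integration.integrable_diff[OF Re_H0_form(1)[OF \<psi>Q] i2]])
      show "integrable lebesgue (\<lambda>p. C * ((b n p)\<^sup>2 * (norm (p - p0))\<^sup>2))"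
        unfolding b_def by (rule integrable_mult_right[OF bump_energy(1)[OF \<rho>]]) simp
      show "AE p in lebesgue. Re (spinor_inner (fourier2 (\<psi> n) p) (H0_symbol A p *v fourier2 (\<psi> n) p))
          - kappa A * (norm (fourier2 (\<psi> n) p))\<^sup>2 \<le> C * ((b n p)\<^sup>2 * (norm (p - p0))\<^sup>2)"
        using pos(1)[of n]
      proof eventually_elim
        case (elim p)
        let ?e = "Re (spinor_inner (spin p0 p) (H0_symbol A p *v spin p0 p)) - kappa A * (norm (spin p0 p))\<^sup>2"
        have F: "fourier2 (\<psi> n) p = b n p *\<^sub>R spin p0 p" using elim by (simp add: \<psi>_def G_def)
        have "Re (spinor_inner (fourier2 (\<psi> n) p) (H0_symbol A p *v fourier2 (\<psi> n) p)) - kappa A * (norm (fourier2 (\<psi> n) p))\<^sup>2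
            = (b n p)\<^sup>2 * ?e"
          unfolding F Re_symbol_scaleR norm_scaleR power_mult_distrib power2_abs right_diff_distrib
          by (simp only: mult.left_commute[of "kappa A"])
        also have "\<dots> \<le> (b n p)\<^sup>2 * (C * (norm (p - p0))\<^sup>2)"
        proof (cases "b n p = 0")
          case False
          show ?thesis by (intro mult_left_mono en supp[OF False]) simp
        qed simp
        also have "\<dots> = C * ((b n p)\<^sup>2 * (norm (p - p0))\<^sup>2)"
          by (rule mult.left_commute)
        finally show ?case .
      qed
    qed
    also have "\<dots> = C * (LINT p|lebesgue. (b n p)\<^sup>2 * (norm (p - p0))\<^sup>2)"
      by (rule integral_mult_right_zero)
    also have "\<dots> \<le> C * (4 / (3 * unit_ball_vol 2) / real (Suc n))"
      unfolding b_def by (intro mult_left_mono C bump_energy(2)[OF \<rho>]) simp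
    also have "\<dots> = C * c * inverse (real (Suc n))"
      by (simp only: c_def divide_inverse mult.assoc)
    finally show ?thesis .
  qed
  have lim: "(\<lambda>n. C * c * inverse (real (Suc n))) \<longlonglongrightarrow> 0"
    by (rule tendsto_mult_right_zero[OF LIMSEQ_inverse_real_of_nat])
  have nn: "0 \<le> Re (excess (\<psi> n) (\<psi> n))" for n
    by (rule positive_form.nonneg[OF excess_positive \<psi>Q])
  have e0: "(\<lambda>n. Re (excess (\<psi> n) (\<psi> n))) \<longlonglongrightarrow> 0"
    by (rule tendsto_sandwich[OF always_eventually always_eventually tendsto_const lim]) (rule allI, rule nn, rule allI, rule up)
  have comp: "cmod (\<psi> n x $ i) \<le> 1" for n x i
  proof -
    have "cmod (\<psi> n x $ i) \<le> (LINT p|lebesgue. cmod (G n p $ i))"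
      unfolding \<psi>_def position_def vec_lambda_beta by (rule fourier_integral_bound[OF pos(3)])
    also have "\<dots> \<le> (LINT p|lebesgue. b n p)"
    proof (rule integral_mono[OF integrable_norm[OF pos(3)]])
      show "integrable lebesgue (b n)" unfolding b_def by (rule bump_integrable[OF \<rho>])
      show "cmod (G n p $ i) \<le> b n p" for p
        unfolding G_nth norm_scaleR abs_of_nonneg[OF b0] by (rule mult_left_le[OF spin_bound b0])
    qed
    also have "\<dots> = 1" unfolding b_def by (rule bump_integral[OF \<rho>]) simp
    finally show ?thesis .
  qed
  have bd: "norm (\<psi> n x) \<le> 2" for n x
  proof -
    have "norm (\<psi> n x) \<le> (\<Sum>i\<in>UNIV. cmod (\<psi> n x $ i))"
      unfolding norm_vec_def by (rule L2_set_le_sum) simp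
    also have "\<dots> \<le> (\<Sum>i\<in>(UNIV :: 2 set). 1)" by (intro sum_mono comp)
    finally show ?thesis by simp
  qed
  have pt: "(\<lambda>n. \<psi> n x) \<longlonglongrightarrow> (exp (\<i> * of_real (p0 \<bullet> x)) / of_real (2 * pi)) *s spin p0 p0" for x
  proof (rule vec_tendstoI)
    fix i
    let ?F = "\<lambda>p. exp (- \<i> * complex_of_real (- x \<bullet> p)) * (spin p0 p $ i)"
    have em: "(\<lambda>p. exp (- \<i> * complex_of_real (- x \<bullet> p))) \<in> borel_measurable lebesgue"
      by (rule borel_lebesgue_measurable) measurable
    have "(\<lambda>n. LINT p|lebesgue. b n p *\<^sub>R ?F p) \<longlonglongrightarrow> ?F p0"
      unfolding b_def
    proof (rule bump_tendsto[OF \<rho>])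
      show "?F \<in> borel_measurable lebesgue" by (rule borel_measurable_times[OF em spin_nth_measurable])
      show "cmod (?F p) \<le> 1" for p by (simp add: norm_mult spin_bound)
      have "isCont (\<lambda>p. exp (- \<i> * complex_of_real (- x \<bullet> p))) p0" by (intro continuous_intros)
      then show "isCont ?F p0" by (rule isCont_mult[OF _ isCont_spin_nth])
    qed
    then have "(\<lambda>n. (LINT p|lebesgue. b n p *\<^sub>R ?F p) / of_real (2 * pi)) \<longlonglongrightarrow> ?F p0 / of_real (2 * pi)"
      by (rule tendsto_divide[OF _ tendsto_const]) simp
    moreover have "(LINT p|lebesgue. b n p *\<^sub>R ?F p) / of_real (2 * pi) = \<psi> n x $ i" for n
      unfolding \<psi>_def position_def vec_lambda_beta fourier_integral_def G_nth
      by (intro arg_cong[of _ _ "\<lambda>z. z / of_real (2 * pi)"] Bochner_Integration.integral_cong refl) simp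
    moreover have "?F p0 / of_real (2 * pi) = ((exp (\<i> * of_real (p0 \<bullet> x)) / of_real (2 * pi)) *s spin p0 p0) $ i"
      by (simp add: inner_commute)
    ultimately show "(\<lambda>n. \<psi> n x $ i) \<longlonglongrightarrow> ((exp (\<i> * of_real (p0 \<bullet> x)) / of_real (2 * pi)) *s spin p0 p0) $ i"
      by (simp only:)
  qed
  show ?thesis
    by (intro exI[of _ \<psi>] conjI allI \<psi>Q e0 bd pt)
qed

end

lemma sum_fun_at: "(\<Sum>j\<in>J. F j) x = (\<Sum>j\<in>J. F j x)" for F :: "'j \<Rightarrow> 'a \<Rightarrow> 'b::comm_monoid_add"
  by (induction J rule: infinite_finite_induct) (simp_all add: zero_fun_def)

context spin_potential
begin

text \<open>Contradiction by compactness of the coefficients. If the trial functions fail for every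
  \<open>n\<close>, each \<open>n\<close> has a bad coefficient vector, normalised to total modulus
  1. Failure bounds the potential energy by the excess, which tends to 0, so a limiting combination
  of plane waves vanishes almost everywhere on \<open>Z\<close>. Independence makes its coefficients
  0, against the normalisation.\<close>

lemma trial_family:
  fixes p :: "nat \<Rightarrow> plane"
  assumes inj: "inj_on p {..<N}" and S: "\<And>j. j < N \<Longrightarrow> p j \<in> min_set A"
    and U: "open U" "min_set A \<subseteq> U" "C2_on U (\<lambda>p. cmod (A p))"
    and Z: "Z \<in> lmeasurable" "0 < measure lebesgue Z" "\<And>x. x \<in> Z \<Longrightarrow> W x \<noteq> 0"
  shows "\<exists>\<psi>. (\<forall>j<N. \<psi> j \<in> sobolev_H1) \<and> (\<forall>c :: nat \<Rightarrow> complex. (\<exists>j<N. c j \<noteq> 0) \<longrightarrow>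
      Re (P.h (\<Sum>j<N. smult (c j) (\<psi> j)) (\<Sum>j<N. smult (c j) (\<psi> j)))
        < kappa A * Re (L2_inner (\<Sum>j<N. smult (c j) (\<psi> j)) (\<Sum>j<N. smult (c j) (\<psi> j))))"
proof (rule ccontr)
  assume contr: "\<not> ?thesis"
  interpret E: positive_form smult sobolev_H1 excess by (rule excess_positive)
  interpret WF: positive_form smult sobolev_H1 w.form by (rule w.positive)
  define good :: "nat \<Rightarrow> (nat \<Rightarrow> plane \<Rightarrow> spinor) \<Rightarrow> bool" where "good j \<psi> \<longleftrightarrow>
    (\<forall>n. \<psi> n \<in> sobolev_H1) \<and> (\<lambda>n. Re (excess (\<psi> n) (\<psi> n))) \<longlonglongrightarrow> 0 \<and>
    (\<forall>n x. norm (\<psi> n x) \<le> 2) \<and>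
    (\<forall>x. (\<lambda>n. \<psi> n x) \<longlonglongrightarrow> (exp (\<i> * of_real (p j \<bullet> x)) / of_real (2 * pi)) *s spin (p j) (p j))" for j \<psi>
  have "\<forall>j\<in>{..<N}. \<exists>\<psi>. good j \<psi>"
  proof
    fix j assume "j \<in> {..<N}"
    then have pj: "p j \<in> min_set A" using S by simp
    show "\<exists>\<psi>. good j \<psi>"
      unfolding good_def by (rule trial_sequence[OF pj U(1) subsetD[OF U(2) pj] U(3)])
  qed
  from bchoice[OF this] obtain \<Psi> where \<Psi>: "\<forall>j\<in>{..<N}. good j (\<Psi> j)" by (rule exE)
  have \<Psi>Q: "\<Psi> j n \<in> sobolev_H1" and \<Psi>E: "(\<lambda>n. Re (excess (\<Psi> j n) (\<Psi> j n))) \<longlonglongrightarrow> 0"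
    and \<Psi>b: "norm (\<Psi> j n x) \<le> 2"
    and \<Psi>l: "(\<lambda>n. \<Psi> j n x) \<longlonglongrightarrow> (exp (\<i> * of_real (p j \<bullet> x)) / of_real (2 * pi)) *s spin (p j) (p j)"
    if "j < N" for j n x
    using bspec[OF \<Psi>, of j] that unfolding good_def by simp_all
  define bad :: "nat \<Rightarrow> (nat \<Rightarrow> complex) \<Rightarrow> bool" where "bad n c \<longleftrightarrow> (\<exists>j<N. c j \<noteq> 0) \<and>
      \<not> Re (P.h (\<Sum>j<N. smult (c j) (\<Psi> j n)) (\<Sum>j<N. smult (c j) (\<Psi> j n)))
        < kappa A * Re (L2_inner (\<Sum>j<N. smult (c j) (\<Psi> j n)) (\<Sum>j<N. smult (c j) (\<Psi> j n)))" for n c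
  have "\<exists>c. bad n c" for n
  proof (rule ccontr)
    assume no: "\<not> (\<exists>c. bad n c)"
    have "\<exists>\<psi>. (\<forall>j<N. \<psi> j \<in> sobolev_H1) \<and> (\<forall>c :: nat \<Rightarrow> complex. (\<exists>j<N. c j \<noteq> 0) \<longrightarrow>
      Re (P.h (\<Sum>j<N. smult (c j) (\<psi> j)) (\<Sum>j<N. smult (c j) (\<psi> j)))
        < kappa A * Re (L2_inner (\<Sum>j<N. smult (c j) (\<psi> j)) (\<Sum>j<N. smult (c j) (\<psi> j))))"
    proof (intro exI[of _ "\<lambda>j. \<Psi> j n"] conjI allI impI)
      fix j assume "j < N"
      then show "\<Psi> j n \<in> sobolev_H1" by (rule \<Psi>Q)
    next
      fix c :: "nat \<Rightarrow> complex" assume c: "\<exists>j<N. c j \<noteq> 0"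
      have "\<not> bad n c" using no by blast
      then show "Re (P.h (\<Sum>j<N. smult (c j) (\<Psi> j n)) (\<Sum>j<N. smult (c j) (\<Psi> j n)))
        < kappa A * Re (L2_inner (\<Sum>j<N. smult (c j) (\<Psi> j n)) (\<Sum>j<N. smult (c j) (\<Psi> j n)))"
        unfolding bad_def using c by blast
    qed
    with contr show False by (rule notE)
  qed
  then obtain c where c: "\<And>n. bad n (c n)" by metis
  \<comment> \<open>The failing inequality is homogeneous of degree two, so the coefficients may be
    divided by their total modulus.\<close>
  define s where "s n = (\<Sum>j<N. cmod (c n j))" for n
  define d where "d n j = of_real (1 / s n) * c n j" for n j
  define \<Phi> where "\<Phi> n = (\<Sum>j<N. smult (d n j) (\<Psi> j n))" for n
  have s: "0 < s n" for n
  proof -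
    obtain j where j: "j < N" "c n j \<noteq> 0" using c[of n] unfolding bad_def by blast
    have "cmod (c n j) \<le> s n" unfolding s_def by (rule member_le_sum) (use j in simp_all)
    then show ?thesis using j by (smt (verit) zero_less_norm_iff)
  qed
  have d1: "(\<Sum>j<N. cmod (d n j)) = 1" for n
  proof -
    have dn: "cmod (d n j) = (1 / s n) * cmod (c n j)" for j
      unfolding d_def norm_mult norm_of_real using s[of n] by simp
    have "(\<Sum>j<N. cmod (d n j)) = (1 / s n) * s n"
      unfolding dn sum_distrib_left[symmetric] s_def[symmetric] ..
    then show ?thesis using s[of n] by simp
  qed
  have d_le: "cmod (d n j) \<le> 1" if "j < N" for n j
    unfolding d1[of n, symmetric] by (rule member_le_sum) (use that in simp_all)
  have \<Phi>Q: "\<Phi> n \<in> sobolev_H1" for n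
    unfolding \<Phi>_def by (rule E.Q_closed(6)) (rule E.Q_closed(2), rule \<Psi>Q, simp)
  \<comment> \<open>Failure of the strict inequality says that \<open>w\<close> is at most the
    excess for the original coefficients; both sides scale by the same factor.\<close>
  have w_le: "Re (w.form (\<Phi> n) (\<Phi> n)) \<le> Re (excess (\<Phi> n) (\<Phi> n))" for n
  proof -
    define X where "X = (\<Sum>j<N. smult (c n j) (\<Psi> j n))"
    have XQ: "X \<in> sobolev_H1"
      unfolding X_def by (rule E.Q_closed(6)) (rule E.Q_closed(2), rule \<Psi>Q, simp)
    have "\<not> Re (P.h X X) < kappa A * Re (L2_inner X X)" using c[of n] unfolding bad_def X_def by blast
    then have "Re (w.form X X) \<le> Re (excess X X)"
      by (simp add: P.h_def excess_def)
    moreover have "\<Phi> n = smult (of_real (1 / s n)) X"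
      unfolding \<Phi>_def X_def d_def P.scale_sum_right by (intro sum.cong refl) (simp only: P.scale_scale)
    ultimately show ?thesis
      by (simp only: E.qf_scale[OF XQ] WF.qf_scale[OF XQ]) (rule mult_left_mono, simp_all)
  qed
  \<comment> \<open>The excess defines a seminorm, and coefficients of modulus at most 1 leave at
    most the sum of the seminorms of the single trial functions, each tending to 0.\<close>
  have to0: "(\<lambda>n. l2 (wt2 (\<Phi> n))) \<longlonglongrightarrow> 0"
  proof (rule Lim_null_comparison[OF always_eventually])
    show "\<forall>n. norm (l2 (wt2 (\<Phi> n))) \<le> (\<Sum>j<N. sqrt (Re (excess (\<Psi> j n) (\<Psi> j n))))"
    proof
      fix n
      have "norm (l2 (wt2 (\<Phi> n))) = sqrt ((l2 (wt2 (\<Phi> n)))\<^sup>2)" by simp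
      also have "\<dots> \<le> sqrt (Re (excess (\<Phi> n) (\<Phi> n)))"
        using w_le[of n] unfolding Re_w[OF \<Phi>Q] by (rule real_sqrt_le_mono)
      also have "\<dots> \<le> (\<Sum>j<N. sqrt (Re (excess (smult (d n j) (\<Psi> j n)) (smult (d n j) (\<Psi> j n)))))"
        unfolding \<Phi>_def by (rule E.triangle_sum) (rule E.Q_closed(2), rule \<Psi>Q, simp)
      also have "\<dots> \<le> (\<Sum>j<N. sqrt (Re (excess (\<Psi> j n) (\<Psi> j n))))"
      proof (rule sum_mono)
        fix j assume "j \<in> {..<N}"
        then have j: "j < N" by simp
        have "(cmod (d n j))\<^sup>2 \<le> 1" using d_le[OF j] by (simp add: power_le_one)
        then have "(cmod (d n j))\<^sup>2 * Re (excess (\<Psi> j n) (\<Psi> j n)) \<le> 1 * Re (excess (\<Psi> j n) (\<Psi> j n))"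
          by (rule mult_right_mono) (rule E.nonneg[OF \<Psi>Q[OF j]])
        then show "sqrt (Re (excess (smult (d n j) (\<Psi> j n)) (smult (d n j) (\<Psi> j n)))) \<le> sqrt (Re (excess (\<Psi> j n) (\<Psi> j n)))"
          unfolding E.qf_scale[OF \<Psi>Q[OF j]] by (intro real_sqrt_le_mono) simp
      qed
      finally show "norm (l2 (wt2 (\<Phi> n))) \<le> (\<Sum>j<N. sqrt (Re (excess (\<Psi> j n) (\<Psi> j n))))" .
    qed
    have "(\<lambda>n. \<Sum>j<N. sqrt (Re (excess (\<Psi> j n) (\<Psi> j n)))) \<longlonglongrightarrow> (\<Sum>j<N. sqrt 0)"
      by (intro tendsto_sum tendsto_real_sqrt \<Psi>E) simp
    then show "(\<lambda>n. \<Sum>j<N. sqrt (Re (excess (\<Psi> j n) (\<Psi> j n)))) \<longlonglongrightarrow> 0" by simp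
  qed
  obtain r where r: "strict_mono (r :: nat \<Rightarrow> nat)" "\<forall>j\<in>{..<N}. \<exists>l. (\<lambda>n. d (r n) j) \<longlonglongrightarrow> l"
  proof (rule function_convergent_subsequence[of "{..<N}" d 1])
    show "countable {..<N}" by simp
    show "norm (d n j) \<le> 1" if "j \<in> {..<N}" for n j using d_le that by simp
    show thesis if "strict_mono k" "\<And>x. x \<in> {..<N} \<Longrightarrow> \<exists>l. (\<lambda>n. d (k n) x) \<longlonglongrightarrow> l" for k :: "nat \<Rightarrow> nat"
      using that \<open>\<And>r. strict_mono r \<Longrightarrow> \<forall>j\<in>{..<N}. \<exists>l. (\<lambda>n. d (r n) j) \<longlonglongrightarrow> l \<Longrightarrow> thesis\<close> by blast
  qed
  from bchoice[OF r(2)] obtain e where "\<forall>j\<in>{..<N}. (\<lambda>n. d (r n) j) \<longlonglongrightarrow> e j" by (rule exE)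
  then have e: "(\<lambda>n. d (r n) j) \<longlonglongrightarrow> e j" if "j < N" for j using that by simp
  have "(\<lambda>n. \<Sum>j<N. cmod (d (r n) j)) \<longlonglongrightarrow> (\<Sum>j<N. cmod (e j))"
    by (intro tendsto_sum tendsto_norm e) simp
  then have e1: "(\<Sum>j<N. cmod (e j)) = 1"
    unfolding d1 by (simp only: LIMSEQ_const_iff)
  define \<Phi>l :: "plane \<Rightarrow> spinor" where
    "\<Phi>l x = (\<chi> i. \<Sum>j<N. e j * ((exp (\<i> * of_real (p j \<bullet> x)) / of_real (2 * pi)) * spin (p j) (p j) $ i))" for x
  have \<Phi>_nth: "\<Phi> n x $ i = (\<Sum>j<N. d n j * \<Psi> j n x $ i)" for n x i
    unfolding \<Phi>_def sum_fun_at sum_component by (simp add: smult_def)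
  have \<Phi>lim: "(\<lambda>n. \<Phi> (r n) x) \<longlonglongrightarrow> \<Phi>l x" for x
  proof (rule vec_tendstoI)
    fix i
    have "(\<lambda>n. \<Sum>j<N. d (r n) j * \<Psi> j (r n) x $ i)
        \<longlonglongrightarrow> (\<Sum>j<N. e j * ((exp (\<i> * of_real (p j \<bullet> x)) / of_real (2 * pi)) *s spin (p j) (p j)) $ i)"
    proof (intro tendsto_sum tendsto_mult)
      fix j assume "j \<in> {..<N}"
      then have j: "j < N" by simp
      show "(\<lambda>n. d (r n) j) \<longlonglongrightarrow> e j" by (rule e[OF j])
      show "(\<lambda>n. \<Psi> j (r n) x $ i) \<longlonglongrightarrow> ((exp (\<i> * of_real (p j \<bullet> x)) / of_real (2 * pi)) *s spin (p j) (p j)) $ i"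
        by (rule tendsto_vec_nth) (rule LIMSEQ_subseq_LIMSEQ[OF \<Psi>l[OF j] r(1), unfolded o_def])
    qed
    then show "(\<lambda>n. \<Phi> (r n) x $ i) \<longlonglongrightarrow> \<Phi>l x $ i"
      unfolding \<Phi>_nth \<Phi>l_def vec_lambda_beta vector_smult_component .
  qed
  have \<Phi>b: "norm (\<Phi> n x) \<le> 2" for n x
  proof -
    have "norm (\<Phi> n x) \<le> (\<Sum>j<N. norm (smult (d n j) (\<Psi> j n) x))"
      unfolding \<Phi>_def sum_fun_at by (rule norm_sum)
    also have "\<dots> \<le> (\<Sum>j<N. cmod (d n j) * 2)"
      by (intro sum_mono) (simp add: smult_def norm_smult_spinor mult_left_mono \<Psi>b)
    also have "\<dots> = 2" using d1[of n] by (simp flip: sum_distrib_right)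
    finally show ?thesis .
  qed
  \<comment> \<open>The combinations are bounded by 2 at every point, so integrability of
    \<open>W\<close> yields the dominating function.\<close>
  have bL: "(\<lambda>x. sqrt (W x) * 2) \<in> L2"
  proof (rule L2_bound)
    show "(\<lambda>x. sqrt (W x) * 2) \<in> borel_measurable lebesgue" using W_measurable by measurable
    show "integrable lebesgue (\<lambda>x. 4 * W x)" using W_int by simp
    show "AE x in lebesgue. (norm (sqrt (W x) * 2))\<^sup>2 \<le> 4 * W x"
      using W_nonneg by (intro AE_I2) (simp add: power_mult_distrib)
  qed
  have wlim: "(\<lambda>n. wt2 (\<Phi> (r n)) x) \<longlonglongrightarrow> wt2 \<Phi>l x" for x
    unfolding wt2_def by (intro tendsto_scaleR tendsto_const \<Phi>lim)
  have wb: "norm (wt2 (\<Phi> (r n)) x) \<le> norm (sqrt (W x) * 2)" for n x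
    using \<Phi>b[of "r n" x] W_nonneg[of x] by (simp add: wt2_def abs_mult mult_left_mono)
  note dc = L2_dominated_convergence[OF bL L2_measurable[OF wt2_L2[OF \<Phi>Q]] wlim wb]
  have "(\<lambda>n. l2 (wt2 (\<Phi> (r n)))) \<longlonglongrightarrow> l2 (wt2 \<Phi>l)"
    by (rule l2_tendsto[OF dc])
  moreover have "(\<lambda>n. l2 (wt2 (\<Phi> (r n)))) \<longlonglongrightarrow> 0"
    using LIMSEQ_subseq_LIMSEQ[OF to0 r(1)] by (simp only: o_def)
  ultimately have "l2 (wt2 \<Phi>l) = 0" by (rule LIMSEQ_unique)
  then have "AE x in lebesgue. wt2 \<Phi>l x = 0" by (rule l2_eq_0_AE[OF dc(2)])
  then obtain M where M: "{x \<in> space lebesgue. \<not> wt2 \<Phi>l x = 0} \<subseteq> M" "emeasure lebesgue M = 0" "M \<in> sets lebesgue"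
    by (rule AE_E)
  have Mnull: "M \<in> null_sets lebesgue" using M(2,3) by (simp add: null_sets_def)
  have "\<forall>j\<in>{..<N}. e j = 0"
  proof (rule trigonometric_independent[OF _ inj])
    show "Z - M \<in> lmeasurable" by (rule fmeasurable_Diff[OF Z(1) M(3)])
    show "0 < measure lebesgue (Z - M)"
      using Z(2) measure_Diff_null_set[OF fmeasurableD[OF Z(1)] Mnull] by simp
    fix x assume x: "x \<in> Z - M"
    then have "wt2 \<Phi>l x = 0" using M(1) by auto
    then have "\<Phi>l x = 0" using Z(3)[of x] x W_nonneg[of x] by (simp add: wt2_def)
    \<comment> \<open>The second component of every \<open>spin\<close> is -1, so it shows the
      coefficients \<open>e j\<close> in a scalar trigonometric sum, up to a common factor.\<close>
    then have "\<Phi>l x $ 2 = 0" by simp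
    then have "(\<Sum>j<N. - (e j * exp (\<i> * of_real (p j \<bullet> x))) / of_real (2 * pi)) = 0"
      by (simp add: \<Phi>l_def spin_nth)
    then show "(\<Sum>j<N. e j * exp (\<i> * of_real (p j \<bullet> x))) = 0"
      unfolding sum_divide_distrib[symmetric] sum_negf by simp
  qed simp
  then have "(\<Sum>j<N. cmod (e j)) = 0" by simp
  with e1 show False by simp
qed

end

text \<open>An infinite set has finite subsets of every size, so testing finite subsets of the
  minimising set settles both cases of the count.\<close>

lemma finite_le_num_points: "(\<And>F. finite F \<Longrightarrow> F \<subseteq> X \<Longrightarrow> enat (card F) \<le> m) \<Longrightarrow> num_points X \<le> m"
proof (cases "finite X")
  case False
  assume le: "\<And>F. finite F \<Longrightarrow> F \<subseteq> X \<Longrightarrow> enat (card F) \<le> m"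
  have n: "enat n \<le> m" for n
    using infinite_arbitrarily_large[OF False, of n] le by blast
  show ?thesis
  proof (cases m)
    case (enat k)
    with n[of "Suc k"] show ?thesis by simp
  qed simp
qed (simp add: num_points_def)

section \<open>Counting eigenvalues\<close>

text \<open>The orthonormal eigenvectors are grouped by eigenvalue. Each group is independent modulo
  null functions, hence no larger than the multiplicity, and an infinite sum in \<open>enat\<close>
  is the supremum of its finite partial sums.\<close>

lemma count_eigenvalues_below:
  assumes b: "\<And>i. i < N \<Longrightarrow> b i \<in> eigenspace T (\<mu> i)" "\<And>i. i < N \<Longrightarrow> \<mu> i < k" "\<And>i. i < N \<Longrightarrow> b i \<in> sobolev_H1"
    and orth: "\<And>i j. i < N \<Longrightarrow> j < N \<Longrightarrow> L2_inner (b i) (b j) = (if i = j then 1 else 0)"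
  shows "enat N \<le> num_eigenvalues_below T k"
proof -
  have herm: "hermitian_form smult sobolev_H1 L2_inner" using ip.hermitian by (simp only: ip_form)
  interpret hermitian_form smult sobolev_H1 L2_inner by (rule herm)
  have inner_null: "L2_inner \<phi> \<psi> = 0" if "\<phi> \<in> sobolev_H1" "\<psi> \<in> sobolev_H1" "AE x in lebesgue. \<psi> x = 0" for \<phi> \<psi>
  proof -
    have "L2_inner \<phi> \<psi> = (LINT x|(lebesgue :: plane measure). 0)"
      unfolding L2_inner_def
    proof (rule integral_cong_AE)
      show "(\<lambda>x. spinor_inner (\<phi> x) (\<psi> x)) \<in> borel_measurable lebesgue"
        by (intro borel_measurable_spinor_inner L2_measurable sobolev_L2 that)
      show "AE x in lebesgue. spinor_inner (\<phi> x) (\<psi> x) = 0"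
        using that(3) by eventually_elim (simp add: spinor_inner_def)
    qed simp
    then show ?thesis by simp
  qed
  have inj: "inj_on b {..<N}"
  proof (rule inj_onI)
    fix i j assume ij: "i \<in> {..<N}" "j \<in> {..<N}" "b i = b j"
    then have "L2_inner (b i) (b j) = 1" using orth[of i i] by simp
    then show "i = j" using orth[of i j] ij by (simp split: if_splits)
  qed
  have ev: "is_eigenvalue T (\<mu> i)" if i: "i < N" for i
  proof -
    have "\<not> (AE x in lebesgue. b i x = 0)"
    proof
      assume "AE x in lebesgue. b i x = 0"
      from inner_null[OF b(3)[OF i] b(3)[OF i] this] orth[OF i i] show False by simp
    qed
    then show ?thesis unfolding is_eigenvalue_def using b(1)[OF i] by blast
  qed
  define I where "I m = {i \<in> {..<N}. \<mu> i = m}" for m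
  have mult: "enat (card (I m)) \<le> multiplicity_of T m" for m
  proof -
    have "card (I m) = card (b ` I m)"
      by (rule card_image[symmetric], rule inj_on_subset[OF inj]) (auto simp: I_def)
    moreover have "finite (b ` I m)" by (simp add: I_def)
    moreover have "b ` I m \<subseteq> eigenspace T m" using b(1) by (auto simp: I_def)
    moreover have "L2_independent (b ` I m)"
      unfolding L2_independent_def
    proof (intro allI impI ballI)
      fix c :: "(plane \<Rightarrow> spinor) \<Rightarrow> complex" and \<psi>
      assume z: "AE x in lebesgue. (\<Sum>\<psi>\<in>b ` I m. c \<psi> *s \<psi> x) = 0" and "\<psi> \<in> b ` I m"
      then obtain i where i: "i \<in> I m" "\<psi> = b i" by blast
      then have iN: "i < N" by (simp add: I_def)
      have BQ: "\<phi> \<in> sobolev_H1" if "\<phi> \<in> b ` I m" for \<phi> using that b(3) by (auto simp: I_def)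
      define s where "s = (\<Sum>\<phi>\<in>b ` I m. smult (c \<phi>) \<phi>)"
      have sQ: "s \<in> sobolev_H1"
        unfolding s_def by (rule subspace_sum[OF subspace_Q]) (rule subspace_scale[OF subspace_Q BQ])
      have "AE x in lebesgue. s x = 0" using z unfolding s_def sum_fun_at smult_def .
      then have "0 = L2_inner (b i) s" using inner_null[OF b(3)[OF iN] sQ] by simp
      also have "\<dots> = (\<Sum>\<phi>\<in>b ` I m. c \<phi> * L2_inner (b i) \<phi>)"
        unfolding s_def by (rule sum_scale_right[OF b(3)[OF iN] BQ])
      also have "\<dots> = (\<Sum>j\<in>I m. c (b j) * L2_inner (b i) (b j))"
        by (subst sum.reindex[OF inj_on_subset[OF inj]]) (auto simp: I_def)
      also have "\<dots> = (\<Sum>j\<in>I m. if i = j then c (b j) else 0)"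
        by (intro sum.cong refl) (use orth iN in \<open>auto simp: I_def\<close>)
      also have "\<dots> = c (b i)" using i(1) by (simp add: I_def)
      finally show "c \<psi> = 0" using i(2) by simp
    qed
    ultimately show ?thesis
      unfolding multiplicity_of_def by (intro SUP_upper2[of "b ` I m"]) auto
  qed
  have "N = (\<Sum>i\<in>{..<N}. 1)" by simp
  also have "\<dots> = (\<Sum>m\<in>\<mu> ` {..<N}. \<Sum>i\<in>{i \<in> {..<N}. \<mu> i = m}. 1)"
    by (rule sum.image_gen) simp
  also have "\<dots> = (\<Sum>m\<in>\<mu> ` {..<N}. card (I m))" by (simp add: I_def)
  finally have N: "N = (\<Sum>m\<in>\<mu> ` {..<N}. card (I m))" .
  have "enat N = of_nat (\<Sum>m\<in>\<mu> ` {..<N}. card (I m))"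
    unfolding N[symmetric] by (rule of_nat_eq_enat[symmetric])
  also have "\<dots> = (\<Sum>m\<in>\<mu> ` {..<N}. of_nat (card (I m)))"
    by (rule of_nat_sum)
  also have "\<dots> = (\<Sum>m\<in>\<mu> ` {..<N}. enat (card (I m)))"
    by (simp only: of_nat_eq_enat)
  also have "\<dots> \<le> (\<Sum>m\<in>\<mu> ` {..<N}. multiplicity_of T m)" by (rule sum_mono) (rule mult)
  also have "\<dots> \<le> num_eigenvalues_below T k"
    unfolding num_eigenvalues_below_def
  proof -
    let ?K = "{\<mu>. is_eigenvalue T \<mu> \<and> \<mu> < k}"
    have "\<mu> ` {..<N} \<subseteq> ?K" using ev b(2) by auto
    then have "(\<Sum>m\<in>\<mu> ` {..<N}. multiplicity_of T m) \<le> (SUP F\<in>{F. finite F \<and> F \<subseteq> ?K}. sum (multiplicity_of T) F)"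
      by (intro SUP_upper) simp
    also have "\<dots> = infsum (multiplicity_of T) ?K"
      by (rule nonneg_infsum_complete[symmetric]) simp
    finally show "(\<Sum>m\<in>\<mu> ` {..<N}. multiplicity_of T m) \<le> infsum (multiplicity_of T) ?K" .
  qed
  finally show ?thesis .
qed

theorem corollary3:
  fixes A :: "real^2 \<Rightarrow> complex" and V :: "real^2 \<Rightarrow> real" and r :: real
  assumes A_cont: "continuous_on UNIV A"
    and A_growth: "Limsup at_infinity (\<lambda>p. ereal (cmod (A p) / (norm p)\<^sup>2)) < 1"
    and A_C2: "\<exists>U. open U \<and> min_set A \<subseteq> U \<and> C2_on U (\<lambda>p. cmod (A p))"
    and r: "r > 1"
    and V_L1: "integrable lebesgue V"
    and V_Lr: "integrable lebesgue (\<lambda>x. \<bar>V x\<bar> powr r)"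
    and V_nonpos: "AE x in lebesgue. V x \<le> 0"
    and V_nonzero: "emeasure lebesgue {x. V x \<noteq> 0} > 0"
  shows "num_points (min_set A) \<le> num_eigenvalues_below (H_op A V) (kappa A)"
proof (rule finite_le_num_points)
  fix F assume F: "finite F" "F \<subseteq> min_set A"
  \<comment> \<open>The modulus is nonnegative at every point, whereas \<open>- V\<close> is so only
    almost everywhere.\<close>
  interpret spin_potential "\<lambda>x. \<bar>V x\<bar>" r A
    by (unfold_locales, simp, rule r, rule integrable_abs[OF V_L1], rule V_Lr, rule A_cont, rule A_growth)
  obtain U where U: "open U" "min_set A \<subseteq> U" "C2_on U (\<lambda>p. cmod (A p))" using A_C2 by blast
  have Vm: "V \<in> borel_measurable lebesgue" by (rule borel_measurable_integrable[OF V_L1])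
  define N where "N = card F"
  obtain p where "bij_betw p {..<N} F"
    using ex_bij_betw_nat_finite[OF F(1)] by (auto simp: N_def atLeast0LessThan)
  then have p: "inj_on p {..<N}" "\<And>j. j < N \<Longrightarrow> p j \<in> min_set A"
    using F(2) by (auto simp: bij_betw_def)
  obtain Z where Z: "Z \<in> lmeasurable" "0 < measure lebesgue Z" "\<And>x. x \<in> Z \<Longrightarrow> \<bar>V x\<bar> \<noteq> 0"
  proof -
    \<comment> \<open>The set where \<open>V\<close> is nonzero may have infinite measure; its
      intersection with some ball has measure both positive and finite.\<close>
    define D where "D n = {x. V x \<noteq> 0} \<inter> cball 0 (real n)" for n
    have Vs: "{x. V x \<noteq> 0} \<in> sets lebesgue"
      using measurable_sets[OF Vm, of "- {0}"] by (simp add: vimage_def Compl_eq)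
    have D: "D n \<in> lmeasurable" for n
      unfolding D_def by (rule fmeasurableI2[OF lmeasurable_cball]) (use Vs in auto)
    have "\<exists>n. 0 < measure lebesgue (D n)"
    proof (rule ccontr)
      assume "\<not> ?thesis"
      then have "measure lebesgue (D n) = 0" for n by (metis measure_nonneg order_le_imp_less_or_eq)
      then have "D n \<in> null_sets lebesgue" for n
        using D[of n] by (simp add: null_sets_def emeasure_eq_measure2 fmeasurableD)
      then have "(\<Union>n. D n) \<in> null_sets lebesgue" by (intro null_sets_UN) 
      moreover have "(\<Union>n. D n) = {x. V x \<noteq> 0}"
        unfolding D_def by (auto simp: dist_norm intro: real_arch_simple)
      ultimately show False using V_nonzero by (simp add: null_sets_def)
    qed
    then obtain n where "0 < measure lebesgue (D n)" by blast
    then show thesis using that[OF D[of n]] by (simp add: D_def)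
  qed
  obtain \<psi> where \<psi>: "\<And>j. j < N \<Longrightarrow> \<psi> j \<in> sobolev_H1" and neg: "\<And>c :: nat \<Rightarrow> complex. \<exists>j<N. c j \<noteq> 0 \<Longrightarrow>
      Re (P.h (\<Sum>j<N. smult (c j) (\<psi> j)) (\<Sum>j<N. smult (c j) (\<psi> j)))
        < kappa A * Re (L2_inner (\<Sum>j<N. smult (c j) (\<psi> j)) (\<Sum>j<N. smult (c j) (\<psi> j)))"
    using trial_family[OF p U Z] by blast
  obtain b \<mu> where b: "\<And>i. i < N \<Longrightarrow> P.eigenvector (\<mu> i) (b i)" "\<And>i. i < N \<Longrightarrow> \<mu> i < kappa A"
    and orth: "\<And>i j. i < N \<Longrightarrow> j < N \<Longrightarrow> L2_inner (b i) (b j) = (if i = j then 1 else 0)"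
    using P.eigenvectors_exist[OF \<psi> neg] by blast
  \<comment> \<open>\<open>V\<close> and \<open>- \<bar>V\<bar>\<close> differ on a null set only,
    so the form of the definitions coincides with the abstract one on the form domain.\<close>
  have h: "H_form A V \<phi> \<theta> = P.h \<phi> \<theta>" if "\<phi> \<in> sobolev_H1" "\<theta> \<in> sobolev_H1" for \<phi> \<theta>
  proof -
    have sm: "(\<lambda>x. spinor_inner (\<phi> x) (\<theta> x)) \<in> borel_measurable lebesgue"
      by (intro borel_measurable_spinor_inner L2_measurable sobolev_L2 that)
    have "(LINT x|lebesgue. of_real (V x) * spinor_inner (\<phi> x) (\<theta> x))
        = (LINT x|lebesgue. - (of_real \<bar>V x\<bar> * spinor_inner (\<phi> x) (\<theta> x)))"
    proof (rule integral_cong_AE)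
      show "(\<lambda>x. of_real (V x) * spinor_inner (\<phi> x) (\<theta> x)) \<in> borel_measurable lebesgue"
        "(\<lambda>x. - (of_real \<bar>V x\<bar> * spinor_inner (\<phi> x) (\<theta> x))) \<in> borel_measurable lebesgue"
        using Vm sm by measurable
      show "AE x in lebesgue. of_real (V x) * spinor_inner (\<phi> x) (\<theta> x) = - (of_real \<bar>V x\<bar> * spinor_inner (\<phi> x) (\<theta> x))"
        using V_nonpos by eventually_elim simp
    qed
    then show ?thesis
      by (simp add: H_form_def P.h_def w_form_eq)
  qed
  have "b i \<in> eigenspace (H_op A V) (\<mu> i)" if i: "i < N" for i
  proof -
    have bQ: "b i \<in> sobolev_H1" and eig: "\<And>\<phi>. \<phi> \<in> sobolev_H1 \<Longrightarrow> P.h \<phi> (b i) = of_real (\<mu> i) * L2_inner \<phi> (b i)"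
      using b(1)[OF i] by (auto simp: P.eigenvector_def)
    have "H_form A V \<phi> (b i) = L2_inner \<phi> (\<lambda>x. \<mu> i *\<^sub>R b i x)" if \<phi>: "\<phi> \<in> sobolev_H1" for \<phi>
      unfolding h[OF \<phi> bQ] eig[OF \<phi>] L2_inner_def spinor_inner_scaleR_right by simp
    then show ?thesis
      unfolding eigenspace_def H_op_def form_operator_def
      using bQ L2_scaleR[OF sobolev_L2[OF bQ], of "\<mu> i"] by simp
  qed
  moreover have "b i \<in> sobolev_H1" if "i < N" for i
    using b(1)[OF that] by (simp add: P.eigenvector_def)
  ultimately show "enat (card F) \<le> num_eigenvalues_below (H_op A V) (kappa A)"
    unfolding N_def[symmetric] using b(2) orth by (intro count_eigenvalues_below[of N b _ \<mu>])
qed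

end
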